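(* Let $u\in W^{1,\mathcal H}(\Omega)$ be a local minimizer of the multi-phase functional $\mathbb F$, where $a_i\in A_{p_i}$ for every $i\in I_N$. Then $u\in L^\infty_{\mathrm{loc}}(\Omega)$. Specifically, there exists a constant $C>0$ depending only on $\mathtt{data}$ such that for any ball $B:=B_r$ whose concentric double $2B=B_{2r}$ satisfies $2B\Subset\Omega$, $$\fint_{2B}\mathcal H\left(x,\frac{\|u-(u)_{2B}\|_{L^\infty(B)}}{r}\right)dx\le C\fint_{2B}\mathcal H\left(x,\frac{|u-(u)_{2B}|}{r}\right)dx.$$ Moreover, if $|\{x\in 2B:u(x)=0\}|\ge\sigma_0|B|$ for some $\sigma_0\in(0,1)$, then $$\fint_{2B}\mathcal H\left(x,\frac{\|u\|_{L^\infty(B)}}{r}\right)dx\le\widetilde C\fint_{2B}\mathcal H\left(x,\frac{|u|}{r}\right)dx,$$ where $\widetilde C>0$ depends only on $\mathtt{data}$ and $\sigma_0$.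
   Context: Let $n\ge2$, $\Omega\subset\mathbb R^n$ a bounded open set, $N\ge1$, $I_N=\{1,\dots,N\}$, and $1<p\le p_1\le\dots\le p_N<\infty$. For $\gamma>1$, a non-negative $\omega\in L^1_{\mathrm{loc}}(\mathbb R^n)$ belongs to the Muckenhoupt class $A_\gamma$ if $[\omega]_{A_\gamma}:=\sup_B\left(\fint_B\omega\,dx\right)\left(\fint_B\omega^{-\frac1{\gamma-1}}dx\right)^{\gamma-1}<\infty$, the supremum being over all balls $B\subset\mathbb R^n$. The coefficients $a_i:\mathbb R^n\to[0,\infty)$ satisfy $a_i\in A_{p_i}$. Set $\mathcal H(x,t)=t^p+\sum_{i=1}^N a_i(x)t^{p_i}$ for $t\ge0$, and for measurable $S\subset\Omega$ set $\mathbb F(v,S)=\int_S\mathcal H(x,|\nabla v|)\,dx$. $L^{\mathcal H}(\Omega)$ is the linear hull of the set of measurable $f:\Omega\to\mathbb R$ with $\int_\Omega\mathcal H(x,|f|)dx<\infty$ (with the Luxemburg norm), $W^{1,\mathcal H}(\Omega)=\{f\in L^{\mathcal H}(\Omega):|\nabla f|\in L^{\mathcal H}(\Omega)\}$ (distributional gradient), and $W^{1,\mathcal H}_{\mathrm{loc}}(\Omega)$ is the corresponding local space. A function $u\in W^{1,\mathcal H}(\Omega)$ is a local minimizer of $\mathbb F$ if $\mathbb F(u,\mathrm{supp}(u-w))\le\mathbb F(w,\mathrm{supp}(u-w))$ for every $w\in W^{1,\mathcal H}_{\mathrm{loc}}(\Omega)$ with $\mathrm{supp}(u-w)\Subset\Omega$.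 $\mathtt{data}$ denotes the collection $n,N,p,\{p_i\}_{i=1}^N,\{[a_i]_{A_{p_i}}\}_{i=1}^N$. $(f)_E=\fint_E f=\frac1{|E|}\int_E f$. *)

theory Defs
  imports "HOL-Analysis.Analysis" "HOL-Probability.Essential_Supremum"
begin

text \<open>
  Functions on an open set \<open>\<Omega>\<close> are total functions on \<open>real^'n\<close> of which only the values
  on \<open>\<Omega>\<close> matter. All measures and integrals are with respect to Lebesgue measure.
\<close>

definition avg :: "(real^'n) set \<Rightarrow> (real^'n \<Rightarrow> real) \<Rightarrow> real" where
  "avg S f = (LINT x:S|lebesgue. f x) / measure lebesgue S"

definition nn_avg :: "(real^'n) set \<Rightarrow> (real^'n \<Rightarrow> ennreal) \<Rightarrow> ennreal" where
  "nn_avg S f = (\<integral>\<^sup>+x\<in>S. f x \<partial>lebesgue) / emeasure lebesgue S"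

definition compactly_contained :: "(real^'n) set \<Rightarrow> (real^'n) set \<Rightarrow> bool" where
  "compactly_contained S \<Omega> \<longleftrightarrow> compact (closure S) \<and> closure S \<subseteq> \<Omega>"

definition supp :: "(real^'n) set \<Rightarrow> (real^'n \<Rightarrow> real) \<Rightarrow> (real^'n) set" where
  "supp \<Omega> f = closure (support_on \<Omega> f)"

definition L1_loc :: "(real^'n) set \<Rightarrow> (real^'n \<Rightarrow> 'b::euclidean_space) set" where
  "L1_loc \<Omega> = {f. \<forall>K. compact K \<and> K \<subseteq> \<Omega> \<longrightarrow> f absolutely_integrable_on K}"

definition Linf_norm :: "(real^'n) set \<Rightarrow> (real^'n \<Rightarrow> real) \<Rightarrow> ennreal" where
  "Linf_norm S f = esssup (lebesgue_on S) (\<lambda>x. ennreal \<bar>f x\<bar>)"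

definition Linf_loc :: "(real^'n) set \<Rightarrow> (real^'n \<Rightarrow> real) set" where
  "Linf_loc \<Omega> = {f \<in> borel_measurable (lebesgue_on \<Omega>).
     \<forall>K. compact K \<and> K \<subseteq> \<Omega> \<longrightarrow> Linf_norm K f < \<infinity>}"

text \<open>Real powers on \<open>[0,\<infinity>]\<close>, meant for exponents \<open>t > 0\<close> only.\<close>

definition ennreal_powr :: "ennreal \<Rightarrow> real \<Rightarrow> ennreal" where
  "ennreal_powr s t = (if s = \<infinity> then \<infinity> else ennreal (enn2real s powr t))"

text \<open>
  The negative power \<open>\<omega>\<^bsup>-1/(\<gamma>-1)\<^esup>\<close> is written as an \<open>ennreal\<close> inverse so that it
  is \<open>\<infinity>\<close> where \<open>\<omega>\<close> vanishes (whereas \<open>0 powr s = 0\<close> on the reals, also for \<open>s < 0\<close>).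
  The product follows the convention \<open>0 \<cdot> \<infinity> = 0\<close>.
\<close>

definition Ap_const :: "real \<Rightarrow> (real^'n \<Rightarrow> real) \<Rightarrow> ennreal" where
  "Ap_const \<gamma> \<omega> =
     (SUP (x, r) \<in> UNIV \<times> {0<..}.
        nn_avg (ball x r) (\<lambda>y. ennreal (\<omega> y)) *
        ennreal_powr (nn_avg (ball x r) (\<lambda>y. inverse (ennreal (\<omega> y powr (1 / (\<gamma> - 1)))))) (\<gamma> - 1))"

definition Muckenhoupt :: "real \<Rightarrow> (real^'n \<Rightarrow> real) set" where
  "Muckenhoupt \<gamma> = {\<omega> \<in> L1_loc UNIV. (\<forall>x. 0 \<le> \<omega> x) \<and> Ap_const \<gamma> \<omega> < \<infinity>}"

text \<open>A function is \<open>C\<^bsup>k+1\<^esup>\<close> iff it is differentiable with \<open>C\<^bsup>k\<^esup>\<close> partial derivatives.\<close>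

definition partial :: "'n \<Rightarrow> (real^'n \<Rightarrow> real) \<Rightarrow> real^'n \<Rightarrow> real" where
  "partial i f x = frechet_derivative f (at x) (axis i 1)"

primrec C_k :: "nat \<Rightarrow> (real^'n \<Rightarrow> real) \<Rightarrow> bool" where
  "C_k 0 f \<longleftrightarrow> continuous_on UNIV f"
| "C_k (Suc k) f \<longleftrightarrow> f differentiable_on UNIV \<and> (\<forall>i. C_k k (partial i f))"

definition test_functions :: "(real^'n) set \<Rightarrow> (real^'n \<Rightarrow> real) set" where
  "test_functions \<Omega> = {\<phi>. (\<forall>k. C_k k \<phi>) \<and> compact (supp UNIV \<phi>) \<and> supp UNIV \<phi> \<subseteq> \<Omega>}"

definition has_weak_gradient ::
  "(real^'n) set \<Rightarrow> (real^'n \<Rightarrow> real) \<Rightarrow> (real^'n \<Rightarrow> real^'n) \<Rightarrow> bool" where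
  "has_weak_gradient \<Omega> f G \<longleftrightarrow> f \<in> L1_loc \<Omega> \<and> G \<in> L1_loc \<Omega> \<and>
     (\<forall>\<phi>\<in>test_functions \<Omega>. \<forall>i.
        (LINT x:\<Omega>|lebesgue. f x * partial i \<phi> x) = - (LINT x:\<Omega>|lebesgue. G x $ i * \<phi> x))"

text \<open>The weak gradient is unique only up to null sets; \<open>weak_gradient\<close> is a representative.\<close>

definition weak_gradient :: "(real^'n) set \<Rightarrow> (real^'n \<Rightarrow> real) \<Rightarrow> real^'n \<Rightarrow> real^'n" where
  "weak_gradient \<Omega> f = (SOME G. has_weak_gradient \<Omega> f G)"

definition orlicz_class ::
  "(real^'n \<Rightarrow> real \<Rightarrow> real) \<Rightarrow> (real^'n) set \<Rightarrow> (real^'n \<Rightarrow> real) set" where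
  "orlicz_class H \<Omega> = {f \<in> borel_measurable (lebesgue_on \<Omega>).
     (\<integral>\<^sup>+x\<in>\<Omega>. ennreal (H x \<bar>f x\<bar>) \<partial>lebesgue) < \<infinity>}"

text \<open>The linear hull of \<open>orlicz_class H \<Omega>\<close> (as functions on \<open>\<Omega>\<close>).\<close>

definition L_space ::
  "(real^'n \<Rightarrow> real \<Rightarrow> real) \<Rightarrow> (real^'n) set \<Rightarrow> (real^'n \<Rightarrow> real) set" where
  "L_space H \<Omega> = {f. \<exists>(k::nat) c g. (\<forall>j<k. g j \<in> orlicz_class H \<Omega>) \<and>
     (\<forall>x\<in>\<Omega>. f x = (\<Sum>j<k. c j * g j x))}"

definition W_space ::
  "(real^'n \<Rightarrow> real \<Rightarrow> real) \<Rightarrow> (real^'n) set \<Rightarrow> (real^'n \<Rightarrow> real) set" where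
  "W_space H \<Omega> = {f \<in> L_space H \<Omega>. (\<exists>G. has_weak_gradient \<Omega> f G) \<and>
     (\<lambda>x. norm (weak_gradient \<Omega> f x)) \<in> L_space H \<Omega>}"

definition W_loc_space ::
  "(real^'n \<Rightarrow> real \<Rightarrow> real) \<Rightarrow> (real^'n) set \<Rightarrow> (real^'n \<Rightarrow> real) set" where
  "W_loc_space H \<Omega> = {f. \<forall>U. open U \<and> compactly_contained U \<Omega> \<longrightarrow> f \<in> W_space H U}"

definition multi_phase ::
  "nat \<Rightarrow> real \<Rightarrow> (nat \<Rightarrow> real) \<Rightarrow> (nat \<Rightarrow> real^'n \<Rightarrow> real) \<Rightarrow> real^'n \<Rightarrow> real \<Rightarrow> real" where
  "multi_phase N p ps a x t = t powr p + (\<Sum>i=1..N. a i x * t powr (ps i))"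

definition energy ::
  "(real^'n \<Rightarrow> real \<Rightarrow> real) \<Rightarrow> (real^'n) set \<Rightarrow> (real^'n \<Rightarrow> real) \<Rightarrow> (real^'n) set \<Rightarrow> ennreal" where
  "energy H \<Omega> v S = (\<integral>\<^sup>+x\<in>S. ennreal (H x (norm (weak_gradient \<Omega> v x))) \<partial>lebesgue)"

definition local_minimizer ::
  "(real^'n \<Rightarrow> real \<Rightarrow> real) \<Rightarrow> (real^'n) set \<Rightarrow> (real^'n \<Rightarrow> real) \<Rightarrow> bool" where
  "local_minimizer H \<Omega> u \<longleftrightarrow> u \<in> W_space H \<Omega> \<and>
     (\<forall>w\<in>W_loc_space H \<Omega>. let S = supp \<Omega> (\<lambda>x. u x - w x) in
        compactly_contained S \<Omega> \<longrightarrow> energy H \<Omega> u S \<le> energy H \<Omega> w S)"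

end

theory Submission
  imports Defs
begin

text \<open>
  De Giorgi's method with all phases treated at once. Put \<open>a\<^sub>0 = 1\<close>, \<open>p\<^sub>0 = p\<close>, so that \<open>\<H>\<close> is the
  sum of the \<open>a\<^sub>i t\<^bsup>p\<^sub>i\<^esup>\<close>, \<open>0 \<le> i \<le> N\<close>, with \<open>a\<^sub>i \<in> A\<^bsub>p\<^sub>i\<^esub>\<close>. Comparing \<open>u\<close> with \<open>u - \<eta>\<^sup>Q (u - k)\<^sub>+\<close>, where
  \<open>Q\<close> exceeds all exponents, convexity of \<open>\<H>(x, \<cdot>)\<close> yields a Caccioppoli inequality for the level sets of
  \<open>u\<close> and of \<open>-u\<close>. Averaging \<open>u\<close> along rays bounds it pointwise by means of \<open>u\<close> and of its gradient over balls;
  together with the \<open>A\<^sub>p\<close> and \<open>A\<^sub>\<infinity>\<close> conditions this gives for every phase a Sobolev inequality on a set \<open>A\<close>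
  that gains a power of \<open>a\<^sub>i(A) / a\<^sub>i(2B)\<close>. Chebyshev's inequality for the dominating phase makes
  the level sets small with respect to Lebesgue measure, hence with respect to every \<open>a\<^sub>i\<close>, and the
  iteration shows \<open>\<bar>u - m\<bar> \<le> M\<close> on \<open>B\<close> as soon as the integral of \<open>\<H>(x, M/r)\<close> over \<open>2B\<close> exceeds a fixed
  multiple of that of \<open>\<H>(x, \<bar>u - m\<bar>/r)\<close>. The constant \<open>m\<close> is arbitrary: the mean of \<open>u\<close> gives the first
  estimate and \<open>m = 0\<close> the second.
\<close>

section \<open>Smooth bump functions\<close>

text \<open>The phases share neither exponent nor weight, and no inequality between
  \<open>a i\<close> and \<open>a j\<close> is available, so smallness obtained from one phase
  cannot be handed to another directly. Lebesgue measure serves as the exchange: the A_p condition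
  bounds relative volume by relative weight (\<open>Ap_weight_subset\<close>), the A_infinity
  property bounds relative weight by a power of relative volume (\<open>Ap_weight_Ainf\<close>).
  Thus all phases gain the same power in each iteration step, the worst one among them. The gain in
  the Sobolev inequality is read off from the means over balls B(x, t s), 0 < t \<le> 1, into which
  ray averages decompose. For fixed t such a mean is bounded on L^p(a) by one use of A_p and Fubini,
  so no maximal function enters. For t not too small the bound improves by the relative weight of
  the set, and the remaining t form a short interval; balancing both ranges yields the exponent.
  Every constant is an explicit function of the dimension, N, the exponents and the A_p constants,
  and is fixed before \<Omega>, the weights and u.\<close>

definition flat :: "nat \<Rightarrow> real \<Rightarrow> real" where
  "flat k t = (if 0 < t then (1 / t) ^ k * exp (- 1 / t) else 0)"

lemma power_le_fact_exp:
  assumes "0 \<le> (x::real)" shows "x ^ n \<le> fact n * exp x"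
proof -
  have s: "(\<lambda>n. x ^ n / fact n) sums exp x"
    using exp_converges[of x] by (simp add: divide_inverse mult.commute)
  then have "sum (\<lambda>n. x ^ n / fact n) {n} \<le> suminf (\<lambda>n. x ^ n / fact n)"
    using assms by (intro sum_le_suminf) (auto simp: sums_iff)
  with s show ?thesis by (simp add: sums_iff divide_le_eq mult.commute)
qed

lemma flat_nonneg: "0 \<le> flat k t"
  by (simp add: flat_def)

text \<open>One term of the exponential series at 1/t absorbs (1/t)^(k+2), which leaves two powers
  of t. Quadratic vanishing makes the difference quotient of every \<open>flat k\<close> at 0 tend
  to 0.\<close>

lemma flat_le_square: "flat k t \<le> fact (k + 2) * t\<^sup>2"
proof (cases "0 < t")
  case True
  have "(1 / t) ^ (k + 2) \<le> fact (k + 2) * exp (1 / t)"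
    using power_le_fact_exp[of "1/t" "k+2"] True by simp
  then have "(1 / t) ^ (k + 2) * (t\<^sup>2 * exp (- 1 / t)) \<le> fact (k + 2) * exp (1 / t) * (t\<^sup>2 * exp (- 1 / t))"
    by (intro mult_right_mono) auto
  moreover have "(1 / t) ^ (k + 2) * (t\<^sup>2 * exp (- 1 / t)) = flat k t"
    using True by (simp add: flat_def power_add power_divide power2_eq_square)
  moreover have "exp (1 / t) * exp (- 1 / t) = 1" by (simp flip: exp_add)
  then have "fact (k + 2) * exp (1 / t) * (t\<^sup>2 * exp (- 1 / t)) = fact (k + 2) * t\<^sup>2"
    by (metis (no_types, lifting) mult.assoc mult.commute mult.right_neutral)
  ultimately show ?thesis by linarith
qed (simp add: flat_def)

lemma flat_0_le_1: "flat 0 t \<le> 1"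
  by (simp add: flat_def)

text \<open>The index \<open>k\<close> exists for the sake of this formula: derivatives of exp(-1/t)
  pick up powers of 1/t, and the family of all \<open>flat k\<close> is closed under differentiation
  up to linear combinations.\<close>

lemma has_field_derivative_flat:
  "(flat k has_field_derivative (flat (k + 2) t - real k * flat (k + 1) t)) (at t)"
proof -
  consider "0 < t" | "t < 0" | "t = 0" by linarith
  then show ?thesis
  proof cases
    case 1
    have "((\<lambda>t. (1 / t) ^ k * exp (- 1 / t)) has_field_derivative
        (flat (k + 2) t - real k * flat (k + 1) t)) (at t)"
      using 1 by (auto intro!: derivative_eq_intros simp: flat_def field_simps power2_eq_square)
        (cases k; simp add: field_simps)
    then show ?thesis
      by (rule has_field_derivative_transform_within_open[of _ _ _ "{0<..}"]) (use 1 in \<open>auto simp: flat_def\<close>)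
  next
    case 2
    have "((\<lambda>t. 0) has_field_derivative (flat (k + 2) t - real k * flat (k + 1) t)) (at t)"
      using 2 by (auto simp: flat_def)
    then show ?thesis
      by (rule has_field_derivative_transform_within_open[of _ _ _ "{..<0}"]) (use 2 in \<open>auto simp: flat_def\<close>)
  next
    case 3
    have "((\<lambda>h. (flat k (0 + h) - flat k 0) / h) \<longlongrightarrow> 0) (at 0)"
    proof (rule Lim_null_comparison)
      show "\<forall>\<^sub>F h in at 0. norm ((flat k (0 + h) - flat k 0) / h) \<le> fact (k + 2) * \<bar>h\<bar>"
      proof (rule eventually_at_topological[THEN iffD2, OF exI[of _ UNIV]], safe)
        fix h :: real assume "h \<noteq> 0"
        then show "norm ((flat k (0 + h) - flat k 0) / h) \<le> fact (k + 2) * \<bar>h\<bar>"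
          using flat_le_square[of k h] flat_nonneg[of k h]
          by (simp add: flat_def[of _ 0] divide_le_eq mult.assoc power2_eq_square)
      qed auto
      show "((\<lambda>h. fact (k + 2) * \<bar>h\<bar>) \<longlongrightarrow> (0::real)) (at 0)"
        by (rule tendsto_eq_intros | simp)+
    qed
    then show ?thesis unfolding 3 by (simp add: DERIV_def flat_def[of _ 0])
  qed
qed

text \<open>A syntactic class instead of all smooth functions: a single induction over the rules
  shows that partial derivatives stay inside (\<open>smooth_partial\<close>), so every
  \<open>C_k\<close> follows at once. The rules suffice to build bumps and cutoffs.\<close>

inductive smooth_fn :: "(real^'n \<Rightarrow> real) \<Rightarrow> bool" where
  smooth_const: "smooth_fn (\<lambda>x. c)"
| smooth_coord: "smooth_fn (\<lambda>x. x $ i)"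
| smooth_add: "smooth_fn f \<Longrightarrow> smooth_fn g \<Longrightarrow> smooth_fn (\<lambda>x. f x + g x)"
| smooth_mult: "smooth_fn f \<Longrightarrow> smooth_fn g \<Longrightarrow> smooth_fn (\<lambda>x. f x * g x)"
| smooth_flat: "smooth_fn f \<Longrightarrow> smooth_fn (\<lambda>x. flat k (f x))"

lemma smooth_sum: "(\<And>i. i \<in> I \<Longrightarrow> smooth_fn (f i)) \<Longrightarrow> smooth_fn (\<lambda>x. \<Sum>i\<in>I. f i x)"
  by (induction I rule: infinite_finite_induct) (auto intro: smooth_fn.intros)

lemma smooth_prod: "(\<And>i. i \<in> I \<Longrightarrow> smooth_fn (f i)) \<Longrightarrow> smooth_fn (\<lambda>x. \<Prod>i\<in>I. f i x)"
  by (induction I rule: infinite_finite_induct) (auto intro: smooth_fn.intros)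

lemma smooth_power: "smooth_fn f \<Longrightarrow> smooth_fn (\<lambda>x. f x ^ k)"
  by (induction k) (auto intro: smooth_fn.intros)

lemma smooth_diff: "smooth_fn f \<Longrightarrow> smooth_fn g \<Longrightarrow> smooth_fn (\<lambda>x. f x - g x)"
  using smooth_add[OF _ smooth_mult[OF smooth_const[of "-1"]], of f g] by simp

lemma partial_eq: "(f has_derivative f') (at x) \<Longrightarrow> partial i f x = f' (axis i 1)"
  unfolding partial_def by (metis frechet_derivative_at)

lemma smooth_partial:
  fixes f :: "real^'n \<Rightarrow> real"
  assumes "smooth_fn f"
  shows "(\<forall>x. f differentiable (at x)) \<and> (\<forall>i. smooth_fn (partial i f))"
  using assms
proof induction
  case (smooth_const c)
  have "partial i (\<lambda>x::real^'n. c) = (\<lambda>x. 0)" for i by (rule ext, subst partial_eq) (auto intro: derivative_eq_intros)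
  then show ?case by (auto intro: smooth_fn.intros)
next
  case (smooth_coord j)
  have d: "((\<lambda>x::real^'n. x $ j) has_derivative (\<lambda>h. h $ j)) (at x)" for x
    by (rule bounded_linear_imp_has_derivative) (rule bounded_linear_vec_nth)
  then have "partial i (\<lambda>x::real^'n. x $ j) = (\<lambda>x. axis i 1 $ j)" for i by (auto simp: partial_eq[OF d])
  then show ?case using d by (auto intro: smooth_fn.intros simp: differentiable_def)
next
  case (smooth_add f g)
  then have d: "(f has_derivative frechet_derivative f (at x)) (at x)"
    "(g has_derivative frechet_derivative g (at x)) (at x)" for x
    by (auto simp: frechet_derivative_works)
  have "partial i (\<lambda>x. f x + g x) = (\<lambda>x. partial i f x + partial i g x)" for i
    by (rule ext, subst partial_eq[OF has_derivative_add[OF d]]) (simp add: partial_def)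
  then show ?case using smooth_add by (auto intro: smooth_fn.intros)
next
  case (smooth_mult f g)
  then have d: "(f has_derivative frechet_derivative f (at x)) (at x)"
    "(g has_derivative frechet_derivative g (at x)) (at x)" for x
    by (auto simp: frechet_derivative_works)
  have "partial i (\<lambda>x. f x * g x) = (\<lambda>x. f x * partial i g x + partial i f x * g x)" for i
    by (rule ext, subst partial_eq[OF has_derivative_mult[OF d]]) (simp add: partial_def)
  then show ?case using smooth_mult by (auto intro!: smooth_fn.smooth_add smooth_fn.smooth_mult)
next
  case (smooth_flat f k)
  then have d: "(f has_derivative frechet_derivative f (at x)) (at x)" for x
    by (auto simp: frechet_derivative_works)
  have d': "((\<lambda>x. flat k (f x)) has_derivative
     (\<lambda>h. (flat (k + 2) (f x) - real k * flat (k + 1) (f x)) * frechet_derivative f (at x) h)) (at x)" for x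
    using has_derivative_compose[OF d, of "flat k", OF has_field_derivative_flat[unfolded has_field_derivative_def]]
    by simp
  have "partial i (\<lambda>x. flat k (f x)) = (\<lambda>x. (flat (k + 2) (f x) - real k * flat (k + 1) (f x)) * partial i f x)" for i
    by (rule ext, subst partial_eq[OF d']) (simp add: partial_def)
  then show ?case using smooth_flat d' by (auto intro!: smooth_fn.intros smooth_diff simp: differentiable_def)
qed

lemma smooth_C_k: "smooth_fn f \<Longrightarrow> C_k k f"
proof (induction k arbitrary: f)
  case 0
  then show ?case using smooth_partial[OF 0]
    by (auto intro!: continuous_at_imp_continuous_on differentiable_imp_continuous_within)
next
  case (Suc k)
  then show ?case using smooth_partial[OF Suc.prems]
    by (auto simp: differentiable_on_def intro: differentiable_at_withinI)
qed

lemma smooth_measurable: "smooth_fn f \<Longrightarrow> f \<in> borel_measurable borel"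
  using smooth_C_k[of f 0] by (auto intro: borel_measurable_continuous_onI)

text \<open>For t > 0 the factor \<open>flat 0 (m * t)\<close>, that is exp(-1/(m t)), tends to 1 as
  m grows, so these functions approximate the indicator of the open box from inside. Translates of
  bumps are bumps again.\<close>

definition bump :: "nat \<Rightarrow> real^'n \<Rightarrow> real^'n \<Rightarrow> real^'n \<Rightarrow> real" where
  "bump m a b x = (\<Prod>i\<in>UNIV. flat 0 (real m * (x $ i - a $ i)) * flat 0 (real m * (b $ i - x $ i)))"

lemma smooth_bump: "smooth_fn (bump m a b)"
  unfolding bump_def[abs_def]
  by (rule smooth_prod smooth_mult smooth_flat smooth_diff smooth_coord smooth_const)+

lemma bump_nonneg: "0 \<le> bump m a b x"
  unfolding bump_def by (intro prod_nonneg) (auto simp: flat_nonneg)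

lemma bump_le_1: "bump m a b x \<le> 1"
  unfolding bump_def by (intro prod_le_1) (auto simp: flat_nonneg flat_0_le_1 intro!: mult_le_one)

lemma bump_eq_0: "x \<notin> box a b \<Longrightarrow> bump m a b x = 0"
proof -
  assume "x \<notin> box a b"
  then obtain i where "x $ i \<le> a $ i \<or> b $ i \<le> x $ i"
    by (auto simp: mem_box_cart not_less)
  then have "flat 0 (real m * (x $ i - a $ i)) * flat 0 (real m * (b $ i - x $ i)) = 0"
    by (auto simp: flat_def zero_less_mult_iff)
  then show ?thesis unfolding bump_def by (intro prod_zero bexI[of _ i]) auto
qed

lemma bump_translate: "bump m a b (x - y) = bump m (a + y) (b + y) x"
  unfolding bump_def by (simp add: algebra_simps)

lemma tendsto_bump: "(\<lambda>m. bump m a b x) \<longlonglongrightarrow> indicator (box a b) x"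
proof (cases "x \<in> box a b")
  case True
  have e: "(\<lambda>m. flat 0 (real m * t)) \<longlonglongrightarrow> 1" if "0 < t" for t
  proof (rule Lim_transform_eventually)
    have "(\<lambda>m. - 1 / t * (1 / real m)) \<longlonglongrightarrow> - 1 / t * 0"
      by (intro tendsto_mult tendsto_const lim_1_over_n)
    from tendsto_exp[OF this] show "(\<lambda>m. exp (- 1 / t * (1 / real m))) \<longlonglongrightarrow> 1" by simp
    show "\<forall>\<^sub>F m in sequentially. exp (- 1 / t * (1 / real m)) = flat 0 (real m * t)"
      using eventually_gt_at_top[of 0] by eventually_elim (use that in \<open>auto simp: flat_def field_simps\<close>)
  qed
  have "(\<lambda>m. bump m a b x) \<longlonglongrightarrow> (\<Prod>i\<in>(UNIV::'a set). 1 * 1)"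
    unfolding bump_def using True by (intro tendsto_prod tendsto_mult e) (auto simp: mem_box_cart)
  then show ?thesis using True by simp
qed (simp add: bump_eq_0)

lemma supp_subset_closed: "closed K \<Longrightarrow> (\<And>x. x \<notin> K \<Longrightarrow> f x = 0) \<Longrightarrow> supp UNIV f \<subseteq> K"
  unfolding supp_def support_on_def by (intro closure_minimal) auto

lemma smooth_test_function:
  assumes "smooth_fn f" "compact K" "K \<subseteq> \<Omega>" "\<And>x. x \<notin> K \<Longrightarrow> f x = 0"
  shows "f \<in> test_functions \<Omega>"
proof -
  have "supp UNIV f \<subseteq> K" using assms by (intro supp_subset_closed) (auto simp: compact_imp_closed)
  moreover have "closed (supp UNIV f)" by (simp add: supp_def)
  ultimately have "compact (supp UNIV f)" using assms(2) by (metis compact_Int_closed inf.absorb_iff2)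
  with assms show ?thesis using \<open>supp UNIV f \<subseteq> K\<close> by (auto simp: test_functions_def smooth_C_k)
qed

lemma bump_test_function: "cbox a b \<subseteq> \<Omega> \<Longrightarrow> bump m a b \<in> test_functions \<Omega>"
proof (rule smooth_test_function[OF smooth_bump compact_cbox[of a b]])
  show "x \<notin> cbox a b \<Longrightarrow> bump m a b x = 0" for x
    using bump_eq_0[of x a b m] box_subset_cbox[of a b] by blast
qed

lemma test_functionD:
  assumes "\<phi> \<in> test_functions \<Omega>"
  shows "continuous_on UNIV \<phi>" "\<phi> differentiable (at x)" "continuous_on UNIV (partial i \<phi>)"
    and "(\<phi> has_derivative (\<lambda>h. \<Sum>i\<in>UNIV. partial i \<phi> x * h $ i)) (at x)"
    and "x \<notin> supp UNIV \<phi> \<Longrightarrow> \<phi> x = 0"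
    and "x \<notin> supp UNIV \<phi> \<Longrightarrow> partial i \<phi> x = 0"
    and "compact (supp UNIV \<phi>)" "supp UNIV \<phi> \<subseteq> \<Omega>"
proof -
  have C: "C_k k \<phi>" for k using assms by (auto simp: test_functions_def)
  show "continuous_on UNIV \<phi>" using C[of 0] by simp
  show d: "\<phi> differentiable (at x)" for x using C[of 1] by (simp add: differentiable_on_def)
  show "continuous_on UNIV (partial i \<phi>)" using C[of 1] by simp
  have f: "(\<phi> has_derivative frechet_derivative \<phi> (at x)) (at x)" using d by (simp add: frechet_derivative_works)
  have "frechet_derivative \<phi> (at x) h = (\<Sum>i\<in>UNIV. partial i \<phi> x * h $ i)" for h
  proof -
    have l: "linear (frechet_derivative \<phi> (at x))" using f has_derivative_linear by blast
    have "frechet_derivative \<phi> (at x) h = frechet_derivative \<phi> (at x) (\<Sum>i\<in>UNIV. h $ i *\<^sub>R axis i 1)"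
      using basis_expansion[of h] by (simp add: scalar_mult_eq_scaleR)
    also have "\<dots> = (\<Sum>i\<in>UNIV. h $ i * frechet_derivative \<phi> (at x) (axis i 1))"
      by (simp add: linear_sum[OF l] linear_cmul[OF l])
    finally show ?thesis by (simp add: partial_def mult.commute)
  qed
  then have "frechet_derivative \<phi> (at x) = (\<lambda>h. \<Sum>i\<in>UNIV. partial i \<phi> x * h $ i)" by (rule ext)
  with f show "(\<phi> has_derivative (\<lambda>h. \<Sum>i\<in>UNIV. partial i \<phi> x * h $ i)) (at x)" by simp
  show z: "x \<notin> supp UNIV \<phi> \<Longrightarrow> \<phi> x = 0" for x
    unfolding supp_def support_on_def using closure_subset[of "{x \<in> UNIV. \<phi> x \<noteq> 0}"] by auto
  show "compact (supp UNIV \<phi>)" "supp UNIV \<phi> \<subseteq> \<Omega>" using assms by (auto simp: test_functions_def)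
  assume x: "x \<notin> supp UNIV \<phi>"
  have "((\<lambda>x. 0) has_derivative (\<lambda>h. 0)) (at x)" by simp
  then have "(\<phi> has_derivative (\<lambda>h. 0)) (at x)"
    by (rule has_derivative_transform_within_open[of _ _ _ _ "- supp UNIV \<phi>"])
       (use x z in \<open>auto simp: supp_def\<close>)
  then show "partial i \<phi> x = 0" by (simp add: partial_eq)
qed

section \<open>Testing against bumps and translations in \<open>L\<^sup>1\<close>\<close>

text \<open>The positive and the negative part of \<open>g\<close> are densities of two measures
  that agree on the intersection-stable generator of open boxes. Uniqueness of densities makes the
  two parts equal almost everywhere, and one of them always vanishes.\<close>

lemma AE_eq_0_if_box_integrals:
  fixes g :: "'a::euclidean_space \<Rightarrow> real"
  assumes g: "integrable lborel g" and box: "\<And>a b. (LINT x|lborel. indicator (box a b) x * g x) = 0"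
  shows "AE x in lborel. g x = 0"
proof -
  have [measurable]: "g \<in> borel_measurable borel" using g by auto
  \<comment> \<open>\<open>ennreal\<close> sends negative reals to 0, so \<open>M\<close> and
    \<open>M'\<close> have the positive and the negative part of \<open>g\<close> as
    densities.\<close>
  define M where "M = density lborel (\<lambda>x. ennreal (g x))"
  define M' where "M' = density lborel (\<lambda>x. ennreal (- g x))"
  have fin: "(\<integral>\<^sup>+x. ennreal (c * g x) * indicator X x \<partial>lborel) < \<infinity>" if "c \<in> {1, -1}" "X \<in> sets borel" for c X
  proof -
    have "(\<integral>\<^sup>+x. ennreal (c * g x) * indicator X x \<partial>lborel) \<le> (\<integral>\<^sup>+x. norm (g x) \<partial>lborel)"
      using that by (intro nn_integral_mono) (auto simp: indicator_def intro!: ennreal_leI)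
    also have "\<dots> < \<infinity>" using g by (simp add: integrable_iff_bounded)
    finally show ?thesis .
  qed
  have "M = M'"
  proof (rule measure_eqI_generator_eq)
    let ?E = "range (\<lambda>(a, b). box a b::'a set)"
    show "Int_stable ?E"
      by (auto simp: Int_stable_def box_Int_box)
    show "?E \<subseteq> Pow UNIV" "sets M = sigma_sets UNIV ?E" "sets M' = sigma_sets UNIV ?E"
      by (simp_all add: borel_eq_box M_def M'_def)
    let ?A = "\<lambda>n::nat. box (- (real n *\<^sub>R One)) (real n *\<^sub>R One) :: 'a set"
    show "range ?A \<subseteq> ?E" "(\<Union>i. ?A i) = UNIV"
      unfolding UN_box_eq_UNIV by auto
    show "emeasure M (?A i) \<noteq> \<infinity>" for i
      using fin[of 1 "?A i"] by (simp add: M_def emeasure_density)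
    show "emeasure M X = emeasure M' X" if "X \<in> ?E" for X
    proof -
      obtain a b where X: "X = box a b" using \<open>X \<in> ?E\<close> by auto
      have i: "integrable lborel (\<lambda>x. indicator (box a b) x * g x)"
        using integrable_mult_indicator[OF _ g, of "box a b"] by simp
      have "enn2real (\<integral>\<^sup>+x. ennreal (indicator (box a b) x * g x) \<partial>lborel)
          = enn2real (\<integral>\<^sup>+x. ennreal (- (indicator (box a b) x * g x)) \<partial>lborel)"
        using real_lebesgue_integral_def[OF i] box[of a b] by simp
      also have "(\<integral>\<^sup>+x. ennreal (indicator (box a b) x * g x) \<partial>lborel) = emeasure M X"
        by (auto simp: M_def X emeasure_density indicator_def intro!: nn_integral_cong)
      also have "(\<integral>\<^sup>+x. ennreal (- (indicator (box a b) x * g x)) \<partial>lborel) = emeasure M' X"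
        by (auto simp: M'_def X emeasure_density indicator_def intro!: nn_integral_cong)
      finally show ?thesis
        using fin[of 1 X] fin[of "-1" X] X
        by (simp add: M_def M'_def emeasure_density)
           (metis (no_types, lifting) ennreal_enn2real)
    qed
  qed
  then have "AE x in lborel. ennreal (g x) = ennreal (- g x)"
    unfolding M_def M'_def 
    by (subst (asm) sigma_finite_measure.density_unique_iff[OF sigma_finite_lborel]) auto
  then show ?thesis
  proof eventually_elim
    case (elim x)
    then show ?case by (cases "0 \<le> g x") (auto simp: ennreal_neg ennreal_eq_0_iff)
  qed
qed

lemma AE_lborel_Diff_box: "AE x in lborel. x \<in> cbox a b \<longrightarrow> x \<in> box a b"
  for a :: "'a::euclidean_space"
proof -
  have "cbox a b - box a b \<in> null_sets lebesgue"
    using negligible_frontier_interval negligible_iff_null_sets by blast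
  then have "cbox a b - box a b \<in> null_sets lborel"
    by (subst (asm) null_sets_completion_iff) auto
  then show ?thesis by (rule AE_I') auto
qed

text \<open>The fundamental lemma of the calculus of variations with bumps as the only test
  functions: as \<open>m\<close> grows, integrals against bumps become integrals over boxes, and
  countably many closed boxes exhaust \<open>\<Omega>\<close>.\<close>

lemma AE_eq_0_if_bump_integrals:
  fixes g :: "real^'n \<Rightarrow> real"
  assumes "open \<Omega>" and [measurable]: "g \<in> borel_measurable borel"
    and int: "\<And>a b. cbox a b \<subseteq> \<Omega> \<Longrightarrow> set_integrable lborel (cbox a b) g"
    and zero: "\<And>m a b. cbox a b \<subseteq> \<Omega> \<Longrightarrow> (LINT x|lborel. bump m a b x * g x) = 0"
  shows "AE x in lborel. x \<in> \<Omega> \<longrightarrow> g x = 0"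
proof -
  have *: "AE x in lborel. x \<in> cbox c d \<longrightarrow> g x = 0" if cd: "cbox c d \<subseteq> \<Omega>" for c d
  proof -
    define g' where "g' = (\<lambda>x. indicator (box c d) x * g x)"
    have g': "integrable lborel g'"
      using set_integrable_subset[OF int[OF cd], of "box c d"]
      by (auto simp: g'_def set_integrable_def box_subset_cbox)
    have "AE x in lborel. g' x = 0"
    proof (rule AE_eq_0_if_box_integrals[OF g'])
      fix a b
      \<comment> \<open>The box criterion asks for all boxes, but bumps are admissible only on boxes
        inside \<open>\<Omega>\<close>; intersecting with \<open>box c d\<close> reduces the former
        to the latter.\<close>
      obtain a' b' where ab': "box a b \<inter> box c d = box a' b'" by (rule that[OF box_Int_box])
      have eq: "indicator (box a b) x * g' x = indicator (box a' b') x * g x" for x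
        using ab' by (auto simp: g'_def indicator_def)
      show "(LINT x|lborel. indicator (box a b) x * g' x) = 0"
      proof (cases "box a' b' = {}")
        case False
        have "closure (box a' b') \<subseteq> closure (box c d)" using ab' by (intro closure_mono) auto
        then have sub: "cbox a' b' \<subseteq> cbox c d" using False ab' by (metis Int_empty_right closure_box)
        have "(\<lambda>m. LINT x|lborel. bump m a' b' x * g x) \<longlonglongrightarrow> (LINT x|lborel. indicator (box a' b') x * g x)"
        proof (rule integral_dominated_convergence[where w="\<lambda>x. \<bar>indicator (cbox a' b') x * g x\<bar>"])
          show "integrable lborel (\<lambda>x. \<bar>indicator (cbox a' b') x * g x\<bar>)"
            using int[of a' b'] sub cd by (intro integrable_abs) (auto simp: set_integrable_def)
          show "AE x in lborel. (\<lambda>m. bump m a' b' x * g x) \<longlonglongrightarrow> indicator (box a' b') x * g x"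
            by (intro AE_I2 tendsto_mult tendsto_bump tendsto_const)
          show "AE x in lborel. norm (bump m a' b' x * g x) \<le> \<bar>indicator (cbox a' b') x * g x\<bar>" for m
          proof (rule AE_I2)
            fix x show "norm (bump m a' b' x * g x) \<le> \<bar>indicator (cbox a' b') x * g x\<bar>"
            proof (cases "x \<in> cbox a' b'")
              case True
              then show ?thesis using bump_nonneg[of m a' b' x] bump_le_1[of m a' b' x]
                by (auto simp: abs_mult intro!: mult_left_le_one_le)
            next
              case False
              then have "x \<notin> box a' b'" using box_subset_cbox[of a' b'] by blast
              then show ?thesis by (simp add: bump_eq_0)
            qed
          qed
          show "(\<lambda>x. bump m a' b' x * g x) \<in> borel_measurable lborel" for m
            using smooth_measurable[OF smooth_bump[of m a' b']] by simp
        qed auto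
        then have "(\<lambda>m. 0) \<longlonglongrightarrow> (LINT x|lborel. indicator (box a' b') x * g x)"
          using zero[of a' b'] sub cd by auto
        then show ?thesis by (simp add: eq LIMSEQ_const_iff)
      qed (simp add: eq)
    qed
    with AE_lborel_Diff_box[of c d] show ?thesis
      by eventually_elim (auto simp: g'_def)
  qed
  obtain \<D> where D: "countable \<D>" "\<D> \<subseteq> Pow \<Omega>" "\<And>X. X \<in> \<D> \<Longrightarrow> \<exists>a b. X = cbox a b" "\<Union>\<D> = \<Omega>"
    using open_countable_Union_open_cbox[OF \<open>open \<Omega>\<close>] by metis
  have "AE x in lborel. \<forall>X\<in>\<D>. x \<in> X \<longrightarrow> g x = 0"
  proof (subst AE_ball_countable[OF D(1)], rule ballI)
    fix X assume X: "X \<in> \<D>"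
    then obtain a b where "X = cbox a b" using D(3) by blast
    with * X D(2) show "AE x in lborel. x \<in> X \<longrightarrow> g x = 0" by blast
  qed
  then show ?thesis
    by eventually_elim (use D(4) in auto)
qed

lemma integrable_lborel_translate:
  fixes f :: "'a::euclidean_space \<Rightarrow> 'b::{banach, second_countable_topology}"
  assumes "integrable lborel f" shows "integrable lborel (\<lambda>x. f (x + c))"
proof -
  have "integrable (distr lborel borel ((+) c)) f" using assms by (simp add: lborel_distr_plus)
  then show ?thesis by (subst (asm) integrable_distr_eq) (use assms in \<open>auto simp: add.commute\<close>)
qed

lemma integral_lborel_translate:
  fixes f :: "'a::euclidean_space \<Rightarrow> 'b::{banach, second_countable_topology}"
  assumes [measurable]: "f \<in> borel_measurable borel"
  shows "(LINT x|lborel. f (x + c)) = (LINT x|lborel. f x)"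
proof -
  have "(LINT x|lborel. f x) = (LINT x|distr lborel borel ((+) c). f x)" by (simp add: lborel_distr_plus)
  also have "\<dots> = (LINT x|lborel. f (x + c))" by (subst integral_distr) (auto simp: add.commute)
  finally show ?thesis by simp
qed

text \<open>Translations are isometries of L^1, so continuity of translation survives L^1
  approximation by an e/3 argument.\<close>

lemma tendsto_translate_L1_approx:
  fixes g :: "'a::euclidean_space \<Rightarrow> real"
  assumes g: "integrable lborel g" and h: "h \<longlonglongrightarrow> (0::'a)"
    and approx: "\<And>e. 0 < e \<Longrightarrow> \<exists>g'. integrable lborel g' \<and> (LINT x|lborel. \<bar>g x - g' x\<bar>) \<le> e \<and>
       (\<lambda>m. LINT x|lborel. \<bar>g' (x + h m) - g' x\<bar>) \<longlonglongrightarrow> 0"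
  shows "(\<lambda>m. LINT x|lborel. \<bar>g (x + h m) - g x\<bar>) \<longlonglongrightarrow> 0"
proof (rule LIMSEQ_I)
  fix e :: real assume "0 < e"
  then obtain g' where g': "integrable lborel g'" "(LINT x|lborel. \<bar>g x - g' x\<bar>) \<le> e / 3"
    and lim: "(\<lambda>m. LINT x|lborel. \<bar>g' (x + h m) - g' x\<bar>) \<longlonglongrightarrow> 0"
    using approx[of "e/3"] by auto
  have [measurable]: "g \<in> borel_measurable borel" "g' \<in> borel_measurable borel" using g g' by auto
  have "eventually (\<lambda>m. (LINT x|lborel. \<bar>g' (x + h m) - g' x\<bar>) < e / 3) sequentially"
    using lim \<open>0 < e\<close> by (intro order_tendstoD(2)[OF lim]) auto
  then obtain n0 where n0: "\<And>m. m \<ge> n0 \<Longrightarrow> (LINT x|lborel. \<bar>g' (x + h m) - g' x\<bar>) < e / 3"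
    by (auto simp: eventually_sequentially)
  show "\<exists>n0. \<forall>m\<ge>n0. norm ((LINT x|lborel. \<bar>g (x + h m) - g x\<bar>) - 0) < e"
  proof (intro exI[of _ n0] allI impI)
    fix m assume "m \<ge> n0"
    have i: "integrable lborel (\<lambda>x. g (x + h m))" "integrable lborel (\<lambda>x. g' (x + h m))"
      using g g' by (auto intro: integrable_lborel_translate)
    have tr: "(LINT x|lborel. \<bar>g (x + h m) - g' (x + h m)\<bar>) = (LINT x|lborel. \<bar>g x - g' x\<bar>)"
      by (rule integral_lborel_translate) auto
    have "(LINT x|lborel. \<bar>g (x + h m) - g x\<bar>)
        \<le> (LINT x|lborel. \<bar>g (x + h m) - g' (x + h m)\<bar> + \<bar>g' (x + h m) - g' x\<bar> + \<bar>g x - g' x\<bar>)"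
      using g g' i by (intro integral_mono) auto
    also have "\<dots> = (LINT x|lborel. \<bar>g x - g' x\<bar>) + (LINT x|lborel. \<bar>g' (x + h m) - g' x\<bar>) + (LINT x|lborel. \<bar>g x - g' x\<bar>)"
      using g g' i by (simp add: tr)
    also have "\<dots> < e" using n0[OF \<open>m \<ge> n0\<close>] g'(2) by linarith
    finally show "norm ((LINT x|lborel. \<bar>g (x + h m) - g x\<bar>) - 0) < e" by simp
  qed
qed

text \<open>A point of an open set stays inside under small translations, so the part that leaves
  has measure tending to 0. Translation preserves volume, hence as much enters as leaves; this is
  the factor 2.\<close>

lemma tendsto_translate_L1_indicator_open:
  fixes h :: "nat \<Rightarrow> 'a::euclidean_space"
  assumes "open U" and fin: "emeasure lborel U < \<infinity>" and h: "h \<longlonglongrightarrow> 0"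
  shows "(\<lambda>m. LINT x|lborel. \<bar>indicator U (x + h m) - indicator U x :: real\<bar>) \<longlonglongrightarrow> 0"
proof -
  have [measurable]: "U \<in> sets borel" using \<open>open U\<close> by auto
  have iU: "integrable lborel (indicator U :: 'a \<Rightarrow> real)" using fin by simp
  have iU': "integrable lborel (\<lambda>x. indicator U (x + c) :: real)" for c by (rule integrable_lborel_translate[OF iU])
  define d where "d = (\<lambda>m x. indicator U x * (1 - indicator U (x + h m)) :: real)"
  have id: "integrable lborel (d m)" for m
    unfolding d_def by (rule Bochner_Integration.integrable_bound[OF iU]) (auto simp: indicator_def)
  have "(\<lambda>m. LINT x|lborel. d m x) \<longlonglongrightarrow> (LINT x::'a|lborel. (0::real))"
  proof (rule integral_dominated_convergence[where w="indicator U :: 'a \<Rightarrow> real"])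
    show "AE x in lborel. (\<lambda>m. d m x) \<longlonglongrightarrow> 0"
    proof (rule AE_I2)
      fix x
      show "(\<lambda>m. d m x) \<longlonglongrightarrow> 0"
      proof (cases "x \<in> U")
        case True
        have "(\<lambda>m. x + h m) \<longlonglongrightarrow> x + 0" by (intro tendsto_add tendsto_const h)
        then have "eventually (\<lambda>m. x + h m \<in> U) sequentially"
          using True \<open>open U\<close> by (simp add: topological_tendstoD)
        then have "eventually (\<lambda>m. d m x = 0) sequentially" by eventually_elim (simp add: d_def)
        then show ?thesis by (rule tendsto_eventually)
      qed (simp add: d_def)
    qed
  qed (use iU id in \<open>auto simp: d_def indicator_def\<close>)
  then have "(\<lambda>m. 2 * (LINT x|lborel. d m x)) \<longlonglongrightarrow> 0" using tendsto_mult_right_zero by fastforce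
  moreover have "(LINT x|lborel. \<bar>indicator U (x + h m) - indicator U x :: real\<bar>) = 2 * (LINT x|lborel. d m x)" for m
  proof -
    have "(LINT x|lborel. \<bar>indicator U (x + h m) - indicator U x :: real\<bar>)
       = (LINT x|lborel. (indicator U (x + h m) - indicator U x) + 2 * d m x)"
      by (intro Bochner_Integration.integral_cong) (auto simp: d_def indicator_def)
    also have "\<dots> = 2 * (LINT x|lborel. d m x)"
      using iU iU' id integral_lborel_translate[of "indicator U :: 'a \<Rightarrow> real" "h m"] by simp
    finally show ?thesis .
  qed
  ultimately show ?thesis by simp
qed

text \<open>Outer regularity reduces measurable sets to open ones; sums and dominated limits of
  simple functions reach all of L^1.\<close>

lemma tendsto_translate_L1:
  fixes g :: "'a::euclidean_space \<Rightarrow> real"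
  assumes "integrable lborel g" and h: "h \<longlonglongrightarrow> (0::'a)"
  shows "(\<lambda>m. LINT x|lborel. \<bar>g (x + h m) - g x\<bar>) \<longlonglongrightarrow> 0"
  using assms(1)
proof (induction rule: integrable_induct)
  case (base A c)
  then have [measurable]: "A \<in> sets borel" and fA: "emeasure lborel A < \<infinity>" by auto
  have ind: "(\<lambda>m. LINT x|lborel. \<bar>indicator A (x + h m) - indicator A x :: real\<bar>) \<longlonglongrightarrow> 0"
  proof (rule tendsto_translate_L1_approx[OF _ h])
    show "integrable lborel (indicator A :: 'a \<Rightarrow> real)" using fA by simp
    fix e :: real assume "0 < e"
    obtain U where U: "open U" "A \<subseteq> U" "emeasure lborel (U - A) < e"
      using outer_regular_lborel[of A e] \<open>0 < e\<close> by auto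
    have [measurable]: "U \<in> sets borel" using U by auto
    have "emeasure lborel U = emeasure lborel A + emeasure lborel (U - A)"
      using U(2) by (subst plus_emeasure) (auto simp: Un_absorb1)
    also have "\<dots> < \<infinity>" using fA U(3) by (simp add: ennreal_add_less_top less_trans[OF U(3)])
    finally have fU: "emeasure lborel U < \<infinity>" .
    have "(LINT x|lborel. \<bar>indicator A x - indicator U x :: real\<bar>) = (LINT x|lborel. indicator (U - A) x)"
      using U(2) by (intro Bochner_Integration.integral_cong) (auto simp: indicator_def)
    also have "\<dots> = measure lborel (U - A)" by simp
    also have "\<dots> \<le> e" using U(3) \<open>0 < e\<close> unfolding measure_def
      by (metis enn2real_leI less_imp_le)
    finally show "\<exists>g'. integrable lborel g' \<and> (LINT x|lborel. \<bar>indicator A x - g' x\<bar>) \<le> e \<and>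
       (\<lambda>m. LINT x|lborel. \<bar>g' (x + h m) - g' x\<bar>) \<longlonglongrightarrow> 0"
      using fU tendsto_translate_L1_indicator_open[OF U(1) fU h]
      by (intro exI[of _ "indicator U"]) auto
  qed
  have "(\<lambda>m. (LINT x|lborel. \<bar>indicator A (x + h m) - indicator A x :: real\<bar>) * \<bar>c\<bar>) \<longlonglongrightarrow> 0"
    using tendsto_mult_left_zero[OF ind] .
  then show ?case by (simp flip: left_diff_distrib add: abs_mult)
next
  case (add f g)
  have "(\<lambda>m. (LINT x|lborel. \<bar>f (x + h m) - f x\<bar>) + (LINT x|lborel. \<bar>g (x + h m) - g x\<bar>)) \<longlonglongrightarrow> 0"
    using tendsto_add[OF add(3,4)] by simp
  then show ?case
  proof (rule tendsto_sandwich[OF _ _ tendsto_const, rotated 2])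
    show "\<forall>\<^sub>F m in sequentially. (LINT x|lborel. \<bar>f (x + h m) + g (x + h m) - (f x + g x)\<bar>)
        \<le> (LINT x|lborel. \<bar>f (x + h m) - f x\<bar>) + (LINT x|lborel. \<bar>g (x + h m) - g x\<bar>)"
    proof (rule always_eventually, rule allI)
      fix m
      have i: "integrable lborel (\<lambda>x. f (x + h m))" "integrable lborel (\<lambda>x. g (x + h m))"
        using add(1,2) by (auto intro: integrable_lborel_translate)
      have "(LINT x|lborel. \<bar>f (x + h m) + g (x + h m) - (f x + g x)\<bar>)
        \<le> (LINT x|lborel. \<bar>f (x + h m) - f x\<bar> + \<bar>g (x + h m) - g x\<bar>)"
        using add(1,2) i by (intro integral_mono) auto
      then show "(LINT x|lborel. \<bar>f (x + h m) + g (x + h m) - (f x + g x)\<bar>)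
        \<le> (LINT x|lborel. \<bar>f (x + h m) - f x\<bar>) + (LINT x|lborel. \<bar>g (x + h m) - g x\<bar>)"
        using add(1,2) i by simp
    qed
  qed auto
next
  case (lim f s)
  have "(\<lambda>i. LINT x|lborel. \<bar>f x - s i x\<bar>) \<longlonglongrightarrow> (LINT x::'a|lborel. (0::real))"
  proof (rule integral_dominated_convergence[where w="\<lambda>x. 3 * \<bar>f x\<bar>"])
    show "AE x in lborel. (\<lambda>i. \<bar>f x - s i x\<bar>) \<longlonglongrightarrow> 0"
    proof (intro AE_I2 tendsto_rabs_zero)
      show "(\<lambda>i. f x - s i x) \<longlonglongrightarrow> 0" for x
        using tendsto_diff[OF tendsto_const lim.hyps(2)[of x], of "f x"] by simp
    qed
    show "AE x in lborel. norm \<bar>f x - s i x\<bar> \<le> 3 * \<bar>f x\<bar>" for i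
    proof (rule AE_I2)
      show "norm \<bar>f x - s i x\<bar> \<le> 3 * \<bar>f x\<bar>" for x using lim.hyps(3)[of x i] by simp
    qed
  qed (use lim.hyps(1,4) in auto)
  then have l: "(\<lambda>i. LINT x|lborel. \<bar>f x - s i x\<bar>) \<longlonglongrightarrow> 0" by simp
  show ?case
  proof (rule tendsto_translate_L1_approx[OF lim.hyps(4) h])
    fix e :: real assume "0 < e"
    then have "eventually (\<lambda>i. (LINT x|lborel. \<bar>f x - s i x\<bar>) < e) sequentially"
      using order_tendstoD(2)[OF l] by auto
    then obtain i where "(LINT x|lborel. \<bar>f x - s i x\<bar>) < e" by (auto simp: eventually_sequentially)
    then show "\<exists>g'. integrable lborel g' \<and> (LINT x|lborel. \<bar>f x - g' x\<bar>) \<le> e \<and>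
       (\<lambda>m. LINT x|lborel. \<bar>g' (x + h m) - g' x\<bar>) \<longlonglongrightarrow> 0"
      using lim.hyps(1) lim.IH by (intro exI[of _ "s i"]) auto
  qed
qed

section \<open>Weak gradients\<close>

text \<open>The Borel counterpart of \<open>has_weak_gradient\<close>: with Borel representatives
  and \<open>lborel\<close>, product measurability and Fubini are available.
  \<open>has_weak_gradient_imp_wgrad\<close> and \<open>wgrad_imp_has_weak_gradient\<close>
  translate between the two.\<close>

definition wgrad :: "(real^'n) set \<Rightarrow> (real^'n \<Rightarrow> real) \<Rightarrow> (real^'n \<Rightarrow> real^'n) \<Rightarrow> bool" where
  "wgrad \<Omega> f G \<longleftrightarrow> f \<in> borel_measurable borel \<and> G \<in> borel_measurable borel \<and>
     (\<forall>K. compact K \<and> K \<subseteq> \<Omega> \<longrightarrow> set_integrable lborel K f \<and> set_integrable lborel K G) \<and>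
     (\<forall>\<phi>\<in>test_functions \<Omega>. \<forall>i.
        (LINT x:\<Omega>|lborel. f x * partial i \<phi> x) = - (LINT x:\<Omega>|lborel. G x $ i * \<phi> x))"

lemma test_function_measurable:
  assumes "\<phi> \<in> test_functions \<Omega>"
  shows "\<phi> \<in> borel_measurable borel" "partial i \<phi> \<in> borel_measurable borel"
  using test_functionD(1,3)[OF assms] by (auto intro: borel_measurable_continuous_onI)

lemma bounded_if_compact_supp:
  fixes g :: "'a::topological_space \<Rightarrow> real"
  assumes "continuous_on UNIV g" "compact K" "\<And>x. x \<notin> K \<Longrightarrow> g x = 0"
  obtains B where "0 \<le> B" "\<And>x. \<bar>g x\<bar> \<le> B"
proof -
  have "compact (g ` K)" using assms by (intro compact_continuous_image) (auto intro: continuous_on_subset)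
  then obtain B where B: "\<And>y. y \<in> g ` K \<Longrightarrow> norm y \<le> B" using compact_imp_bounded bounded_iff by metis
  show ?thesis
  proof (rule that[of "max 0 B"])
    show "\<bar>g x\<bar> \<le> max 0 B" for x using B[of "g x"] assms(3)[of x] by (cases "x \<in> K") (auto simp: le_max_iff_disj)
  qed auto
qed

lemma test_function_bounded:
  assumes "\<phi> \<in> test_functions \<Omega>"
  obtains B where "0 \<le> B" "\<And>x. \<bar>\<phi> x\<bar> \<le> B" "\<And>i x. \<bar>partial i \<phi> x\<bar> \<le> B"
proof -
  obtain B where B: "0 \<le> B" "\<And>x. \<bar>\<phi> x\<bar> \<le> B"
    using bounded_if_compact_supp[OF test_functionD(1)[OF assms] test_functionD(7)[OF assms]] test_functionD(5)[OF assms] by metis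
  have "\<exists>B\<ge>0. \<forall>x. \<bar>partial i \<phi> x\<bar> \<le> B" for i
    using bounded_if_compact_supp[OF test_functionD(3)[OF assms] test_functionD(7)[OF assms]] test_functionD(6)[OF assms] by metis
  then obtain B' where B': "\<And>i. 0 \<le> B' i" "\<And>i x. \<bar>partial i \<phi> x\<bar> \<le> B' i" by metis
  show ?thesis
  proof (rule that[of "B + sum B' UNIV"])
    show "\<bar>partial i \<phi> x\<bar> \<le> B + sum B' UNIV" for i x
      using B'(2)[of i x] member_le_sum[of i UNIV B'] B'(1) B(1) by fastforce
    show "\<bar>\<phi> x\<bar> \<le> B + sum B' UNIV" for x
      using B(2)[of x] sum_nonneg[of UNIV B'] B'(1) by fastforce
    show "0 \<le> B + sum B' UNIV" using sum_nonneg[of UNIV B'] B'(1) B(1) by fastforce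
  qed
qed

lemma integrable_times_bounded:
  fixes f g :: "'a \<Rightarrow> real"
  assumes "integrable M f" "g \<in> borel_measurable M" "\<And>x. \<bar>g x\<bar> \<le> B"
  shows "integrable M (\<lambda>x. f x * g x)"
proof (rule Bochner_Integration.integrable_bound[of M "\<lambda>x. B * f x"])
  show "AE x in M. norm (f x * g x) \<le> norm (B * f x)"
  proof (rule AE_I2)
    fix x
    have "\<bar>f x\<bar> * \<bar>g x\<bar> \<le> \<bar>f x\<bar> * \<bar>B\<bar>"
      using assms(3)[of x] by (intro mult_left_mono) auto
    then show "norm (f x * g x) \<le> norm (B * f x)" by (simp add: abs_mult mult.commute)
  qed
qed (use assms in auto)

lemma wgrad_integrable:
  assumes "wgrad \<Omega> f G" "compact K" "K \<subseteq> \<Omega>"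
  shows "integrable lborel (\<lambda>x. indicator K x * f x)" "integrable lborel (\<lambda>x. indicator K x * (G x \<bullet> h))"
    "integrable lborel (\<lambda>x. indicator K x * norm (G x))"
proof -
  have i: "integrable lborel (\<lambda>x. indicator K x *\<^sub>R f x)" "integrable lborel (\<lambda>x. indicator K x *\<^sub>R G x)"
    using assms unfolding wgrad_def set_integrable_def by blast+
  then show "integrable lborel (\<lambda>x. indicator K x * f x)" by simp
  have "integrable lborel (\<lambda>x. (indicator K x *\<^sub>R G x) \<bullet> h)" using i(2) by (intro integrable_inner_left) auto
  then show "integrable lborel (\<lambda>x. indicator K x * (G x \<bullet> h))" by simp
  have "integrable lborel (\<lambda>x. norm (indicator K x *\<^sub>R G x))" using i(2) by (rule integrable_norm)
  then show "integrable lborel (\<lambda>x. indicator K x * norm (G x))" by simp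
qed

text \<open>Integrability is known on compact subsets only. Cutting off at some \<open>K\<close>
  that contains the support, compact in all applications, makes both integrals absolutely
  convergent, so that sums and differences may be split.\<close>

lemma wgradD:
  assumes "wgrad \<Omega> f G" "\<phi> \<in> test_functions \<Omega>" "supp UNIV \<phi> \<subseteq> K" "K \<subseteq> \<Omega>"
  shows "(LINT x|lborel. indicator K x * f x * partial i \<phi> x) = - (LINT x|lborel. indicator K x * (G x $ i) * \<phi> x)"
proof -
  have "(LINT x|lborel. indicator K x * f x * partial i \<phi> x) = (LINT x:\<Omega>|lborel. f x * partial i \<phi> x)"
    unfolding set_lebesgue_integral_def using assms test_functionD(6)[OF assms(2)]
    by (intro Bochner_Integration.integral_cong) (auto simp: indicator_def)
  also have "\<dots> = - (LINT x:\<Omega>|lborel. G x $ i * \<phi> x)" using assms by (auto simp: wgrad_def)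
  also have "(LINT x:\<Omega>|lborel. G x $ i * \<phi> x) = (LINT x|lborel. indicator K x * (G x $ i) * \<phi> x)"
    unfolding set_lebesgue_integral_def using assms test_functionD(5)[OF assms(2)]
    by (intro Bochner_Integration.integral_cong) (auto simp: indicator_def)
  finally show ?thesis .
qed

lemma wgrad_directional:
  assumes w: "wgrad \<Omega> f G" and \<phi>: "\<phi> \<in> test_functions \<Omega>" and K: "supp UNIV \<phi> \<subseteq> K" "compact K" "K \<subseteq> \<Omega>"
  shows "(LINT x|lborel. indicator K x * f x * (\<Sum>i\<in>UNIV. partial i \<phi> x * h $ i))
    = - (LINT x|lborel. indicator K x * (G x \<bullet> h) * \<phi> x)"
proof -
  obtain B where B: "0 \<le> B" "\<And>x. \<bar>\<phi> x\<bar> \<le> B" "\<And>i x. \<bar>partial i \<phi> x\<bar> \<le> B" using test_function_bounded[OF \<phi>] by blast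
  note [measurable] = test_function_measurable[OF \<phi>]
  have a: "integrable lborel (\<lambda>x. indicator K x * f x * partial i \<phi> x)" for i
    by (rule integrable_times_bounded[OF wgrad_integrable(1)[OF w K(2,3)] _ B(3)]) auto
  have b: "integrable lborel (\<lambda>x. indicator K x * (G x $ i) * \<phi> x)" for i
    using integrable_times_bounded[OF wgrad_integrable(2)[OF w K(2,3), of "axis i 1"] _ B(2)] by (simp add: inner_axis)
  have "(LINT x|lborel. indicator K x * f x * (\<Sum>i\<in>UNIV. partial i \<phi> x * h $ i))
      = (LINT x|lborel. (\<Sum>i\<in>UNIV. h $ i * (indicator K x * f x * partial i \<phi> x)))"
    by (intro Bochner_Integration.integral_cong) (auto simp: sum_distrib_left intro!: sum.cong)
  also have "\<dots> = (\<Sum>i\<in>UNIV. h $ i * (LINT x|lborel. indicator K x * f x * partial i \<phi> x))"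
    using a by (subst Bochner_Integration.integral_sum) auto
  also have "\<dots> = (\<Sum>i\<in>UNIV. h $ i * - (LINT x|lborel. indicator K x * (G x $ i) * \<phi> x))"
    by (simp add: wgradD[OF w \<phi> K(1,3)])
  also have "\<dots> = - (\<Sum>i\<in>UNIV. h $ i * (LINT x|lborel. indicator K x * (G x $ i) * \<phi> x))"
    by (simp add: sum_negf)
  also have "(\<Sum>i\<in>UNIV. h $ i * (LINT x|lborel. indicator K x * (G x $ i) * \<phi> x))
      = (LINT x|lborel. (\<Sum>i\<in>UNIV. h $ i * (indicator K x * (G x $ i) * \<phi> x)))"
    using b by (subst Bochner_Integration.integral_sum) auto
  also have "\<dots> = (LINT x|lborel. indicator K x * (G x \<bullet> h) * \<phi> x)"
    by (intro Bochner_Integration.integral_cong)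
      (auto simp: inner_vec_def sum_distrib_left sum_distrib_right mult_ac intro!: sum.cong)
  finally show ?thesis .
qed

lemma bump_translate_partial:
  "partial i (bump m (a + y) (b + y)) x = partial i (bump m a b) (x - y)"
proof -
  have d: "(bump m a b has_derivative frechet_derivative (bump m a b) (at (x - y))) (at (x - y))"
    using smooth_partial[OF smooth_bump[of m a b]] by (simp add: frechet_derivative_works)
  have "((\<lambda>x. bump m a b (x - y)) has_derivative frechet_derivative (bump m a b) (at (x - y))) (at x)"
    by (rule has_derivative_compose[of "\<lambda>x. x - y" "\<lambda>h. h", OF _ d]) (auto intro!: derivative_eq_intros)
  from partial_eq[OF this, of i] show ?thesis by (simp add: bump_translate partial_def)
qed

text \<open>The difference of both sides is tested with bumps. Fubini and a change of variables move
  the shift by t h onto the bump, the weak gradient trades G . h for minus the derivative of the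
  bump along h, and integrating in t gives a plain difference of bumps. The exceptional null set
  depends on \<open>h\<close>.\<close>

lemma wgrad_line:
  fixes h :: "real^'n"
  assumes w: "wgrad \<Omega> f G" and S: "open S" and K: "compact K" "K \<subseteq> \<Omega>"
    and seg: "\<And>x t. x \<in> S \<Longrightarrow> 0 \<le> t \<Longrightarrow> t \<le> 1 \<Longrightarrow> x + t *\<^sub>R h \<in> K"
  shows "AE x in lborel. x \<in> S \<longrightarrow> f (x + h) - f x = (LINT t:{0..1}|lborel. G (x + t *\<^sub>R h) \<bullet> h)"
proof -
  have [measurable]: "f \<in> borel_measurable borel" "G \<in> borel_measurable borel" using w by (auto simp: wgrad_def)
  have [measurable]: "K \<in> sets borel" using K by (auto intro: borel_compact)
  \<comment> \<open>The cutoff makes both functions integrable on the whole space, so they may be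
    translated freely; along the segments in question it changes nothing.\<close>
  define f1 where "f1 = (\<lambda>x. indicator K x * f x)"
  define g1 where "g1 = (\<lambda>x. indicator K x * (G x \<bullet> h))"
  have f1: "integrable lborel f1" and g1: "integrable lborel g1"
    using wgrad_integrable[OF w K] by (auto simp: f1_def g1_def)
  have [measurable]: "f1 \<in> borel_measurable borel" "g1 \<in> borel_measurable borel"
    unfolding f1_def g1_def by measurable
  define P where "P = (\<lambda>(t::real, x). indicator {0..1} t * g1 (x + t *\<^sub>R h))"
  have P: "integrable (lborel \<Otimes>\<^sub>M lborel) P"
  proof (rule lborel_pair.Fubini_integrable)
    show "P \<in> borel_measurable (lborel \<Otimes>\<^sub>M lborel)" unfolding P_def by measurable
    show "AE t in lborel. integrable lborel (\<lambda>x. P (t, x))"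
      unfolding P_def by (auto intro!: integrable_lborel_translate g1)
    have "(LINT x|lborel. norm (P (t, x))) = indicator {0..1} t *\<^sub>R (LINT x|lborel. \<bar>g1 x\<bar>)" for t
      using integral_lborel_translate[of "\<lambda>x. \<bar>g1 x\<bar>" "t *\<^sub>R h"]
      by (cases "t \<in> {0..1}") (auto simp: P_def)
    then show "integrable lborel (\<lambda>t. LINT x|lborel. norm (P (t, x)))"
      by (auto intro!: integrable_real_mult_indicator)
  qed
  define D where "D = (\<lambda>x. f1 (x + h) - f1 x - (LINT t|lborel. P (t, x)))"
  have P': "integrable lborel (\<lambda>x. LINT t|lborel. P (t, x))"
    using lborel_pair.integrable_snd[of "\<lambda>t x. P (t, x)"] P by simp
  have D: "integrable lborel D"
    unfolding D_def using f1 integrable_lborel_translate[OF f1, of h] P' by auto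
  have "AE x in lborel. x \<in> S \<longrightarrow> D x = 0"
  proof (rule AE_eq_0_if_bump_integrals[OF S])
    show "D \<in> borel_measurable borel" using D by auto
    show "set_integrable lborel (cbox a b) D" for a b
      unfolding set_integrable_def using D by (intro integrable_mult_indicator) auto
    fix m a b assume ab: "cbox a b \<subseteq> S"
    define \<phi> where "\<phi> = bump m a b"
    define \<psi> where "\<psi> = (\<lambda>x. \<Sum>i\<in>UNIV. partial i \<phi> x * h $ i)"
    have "S \<subseteq> \<Omega>" using seg[of _ 0] K by auto
    then have \<phi>: "\<phi> \<in> test_functions \<Omega>" using ab unfolding \<phi>_def by (intro bump_test_function) auto
    note [measurable] = test_function_measurable[OF \<phi>]
    have [measurable]: "\<psi> \<in> borel_measurable borel" unfolding \<psi>_def by measurable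
    obtain B where B: "0 \<le> B" "\<And>x. \<bar>\<phi> x\<bar> \<le> B" "\<And>i x. \<bar>partial i \<phi> x\<bar> \<le> B" using test_function_bounded[OF \<phi>] by blast
    define B' where "B' = (\<Sum>i\<in>UNIV. B * \<bar>h $ i\<bar>)"
    have B': "\<bar>\<psi> x\<bar> \<le> B'" for x
    proof -
      have "\<bar>\<psi> x\<bar> \<le> (\<Sum>i\<in>UNIV. \<bar>partial i \<phi> x * h $ i\<bar>)" unfolding \<psi>_def by (rule sum_abs)
      also have "\<dots> \<le> B'" unfolding B'_def using B(3) by (intro sum_mono) (auto simp: abs_mult intro!: mult_right_mono)
      finally show ?thesis .
    qed
    have cont_\<psi>: "continuous_on UNIV \<psi>"
      unfolding \<psi>_def using test_functionD(3)[OF \<phi>] by (intro continuous_intros) auto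
    \<comment> \<open>The form that \<open>P\<close> times the bump takes after the change of
      variables and integration by parts, up to sign: \<open>\<psi>\<close> is the derivative of
      \<open>\<phi>\<close> along \<open>h\<close>.\<close>
    define Q where "Q = (\<lambda>(t::real, x). indicator {0..1} t * (f1 x * \<psi> (x - t *\<^sub>R h)))"
    have Q: "integrable (lborel \<Otimes>\<^sub>M lborel) Q"
    proof (rule Bochner_Integration.integrable_bound)
      show "integrable (lborel \<Otimes>\<^sub>M lborel) (\<lambda>(t::real, x). indicator {0..1} t * (B' * f1 x))"
      proof (rule lborel_pair.Fubini_integrable)
        show "AE t in lborel. integrable lborel (\<lambda>x. case (t::real, x) of (t, x) \<Rightarrow> indicator {0..1} t * (B' * f1 x))"
          using f1 by auto
        have "(LINT x|lborel. norm (case (t::real, x) of (t, x) \<Rightarrow> indicator {0..1} t * (B' * f1 x)))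
          = indicator {0..1} t *\<^sub>R (LINT x|lborel. \<bar>B' * f1 x\<bar>)" for t
          by (cases "t \<in> {0..1}") auto
        then show "integrable lborel (\<lambda>t. LINT x|lborel. norm (case (t::real, x) of (t, x) \<Rightarrow> indicator {0..1} t * (B' * f1 x)))"
          by (auto intro!: integrable_real_mult_indicator)
      qed measurable
      show "Q \<in> borel_measurable (lborel \<Otimes>\<^sub>M lborel)" unfolding Q_def by measurable
      show "AE z in lborel \<Otimes>\<^sub>M lborel. norm (Q z) \<le> norm (case z of (t::real, x) \<Rightarrow> indicator {0..1} t * (B' * f1 x))"
      proof (rule AE_I2)
        fix z :: "real \<times> (real^'n)"
        have "\<bar>f1 x\<bar> * \<bar>\<psi> y\<bar> \<le> \<bar>B'\<bar> * \<bar>f1 x\<bar>" for x y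
          using mult_right_mono[OF B'[of y] abs_ge_zero[of "f1 x"]] mult_right_mono[OF abs_ge_self[of B'] abs_ge_zero[of "f1 x"]]
          by (simp add: mult.commute)
        then show "norm (Q z) \<le> norm (case z of (t::real, x) \<Rightarrow> indicator {0..1} t * (B' * f1 x))"
          by (cases z) (auto simp: Q_def abs_mult indicator_def)
      qed
    qed
    have i\<phi>: "integrable lborel (\<lambda>x. f1 x * \<phi> (x - c))" for c
      by (rule integrable_times_bounded[OF f1 _ B(2)]) auto
    have i\<phi>': "integrable lborel (\<lambda>x. f1 (x + h) * \<phi> x)"
      by (rule integrable_times_bounded[OF integrable_lborel_translate[OF f1] _ B(2)]) auto
    have P\<phi>: "integrable (lborel \<Otimes>\<^sub>M lborel) (\<lambda>(t, x). P (t, x) * \<phi> x)"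
      using integrable_times_bounded[OF P, of "\<lambda>(t, x). \<phi> x" B] B(2) by (simp add: split_beta')
    have "(LINT x|lborel. \<phi> x * (LINT t|lborel. P (t, x))) = (LINT x|lborel. LINT t|lborel. P (t, x) * \<phi> x)"
      by (simp add: mult.commute)
    also have "\<dots> = (LINT t|lborel. LINT x|lborel. P (t, x) * \<phi> x)"
      by (rule lborel_pair.Fubini_integral[OF P\<phi>])
    also have "\<dots> = (LINT t|lborel. - (LINT x|lborel. Q (t, x)))"
    proof (rule Bochner_Integration.integral_cong[OF refl])
      fix t :: real
      show "(LINT x|lborel. P (t, x) * \<phi> x) = - (LINT x|lborel. Q (t, x))"
      proof (cases "t \<in> {0..1}")
        case True
        \<comment> \<open>The shifted bump lives on the shifted box, which stays in \<open>K\<close>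
          by \<open>seg\<close>; hence it is an admissible test function for every t in
          [0,1].\<close>
        define \<phi>t where "\<phi>t = bump m (a + t *\<^sub>R h) (b + t *\<^sub>R h)"
        have sub: "cbox (a + t *\<^sub>R h) (b + t *\<^sub>R h) \<subseteq> K"
        proof
          fix x assume "x \<in> cbox (a + t *\<^sub>R h) (b + t *\<^sub>R h)"
          then have "x - t *\<^sub>R h \<in> cbox a b" by (auto simp: mem_box_cart algebra_simps)
          then show "x \<in> K" using seg[of "x - t *\<^sub>R h" t] ab True by auto
        qed
        then have \<phi>t: "\<phi>t \<in> test_functions \<Omega>" unfolding \<phi>t_def using K by (intro bump_test_function) auto
        have supp: "supp UNIV \<phi>t \<subseteq> K"
          unfolding \<phi>t_def
        proof (rule supp_subset_closed)
          show "closed K" using K(1) by (rule compact_imp_closed)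
          fix x assume "x \<notin> K"
          then have "x \<notin> box (a + t *\<^sub>R h) (b + t *\<^sub>R h)" using sub box_subset_cbox by blast
          then show "bump m (a + t *\<^sub>R h) (b + t *\<^sub>R h) x = 0" by (rule bump_eq_0)
        qed
        have "(LINT x|lborel. P (t, x) * \<phi> x) = (LINT x|lborel. g1 (x + t *\<^sub>R h) * \<phi> ((x + t *\<^sub>R h) - t *\<^sub>R h))"
          using True by (simp add: P_def)
        also have "\<dots> = (LINT x|lborel. g1 x * \<phi> (x - t *\<^sub>R h))"
          by (rule integral_lborel_translate) measurable
        also have "\<dots> = (LINT x|lborel. indicator K x * (G x \<bullet> h) * \<phi>t x)"
          by (simp add: g1_def \<phi>t_def \<phi>_def bump_translate)
        also have "\<dots> = - (LINT x|lborel. indicator K x * f x * (\<Sum>i\<in>UNIV. partial i \<phi>t x * h $ i))"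
          using wgrad_directional[OF w \<phi>t supp K, of h] by simp
        also have "(LINT x|lborel. indicator K x * f x * (\<Sum>i\<in>UNIV. partial i \<phi>t x * h $ i)) = (LINT x|lborel. Q (t, x))"
          using True by (simp add: Q_def f1_def \<psi>_def \<phi>_def \<phi>t_def bump_translate_partial)
        finally show ?thesis .
      qed (simp add: P_def Q_def)
    qed
    also have "\<dots> = - (LINT t|lborel. LINT x|lborel. Q (t, x))" by simp
    also have "(LINT t|lborel. LINT x|lborel. Q (t, x)) = (LINT x|lborel. LINT t|lborel. Q (t, x))"
      using lborel_pair.Fubini_integral[of "\<lambda>t x. Q (t, x)"] Q by simp
    also have "\<dots> = (LINT x|lborel. f1 x * \<phi> x - f1 x * \<phi> (x - h))"
    proof (rule Bochner_Integration.integral_cong[OF refl])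
      fix x
      have "(LINT t|lborel. indicator {0..1} t *\<^sub>R \<psi> (x - t *\<^sub>R h)) = - \<phi> (x - 1 *\<^sub>R h) - - \<phi> (x - 0 *\<^sub>R h)"
      proof (rule integral_FTC_atLeastAtMost)
        fix t :: real
        have d: "(\<phi> has_derivative (\<lambda>k. \<Sum>i\<in>UNIV. partial i \<phi> (x - t *\<^sub>R h) * k $ i)) (at (x - t *\<^sub>R h))"
          by (rule test_functionD(4)[OF \<phi>])
        have "((\<lambda>t. \<phi> (x - t *\<^sub>R h)) has_derivative (\<lambda>s. \<Sum>i\<in>UNIV. partial i \<phi> (x - t *\<^sub>R h) * (- s *\<^sub>R h) $ i)) (at t within {0..1})"
          by (rule has_derivative_compose[where g=\<phi> and f="\<lambda>t. x - t *\<^sub>R h", OF _ d]) (auto intro!: derivative_eq_intros)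
        then have "((\<lambda>t. \<phi> (x - t *\<^sub>R h)) has_derivative (\<lambda>s. s * - \<psi> (x - t *\<^sub>R h))) (at t within {0..1})"
          by (rule has_derivative_eq_rhs) (auto simp: \<psi>_def sum_distrib_left sum_negf mult_ac)
        then have "((\<lambda>t. \<phi> (x - t *\<^sub>R h)) has_vector_derivative - \<psi> (x - t *\<^sub>R h)) (at t within {0..1})"
          by (simp add: has_vector_derivative_def)
        from has_vector_derivative_minus[OF this]
        show "((\<lambda>t. - \<phi> (x - t *\<^sub>R h)) has_vector_derivative \<psi> (x - t *\<^sub>R h)) (at t within {0..1})" by simp
      next
        show "continuous_on {0..1} (\<lambda>t. \<psi> (x - t *\<^sub>R h))"
          by (rule continuous_on_compose2[OF cont_\<psi>]) (auto intro!: continuous_intros)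
      qed simp
      then have "(LINT t|lborel. indicator {0..1} t * \<psi> (x - t *\<^sub>R h)) = \<phi> x - \<phi> (x - h)" by simp
      then have "f1 x * (LINT t|lborel. indicator {0..1} t * \<psi> (x - t *\<^sub>R h)) = f1 x * \<phi> x - f1 x * \<phi> (x - h)"
        by (simp only: right_diff_distrib)
      then show "(LINT t|lborel. Q (t, x)) = f1 x * \<phi> x - f1 x * \<phi> (x - h)"
        by (simp add: Q_def mult.left_commute flip: integral_mult_right_zero)
    qed
    also have "\<dots> = (LINT x|lborel. f1 x * \<phi> x) - (LINT x|lborel. f1 x * \<phi> (x - h))"
      using i\<phi>[of 0] i\<phi>[of h] by simp
    also have "(LINT x|lborel. f1 x * \<phi> (x - h)) = (LINT x|lborel. f1 (x + h) * \<phi> x)"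
      using integral_lborel_translate[of "\<lambda>x. f1 x * \<phi> (x - h)" h] by simp
    finally have eq: "(LINT x|lborel. \<phi> x * (LINT t|lborel. P (t, x)))
       = (LINT x|lborel. f1 (x + h) * \<phi> x) - (LINT x|lborel. f1 x * \<phi> x)" by simp
    have iP: "integrable lborel (\<lambda>x. \<phi> x * (LINT t|lborel. P (t, x)))"
      using integrable_times_bounded[OF P' _ B(2)] by (simp add: mult.commute)
    have "(LINT x|lborel. \<phi> x * D x) = (LINT x|lborel. f1 (x + h) * \<phi> x - f1 x * \<phi> x - \<phi> x * (LINT t|lborel. P (t, x)))"
      unfolding D_def by (intro Bochner_Integration.integral_cong) (auto simp: algebra_simps)
    also have "\<dots> = 0" using i\<phi>[of 0] i\<phi>' iP eq by simp
    finally show "(LINT x|lborel. bump m a b x * D x) = 0" by (simp add: \<phi>_def)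
  qed
  then show ?thesis
  proof eventually_elim
    case (elim x)
    show ?case
    proof
      assume x: "x \<in> S"
      have "f1 (x + h) = f (x + h)" "f1 x = f x" using seg[OF x, of 1] seg[OF x, of 0] by (auto simp: f1_def)
      moreover have "(LINT t|lborel. P (t, x)) = (LINT t:{0..1}|lborel. G (x + t *\<^sub>R h) \<bullet> h)"
        unfolding set_lebesgue_integral_def
        using seg[OF x] by (intro Bochner_Integration.integral_cong) (auto simp: P_def g1_def indicator_def)
      ultimately show "f (x + h) - f x = (LINT t:{0..1}|lborel. G (x + t *\<^sub>R h) \<bullet> h)"
        using elim x by (simp add: D_def)
    qed
  qed
qed

text \<open>Minkowski's inequality: the L^1 distance of the average to \<open>g\<close> is at most
  the average of the distances of the translates to \<open>g\<close>. These tend to 0 and are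
  bounded by twice the norm of \<open>g\<close>, so dominated convergence in s applies.\<close>

lemma tendsto_avg_translate_L1:
  fixes g :: "'a::euclidean_space \<Rightarrow> real" and k :: "nat \<Rightarrow> 'a"
  assumes g: "integrable lborel g" and k: "k \<longlonglongrightarrow> 0"
  shows "integrable lborel (\<lambda>x. LINT s|lborel. indicator {0..1} s * g (x + s *\<^sub>R k m))"
    and "(\<lambda>m. LINT x|lborel. \<bar>(LINT s|lborel. indicator {0..1} s * g (x + s *\<^sub>R k m)) - g x\<bar>) \<longlonglongrightarrow> 0"
proof -
  have [measurable]: "g \<in> borel_measurable borel" using g by auto
  define N where "N = (\<lambda>h. LINT x|lborel. \<bar>g (x + h) - g x\<bar>)"
  have [measurable]: "N \<in> borel_measurable borel" unfolding N_def by measurable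
  have Nle: "N h \<le> 2 * (LINT x|lborel. \<bar>g x\<bar>)" for h
  proof -
    have "N h \<le> (LINT x|lborel. \<bar>g (x + h)\<bar> + \<bar>g x\<bar>)"
      unfolding N_def using g integrable_lborel_translate[OF g, of h] by (intro integral_mono) auto
    also have "\<dots> = (LINT x|lborel. \<bar>g (x + h)\<bar>) + (LINT x|lborel. \<bar>g x\<bar>)"
      using g integrable_lborel_translate[OF g, of h] by simp
    also have "(LINT x|lborel. \<bar>g (x + h)\<bar>) = (LINT x|lborel. \<bar>g x\<bar>)"
      using integral_lborel_translate[of "\<lambda>x. \<bar>g x\<bar>" h] by simp
    finally show ?thesis by simp
  qed
  have N0: "0 \<le> N h" for h unfolding N_def by simp
  \<comment> \<open>The parameter \<open>c\<close> covers two uses: c = 0 for integrability of the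
    averaged function, c = 1 for the differences.\<close>
  have R: "integrable (lborel \<Otimes>\<^sub>M lborel) (\<lambda>(s::real, x). indicator {0..1} s * (g (x + s *\<^sub>R h) - c * g x))" for h c
  proof (rule lborel_pair.Fubini_integrable)
    show "AE s in lborel. integrable lborel (\<lambda>x. case (s::real, x) of (s, x) \<Rightarrow> indicator {0..1} s * (g (x + s *\<^sub>R h) - c * g x))"
      using g integrable_lborel_translate[OF g] by (intro AE_I2) auto
    have le: "(LINT x|lborel. \<bar>g (x + k) - c * g x\<bar>) \<le> (1 + \<bar>c\<bar>) * (LINT x|lborel. \<bar>g x\<bar>)" for k
    proof -
      have "(LINT x|lborel. \<bar>g (x + k) - c * g x\<bar>) \<le> (LINT x|lborel. \<bar>g (x + k)\<bar> + \<bar>c\<bar> * \<bar>g x\<bar>)"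
      proof (rule integral_mono)
        show "\<bar>g (x + k) - c * g x\<bar> \<le> \<bar>g (x + k)\<bar> + \<bar>c\<bar> * \<bar>g x\<bar>" for x
          using abs_triangle_ineq4[of "g (x + k)" "c * g x"] by (simp add: abs_mult)
      qed (use g integrable_lborel_translate[OF g, of k] in auto)
      also have "\<dots> = (1 + \<bar>c\<bar>) * (LINT x|lborel. \<bar>g x\<bar>)"
        using g integrable_lborel_translate[OF g, of k] integral_lborel_translate[of "\<lambda>x. \<bar>g x\<bar>" k]
        by (simp add: algebra_simps)
      finally show ?thesis .
    qed
    have "integrable lborel (\<lambda>s::real. indicator {0..1} s * (LINT x|lborel. \<bar>g (x + s *\<^sub>R h) - c * g x\<bar>))"
    proof (rule Bochner_Integration.integrable_bound)
      show "integrable lborel (\<lambda>s::real. indicator {0..1} s * ((1 + \<bar>c\<bar>) * (LINT x|lborel. \<bar>g x\<bar>)) :: real)" by simp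
      show "AE s in lborel. norm (indicator {0..1} s * (LINT x|lborel. \<bar>g (x + s *\<^sub>R h) - c * g x\<bar>))
         \<le> norm (indicator {0..1} s * ((1 + \<bar>c\<bar>) * (LINT x|lborel. \<bar>g x\<bar>)) :: real)"
        using le by (intro AE_I2) (auto simp: indicator_def)
    qed measurable
    then show "integrable lborel (\<lambda>s. LINT x|lborel. norm (case (s::real, x) of (s, x) \<Rightarrow> indicator {0..1} s * (g (x + s *\<^sub>R h) - c * g x)))"
      by (simp add: abs_mult)
  qed measurable
  show "integrable lborel (\<lambda>x. LINT s|lborel. indicator {0..1} s * g (x + s *\<^sub>R k m))" for m
    using lborel_pair.integrable_snd[OF R[of "k m" 0]] by simp
  have le: "(LINT x|lborel. \<bar>(LINT s|lborel. indicator {0..1} s * g (x + s *\<^sub>R k m)) - g x\<bar>)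
      \<le> (LINT s|lborel. indicator {0..1} s * N (s *\<^sub>R k m))" for m
  proof -
    let ?R = "\<lambda>(s::real, x). indicator {0..1} s * (g (x + s *\<^sub>R k m) - 1 * g x)"
    have "(LINT x|lborel. \<bar>(LINT s|lborel. indicator {0..1} s * g (x + s *\<^sub>R k m)) - g x\<bar>)
       \<le> (LINT x|lborel. LINT s|lborel. \<bar>indicator {0..1} s * (g (x + s *\<^sub>R k m) - g x)\<bar>)"
    proof (rule integral_mono_AE)
      show "integrable lborel (\<lambda>x. \<bar>(LINT s|lborel. indicator {0..1} s * g (x + s *\<^sub>R k m)) - g x\<bar>)"
        using lborel_pair.integrable_snd[OF R[of "k m" 0]] g by auto
      have "integrable (lborel \<Otimes>\<^sub>M lborel) (\<lambda>(s, x). \<bar>?R (s, x)\<bar>)"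
        using integrable_abs[OF R[of "k m" 1]] by (simp add: split_beta')
      from lborel_pair.integrable_snd[OF this]
      show "integrable lborel (\<lambda>x. LINT s|lborel. \<bar>indicator {0..1} s * (g (x + s *\<^sub>R k m) - g x)\<bar>)" by simp
      show "AE x in lborel. \<bar>(LINT s|lborel. indicator {0..1} s * g (x + s *\<^sub>R k m)) - g x\<bar>
          \<le> (LINT s|lborel. \<bar>indicator {0..1} s * (g (x + s *\<^sub>R k m) - g x)\<bar>)"
        using lborel_pair.AE_integrable_snd[OF R[of "k m" 0]]
      proof eventually_elim
        case (elim x)
        have i: "integrable lborel (\<lambda>s. indicator {0..1} s * g (x + s *\<^sub>R k m))"
          using elim by simp
        have "(LINT s|lborel. indicator {0..1} s * g (x + s *\<^sub>R k m)) - g x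
          = (LINT s|lborel. indicator {0..1} s * g (x + s *\<^sub>R k m)) - (LINT s::real|lborel. indicator {0..1} s * g x)"
          by simp
        also have "\<dots> = (LINT s|lborel. indicator {0..1} s * g (x + s *\<^sub>R k m) - indicator {0..1} s * g x)"
          using i by (subst Bochner_Integration.integral_diff) auto
        also have "\<dots> = (LINT s|lborel. indicator {0..1} s * (g (x + s *\<^sub>R k m) - g x))"
          by (simp add: algebra_simps)
        finally have e: "(LINT s|lborel. indicator {0..1} s * g (x + s *\<^sub>R k m)) - g x
          = (LINT s|lborel. indicator {0..1} s * (g (x + s *\<^sub>R k m) - g x))" .
        show ?case unfolding e by (rule integral_abs_bound)
      qed
    qed
    also have "\<dots> = (LINT s|lborel. LINT x|lborel. \<bar>indicator {0..1} s * (g (x + s *\<^sub>R k m) - g x)\<bar>)"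
    proof -
      have "integrable (lborel \<Otimes>\<^sub>M lborel) (\<lambda>(s, x). \<bar>?R (s, x)\<bar>)"
        using integrable_abs[OF R[of "k m" 1]] by (simp add: split_beta')
      from lborel_pair.Fubini_integral[OF this] show ?thesis by simp
    qed
    also have "\<dots> = (LINT s|lborel. indicator {0..1} s * N (s *\<^sub>R k m))"
      by (simp add: abs_mult N_def)
    finally show ?thesis .
  qed
  have "(\<lambda>m. LINT s|lborel. indicator {0..1} s * N (s *\<^sub>R k m)) \<longlonglongrightarrow> (LINT s::real|lborel. (0::real))"
  proof (rule integral_dominated_convergence[where w="\<lambda>s. indicator {0..1} s * (2 * (LINT x|lborel. \<bar>g x\<bar>))"])
    show "AE s in lborel. (\<lambda>m. indicator {0..1} s * N (s *\<^sub>R k m)) \<longlonglongrightarrow> 0"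
    proof (rule AE_I2)
      fix s :: real
      have "(\<lambda>m. s *\<^sub>R k m) \<longlonglongrightarrow> s *\<^sub>R 0" by (intro tendsto_scaleR tendsto_const k)
      then have "(\<lambda>m. N (s *\<^sub>R k m)) \<longlonglongrightarrow> 0"
        unfolding N_def by (intro tendsto_translate_L1[OF g]) simp
      then show "(\<lambda>m. indicator {0..1} s * N (s *\<^sub>R k m)) \<longlonglongrightarrow> 0" by (rule tendsto_mult_right_zero)
    qed
    show "AE s in lborel. norm (indicator {0..1} s * N (s *\<^sub>R k m)) \<le> indicator {0..1} s * (2 * (LINT x|lborel. \<bar>g x\<bar>))" for m
      using Nle N0 by (intro AE_I2) (auto simp: indicator_def)
  qed auto
  then have "(\<lambda>m. LINT s|lborel. indicator {0..1} s * N (s *\<^sub>R k m)) \<longlonglongrightarrow> 0" by simp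
  then show "(\<lambda>m. LINT x|lborel. \<bar>(LINT s|lborel. indicator {0..1} s * g (x + s *\<^sub>R k m)) - g x\<bar>) \<longlonglongrightarrow> 0"
    by (rule tendsto_sandwich[OF _ _ tendsto_const, rotated 2]) (use le in auto)
qed

text \<open>Difference quotients are used instead of mollification: along a suitable sequence of steps the
  difference quotient of \<open>f\<close> converges in \<open>L\<^sup>1\<close> to the weak partial derivative.\<close>

lemma wgrad_compose:
  assumes w: "wgrad \<Omega> f G" and "open \<Omega>"
    and F: "\<And>t. (F has_field_derivative F' t) (at t)" and F1: "\<And>t. \<bar>F' t\<bar> \<le> 1"
    and [measurable]: "F' \<in> borel_measurable borel"
  shows "wgrad \<Omega> (\<lambda>x. F (f x)) (\<lambda>x. F' (f x) *\<^sub>R G x)"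
proof -
  have [measurable]: "f \<in> borel_measurable borel" "G \<in> borel_measurable borel" using w by (auto simp: wgrad_def)
  have "continuous_on UNIV F" using F by (auto intro!: continuous_at_imp_continuous_on DERIV_isCont)
  then have [measurable]: "F \<in> borel_measurable borel" by (rule borel_measurable_continuous_onI)
  have lip: "\<bar>F s - F t\<bar> \<le> \<bar>s - t\<bar>" for s t
  proof -
    have "norm (F s - F t) \<le> 1 * norm (s - t)"
      by (rule field_differentiable_bound[of UNIV F F']) (use F F1 in auto)
    then show ?thesis by simp
  qed
  have int: "integrable lborel (\<lambda>x. indicator K x * F (f x))" "integrable lborel (\<lambda>x. indicator K x *\<^sub>R (F' (f x) *\<^sub>R G x))"
    if K: "compact K" "K \<subseteq> \<Omega>" for K
  proof -
    have [measurable]: "K \<in> sets borel" using K by (auto intro: borel_compact)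
    have "integrable lborel (\<lambda>x. indicator K x * \<bar>F 0\<bar> + \<bar>indicator K x * f x\<bar>)"
      using wgrad_integrable(1)[OF w K] emeasure_compact_finite[OF K(1)] by auto
    then show "integrable lborel (\<lambda>x. indicator K x * F (f x))"
    proof (rule Bochner_Integration.integrable_bound)
      show "AE x in lborel. norm (indicator K x * F (f x)) \<le> norm (indicator K x * \<bar>F 0\<bar> + \<bar>indicator K x * f x\<bar>)"
      proof (rule AE_I2)
        show "norm (indicator K x * F (f x)) \<le> norm (indicator K x * \<bar>F 0\<bar> + \<bar>indicator K x * f x\<bar>)" for x
          using lip[of "f x" 0] by (cases "x \<in> K") auto
      qed
    qed measurable
    show "integrable lborel (\<lambda>x. indicator K x *\<^sub>R (F' (f x) *\<^sub>R G x))"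
      using wgrad_integrable(3)[OF w K]
    proof (rule Bochner_Integration.integrable_bound)
      show "AE x in lborel. norm (indicator K x *\<^sub>R (F' (f x) *\<^sub>R G x)) \<le> norm (indicator K x * norm (G x))"
        using F1 by (intro AE_I2) (auto simp: indicator_def intro!: mult_left_le_one_le)
    qed measurable
  qed
  have "(LINT x:\<Omega>|lborel. F (f x) * partial i \<phi> x) = - (LINT x:\<Omega>|lborel. (F' (f x) *\<^sub>R G x) $ i * \<phi> x)"
    if \<phi>: "\<phi> \<in> test_functions \<Omega>" for \<phi> i
  proof -
    define K0 where "K0 = supp UNIV \<phi>"
    have K0: "compact K0" "K0 \<subseteq> \<Omega>" using test_functionD(7,8)[OF \<phi>] by (auto simp: K0_def)
    obtain \<delta> where \<delta>: "0 < \<delta>" "(\<Union>x\<in>K0. cball x \<delta>) \<subseteq> \<Omega>"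
      using compact_subset_open_imp_cball_epsilon_subset[OF K0(1) \<open>open \<Omega>\<close> K0(2)] .
    \<comment> \<open>The closed \<open>\<delta>\<close>-neighbourhood of the support. Test points
      are taken in the \<open>\<delta>/2\<close>-neighbourhood \<open>S\<close> and steps are at
      most \<open>\<delta>/2\<close>, so all segments remain in \<open>K\<close>.\<close>
    define K where "K = (\<Union>x\<in>K0. \<Union>y\<in>cball 0 \<delta>. {x + y})"
    have K: "compact K" unfolding K_def by (intro compact_sums' K0) auto
    have K_iff: "z \<in> K \<longleftrightarrow> (\<exists>x\<in>K0. dist x z \<le> \<delta>)" for z
    proof
      assume "\<exists>x\<in>K0. dist x z \<le> \<delta>"
      then obtain x where "x \<in> K0" "dist x z \<le> \<delta>" by auto
      then have "x \<in> K0" "z - x \<in> cball 0 \<delta>" "z = x + (z - x)" by (auto simp: dist_norm norm_minus_commute)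
      then show "z \<in> K" unfolding K_def by blast
    next
      assume "z \<in> K"
      then obtain x y where "x \<in> K0" "norm y \<le> \<delta>" "z = x + y" by (auto simp: K_def)
      then show "\<exists>x\<in>K0. dist x z \<le> \<delta>" by (intro bexI[of _ x]) (auto simp: dist_norm)
    qed
    have K\<Omega>: "K \<subseteq> \<Omega>" using \<delta>(2) by (auto simp: K_iff)
    have K0K: "K0 \<subseteq> K" using \<delta>(1) by (force simp: K_iff)
    define S where "S = (\<Union>x\<in>K0. ball x (\<delta>/2))"
    have S: "open S" "K0 \<subseteq> S" using \<delta>(1) by (auto simp: S_def)
    define e where "e = (axis i 1 :: real^'a)"
    have ne: "norm e = 1" by (simp add: e_def)
    define \<tau> where "\<tau> = (\<lambda>m::nat. \<delta> / 2 / real (Suc m))"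
    have \<tau>0: "0 < \<tau> m" for m using \<delta>(1) by (simp add: \<tau>_def)
    have \<tau>1: "\<tau> m \<le> \<delta> / 2" for m using \<delta>(1) by (simp add: \<tau>_def divide_le_eq mult_left_le)
    have \<tau>_lim: "\<tau> \<longlonglongrightarrow> 0" unfolding \<tau>_def by (rule lim_const_over_n[THEN LIMSEQ_Suc])
    define k where "k = (\<lambda>m. \<tau> m *\<^sub>R e)"
    have k: "k \<longlonglongrightarrow> 0" unfolding k_def using tendsto_scaleR[OF \<tau>_lim tendsto_const[of e]] by simp
    have seg: "x + t *\<^sub>R k m \<in> K" if "x \<in> S" "0 \<le> t" "t \<le> 1" for x t m
    proof -
      have "\<exists>y\<in>K0. dist y x < \<delta>/2" using that(1) unfolding S_def UN_iff mem_ball .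
      then obtain y where y: "y \<in> K0" "dist y x < \<delta>/2" by blast
      have "dist x (x + t *\<^sub>R k m) = t * \<tau> m" using that \<tau>0[of m] ne by (simp add: dist_norm k_def)
      also have "\<dots> \<le> 1 * (\<delta>/2)" using that \<tau>1[of m] \<tau>0[of m] by (intro mult_mono) auto
      finally have "dist y (x + t *\<^sub>R k m) \<le> \<delta>" using dist_triangle[of y "x + t *\<^sub>R k m" x] y(2) by simp
      then show ?thesis using y K_iff by blast
    qed
    have [measurable]: "K \<in> sets borel" using K by (auto intro: borel_compact)
    have line: "AE x in lborel. x \<in> S \<longrightarrow> f (x + k m) - f x = (LINT t:{0..1}|lborel. G (x + t *\<^sub>R k m) \<bullet> k m)" for m
      by (rule wgrad_line[OF w S(1) K K\<Omega>]) (rule seg)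
    define f1 where "f1 = (\<lambda>x. indicator K x * f x)"
    define g1 where "g1 = (\<lambda>x. indicator K x * (G x \<bullet> e))"
    have f1: "integrable lborel f1" and g1: "integrable lborel g1"
      using wgrad_integrable[OF w K K\<Omega>] by (auto simp: f1_def g1_def)
    have [measurable]: "f1 \<in> borel_measurable borel" "g1 \<in> borel_measurable borel"
      unfolding f1_def g1_def by measurable
    define A where "A = (\<lambda>m x. LINT s|lborel. indicator {0..1} s * g1 (x + s *\<^sub>R k m))"
    have A: "integrable lborel (A m)" for m
      unfolding A_def by (rule tendsto_avg_translate_L1(1)[OF g1 k])
    have A_lim: "(\<lambda>m. LINT x|lborel. \<bar>A m x - g1 x\<bar>) \<longlonglongrightarrow> 0"
      unfolding A_def by (rule tendsto_avg_translate_L1(2)[OF g1 k])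
    \<comment> \<open>Translates of \<open>f1\<close> converge in L^1 only, whereas the limit of the
      quotients \<open>q\<close> below is a pointwise matter; a subsequence provides it almost
      everywhere.\<close>
    obtain \<rho> where \<rho>: "strict_mono \<rho>" and f1_lim: "AE x in lborel. (\<lambda>m. f1 (x + k (\<rho> m)) - f1 x) \<longlonglongrightarrow> 0"
      using tendsto_L1_AE_subseq[of lborel "\<lambda>m x. f1 (x + k m) - f1 x"] tendsto_translate_L1[OF f1 k]
        f1 integrable_lborel_translate[OF f1] by auto
    obtain B where B: "0 \<le> B" "\<And>x. \<bar>\<phi> x\<bar> \<le> B" "\<And>i x. \<bar>partial i \<phi> x\<bar> \<le> B" using test_function_bounded[OF \<phi>] by blast
    note [measurable] = test_function_measurable[OF \<phi>]
    have \<phi>0: "\<phi> x = 0" "partial i \<phi> x = 0" if "x \<notin> K0" for x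
      using test_functionD(5,6)[OF \<phi>] that by (auto simp: K0_def)
    define F1 where "F1 = (\<lambda>x. indicator K x * F (f x))"
    have F1i: "integrable lborel F1" unfolding F1_def by (rule int(1)[OF K K\<Omega>])
    have [measurable]: "F1 \<in> borel_measurable borel" unfolding F1_def by measurable
    \<comment> \<open>The slope of \<open>F\<close> between the two values of \<open>f1\<close>,
      completed by \<open>F'\<close> where they coincide. It is bounded by 1, and increments of
      \<open>F\<close> are always \<open>q\<close> times increments of \<open>f1\<close>.\<close>
    define q where "q = (\<lambda>m x. if f1 (x + k m) = f1 x then F' (f1 x) else (F (f1 (x + k m)) - F (f1 x)) / (f1 (x + k m) - f1 x))"
    have [measurable]: "q m \<in> borel_measurable borel" for m unfolding q_def by measurable
    have q1: "\<bar>q m x\<bar> \<le> 1" for m x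
      using lip[of "f1 (x + k m)" "f1 x"] F1 by (auto simp: q_def divide_le_eq abs_divide)
    have d\<phi>: "((\<lambda>t. \<phi> (x - t *\<^sub>R e)) has_real_derivative - partial i \<phi> (x - t *\<^sub>R e)) (at t)" for x t
    proof -
      have d: "(\<phi> has_derivative (\<lambda>h. \<Sum>j\<in>UNIV. partial j \<phi> (x - t *\<^sub>R e) * h $ j)) (at (x - t *\<^sub>R e))"
        by (rule test_functionD(4)[OF \<phi>])
      have a: "((\<lambda>t. \<phi> (x - t *\<^sub>R e)) has_derivative (\<lambda>s. \<Sum>j\<in>UNIV. partial j \<phi> (x - t *\<^sub>R e) * (- s *\<^sub>R e) $ j)) (at t)"
        by (rule has_derivative_compose[where g=\<phi> and f="\<lambda>t. x - t *\<^sub>R e", OF _ d]) (auto intro!: derivative_eq_intros)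
      have b: "(\<Sum>j\<in>UNIV. partial j \<phi> (x - t *\<^sub>R e) * (- s *\<^sub>R e) $ j) = - partial i \<phi> (x - t *\<^sub>R e) * s" for s
      proof -
        have "(- s *\<^sub>R e) $ j = (if j = i then - s else 0)" for j by (simp add: e_def axis_def)
        then show ?thesis by (simp only: if_distrib[of "\<lambda>z. _ * z"]) (simp cong: if_cong)
      qed
      show ?thesis unfolding has_field_derivative_def
        by (rule has_derivative_eq_rhs[OF a]) (rule ext, rule b)
    qed
    have \<phi>_lip: "\<bar>\<phi> (x - t *\<^sub>R e) - \<phi> x\<bar> \<le> B * \<bar>t\<bar>" for x t
    proof -
      have "norm (\<phi> (x - t *\<^sub>R e) - \<phi> (x - 0 *\<^sub>R e)) \<le> B * norm (t - 0)"
        by (rule field_differentiable_bound[of UNIV "\<lambda>t. \<phi> (x - t *\<^sub>R e)"]) (use d\<phi> B(3) in auto)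
      then show ?thesis by simp
    qed
    \<comment> \<open>The difference quotient placed on the test function, where its limit is
      classical. A change of variables moves it onto \<open>F1\<close>, where
      \<open>wgrad_line\<close> evaluates it as \<open>q m x * A m x\<close>.\<close>
    define L where "L = (\<lambda>m. LINT x|lborel. F1 x * ((\<phi> (x - k m) - \<phi> x) / \<tau> m))"
    have L1: "L \<longlonglongrightarrow> (LINT x|lborel. F1 x * - partial i \<phi> x)"
      unfolding L_def
    proof (rule integral_dominated_convergence[where w="\<lambda>x. B * \<bar>F1 x\<bar>"])
      show "AE x in lborel. (\<lambda>m. F1 x * ((\<phi> (x - k m) - \<phi> x) / \<tau> m)) \<longlonglongrightarrow> F1 x * - partial i \<phi> x"
      proof (rule AE_I2)
        fix x
        have "((\<lambda>h. (\<phi> (x - (0 + h) *\<^sub>R e) - \<phi> (x - 0 *\<^sub>R e)) / h) \<longlongrightarrow> - partial i \<phi> (x - 0 *\<^sub>R e)) (at 0)"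
          using d\<phi>[of x 0] by (simp add: DERIV_def)
        then have "((\<lambda>h. (\<phi> (x - h *\<^sub>R e) - \<phi> x) / h) \<longlongrightarrow> - partial i \<phi> x) (at 0)" by simp
        then have "(\<lambda>m. (\<phi> (x - \<tau> m *\<^sub>R e) - \<phi> x) / \<tau> m) \<longlonglongrightarrow> - partial i \<phi> x"
          by (rule filterlim_compose) (use \<tau>_lim \<tau>0 in \<open>auto simp: filterlim_at less_imp_neq[THEN not_sym]\<close>)
        then show "(\<lambda>m. F1 x * ((\<phi> (x - k m) - \<phi> x) / \<tau> m)) \<longlonglongrightarrow> F1 x * - partial i \<phi> x"
          unfolding k_def by (rule tendsto_mult[OF tendsto_const])
      qed
      show "AE x in lborel. norm (F1 x * ((\<phi> (x - k m) - \<phi> x) / \<tau> m)) \<le> B * \<bar>F1 x\<bar>" for m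
      proof (rule AE_I2)
        fix x
        have "\<bar>(\<phi> (x - k m) - \<phi> x) / \<tau> m\<bar> \<le> B"
          using \<phi>_lip[of x "\<tau> m"] \<tau>0[of m] by (simp add: k_def abs_divide divide_le_eq)
        then show "norm (F1 x * ((\<phi> (x - k m) - \<phi> x) / \<tau> m)) \<le> B * \<bar>F1 x\<bar>"
          unfolding real_norm_def abs_mult[of "F1 x"] by (subst mult.commute) (intro mult_right_mono abs_ge_zero)
      qed
    qed (use F1i in auto)
    have L_eq: "L m = (LINT x|lborel. \<phi> x * (q m x * A m x))" for m
    proof -
      have i1: "integrable lborel (\<lambda>x. F1 x * \<phi> (x - c))" for c
        by (rule integrable_times_bounded[OF F1i _ B(2)]) auto
      have i2: "integrable lborel (\<lambda>x. F1 (x + c) * \<phi> x)" for c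
        by (rule integrable_times_bounded[OF integrable_lborel_translate[OF F1i] _ B(2)]) auto
      have "L m = (LINT x|lborel. (F1 x * \<phi> (x - k m) - F1 x * \<phi> x) / \<tau> m)"
        unfolding L_def by (simp add: algebra_simps)
      also have "\<dots> = ((LINT x|lborel. F1 x * \<phi> (x - k m)) - (LINT x|lborel. F1 x * \<phi> x)) / \<tau> m"
        using i1[of "k m"] i1[of 0] by simp
      also have "(LINT x|lborel. F1 x * \<phi> (x - k m)) = (LINT x|lborel. F1 (x + k m) * \<phi> x)"
        using integral_lborel_translate[of "\<lambda>x. F1 x * \<phi> (x - k m)" "k m"] by simp
      also have "((LINT x|lborel. F1 (x + k m) * \<phi> x) - (LINT x|lborel. F1 x * \<phi> x)) / \<tau> m
          = (LINT x|lborel. (F1 (x + k m) * \<phi> x - F1 x * \<phi> x) / \<tau> m)"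
        using i1[of 0] i2[of "k m"] by simp
      also have "\<dots> = (LINT x|lborel. \<phi> x * (q m x * A m x))"
      proof (rule integral_cong_AE)
        show "AE x in lborel. (F1 (x + k m) * \<phi> x - F1 x * \<phi> x) / \<tau> m = \<phi> x * (q m x * A m x)"
          using line[of m]
        proof eventually_elim
          case (elim x)
          show ?case
          proof (cases "x \<in> K0")
            case True
            then have xS: "x \<in> S" using S(2) by auto
            have inK: "x \<in> K" "x + k m \<in> K" using seg[OF xS, of 0 m] seg[OF xS, of 1 m] by auto
            have "f1 (x + k m) - f1 x = (LINT t:{0..1}|lborel. G (x + t *\<^sub>R k m) \<bullet> k m)"
              using elim xS inK by (simp add: f1_def)
            also have "\<dots> = (LINT t|lborel. \<tau> m * (indicator {0..1} t * g1 (x + t *\<^sub>R k m)))"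
              unfolding set_lebesgue_integral_def using seg[OF xS]
              by (intro Bochner_Integration.integral_cong) (auto simp: g1_def k_def indicator_def)
            also have "\<dots> = \<tau> m * A m x" by (simp add: A_def)
            finally have D: "f1 (x + k m) - f1 x = \<tau> m * A m x" .
            have "F1 (x + k m) - F1 x = q m x * (f1 (x + k m) - f1 x)"
              using inK by (auto simp: q_def F1_def f1_def)
            also have "\<dots> = q m x * (\<tau> m * A m x)" by (simp only: D)
            finally show ?thesis using \<tau>0[of m] by (simp add: field_simps flip: left_diff_distrib)
          qed (simp add: \<phi>0)
        qed
      qed (use A in auto)
      finally show ?thesis .
    qed
    have b1: "integrable lborel (\<lambda>x. g1 x * (\<phi> x * F' (f1 x)))"
    proof (rule integrable_times_bounded[OF g1])
      show "\<bar>\<phi> x * F' (f1 x)\<bar> \<le> B * 1" for x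
        unfolding abs_mult using B(2)[of x] F1[of "f1 x"] B(1) by (intro mult_mono) auto
    qed measurable
    have b2: "integrable lborel (\<lambda>x. A m x * (\<phi> x * q m x))" for m
    proof (rule integrable_times_bounded[OF A])
      show "\<bar>\<phi> x * q m x\<bar> \<le> B * 1" for x
        unfolding abs_mult using B(2)[of x] q1[of m x] B(1) by (intro mult_mono) auto
    qed measurable
    have b3: "integrable lborel (\<lambda>x. g1 x * (\<phi> x * q m x))" for m
    proof (rule integrable_times_bounded[OF g1])
      show "\<bar>\<phi> x * q m x\<bar> \<le> B * 1" for x
        unfolding abs_mult using B(2)[of x] q1[of m x] B(1) by (intro mult_mono) auto
    qed measurable
    have L2: "(\<lambda>m. LINT x|lborel. g1 x * (\<phi> x * q (\<rho> m) x)) \<longlonglongrightarrow> (LINT x|lborel. g1 x * (\<phi> x * F' (f1 x)))"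
    proof (rule integral_dominated_convergence[where w="\<lambda>x. \<bar>g1 x\<bar> * (B * 1)"])
      show "AE x in lborel. (\<lambda>m. g1 x * (\<phi> x * q (\<rho> m) x)) \<longlonglongrightarrow> g1 x * (\<phi> x * F' (f1 x))"
        using f1_lim
      proof eventually_elim
        case (elim x)
        \<comment> \<open>Continuity of the slope function at 0, including the filled-in value,
          turns convergence of the increments into convergence of \<open>q\<close> even if some
          increments vanish.\<close>
        define \<Psi> where "\<Psi> = (\<lambda>h. if h = 0 then F' (f1 x) else (F (f1 x + h) - F (f1 x)) / h)"
        have "(\<Psi> \<longlongrightarrow> F' (f1 x)) (at 0)"
          using F[of "f1 x"] unfolding DERIV_def
          by (rule Lim_transform_eventually) (auto simp: \<Psi>_def eventually_at_filter)
        then have "isCont \<Psi> 0" by (simp add: isCont_def \<Psi>_def)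
        then have "(\<lambda>m. \<Psi> (f1 (x + k (\<rho> m)) - f1 x)) \<longlonglongrightarrow> \<Psi> 0"
          using elim by (rule isCont_tendsto_compose)
        moreover have "\<Psi> (f1 (x + k (\<rho> m)) - f1 x) = q (\<rho> m) x" for m by (simp add: \<Psi>_def q_def)
        moreover have "\<Psi> 0 = F' (f1 x)" by (simp add: \<Psi>_def)
        ultimately have "(\<lambda>m. q (\<rho> m) x) \<longlonglongrightarrow> F' (f1 x)" by simp
        then show ?case by (intro tendsto_mult tendsto_const)
      qed
      show "AE x in lborel. norm (g1 x * (\<phi> x * q (\<rho> m) x)) \<le> \<bar>g1 x\<bar> * (B * 1)" for m
        unfolding real_norm_def abs_mult using B(2) q1 B(1) by (intro AE_I2 mult_left_mono mult_mono) auto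
    qed (use g1 in auto)
    \<comment> \<open>\<open>A m\<close> converges to \<open>g1\<close> in L^1 and its factor
      \<open>\<phi> x * q m x\<close> is bounded by \<open>B\<close>, so \<open>A m\<close> may be
      replaced by \<open>g1\<close> before the limit of \<open>q\<close> is taken.\<close>
    have L3: "(\<lambda>m. L m - (LINT x|lborel. g1 x * (\<phi> x * q m x))) \<longlonglongrightarrow> 0"
    proof (rule Lim_null_comparison)
      show "(\<lambda>m. B * (LINT x|lborel. \<bar>A m x - g1 x\<bar>)) \<longlonglongrightarrow> 0" by (rule tendsto_mult_right_zero[OF A_lim])
      show "\<forall>\<^sub>F m in sequentially. norm (L m - (LINT x|lborel. g1 x * (\<phi> x * q m x))) \<le> B * (LINT x|lborel. \<bar>A m x - g1 x\<bar>)"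
      proof (rule always_eventually, rule allI)
        fix m
        have "L m - (LINT x|lborel. g1 x * (\<phi> x * q m x)) = (LINT x|lborel. (A m x - g1 x) * (\<phi> x * q m x))"
          unfolding L_eq using b2[of m] b3[of m] by (simp add: algebra_simps)
        also have "norm \<dots> \<le> (LINT x|lborel. norm ((A m x - g1 x) * (\<phi> x * q m x)))" by (rule integral_norm_bound)
        also have "\<dots> \<le> (LINT x|lborel. B * \<bar>A m x - g1 x\<bar>)"
        proof (rule integral_mono)
          show "integrable lborel (\<lambda>x. norm ((A m x - g1 x) * (\<phi> x * q m x)))"
            using b2[of m] b3[of m] by (simp add: algebra_simps)
          show "norm ((A m x - g1 x) * (\<phi> x * q m x)) \<le> B * \<bar>A m x - g1 x\<bar>" for x
          proof -
            have "\<bar>\<phi> x * q m x\<bar> \<le> B * 1"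
              unfolding abs_mult using B(2)[of x] q1[of m x] B(1) by (intro mult_mono) auto
            then have "\<bar>A m x - g1 x\<bar> * \<bar>\<phi> x * q m x\<bar> \<le> \<bar>A m x - g1 x\<bar> * (B * 1)"
              by (rule mult_left_mono) simp
            then show ?thesis unfolding real_norm_def abs_mult[of "A m x - g1 x"] by (simp only: mult.commute mult_1_right)
          qed
        qed (use A[of m] g1 in auto)
        finally show "norm (L m - (LINT x|lborel. g1 x * (\<phi> x * q m x))) \<le> B * (LINT x|lborel. \<bar>A m x - g1 x\<bar>)" by simp
      qed
    qed
    have "(\<lambda>m. (L (\<rho> m) - (LINT x|lborel. g1 x * (\<phi> x * q (\<rho> m) x))) + (LINT x|lborel. g1 x * (\<phi> x * q (\<rho> m) x)))
       \<longlonglongrightarrow> 0 + (LINT x|lborel. g1 x * (\<phi> x * F' (f1 x)))"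
      using LIMSEQ_subseq_LIMSEQ[OF L3 \<rho>] by (intro tendsto_add L2) (simp add: o_def)
    moreover have "(\<lambda>m. L (\<rho> m)) \<longlonglongrightarrow> (LINT x|lborel. F1 x * - partial i \<phi> x)"
      using LIMSEQ_subseq_LIMSEQ[OF L1 \<rho>] by (simp add: o_def)
    ultimately have "(LINT x|lborel. F1 x * - partial i \<phi> x) = (LINT x|lborel. g1 x * (\<phi> x * F' (f1 x)))"
      using LIMSEQ_unique by fastforce
    moreover have "(LINT x:\<Omega>|lborel. F (f x) * partial i \<phi> x) = - (LINT x|lborel. F1 x * - partial i \<phi> x)"
      unfolding set_lebesgue_integral_def F1_def using \<phi>0 K0K K\<Omega>
      by (simp flip: integral_minus) (intro Bochner_Integration.integral_cong, auto simp: indicator_def)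
    moreover have "(LINT x:\<Omega>|lborel. (F' (f x) *\<^sub>R G x) $ i * \<phi> x) = (LINT x|lborel. g1 x * (\<phi> x * F' (f1 x)))"
      unfolding set_lebesgue_integral_def f1_def g1_def using \<phi>0 K0K K\<Omega>
      by (intro Bochner_Integration.integral_cong) (auto simp: indicator_def e_def inner_axis)
    ultimately show ?thesis by simp
  qed
  then show ?thesis
    unfolding wgrad_def set_integrable_def using int by auto
qed

section \<open>Truncations, products and differences of weakly differentiable functions\<close>

lemma wgrad_uminus: "wgrad \<Omega> f G \<Longrightarrow> open \<Omega> \<Longrightarrow> wgrad \<Omega> (\<lambda>x. - f x) (\<lambda>x. - G x)"
  using wgrad_compose[of \<Omega> f G "\<lambda>t. - t" "\<lambda>t. -1", OF _ _ DERIV_minus[OF DERIV_ident]] by simp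

text \<open>For t > 0 this is t - e + e^2/(t + e): a C^1 substitute for the positive part with slope
  in [0,1], to which \<open>wgrad_compose\<close> applies.\<close>

definition pos_approx :: "real \<Rightarrow> real \<Rightarrow> real" where
  "pos_approx e t = (if 0 < t then t\<^sup>2 / (t + e) else 0)"

lemma pos_approx_deriv:
  assumes "0 < e"
  shows "(pos_approx e has_field_derivative (if 0 < t then 1 - e\<^sup>2 / (t + e)\<^sup>2 else 0)) (at t)"
proof -
  consider "0 < t" | "t < 0" | "t = 0" by linarith
  then show ?thesis
  proof cases
    case 1
    have "((\<lambda>t. t\<^sup>2 / (t + e)) has_field_derivative ((2 * t * (t + e) - t\<^sup>2) / (t + e)\<^sup>2)) (at t)"
      using 1 assms by (auto intro!: derivative_eq_intros simp: power2_eq_square)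
    also have "(2 * t * (t + e) - t\<^sup>2) / (t + e)\<^sup>2 = ((t + e)\<^sup>2 - e\<^sup>2) / (t + e)\<^sup>2"
      by (simp add: power2_eq_square algebra_simps)
    also have "\<dots> = 1 - e\<^sup>2 / (t + e)\<^sup>2"
      using 1 assms by (subst diff_divide_distrib) simp
    finally have "((\<lambda>t. t\<^sup>2 / (t + e)) has_field_derivative (1 - e\<^sup>2 / (t + e)\<^sup>2)) (at t)" .
    then have "(pos_approx e has_field_derivative (1 - e\<^sup>2 / (t + e)\<^sup>2)) (at t)"
      by (rule has_field_derivative_transform_within_open[of _ _ _ "{0<..}"]) (use 1 in \<open>auto simp: pos_approx_def\<close>)
    with 1 show ?thesis by simp
  next
    case 2
    have "((\<lambda>t. 0) has_field_derivative 0) (at t)" by simp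
    then have "(pos_approx e has_field_derivative 0) (at t)"
      by (rule has_field_derivative_transform_within_open[of _ _ _ "{..<0}"]) (use 2 in \<open>auto simp: pos_approx_def\<close>)
    with 2 show ?thesis by simp
  next
    case 3
    have "((\<lambda>h. (pos_approx e (0 + h) - pos_approx e 0) / h) \<longlongrightarrow> 0) (at 0)"
    proof (rule Lim_null_comparison)
      show "\<forall>\<^sub>F h in at 0. norm ((pos_approx e (0 + h) - pos_approx e 0) / h) \<le> \<bar>h\<bar> / e"
      proof (rule eventually_at_topological[THEN iffD2, OF exI[of _ UNIV]], safe)
        fix h :: real assume "h \<noteq> 0"
        show "norm ((pos_approx e (0 + h) - pos_approx e 0) / h) \<le> \<bar>h\<bar> / e"
        proof (cases "0 < h")
          case True
          have "h / (h + e) \<le> h / e" using True assms by (intro divide_left_mono) auto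
          then show ?thesis using True assms by (simp add: pos_approx_def power2_eq_square)
        next
          case False
          then show ?thesis using assms divide_nonpos_pos[of h e] by (simp add: pos_approx_def)
        qed
      qed auto
      show "((\<lambda>h. \<bar>h\<bar> / e) \<longlongrightarrow> 0) (at 0)"
        using assms by (auto intro!: tendsto_eq_intros)
    qed
    then show ?thesis unfolding 3 by (simp add: DERIV_def)
  qed
qed

text \<open>Both sides of the identity for the approximations pass to the limit by domination. All
  approximations have slope 0 at the level \<open>k\<close> itself, which is why the gradient
  carries the strict condition \<open>k < f x\<close>.\<close>

lemma wgrad_pos_part:
  assumes w: "wgrad \<Omega> f G" and op: "open \<Omega>"
  shows "wgrad \<Omega> (\<lambda>x. max 0 (f x - k)) (\<lambda>x. (if k < f x then 1 else 0) *\<^sub>R G x)"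
proof -
  have [measurable]: "f \<in> borel_measurable borel" "G \<in> borel_measurable borel" using w by (auto simp: wgrad_def)
  define e where "e = (\<lambda>m. inverse (real (Suc m)))"
  have e0: "0 < e m" for m by (simp add: e_def)
  have e_lim: "e \<longlonglongrightarrow> 0" unfolding e_def by (rule LIMSEQ_inverse_real_of_nat)
  define F where "F = (\<lambda>m t. pos_approx (e m) (t - k))"
  define F' where "F' = (\<lambda>m t. if 0 < t - k then 1 - (e m)\<^sup>2 / (t - k + e m)\<^sup>2 else 0)"
  have F'1: "\<bar>F' m t\<bar> \<le> 1" for m t
    using e0[of m] by (auto simp: F'_def abs_le_iff divide_le_eq power_mono)
  have Fle: "\<bar>F m t\<bar> \<le> max 0 (t - k)" for m t
  proof (cases "0 < t - k")
    case True
    have "(t - k)\<^sup>2 / (t - k + e m) \<le> t - k"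
      using True e0[of m] by (subst pos_divide_le_eq) (auto simp: power2_eq_square intro!: mult_left_mono)
    moreover have "0 \<le> (t - k)\<^sup>2 / (t - k + e m)" using True e0[of m] by simp
    ultimately show ?thesis using True e0[of m] by (simp add: F_def pos_approx_def)
  qed (simp add: F_def pos_approx_def)
  have wm: "wgrad \<Omega> (\<lambda>x. F m (f x)) (\<lambda>x. F' m (f x) *\<^sub>R G x)" for m
  proof (rule wgrad_compose[OF w op])
    show "(F m has_field_derivative F' m t) (at t)" for t
    proof -
      have d: "((\<lambda>t. t - k) has_field_derivative 1) (at t)" by (auto intro!: derivative_eq_intros)
      show ?thesis unfolding F_def F'_def
        using DERIV_chain2[where g="\<lambda>t. t - k", OF pos_approx_deriv[OF e0[of m], of "t - k"] d] by simp
    qed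
    show "F' m \<in> borel_measurable borel" unfolding F'_def by measurable
  qed (rule F'1)
  have F_lim: "(\<lambda>m. F m t) \<longlonglongrightarrow> max 0 (t - k)" for t
  proof (cases "0 < t - k")
    case True
    have "(\<lambda>m. (t - k)\<^sup>2 / (t - k + e m)) \<longlonglongrightarrow> (t - k)\<^sup>2 / (t - k + 0)"
      using True by (intro tendsto_intros e_lim) auto
    then show ?thesis using True by (simp add: F_def pos_approx_def power2_eq_square)
  qed (simp add: F_def pos_approx_def max_def)
  have F'_lim: "(\<lambda>m. F' m t) \<longlonglongrightarrow> (if k < t then 1 else 0)" for t
  proof (cases "0 < t - k")
    case True
    have "(\<lambda>m. 1 - (e m)\<^sup>2 / (t - k + e m)\<^sup>2) \<longlonglongrightarrow> 1 - 0\<^sup>2 / (t - k + 0)\<^sup>2"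
      using True by (intro tendsto_intros e_lim) auto
    then show ?thesis using True by (simp add: F'_def)
  qed (simp add: F'_def)
  have int: "integrable lborel (\<lambda>x. indicator K x * \<bar>k\<bar> + \<bar>indicator K x * f x\<bar>)"
    if K: "compact K" "K \<subseteq> \<Omega>" for K
  proof -
    have [measurable]: "K \<in> sets borel" using K by (auto intro: borel_compact)
    show ?thesis using wgrad_integrable(1)[OF w K] emeasure_compact_finite[OF K(1)] by auto
  qed
  have "(LINT x:\<Omega>|lborel. max 0 (f x - k) * partial i \<phi> x)
      = - (LINT x:\<Omega>|lborel. ((if k < f x then 1 else 0) *\<^sub>R G x) $ i * \<phi> x)"
    if \<phi>: "\<phi> \<in> test_functions \<Omega>" for \<phi> i
  proof -
    define K where "K = supp UNIV \<phi>"
    have K: "compact K" "K \<subseteq> \<Omega>" using test_functionD(7,8)[OF \<phi>] by (auto simp: K_def)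
    have [measurable]: "K \<in> sets borel" using K by (auto intro: borel_compact)
    have [measurable]: "\<Omega> \<in> sets borel" using op by auto
    note [measurable] = test_function_measurable[OF \<phi>]
    have "(\<lambda>x. G x \<bullet> axis i 1) \<in> borel_measurable borel" by measurable
    then have [measurable]: "(\<lambda>x. G x $ i) \<in> borel_measurable borel" by (simp add: inner_axis)
    obtain B where B: "0 \<le> B" "\<And>x. \<bar>\<phi> x\<bar> \<le> B" "\<And>i x. \<bar>partial i \<phi> x\<bar> \<le> B" using test_function_bounded[OF \<phi>] by blast
    have z: "\<phi> x = 0" "partial i \<phi> x = 0" if "x \<notin> K" for x
      using test_functionD(5,6)[OF \<phi>] that by (auto simp: K_def)
    have [measurable]: "(\<lambda>x. F m (f x)) \<in> borel_measurable borel" "(\<lambda>x. F' m (f x)) \<in> borel_measurable borel" for m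
      unfolding F_def F'_def pos_approx_def by measurable
    have "(\<lambda>m. LINT x:\<Omega>|lborel. F m (f x) * partial i \<phi> x) \<longlonglongrightarrow> (LINT x:\<Omega>|lborel. max 0 (f x - k) * partial i \<phi> x)"
      unfolding set_lebesgue_integral_def
    proof (rule integral_dominated_convergence[where w="\<lambda>x. (indicator K x * \<bar>k\<bar> + \<bar>indicator K x * f x\<bar>) * B"])
      show "AE x in lborel. (\<lambda>m. indicator \<Omega> x *\<^sub>R (F m (f x) * partial i \<phi> x)) \<longlonglongrightarrow> indicator \<Omega> x *\<^sub>R (max 0 (f x - k) * partial i \<phi> x)"
        by (intro AE_I2 tendsto_intros F_lim)
      show "AE x in lborel. norm (indicator \<Omega> x *\<^sub>R (F m (f x) * partial i \<phi> x)) \<le> (indicator K x * \<bar>k\<bar> + \<bar>indicator K x * f x\<bar>) * B" for m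
      proof (rule AE_I2)
        fix x
        show "norm (indicator \<Omega> x *\<^sub>R (F m (f x) * partial i \<phi> x)) \<le> (indicator K x * \<bar>k\<bar> + \<bar>indicator K x * f x\<bar>) * B"
        proof (cases "x \<in> K")
          case True
          have "\<bar>F m (f x)\<bar> * \<bar>partial i \<phi> x\<bar> \<le> (\<bar>k\<bar> + \<bar>f x\<bar>) * B"
            using Fle[of m "f x"] B(3)[of i x] B(1) by (intro mult_mono) auto
          then show ?thesis using True K(2) by (auto simp: abs_mult)
        qed (use z B in auto)
      qed
    qed (use int[OF K] in auto)
    moreover have "(\<lambda>m. LINT x:\<Omega>|lborel. (F' m (f x) *\<^sub>R G x) $ i * \<phi> x) \<longlonglongrightarrow> (LINT x:\<Omega>|lborel. ((if k < f x then 1 else 0) *\<^sub>R G x) $ i * \<phi> x)"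
      unfolding set_lebesgue_integral_def
    proof (rule integral_dominated_convergence[where w="\<lambda>x. indicator K x * norm (G x) * B"])
      show "AE x in lborel. (\<lambda>m. indicator \<Omega> x *\<^sub>R ((F' m (f x) *\<^sub>R G x) $ i * \<phi> x)) \<longlonglongrightarrow> indicator \<Omega> x *\<^sub>R (((if k < f x then 1 else 0) *\<^sub>R G x) $ i * \<phi> x)"
        by (intro AE_I2 tendsto_scaleR tendsto_mult tendsto_vec_nth F'_lim tendsto_const)
      show "AE x in lborel. norm (indicator \<Omega> x *\<^sub>R ((F' m (f x) *\<^sub>R G x) $ i * \<phi> x)) \<le> indicator K x * norm (G x) * B" for m
      proof (rule AE_I2)
        fix x
        show "norm (indicator \<Omega> x *\<^sub>R ((F' m (f x) *\<^sub>R G x) $ i * \<phi> x)) \<le> indicator K x * norm (G x) * B"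
        proof (cases "x \<in> K")
          case True
          have "\<bar>F' m (f x)\<bar> * \<bar>G x $ i\<bar> * \<bar>\<phi> x\<bar> \<le> 1 * norm (G x) * B"
            using F'1[of m "f x"] B(2)[of x] B(1) component_le_norm_cart[of "G x" i] by (intro mult_mono) auto
          then show ?thesis using True K(2) by (auto simp: abs_mult)
        qed (use z B in auto)
      qed
      show "integrable lborel (\<lambda>x. indicator K x * norm (G x) * B)"
        using wgrad_integrable(3)[OF w K] by auto
    qed (unfold vector_scaleR_component, measurable)
    moreover have "(LINT x:\<Omega>|lborel. F m (f x) * partial i \<phi> x) = - (LINT x:\<Omega>|lborel. (F' m (f x) *\<^sub>R G x) $ i * \<phi> x)" for m
      using wm[of m] \<phi> unfolding wgrad_def by blast
    ultimately have "(\<lambda>m. - (LINT x:\<Omega>|lborel. (F' m (f x) *\<^sub>R G x) $ i * \<phi> x)) \<longlonglongrightarrow> (LINT x:\<Omega>|lborel. max 0 (f x - k) * partial i \<phi> x)"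
      and "(\<lambda>m. - (LINT x:\<Omega>|lborel. (F' m (f x) *\<^sub>R G x) $ i * \<phi> x)) \<longlonglongrightarrow> - (LINT x:\<Omega>|lborel. ((if k < f x then 1 else 0) *\<^sub>R G x) $ i * \<phi> x)"
      by (simp, intro tendsto_minus)
    then show ?thesis by (rule LIMSEQ_unique)
  qed
  moreover have "set_integrable lborel K (\<lambda>x. max 0 (f x - k))" "set_integrable lborel K (\<lambda>x. (if k < f x then 1 else 0) *\<^sub>R G x)"
    if K: "compact K" "K \<subseteq> \<Omega>" for K
  proof -
    have [measurable]: "K \<in> sets borel" using K by (auto intro: borel_compact)
    show "set_integrable lborel K (\<lambda>x. max 0 (f x - k))"
      unfolding set_integrable_def
    proof (rule Bochner_Integration.integrable_bound[OF int[OF K]])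
      show "AE x in lborel. norm (indicator K x *\<^sub>R max 0 (f x - k)) \<le> norm (indicator K x * \<bar>k\<bar> + \<bar>indicator K x * f x\<bar>)"
        by (rule AE_I2) (auto simp: indicator_def)
    qed measurable
    show "set_integrable lborel K (\<lambda>x. (if k < f x then 1 else 0) *\<^sub>R G x)"
      unfolding set_integrable_def
    proof (rule Bochner_Integration.integrable_bound[OF wgrad_integrable(3)[OF w K]])
      show "AE x in lborel. norm (indicator K x *\<^sub>R ((if k < f x then 1 else 0) *\<^sub>R G x)) \<le> norm (indicator K x * norm (G x))"
        by (rule AE_I2) (auto simp: indicator_def)
    qed measurable
  qed
  ultimately show ?thesis unfolding wgrad_def by auto
qed

lemma C_k_Suc_imp: "C_k (Suc k) f \<Longrightarrow> C_k k f"
proof (induction k arbitrary: f)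
  case 0
  then show ?case by (auto simp: differentiable_on_def intro!: differentiable_imp_continuous_on)
next
  case (Suc k)
  have d: "f differentiable_on UNIV" and c: "C_k (Suc k) (partial i f)" for i
    using Suc.prems by (auto simp: C_k.simps(2)[of "Suc k" f] simp del: C_k.simps)
  show ?case unfolding C_k.simps(2) using d Suc.IH[OF c] by blast
qed

lemma partial_add:
  assumes "f differentiable (at x)" "g differentiable (at x)"
  shows "partial i (\<lambda>x. f x + g x) x = partial i f x + partial i g x"
  using partial_eq[OF has_derivative_add[OF assms[unfolded frechet_derivative_works]]] by (simp add: partial_def)

lemma partial_mult:
  assumes "f differentiable (at x)" "g differentiable (at x)"
  shows "partial i (\<lambda>x. f x * g x) x = f x * partial i g x + partial i f x * g x"
  using partial_eq[OF has_derivative_mult[OF assms[unfolded frechet_derivative_works]]] by (simp add: partial_def)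

lemma C_k_add: "C_k k f \<Longrightarrow> C_k k g \<Longrightarrow> C_k k (\<lambda>x. f x + g x)"
proof (induction k arbitrary: f g)
  case (Suc k)
  then have "partial i (\<lambda>x. f x + g x) = (\<lambda>x. partial i f x + partial i g x)" for i
    by (intro ext partial_add) (auto simp: differentiable_on_def)
  with Suc show ?case by (auto intro: differentiable_on_add)
qed (auto intro: continuous_on_add)

lemma C_k_mult: "C_k k f \<Longrightarrow> C_k k g \<Longrightarrow> C_k k (\<lambda>x. f x * g x)"
proof (induction k arbitrary: f g)
  case (Suc k)
  then have "partial i (\<lambda>x. f x * g x) = (\<lambda>x. f x * partial i g x + partial i f x * g x)" for i
    by (intro ext partial_mult) (auto simp: differentiable_on_def)
  with Suc show ?case
    using C_k_Suc_imp[OF Suc.prems(1)] C_k_Suc_imp[OF Suc.prems(2)]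
    by (auto intro!: differentiable_on_mult C_k_add)
qed (auto intro: continuous_on_mult)

text \<open>If \<open>\<phi>\<close> is a test function, so is \<open>\<eta>\<close> times
  \<open>\<phi>\<close>; testing the gradient of \<open>f\<close> with it and expanding the
  derivative of the product gives the claim.\<close>

lemma wgrad_smooth_mult:
  assumes w: "wgrad \<Omega> f G" and op: "open \<Omega>" and \<eta>: "smooth_fn \<eta>"
  shows "wgrad \<Omega> (\<lambda>x. \<eta> x * f x) (\<lambda>x. \<eta> x *\<^sub>R G x + f x *\<^sub>R (\<chi> i. partial i \<eta> x))"
proof -
  have [measurable]: "f \<in> borel_measurable borel" "G \<in> borel_measurable borel" using w by (auto simp: wgrad_def)
  have [measurable]: "\<eta> \<in> borel_measurable borel" by (rule smooth_measurable[OF \<eta>])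
  have p: "smooth_fn (partial i \<eta>)" for i using smooth_partial[OF \<eta>] by auto
  have [measurable]: "partial i \<eta> \<in> borel_measurable borel" for i by (rule smooth_measurable[OF p])
  have [measurable]: "(\<lambda>x. \<chi> i. partial i \<eta> x) \<in> borel_measurable borel"
    by (rule borel_measurable_continuous_onI) (use smooth_C_k[OF p, where k=0] in \<open>auto intro!: continuous_on_vec_lambda\<close>)
  have d\<eta>: "\<eta> differentiable (at x)" for x using smooth_partial[OF \<eta>] by auto
  have bdd: "\<exists>B\<ge>0. \<forall>x\<in>K. \<bar>g x\<bar> \<le> B" if "compact K" "smooth_fn g" for K and g :: "real^'a \<Rightarrow> real"
  proof -
    have "compact (g ` K)" using smooth_C_k[OF that(2), of 0] that(1)
      by (intro compact_continuous_image) (auto intro: continuous_on_subset)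
    then obtain B where "\<And>y. y \<in> g ` K \<Longrightarrow> norm y \<le> B" using compact_imp_bounded bounded_iff by metis
    then show ?thesis by (intro exI[of _ "max 0 B"]) (auto simp: le_max_iff_disj)
  qed
  have i1: "integrable lborel (\<lambda>x. indicator K x * f x * g x)"
    if K: "compact K" "K \<subseteq> \<Omega>" and g: "smooth_fn g" for K g
  proof -
    have [measurable]: "K \<in> sets borel" using K by (auto intro: borel_compact)
    obtain B where "0 \<le> B" "\<forall>x\<in>K. \<bar>g x\<bar> \<le> B" using bdd[OF K(1) g] by auto
    then have "integrable lborel (\<lambda>x. (indicator K x * f x) * (indicator K x * g x))"
      using smooth_measurable[OF g]
      by (intro integrable_times_bounded[OF wgrad_integrable(1)[OF w K], of _ B]) (auto simp: indicator_def)
    moreover have "(\<lambda>x. (indicator K x * f x) * (indicator K x * g x)) = (\<lambda>x. indicator K x * f x * g x)"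
      by (auto simp: indicator_def fun_eq_iff)
    ultimately show ?thesis by (simp only:)
  qed
  have i2: "integrable lborel (\<lambda>x. indicator K x *\<^sub>R (\<eta> x *\<^sub>R G x))" if K: "compact K" "K \<subseteq> \<Omega>" for K
  proof -
    have [measurable]: "K \<in> sets borel" using K by (auto intro: borel_compact)
    obtain B where B: "0 \<le> B" "\<forall>x\<in>K. \<bar>\<eta> x\<bar> \<le> B" using bdd[OF K(1) \<eta>] by auto
    show ?thesis
    proof (rule Bochner_Integration.integrable_bound)
      show "integrable lborel (\<lambda>x. B * (indicator K x * norm (G x)))" using wgrad_integrable(3)[OF w K] by auto
      show "AE x in lborel. norm (indicator K x *\<^sub>R (\<eta> x *\<^sub>R G x)) \<le> norm (B * (indicator K x * norm (G x)))"
        using B by (intro AE_I2) (auto simp: indicator_def intro!: mult_right_mono)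
    qed measurable
  qed
  have i3: "integrable lborel (\<lambda>x. indicator K x *\<^sub>R (f x *\<^sub>R (\<chi> i. partial i \<eta> x)))" if K: "compact K" "K \<subseteq> \<Omega>" for K
  proof -
    have [measurable]: "K \<in> sets borel" using K by (auto intro: borel_compact)
    have s: "integrable lborel (\<lambda>x. \<Sum>i\<in>UNIV. \<bar>indicator K x * f x * partial i \<eta> x\<bar>)"
      using i1[OF K p] by (intro Bochner_Integration.integrable_sum integrable_abs)
    show ?thesis
    proof (rule Bochner_Integration.integrable_bound[OF s])
      show "AE x in lborel. norm (indicator K x *\<^sub>R (f x *\<^sub>R (\<chi> i. partial i \<eta> x))) \<le> norm (\<Sum>i\<in>UNIV. \<bar>indicator K x * f x * partial i \<eta> x\<bar>)"
      proof (rule AE_I2)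
        fix x
        show "norm (indicator K x *\<^sub>R (f x *\<^sub>R (\<chi> i. partial i \<eta> x))) \<le> norm (\<Sum>i\<in>UNIV. \<bar>indicator K x * f x * partial i \<eta> x\<bar>)"
          using norm_le_l1_cart[of "indicator K x *\<^sub>R (f x *\<^sub>R (\<chi> i. partial i \<eta> x))"]
          by (simp add: sum_nonneg mult.assoc)
      qed
    qed measurable
  qed
  have "(LINT x:\<Omega>|lborel. \<eta> x * f x * partial i \<phi> x)
      = - (LINT x:\<Omega>|lborel. (\<eta> x *\<^sub>R G x + f x *\<^sub>R (\<chi> i. partial i \<eta> x)) $ i * \<phi> x)"
    if \<phi>: "\<phi> \<in> test_functions \<Omega>" for \<phi> i
  proof -
    define K where "K = supp UNIV \<phi>"
    have K: "compact K" "K \<subseteq> \<Omega>" using test_functionD(7,8)[OF \<phi>] by (auto simp: K_def)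
    note [measurable] = test_function_measurable[OF \<phi>]
    obtain B where B: "0 \<le> B" "\<And>x. \<bar>\<phi> x\<bar> \<le> B" "\<And>i x. \<bar>partial i \<phi> x\<bar> \<le> B" using test_function_bounded[OF \<phi>] by blast
    have z: "\<phi> x = 0" "partial i \<phi> x = 0" if "x \<notin> K" for x
      using test_functionD(5,6)[OF \<phi>] that by (auto simp: K_def)
    define \<psi> where "\<psi> = (\<lambda>x. \<eta> x * \<phi> x)"
    have supp: "supp UNIV \<psi> \<subseteq> K"
      using z K by (intro supp_subset_closed) (auto simp: \<psi>_def compact_imp_closed)
    have "compact (supp UNIV \<psi>)"
      using supp K(1) by (metis compact_Int_closed inf.absorb_iff2 supp_def closed_closure)
    then have \<psi>: "\<psi> \<in> test_functions \<Omega>"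
      using \<phi> supp K(2) smooth_C_k[OF \<eta>] by (auto simp: test_functions_def \<psi>_def intro!: C_k_mult)
    have p\<psi>: "partial i \<psi> x = \<eta> x * partial i \<phi> x + partial i \<eta> x * \<phi> x" for x
      unfolding \<psi>_def by (intro partial_mult d\<eta> test_functionD(2)[OF \<phi>])
    have a: "integrable lborel (\<lambda>x. indicator K x * f x * \<eta> x * partial i \<phi> x)"
      by (rule integrable_times_bounded[OF i1[OF K \<eta>] _ B(3)]) auto
    have b: "integrable lborel (\<lambda>x. indicator K x * f x * partial i \<eta> x * \<phi> x)"
      by (rule integrable_times_bounded[OF i1[OF K p] _ B(2)]) auto
    have c: "integrable lborel (\<lambda>x. indicator K x * (\<eta> x * G x $ i) * \<phi> x)"
    proof (rule integrable_times_bounded[OF _ _ B(2)])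
      have "integrable lborel (\<lambda>x. (indicator K x *\<^sub>R (\<eta> x *\<^sub>R G x)) \<bullet> axis i 1)"
        using i2[OF K] by (intro integrable_inner_left) auto
      then show "integrable lborel (\<lambda>x. indicator K x * (\<eta> x * G x $ i))" by (simp add: inner_axis mult.assoc)
    qed auto
    have "(LINT x|lborel. indicator K x * f x * partial i \<psi> x) = - (LINT x|lborel. indicator K x * (G x $ i) * \<psi> x)"
      by (rule wgradD[OF w \<psi> supp K(2)])
    also have "(LINT x|lborel. indicator K x * f x * partial i \<psi> x)
       = (LINT x|lborel. indicator K x * f x * \<eta> x * partial i \<phi> x) + (LINT x|lborel. indicator K x * f x * partial i \<eta> x * \<phi> x)"
      unfolding p\<psi> using a b by (subst Bochner_Integration.integral_add[symmetric]) (auto simp: algebra_simps)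
    finally have "(LINT x|lborel. indicator K x * f x * \<eta> x * partial i \<phi> x)
       = - ((LINT x|lborel. indicator K x * (\<eta> x * G x $ i) * \<phi> x) + (LINT x|lborel. indicator K x * f x * partial i \<eta> x * \<phi> x))"
      by (simp add: \<psi>_def mult_ac)
    also have "\<dots> = - (LINT x|lborel. indicator K x * (\<eta> x * G x $ i) * \<phi> x + indicator K x * f x * partial i \<eta> x * \<phi> x)"
      using c b by simp
    also have "\<dots> = - (LINT x:\<Omega>|lborel. (\<eta> x *\<^sub>R G x + f x *\<^sub>R (\<chi> i. partial i \<eta> x)) $ i * \<phi> x)"
      unfolding set_lebesgue_integral_def using z K(2)
      by (intro arg_cong[of _ _ uminus] Bochner_Integration.integral_cong) (auto simp: indicator_def algebra_simps)
    also have "(LINT x|lborel. indicator K x * f x * \<eta> x * partial i \<phi> x) = (LINT x:\<Omega>|lborel. \<eta> x * f x * partial i \<phi> x)"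
      unfolding set_lebesgue_integral_def using z K(2)
      by (intro Bochner_Integration.integral_cong) (auto simp: indicator_def)
    finally show ?thesis .
  qed
  moreover have "set_integrable lborel K (\<lambda>x. \<eta> x * f x)"
    "set_integrable lborel K (\<lambda>x. \<eta> x *\<^sub>R G x + f x *\<^sub>R (\<chi> i. partial i \<eta> x))" if K: "compact K" "K \<subseteq> \<Omega>" for K
    using i1[OF K \<eta>] Bochner_Integration.integrable_add[OF i2[OF K] i3[OF K]]
    by (auto simp: set_integrable_def scaleR_add_right mult_ac)
  ultimately show ?thesis unfolding wgrad_def by auto
qed

lemma wgrad_diff:
  assumes w: "wgrad \<Omega> f G" "wgrad \<Omega> g H"
  shows "wgrad \<Omega> (\<lambda>x. f x - g x) (\<lambda>x. G x - H x)"
proof -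
  have [measurable]: "f \<in> borel_measurable borel" "G \<in> borel_measurable borel"
    "g \<in> borel_measurable borel" "H \<in> borel_measurable borel" using w by (auto simp: wgrad_def)
  have "(LINT x:\<Omega>|lborel. (f x - g x) * partial i \<phi> x) = - (LINT x:\<Omega>|lborel. (G x - H x) $ i * \<phi> x)"
    if \<phi>: "\<phi> \<in> test_functions \<Omega>" for \<phi> i
  proof -
    define K where "K = supp UNIV \<phi>"
    have K: "compact K" "K \<subseteq> \<Omega>" "supp UNIV \<phi> \<subseteq> K" using test_functionD(7,8)[OF \<phi>] by (auto simp: K_def)
    note [measurable] = test_function_measurable[OF \<phi>]
    obtain B where B: "0 \<le> B" "\<And>x. \<bar>\<phi> x\<bar> \<le> B" "\<And>i x. \<bar>partial i \<phi> x\<bar> \<le> B" using test_function_bounded[OF \<phi>] by blast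
    have z: "\<phi> x = 0" "partial i \<phi> x = 0" if "x \<notin> K" for x
      using test_functionD(5,6)[OF \<phi>] that by (auto simp: K_def)
    have a: "integrable lborel (\<lambda>x. indicator K x * f x * partial i \<phi> x)" "integrable lborel (\<lambda>x. indicator K x * g x * partial i \<phi> x)"
      by (rule integrable_times_bounded[OF wgrad_integrable(1)[OF w(1) K(1,2)] _ B(3)], simp)
        (rule integrable_times_bounded[OF wgrad_integrable(1)[OF w(2) K(1,2)] _ B(3)], simp)
    have b: "integrable lborel (\<lambda>x. indicator K x * G x $ i * \<phi> x)" "integrable lborel (\<lambda>x. indicator K x * H x $ i * \<phi> x)"
      using integrable_times_bounded[OF wgrad_integrable(2)[OF w(1) K(1,2), of "axis i 1"] _ B(2)]
        integrable_times_bounded[OF wgrad_integrable(2)[OF w(2) K(1,2), of "axis i 1"] _ B(2)] by (auto simp: inner_axis)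
    have "(LINT x:\<Omega>|lborel. (f x - g x) * partial i \<phi> x)
      = (LINT x|lborel. indicator K x * f x * partial i \<phi> x - indicator K x * g x * partial i \<phi> x)"
      unfolding set_lebesgue_integral_def using z K(2)
      by (intro Bochner_Integration.integral_cong) (auto simp: indicator_def algebra_simps)
    also have "\<dots> = - ((LINT x|lborel. indicator K x * G x $ i * \<phi> x) - (LINT x|lborel. indicator K x * H x $ i * \<phi> x))"
      using a by (simp add: wgradD[OF w(1) \<phi> K(3,2)] wgradD[OF w(2) \<phi> K(3,2)])
    also have "\<dots> = - (LINT x|lborel. indicator K x * G x $ i * \<phi> x - indicator K x * H x $ i * \<phi> x)"
      using b by simp
    also have "\<dots> = - (LINT x:\<Omega>|lborel. (G x - H x) $ i * \<phi> x)"
      unfolding set_lebesgue_integral_def using z K(2)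
      by (intro arg_cong[of _ _ uminus] Bochner_Integration.integral_cong) (auto simp: indicator_def algebra_simps)
    finally show ?thesis .
  qed
  moreover have "set_integrable lborel K (\<lambda>x. f x - g x)" "set_integrable lborel K (\<lambda>x. G x - H x)"
    if "compact K" "K \<subseteq> \<Omega>" for K
    using w that by (auto simp: wgrad_def intro!: set_integral_diff)
  ultimately show ?thesis unfolding wgrad_def by auto
qed

section \<open>Averages along rays\<close>

lemma ball_in_sets_borel [measurable]: "ball x r \<in> sets borel"
  by simp

lemma nn_integral_lborel_affine:
  fixes f :: "'a::euclidean_space \<Rightarrow> ennreal"
  assumes [measurable]: "f \<in> borel_measurable borel" and "0 < c"
  shows "(\<integral>\<^sup>+h. f (x + c *\<^sub>R h) \<partial>lborel) = ennreal (1 / c ^ DIM('a)) * (\<integral>\<^sup>+y. f y \<partial>lborel)"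
proof -
  have "(\<integral>\<^sup>+y. f y \<partial>lborel) = (\<integral>\<^sup>+y. f y \<partial>density (distr lborel borel (\<lambda>h. x + c *\<^sub>R h)) (\<lambda>_. ennreal (\<bar>c\<bar> ^ DIM('a))))"
    using lborel_affine[of c x] assms by simp
  also have "\<dots> = ennreal (c ^ DIM('a)) * (\<integral>\<^sup>+h. f (x + c *\<^sub>R h) \<partial>lborel)"
    using assms by (simp add: nn_integral_density nn_integral_distr nn_integral_cmult)
  finally have "ennreal (1 / c ^ DIM('a)) * (\<integral>\<^sup>+y. f y \<partial>lborel)
     = (ennreal (1 / c ^ DIM('a)) * ennreal (c ^ DIM('a))) * (\<integral>\<^sup>+h. f (x + c *\<^sub>R h) \<partial>lborel)"
    by (simp add: mult.assoc)
  also have "ennreal (1 / c ^ DIM('a)) * ennreal (c ^ DIM('a)) = 1"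
    using assms by (simp flip: ennreal_mult)
  finally show ?thesis by simp
qed

lemma nn_integral_ball_scale:
  fixes f :: "'a::euclidean_space \<Rightarrow> ennreal"
  assumes [measurable]: "f \<in> borel_measurable borel" and "0 < c"
  shows "(\<integral>\<^sup>+h. indicator (ball 0 s) h * f (x + c *\<^sub>R h) \<partial>lborel)
     = ennreal (1 / c ^ DIM('a)) * (\<integral>\<^sup>+y. indicator (ball x (c * s)) y * f y \<partial>lborel)"
proof -
  have "indicator (ball 0 s) h = (indicator (ball x (c * s)) (x + c *\<^sub>R h) :: ennreal)" for h
    using assms by (auto simp: indicator_def dist_norm)
  moreover have "(\<lambda>y. indicator (ball x (c * s)) y * f y) \<in> borel_measurable borel" by measurable
  ultimately show ?thesis
    using nn_integral_lborel_affine[of "\<lambda>y. indicator (ball x (c * s)) y * f y" c x] \<open>0 < c\<close> by simp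
qed

text \<open>Averaging the line formula over all steps in a ball replaces the representation of a Sobolev
  function by a Riesz potential.\<close>

lemma wgrad_avg:
  fixes x0 :: "real^'n"
  assumes w: "wgrad \<Omega> v G" and s: "0 < s" and sub: "cball x0 (R + s) \<subseteq> \<Omega>"
  shows "AE x in lborel. x \<in> ball x0 R \<longrightarrow> ennreal (v x) * emeasure lborel (ball (0::real^'n) s) \<le>
     (\<integral>\<^sup>+y. indicator (ball x s) y * ennreal (v y) \<partial>lborel) +
     (\<integral>\<^sup>+t. indicator {0<..1} t * (ennreal (s / t ^ CARD('n)) * (\<integral>\<^sup>+y. indicator (ball x (t * s)) y * ennreal (norm (G y)) \<partial>lborel)) \<partial>lborel)"
proof -
  have [measurable]: "v \<in> borel_measurable borel" "G \<in> borel_measurable borel" using w by (auto simp: wgrad_def)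
  \<comment> \<open>The triangle inequality for the line formula, as a predicate in (x, h): it is
    known for almost every x at each fixed h and is wanted for almost every h at almost every
    x.\<close>
  define P where "P = (\<lambda>x h. x \<in> ball x0 R \<and> h \<in> ball 0 s \<longrightarrow>
    ennreal (v x) \<le> ennreal (v (x + h)) + (\<integral>\<^sup>+t. indicator {0<..1} t * ennreal (s * norm (G (x + t *\<^sub>R h))) \<partial>lborel))"
  have "AE x in lborel. P x h" for h
  proof (cases "h \<in> ball 0 s")
    case True
    have "AE x in lborel. x \<in> ball x0 R \<longrightarrow> v (x + h) - v x = (LINT t:{0..1}|lborel. G (x + t *\<^sub>R h) \<bullet> h)"
    proof (rule wgrad_line[OF w open_ball compact_cball sub])
      fix x t assume x: "x \<in> ball x0 R" "0 \<le> t" "t \<le> (1::real)"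
      have "dist x (x + t *\<^sub>R h) = t * norm h" using x by (simp add: dist_norm)
      also have "\<dots> \<le> 1 * s" using x True by (intro mult_mono) auto
      finally show "x + t *\<^sub>R h \<in> cball x0 (R + s)" using x dist_triangle[of x0 "x + t *\<^sub>R h" x] by auto
    qed
    then show ?thesis
    proof eventually_elim
      case (elim x)
      show ?case unfolding P_def
      proof
        assume x: "x \<in> ball x0 R \<and> h \<in> ball 0 s"
        define I where "I = (LINT t:{0..1}|lborel. G (x + t *\<^sub>R h) \<bullet> h)"
        have "ennreal \<bar>I\<bar> \<le> (\<integral>\<^sup>+t. norm (indicator {0..1} t *\<^sub>R (G (x + t *\<^sub>R h) \<bullet> h)) \<partial>lborel)"
        proof (cases "integrable lborel (\<lambda>t. indicator {0..1} t *\<^sub>R (G (x + t *\<^sub>R h) \<bullet> h))")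
          case True
          then show ?thesis unfolding I_def set_lebesgue_integral_def real_norm_def[symmetric]
            by (rule integral_norm_bound_ennreal)
        next
          case False
          \<comment> \<open>A Bochner integral of a non-integrable function is 0 by convention, so
            the estimate holds in this case as well.\<close>
          then have "I = 0" unfolding I_def set_lebesgue_integral_def by (rule not_integrable_integral_eq)
          then show ?thesis by simp
        qed
        also have "\<dots> \<le> (\<integral>\<^sup>+t. indicator {0<..1} t * ennreal (s * norm (G (x + t *\<^sub>R h))) \<partial>lborel)"
        proof (rule nn_integral_mono_AE)
          show "AE t in lborel. ennreal (norm (indicator {0..1} t *\<^sub>R (G (x + t *\<^sub>R h) \<bullet> h)))
             \<le> indicator {0<..1} t * ennreal (s * norm (G (x + t *\<^sub>R h)))"
            using AE_lborel_singleton[of "0::real"]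
          proof eventually_elim
            case (elim t)
            have "\<bar>G (x + t *\<^sub>R h) \<bullet> h\<bar> \<le> norm (G (x + t *\<^sub>R h)) * norm h" by (rule Cauchy_Schwarz_ineq2)
            also have "\<dots> \<le> s * norm (G (x + t *\<^sub>R h))" using True
              by (subst mult.commute) (intro mult_right_mono, auto)
            finally show ?case using elim by (auto simp: indicator_def intro!: ennreal_leI)
          qed
        qed
        finally have I: "ennreal \<bar>I\<bar> \<le> (\<integral>\<^sup>+t. indicator {0<..1} t * ennreal (s * norm (G (x + t *\<^sub>R h))) \<partial>lborel)" .
        have "v (x + h) - v x = I" using elim x by (simp add: I_def)
        then have "ennreal (v x) \<le> ennreal (max 0 (v (x + h)) + \<bar>I\<bar>)" by (intro ennreal_leI) auto
        also have "\<dots> = ennreal (v (x + h)) + ennreal \<bar>I\<bar>" by (subst ennreal_plus) (auto simp: max_def ennreal_neg)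
        also note add_left_mono[OF I]
        finally show "ennreal (v x) \<le> ennreal (v (x + h)) + (\<integral>\<^sup>+t. indicator {0<..1} t * ennreal (s * norm (G (x + t *\<^sub>R h))) \<partial>lborel)" .
      qed
    qed
  qed (simp add: P_def)
  \<comment> \<open>Measurability of \<open>P\<close> on the product allows the quantifiers to be
    exchanged by Fubini, after which the inequality may be integrated over h.\<close>
  then have "AE h in lborel. AE x in lborel. P x h" by simp
  moreover have "{z \<in> space (lborel \<Otimes>\<^sub>M lborel). P (fst z) (snd z)} \<in> sets (lborel \<Otimes>\<^sub>M (lborel :: (real^'n) measure))"
    unfolding P_def by measurable
  ultimately have "AE x in lborel. AE h in lborel. P x h"
    by (subst lborel_pair.AE_commute)
  then show ?thesis
  proof eventually_elim
    case (elim x)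
    show ?case
    proof
      assume x: "x \<in> ball x0 R"
      have "ennreal (v x) * emeasure lborel (ball (0::real^'n) s) = (\<integral>\<^sup>+h. indicator (ball (0::real^'n) s) h * ennreal (v x) \<partial>lborel)"
        by (subst nn_integral_multc) (auto simp: mult.commute)
      also have "\<dots> \<le> (\<integral>\<^sup>+h. indicator (ball 0 s) h * (ennreal (v (x + h)) + (\<integral>\<^sup>+t. indicator {0<..1} t * ennreal (s * norm (G (x + t *\<^sub>R h))) \<partial>lborel)) \<partial>lborel)"
      proof (rule nn_integral_mono_AE)
        show "AE h in lborel. indicator (ball 0 s) h * ennreal (v x) \<le> indicator (ball 0 s) h * (ennreal (v (x + h)) + (\<integral>\<^sup>+t. indicator {0<..1} t * ennreal (s * norm (G (x + t *\<^sub>R h))) \<partial>lborel))"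
          using elim by eventually_elim (use x in \<open>auto simp: P_def indicator_def\<close>)
      qed
      also have "\<dots> = (\<integral>\<^sup>+h. indicator (ball 0 s) h * ennreal (v (x + h)) \<partial>lborel)
         + (\<integral>\<^sup>+h. indicator (ball 0 s) h * (\<integral>\<^sup>+t. indicator {0<..1} t * ennreal (s * norm (G (x + t *\<^sub>R h))) \<partial>lborel) \<partial>lborel)"
        unfolding distrib_left by (rule nn_integral_add) measurable
      also have "(\<integral>\<^sup>+h. indicator (ball 0 s) h * ennreal (v (x + h)) \<partial>lborel) = (\<integral>\<^sup>+y. indicator (ball x s) y * ennreal (v y) \<partial>lborel)"
        using nn_integral_ball_scale[of "\<lambda>y. ennreal (v y)" 1 s x] by simp
      also have "(\<integral>\<^sup>+h. indicator (ball 0 s) h * (\<integral>\<^sup>+t. indicator {0<..1} t * ennreal (s * norm (G (x + t *\<^sub>R h))) \<partial>lborel) \<partial>lborel)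
         = (\<integral>\<^sup>+h. \<integral>\<^sup>+t. indicator (ball 0 s) h * (indicator {0<..1} t * ennreal (s * norm (G (x + t *\<^sub>R h)))) \<partial>lborel \<partial>lborel)"
        by (simp add: nn_integral_cmult)
      also have "\<dots> = (\<integral>\<^sup>+t. \<integral>\<^sup>+h. indicator (ball 0 s) h * (indicator {0<..1} t * ennreal (s * norm (G (x + t *\<^sub>R h)))) \<partial>lborel \<partial>lborel)"
        by (rule lborel_pair.Fubini') measurable
      \<comment> \<open>For fixed t the substitution y = x + t h maps the ball of radius s onto the
        ball of radius t s around x, with Jacobian t^n.\<close>
      also have "\<dots> = (\<integral>\<^sup>+t. indicator {0<..1} t * (ennreal (s / t ^ CARD('n)) * (\<integral>\<^sup>+y. indicator (ball x (t * s)) y * ennreal (norm (G y)) \<partial>lborel)) \<partial>lborel)"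
      proof (rule nn_integral_cong)
        fix t :: real
        show "(\<integral>\<^sup>+h. indicator (ball 0 s) h * (indicator {0<..1} t * ennreal (s * norm (G (x + t *\<^sub>R h)))) \<partial>lborel)
          = indicator {0<..1} t * (ennreal (s / t ^ CARD('n)) * (\<integral>\<^sup>+y. indicator (ball x (t * s)) y * ennreal (norm (G y)) \<partial>lborel))"
        proof (cases "t \<in> {0<..1}")
          case True
          then have "(\<integral>\<^sup>+h. indicator (ball 0 s) h * (indicator {0<..1} t * ennreal (s * norm (G (x + t *\<^sub>R h)))) \<partial>lborel)
            = ennreal s * (\<integral>\<^sup>+h. indicator (ball 0 s) h * ennreal (norm (G (x + t *\<^sub>R h))) \<partial>lborel)"
            using s by (subst nn_integral_cmult[symmetric]) (auto intro!: nn_integral_cong simp: ennreal_mult mult_ac)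
          also have "\<dots> = ennreal s * (ennreal (1 / t ^ CARD('n)) * (\<integral>\<^sup>+y. indicator (ball x (t * s)) y * ennreal (norm (G y)) \<partial>lborel))"
            using nn_integral_ball_scale[of "\<lambda>y. ennreal (norm (G y))" t s x] True by simp
          also have "\<dots> = ennreal (s / t ^ CARD('n)) * (\<integral>\<^sup>+y. indicator (ball x (t * s)) y * ennreal (norm (G y)) \<partial>lborel)"
            using True s by (simp add: mult.assoc[symmetric] ennreal_mult[symmetric])
          finally show ?thesis using True by simp
        qed simp
      qed
      finally show "ennreal (v x) * emeasure lborel (ball (0::real^'n) s) \<le>
       (\<integral>\<^sup>+y. indicator (ball x s) y * ennreal (v y) \<partial>lborel) +
       (\<integral>\<^sup>+t. indicator {0<..1} t * (ennreal (s / t ^ CARD('n)) * (\<integral>\<^sup>+y. indicator (ball x (t * s)) y * ennreal (norm (G y)) \<partial>lborel)) \<partial>lborel)" .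
    qed
  qed
qed

section \<open>Uniqueness of weak gradients; Borel and Lebesgue representatives\<close>

lemma wgrad_unique:
  assumes w: "wgrad \<Omega> f G" "wgrad \<Omega> g H" and op: "open \<Omega>"
    and eq: "AE x in lborel. x \<in> \<Omega> \<longrightarrow> f x = g x"
  shows "AE x in lborel. x \<in> \<Omega> \<longrightarrow> G x = H x"
proof -
  have [measurable]: "f \<in> borel_measurable borel" "G \<in> borel_measurable borel"
    "g \<in> borel_measurable borel" "H \<in> borel_measurable borel" using w by (auto simp: wgrad_def)
  have [measurable]: "\<Omega> \<in> sets borel" using op by auto
  have "AE x in lborel. x \<in> \<Omega> \<longrightarrow> (G x - H x) \<bullet> axis i 1 = 0" for i
  proof (rule AE_eq_0_if_bump_integrals[OF op])
    show "(\<lambda>x. (G x - H x) \<bullet> axis i 1) \<in> borel_measurable borel" by measurable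
    have i: "integrable lborel (\<lambda>x. indicator K x * (G x \<bullet> axis i 1) - indicator K x * (H x \<bullet> axis i 1))"
      if "compact K" "K \<subseteq> \<Omega>" for K
      using wgrad_integrable(2)[OF w(1) that] wgrad_integrable(2)[OF w(2) that] by auto
    show "set_integrable lborel (cbox a b) (\<lambda>x. (G x - H x) \<bullet> axis i 1)" if "cbox a b \<subseteq> \<Omega>" for a b
      using i[OF compact_cbox that] unfolding set_integrable_def by (simp add: inner_diff_left algebra_simps)
    fix m a b assume ab: "cbox a b \<subseteq> \<Omega>"
    let ?K = "cbox a b" and ?\<phi> = "bump m a b"
    have \<phi>: "?\<phi> \<in> test_functions \<Omega>" by (rule bump_test_function[OF ab])
    note [measurable] = test_function_measurable[OF \<phi>]
    have B: "\<bar>?\<phi> x\<bar> \<le> 1" for x using bump_nonneg[of m a b x] bump_le_1[of m a b x] by simp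
    have z: "?\<phi> x = 0" if "x \<notin> ?K" for x
    proof (rule bump_eq_0)
      show "x \<notin> box a b" using that box_subset_cbox[of a b] by (meson subsetD)
    qed
    have supp: "supp UNIV ?\<phi> \<subseteq> ?K" using z by (intro supp_subset_closed) auto
    have c: "integrable lborel (\<lambda>x. indicator ?K x * (G x $ i) * ?\<phi> x)" "integrable lborel (\<lambda>x. indicator ?K x * (H x $ i) * ?\<phi> x)"
      using integrable_times_bounded[OF wgrad_integrable(2)[OF w(1) compact_cbox ab, of "axis i 1"] _ B]
        integrable_times_bounded[OF wgrad_integrable(2)[OF w(2) compact_cbox ab, of "axis i 1"] _ B] by (auto simp: inner_axis)
    have "(LINT x|lborel. ?\<phi> x * ((G x - H x) \<bullet> axis i 1))
       = (LINT x|lborel. indicator ?K x * (G x $ i) * ?\<phi> x - indicator ?K x * (H x $ i) * ?\<phi> x)"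
      using z by (intro Bochner_Integration.integral_cong) (auto simp: indicator_def inner_axis algebra_simps)
    also have "\<dots> = (LINT x|lborel. indicator ?K x * (G x $ i) * ?\<phi> x) - (LINT x|lborel. indicator ?K x * (H x $ i) * ?\<phi> x)"
      using c by simp
    also have "\<dots> = (LINT x|lborel. indicator ?K x * g x * partial i ?\<phi> x) - (LINT x|lborel. indicator ?K x * f x * partial i ?\<phi> x)"
      using wgradD[OF w(1) \<phi> supp ab, of i] wgradD[OF w(2) \<phi> supp ab, of i] by simp
    also have "(LINT x|lborel. indicator ?K x * g x * partial i ?\<phi> x) = (LINT x|lborel. indicator ?K x * f x * partial i ?\<phi> x)"
    proof (rule integral_cong_AE)
      show "AE x in lborel. indicator ?K x * g x * partial i ?\<phi> x = indicator ?K x * f x * partial i ?\<phi> x"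
        using eq by eventually_elim (use ab in \<open>auto simp: indicator_def\<close>)
    qed measurable
    finally show "(LINT x|lborel. ?\<phi> x * ((G x - H x) \<bullet> axis i 1)) = 0" by simp
  qed
  then have "AE x in lborel. \<forall>i\<in>UNIV. x \<in> \<Omega> \<longrightarrow> (G x - H x) \<bullet> axis i 1 = 0"
    by (intro AE_finite_allI) auto
  then show ?thesis
    by eventually_elim (auto simp: vec_eq_iff inner_axis)
qed

lemma lebesgue_ex_borel:
  fixes g :: "'a::euclidean_space \<Rightarrow> 'b::euclidean_space"
  assumes "g \<in> borel_measurable lebesgue"
  obtains g' where "g' \<in> borel_measurable borel" "AE x in lborel. g x = g' x"
proof -
  have "\<exists>h\<in>borel_measurable lborel. AE x in lborel. g x \<bullet> b = h x" for b
    using assms by (intro completion_ex_borel_measurable_real) auto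
  then have "\<exists>h. \<forall>b. h b \<in> borel_measurable lborel \<and> (AE x in lborel. g x \<bullet> b = h b x)"
    by (intro choice) blast
  then obtain h where h: "\<And>b. h b \<in> borel_measurable borel" "\<And>b. AE x in lborel. g x \<bullet> b = h b x"
    by auto
  show ?thesis
  proof (rule that[of "\<lambda>x. \<Sum>b\<in>Basis. h b x *\<^sub>R b"])
    show "(\<lambda>x. \<Sum>b\<in>Basis. h b x *\<^sub>R b) \<in> borel_measurable borel" using h(1) by measurable
    have "AE x in lborel. \<forall>b\<in>Basis. g x \<bullet> b = h b x" using h(2) by (intro AE_finite_allI) auto
    then show "AE x in lborel. g x = (\<Sum>b\<in>Basis. h b x *\<^sub>R b)"
    proof eventually_elim
      case (elim x)
      have "g x = (\<Sum>b\<in>Basis. (g x \<bullet> b) *\<^sub>R b)" by (simp add: euclidean_representation)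
      also have "\<dots> = (\<Sum>b\<in>Basis. h b x *\<^sub>R b)" using elim by (intro sum.cong) auto
      finally show ?case .
    qed
  qed
qed

text \<open>Integrability on each member of a compact exhaustion gives measurability of the cutoffs,
  and these are eventually constant at every point.\<close>

lemma L1_loc_measurable:
  fixes \<Omega> :: "(real^'n) set"
  assumes "f \<in> L1_loc \<Omega>" "open \<Omega>"
  shows "(\<lambda>x. indicator \<Omega> x *\<^sub>R f x) \<in> borel_measurable lebesgue"
proof -
  have "\<exists>C. (\<forall>n. compact (C n)) \<and> (\<forall>n. C n \<subseteq> \<Omega>) \<and> (\<forall>n. C n \<subseteq> interior (C (Suc n))) \<and> \<Union> (range C) = \<Omega>"
  proof (rule open_Union_compact_subsets[OF \<open>open \<Omega>\<close>])
    fix C :: "nat \<Rightarrow> (real^'n) set"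
    assume "\<And>n. compact (C n)" "\<And>n. C n \<subseteq> \<Omega>" "\<And>n. C n \<subseteq> interior (C (Suc n))" "\<Union> (range C) = \<Omega>"
    then show ?thesis by (intro exI[of _ C]) simp
  qed
  then obtain C where C: "\<And>n. compact (C n)" "\<And>n. C n \<subseteq> \<Omega>" "\<And>n. C n \<subseteq> interior (C (Suc n))" "\<Union> (range C) = \<Omega>"
    by auto
  have inc: "C n \<subseteq> C m" if "n \<le> m" for n m
    by (rule lift_Suc_mono_le[OF _ that]) (use C(3) interior_subset in blast)
  show ?thesis
  proof (rule borel_measurable_LIMSEQ_metric)
    show "(\<lambda>x. indicator (C n) x *\<^sub>R f x) \<in> borel_measurable lebesgue" for n
      using assms(1) C(1,2)[of n] unfolding L1_loc_def set_integrable_def by auto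
    show "(\<lambda>n. indicator (C n) x *\<^sub>R f x) \<longlonglongrightarrow> indicator \<Omega> x *\<^sub>R f x" for x
    proof (rule tendsto_eventually)
      show "\<forall>\<^sub>F n in sequentially. indicator (C n) x *\<^sub>R f x = indicator \<Omega> x *\<^sub>R f x"
      proof (cases "x \<in> \<Omega>")
        case True
        then obtain n where "x \<in> C n" using C(4) by blast
        then have "x \<in> C m" if "n \<le> m" for m using inc[OF that] by blast
        with True show ?thesis unfolding eventually_sequentially
          by (intro exI[of _ n]) auto
      next
        case False
        then have "x \<notin> C n" for n using C(2) by blast
        with False show ?thesis by simp
      qed
    qed
  qed
qed

lemma set_integral_lebesgue_lborel:
  fixes g g' :: "'a::euclidean_space \<Rightarrow> real"
  assumes op: "open \<Omega>" and g'[measurable]: "g' \<in> borel_measurable borel"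
    and e: "AE x in lebesgue. x \<in> \<Omega> \<longrightarrow> g x = g' x"
  shows "(LINT x:\<Omega>|lebesgue. g x) = (LINT x:\<Omega>|lborel. g' x)"
proof -
  have [measurable]: "\<Omega> \<in> sets borel" using op by auto
  have ae: "AE x in lebesgue. indicator \<Omega> x *\<^sub>R g' x = indicator \<Omega> x *\<^sub>R g x"
    using e by eventually_elim (auto simp: indicator_def)
  have m: "(\<lambda>x. indicator \<Omega> x *\<^sub>R g' x) \<in> borel_measurable lebesgue" by (rule measurable_completion) measurable
  have "(LINT x|lebesgue. indicator \<Omega> x *\<^sub>R g x) = (LINT x|lebesgue. indicator \<Omega> x *\<^sub>R g' x)"
    by (intro integral_cong_AE m borel_measurable_AE[OF m ae]) (use ae in eventually_elim, auto)
  also have "\<dots> = (LINT x|lborel. indicator \<Omega> x *\<^sub>R g' x)"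
    by (rule integral_completion) measurable
  finally show ?thesis unfolding set_lebesgue_integral_def .
qed

lemma has_weak_gradient_imp_wgrad:
  assumes h: "has_weak_gradient \<Omega> f G" and op: "open \<Omega>"
  obtains f' G' where "wgrad \<Omega> f' G'" "AE x in lborel. x \<in> \<Omega> \<longrightarrow> f x = f' x \<and> G x = G' x"
proof -
  have L: "f \<in> L1_loc \<Omega>" "G \<in> L1_loc \<Omega>" using h by (auto simp: has_weak_gradient_def)
  have [measurable]: "\<Omega> \<in> sets borel" using op by auto
  obtain f' where f'[measurable]: "f' \<in> borel_measurable borel" and fe: "AE x in lborel. indicator \<Omega> x *\<^sub>R f x = f' x"
    using lebesgue_ex_borel[OF L1_loc_measurable[OF L(1) op]] by blast
  obtain G' where G'[measurable]: "G' \<in> borel_measurable borel" and Ge: "AE x in lborel. indicator \<Omega> x *\<^sub>R G x = G' x"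
    using lebesgue_ex_borel[OF L1_loc_measurable[OF L(2) op]] by blast
  have eq: "AE x in lborel. x \<in> \<Omega> \<longrightarrow> f x = f' x \<and> G x = G' x"
    using fe Ge by eventually_elim auto
  have eq': "AE x in lebesgue. x \<in> \<Omega> \<longrightarrow> f x = f' x \<and> G x = G' x"
    using eq by (simp add: AE_completion_iff)
  have int: "set_integrable lborel K g'"
    if K: "compact K" "K \<subseteq> \<Omega>" and g: "g absolutely_integrable_on K" and g': "g' \<in> borel_measurable borel"
      and e: "AE x in lebesgue. x \<in> \<Omega> \<longrightarrow> g x = g' x"
    for K and g g' :: "real^'a \<Rightarrow> 'b::euclidean_space"
  proof -
    have [measurable]: "K \<in> sets borel" using K by (auto intro: borel_compact)
    note g'[measurable]
    have "integrable lebesgue (\<lambda>x. indicator K x *\<^sub>R g' x)"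
    proof (rule integrable_cong_AE_imp[OF g[unfolded set_integrable_def]])
      show "(\<lambda>x. indicator K x *\<^sub>R g' x) \<in> borel_measurable lebesgue"
        by (rule measurable_completion) measurable
      show "AE x in lebesgue. indicator K x *\<^sub>R g x = indicator K x *\<^sub>R g' x"
        using e by eventually_elim (use K in \<open>auto simp: indicator_def\<close>)
    qed
    then show ?thesis unfolding set_integrable_def
      by (subst (asm) integrable_completion) auto
  qed
  have "wgrad \<Omega> f' G'"
    unfolding wgrad_def
  proof (intro conjI allI impI ballI)
    fix K assume K: "compact K \<and> K \<subseteq> \<Omega>"
    show "set_integrable lborel K f'"
      by (rule int[of _ f]) (use K L eq' in \<open>auto simp: L1_loc_def\<close>)
    show "set_integrable lborel K G'"
      by (rule int[of _ G]) (use K L eq' in \<open>auto simp: L1_loc_def\<close>)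
  next
    fix \<phi> i assume \<phi>: "\<phi> \<in> test_functions \<Omega>"
    note [measurable] = test_function_measurable[OF \<phi>]
    have "(\<lambda>x. G' x \<bullet> axis i 1) \<in> borel_measurable borel" by measurable
    then have [measurable]: "(\<lambda>x. G' x $ i) \<in> borel_measurable borel" by (simp add: inner_axis)
    have "(LINT x:\<Omega>|lborel. f' x * partial i \<phi> x) = (LINT x:\<Omega>|lebesgue. f x * partial i \<phi> x)"
      by (rule set_integral_lebesgue_lborel[OF op, symmetric]) (measurable, use eq' in eventually_elim, auto)
    also have "\<dots> = - (LINT x:\<Omega>|lebesgue. G x $ i * \<phi> x)" using h \<phi> unfolding has_weak_gradient_def by blast
    also have "(LINT x:\<Omega>|lebesgue. G x $ i * \<phi> x) = (LINT x:\<Omega>|lborel. G' x $ i * \<phi> x)"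
      by (rule set_integral_lebesgue_lborel[OF op]) (measurable, use eq' in eventually_elim, auto)
    finally show "(LINT x:\<Omega>|lborel. f' x * partial i \<phi> x) = - (LINT x:\<Omega>|lborel. G' x $ i * \<phi> x)" .
  qed (fact f' G')+
  with eq show ?thesis using that by blast
qed

lemma wgrad_imp_has_weak_gradient:
  assumes w: "wgrad \<Omega> f' G" and op: "open \<Omega>" and eq: "AE x in lborel. x \<in> \<Omega> \<longrightarrow> f x = f' x"
  shows "has_weak_gradient \<Omega> f G"
proof -
  have [measurable]: "f' \<in> borel_measurable borel" "G \<in> borel_measurable borel" using w by (auto simp: wgrad_def)
  have [measurable]: "\<Omega> \<in> sets borel" using op by auto
  have eq': "AE x in lebesgue. x \<in> \<Omega> \<longrightarrow> f x = f' x" using eq by (simp add: AE_completion_iff)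
  have f: "f absolutely_integrable_on K" if K: "compact K" "K \<subseteq> \<Omega>" for K
  proof -
    have [measurable]: "K \<in> sets borel" using K by (auto intro: borel_compact)
    have m: "(\<lambda>x. indicator K x *\<^sub>R f' x) \<in> borel_measurable lebesgue" by (rule measurable_completion) measurable
    have ae: "AE x in lebesgue. indicator K x *\<^sub>R f' x = indicator K x *\<^sub>R f x"
      using eq' by eventually_elim (use K in \<open>auto simp: indicator_def\<close>)
    have "integrable lebesgue (\<lambda>x. indicator K x *\<^sub>R f' x)"
      using wgrad_integrable(1)[OF w K] by (subst integrable_completion) auto
    then show ?thesis unfolding set_integrable_def
      by (rule integrable_cong_AE_imp[OF _ borel_measurable_AE[OF m ae]]) (use ae in eventually_elim, simp)
  qed
  have G: "G absolutely_integrable_on K" if K: "compact K" "K \<subseteq> \<Omega>" for K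
  proof -
    have [measurable]: "K \<in> sets borel" using K by (auto intro: borel_compact)
    show ?thesis using w K unfolding wgrad_def set_integrable_def by (subst integrable_completion) auto
  qed
  show ?thesis
    unfolding has_weak_gradient_def
  proof (intro conjI ballI allI)
    show "f \<in> L1_loc \<Omega>" "G \<in> L1_loc \<Omega>" using f G by (auto simp: L1_loc_def)
    fix \<phi> i assume \<phi>: "\<phi> \<in> test_functions \<Omega>"
    note [measurable] = test_function_measurable[OF \<phi>]
    have "(\<lambda>x. G x \<bullet> axis i 1) \<in> borel_measurable borel" by measurable
    then have [measurable]: "(\<lambda>x. G x $ i) \<in> borel_measurable borel" by (simp add: inner_axis)
    have "(LINT x:\<Omega>|lebesgue. f x * partial i \<phi> x) = (LINT x:\<Omega>|lborel. f' x * partial i \<phi> x)"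
      by (rule set_integral_lebesgue_lborel[OF op]) (measurable, use eq' in eventually_elim, auto)
    also have "\<dots> = - (LINT x:\<Omega>|lborel. G x $ i * \<phi> x)" using w \<phi> unfolding wgrad_def by blast
    also have "(LINT x:\<Omega>|lborel. G x $ i * \<phi> x) = (LINT x:\<Omega>|lebesgue. G x $ i * \<phi> x)"
    proof (rule set_integral_lebesgue_lborel[OF op, symmetric])
      show "(\<lambda>x. G x $ i * \<phi> x) \<in> borel_measurable borel" by measurable
    qed simp
    finally show "(LINT x:\<Omega>|lebesgue. f x * partial i \<phi> x) = - (LINT x:\<Omega>|lebesgue. G x $ i * \<phi> x)" .
  qed
qed

text \<open>\<open>weak_gradient\<close> is a choice by \<open>SOME\<close>; uniqueness makes every
  possible choice agree almost everywhere with a gradient that has been computed, so energies do not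
  depend on it.\<close>

lemma weak_gradient_AE_eq:
  assumes w: "wgrad \<Omega> f' G" and op: "open \<Omega>" and eq: "AE x in lborel. x \<in> \<Omega> \<longrightarrow> f x = f' x"
  shows "AE x in lborel. x \<in> \<Omega> \<longrightarrow> weak_gradient \<Omega> f x = G x"
proof -
  have "has_weak_gradient \<Omega> f G" by (rule wgrad_imp_has_weak_gradient[OF w op eq])
  then have "has_weak_gradient \<Omega> f (weak_gradient \<Omega> f)" unfolding weak_gradient_def by (rule someI[of "has_weak_gradient \<Omega> f"])
  then obtain g H where g: "wgrad \<Omega> g H" "AE x in lborel. x \<in> \<Omega> \<longrightarrow> f x = g x \<and> weak_gradient \<Omega> f x = H x"
    by (rule has_weak_gradient_imp_wgrad[OF _ op])
  have "AE x in lborel. x \<in> \<Omega> \<longrightarrow> H x = G x"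
  proof (rule wgrad_unique[OF g(1) w op])
    show "AE x in lborel. x \<in> \<Omega> \<longrightarrow> g x = f' x" using g(2) eq by eventually_elim auto
  qed
  with g(2) show ?thesis by eventually_elim auto
qed

lemma wgrad_subset:
  assumes w: "wgrad \<Omega> f G" and U: "U \<subseteq> \<Omega>"
  shows "wgrad U f G"
proof -
  have "(LINT x:U|lborel. f x * partial i \<phi> x) = - (LINT x:U|lborel. G x $ i * \<phi> x)"
    if \<phi>: "\<phi> \<in> test_functions U" for \<phi> i
  proof -
    have \<phi>': "\<phi> \<in> test_functions \<Omega>" using \<phi> U by (auto simp: test_functions_def)
    have z: "\<phi> x = 0" "partial i \<phi> x = 0" if "x \<notin> U" for x
      using test_functionD(5,6,8)[OF \<phi>] that by blast+
    have "(LINT x:U|lborel. f x * partial i \<phi> x) = (LINT x:\<Omega>|lborel. f x * partial i \<phi> x)"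
      "(LINT x:U|lborel. G x $ i * \<phi> x) = (LINT x:\<Omega>|lborel. G x $ i * \<phi> x)"
      unfolding set_lebesgue_integral_def using z U
      by (intro Bochner_Integration.integral_cong; auto simp: indicator_def)+
    then show ?thesis using w \<phi>' by (auto simp: wgrad_def)
  qed
  moreover have "set_integrable lborel K f \<and> set_integrable lborel K G" if "compact K \<and> K \<subseteq> U" for K
    using w that U order_trans[of K U \<Omega>] unfolding wgrad_def by simp
  ultimately show ?thesis using w unfolding wgrad_def by simp
qed

section \<open>Muckenhoupt weights\<close>

abbreviation wm :: "(real^'n \<Rightarrow> real) \<Rightarrow> (real^'n) measure" where
  "wm a \<equiv> density lborel (\<lambda>x. ennreal (a x))"

section \<open>Real powers and Hoelder's inequality in [0,\<infinity>]\<close>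

lemma ennreal_powr_ennreal [simp]: "0 \<le> x \<Longrightarrow> ennreal_powr (ennreal x) p = ennreal (x powr p)"
  by (simp add: ennreal_powr_def)

lemma ennreal_powr_0 [simp]: "ennreal_powr 0 p = 0"
  by (simp add: ennreal_powr_def)

lemma ennreal_powr_one [simp]: "ennreal_powr 1 p = 1"
  using ennreal_powr_ennreal[of 1 p] by simp

lemma ennreal_powr_top [simp]: "ennreal_powr top p = top"
  by (simp add: ennreal_powr_def)

lemma ennreal_powr_mono: "x \<le> y \<Longrightarrow> 0 \<le> p \<Longrightarrow> ennreal_powr x p \<le> ennreal_powr y p"
  by (cases x; cases y) (auto simp: top_unique intro!: ennreal_leI powr_mono2)

lemma ennreal_powr_mult:
  assumes "0 < p" shows "ennreal_powr (x * y) p = ennreal_powr x p * ennreal_powr y p"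
proof (cases x; cases y)
  fix r s :: real assume "x = ennreal r" "0 \<le> r" "y = ennreal s" "0 \<le> s"
  then show ?thesis by (simp add: powr_mult flip: ennreal_mult)
next
  fix r :: real assume *: "x = ennreal r" "0 \<le> r" "y = top"
  then show ?thesis by (cases "r = 0") (auto simp: ennreal_mult_top ennreal_mult_eq_top_iff)
next
  fix s :: real assume *: "x = top" "y = ennreal s" "0 \<le> s"
  then show ?thesis by (cases "s = 0") (auto simp: ennreal_top_mult)
qed (auto simp: ennreal_top_mult)

lemma ennreal_powr_add_le:
  assumes "0 \<le> p" shows "ennreal_powr (x + y) p \<le> ennreal (2 powr p) * (ennreal_powr x p + ennreal_powr y p)"
proof (cases x; cases y)
  fix r s :: real assume rs: "x = ennreal r" "0 \<le> r" "y = ennreal s" "0 \<le> s"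
  have "(r + s) powr p \<le> (2 * max r s) powr p" using rs assms by (intro powr_mono2) auto
  also have "\<dots> = 2 powr p * max r s powr p" using rs by (simp add: powr_mult)
  also have "\<dots> \<le> 2 powr p * (r powr p + s powr p)" by (intro mult_left_mono) (auto simp: max_def)
  finally show ?thesis using rs by (simp flip: ennreal_plus ennreal_mult)
qed (auto simp: ennreal_mult_top)

lemma measurable_ennreal_powr [measurable (raw)]:
  assumes [measurable]: "f \<in> borel_measurable M"
  shows "(\<lambda>x. ennreal_powr (f x) p) \<in> borel_measurable M"
  unfolding ennreal_powr_def by measurable

lemma ennreal_powr_eq_0_iff: "ennreal_powr x p = 0 \<longleftrightarrow> x = 0"
  by (cases x) (auto simp: ennreal_eq_0_iff)

lemma ennreal_Young:
  fixes x y :: ennreal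
  assumes pq: "1 < p" "1 < q" "1 / p + 1 / q = 1"
  shows "x * y \<le> ennreal (1 / p) * ennreal_powr x p + ennreal (1 / q) * ennreal_powr y q"
proof (cases x; cases y)
  fix r s :: real assume rs: "x = ennreal r" "0 \<le> r" "y = ennreal s" "0 \<le> s"
  then show ?thesis using Youngs_inequality[OF pq rs(2,4)] pq
    by (simp flip: ennreal_mult ennreal_plus)
qed (use pq in \<open>auto simp: ennreal_mult_top\<close>)

text \<open>Stated after raising to the power \<open>p\<close>, so that no roots occur and the
  exponent \<open>p - 1\<close> matches the Muckenhoupt condition. Factors 0 and \<infinity> are
  treated apart, in accordance with 0 times \<infinity> being 0.\<close>

lemma nn_integral_Holder:
  fixes f g :: "'a \<Rightarrow> ennreal"
  assumes [measurable]: "f \<in> borel_measurable M" "g \<in> borel_measurable M"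
    and p: "1 < p"
  shows "ennreal_powr (\<integral>\<^sup>+x. f x * g x \<partial>M) p
     \<le> (\<integral>\<^sup>+x. ennreal_powr (f x) p \<partial>M) * ennreal_powr (\<integral>\<^sup>+x. ennreal_powr (g x) (p / (p - 1)) \<partial>M) (p - 1)"
proof -
  define q where "q = p / (p - 1)"
  have q: "1 < q" "1 / p + 1 / q = 1" using p by (auto simp: q_def field_simps)
  define F where "F = (\<integral>\<^sup>+x. ennreal_powr (f x) p \<partial>M)"
  define G where "G = (\<integral>\<^sup>+x. ennreal_powr (g x) q \<partial>M)"
  consider "F = 0" | "G = 0" | "F \<noteq> 0" "G = top" | "G \<noteq> 0" "F = top" | "F \<noteq> 0" "F \<noteq> top" "G \<noteq> 0" "G \<noteq> top" by blast
  then have "ennreal_powr (\<integral>\<^sup>+x. f x * g x \<partial>M) p \<le> F * ennreal_powr G (p - 1)"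
  proof cases
    case 1
    then have "AE x in M. f x = 0" unfolding F_def by (subst (asm) nn_integral_0_iff_AE) (auto simp: ennreal_powr_eq_0_iff)
    then have "AE x in M. f x * g x = 0" by eventually_elim simp
    then have "(\<integral>\<^sup>+x. f x * g x \<partial>M) = 0" by (subst nn_integral_0_iff_AE) auto
    then show ?thesis by simp
  next
    case 2
    then have "AE x in M. g x = 0" unfolding G_def by (subst (asm) nn_integral_0_iff_AE) (auto simp: ennreal_powr_eq_0_iff)
    then have "AE x in M. f x * g x = 0" by eventually_elim simp
    then have "(\<integral>\<^sup>+x. f x * g x \<partial>M) = 0" by (subst nn_integral_0_iff_AE) auto
    then show ?thesis by simp
  next
    case 3
    then show ?thesis by (simp add: ennreal_mult_top)
  next
    case 4
    then show ?thesis by (simp add: ennreal_top_mult ennreal_powr_eq_0_iff)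
  next
    case 5
    obtain F' where F': "F = ennreal F'" "0 < F'" using 5 by (cases F) (auto simp: less_le)
    obtain G' where G': "G = ennreal G'" "0 < G'" using 5 by (cases G) (auto simp: less_le)
    \<comment> \<open>Scaling by \<open>c\<close> and \<open>d\<close> normalizes both integrals to
      1, and Young's inequality then bounds the integral of the product by 1/p + 1/q = 1.\<close>
    define c where "c = F' powr (- 1 / p)"
    define d where "d = G' powr (- 1 / q)"
    have cp: "c powr p = 1 / F'"
    proof -
      have "c powr p = F' powr (- 1)" unfolding c_def powr_powr using p by simp
      then show ?thesis using F' by (simp add: powr_minus_divide)
    qed
    have dq: "d powr q = 1 / G'"
    proof -
      have "d powr q = G' powr (- 1)" unfolding d_def powr_powr using q by simp
      then show ?thesis using G' by (simp add: powr_minus_divide)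
    qed
    have c: "0 < c" "c powr p * F' = 1" using F' cp by (auto simp: c_def)
    have d: "0 < d" "d powr q * G' = 1" using G' dq by (auto simp: d_def)
    have "ennreal (c * d) * (\<integral>\<^sup>+x. f x * g x \<partial>M) = (\<integral>\<^sup>+x. (ennreal c * f x) * (ennreal d * g x) \<partial>M)"
      using c d by (subst nn_integral_cmult[symmetric]) (auto simp: ennreal_mult mult_ac)
    also have "\<dots> \<le> (\<integral>\<^sup>+x. ennreal (1 / p) * ennreal_powr (ennreal c * f x) p + ennreal (1 / q) * ennreal_powr (ennreal d * g x) q \<partial>M)"
      by (intro nn_integral_mono ennreal_Young p q)
    also have "\<dots> = ennreal (1 / p) * (ennreal (c powr p) * F) + ennreal (1 / q) * (ennreal (d powr q) * G)"
      using p q c d by (simp add: nn_integral_add nn_integral_cmult ennreal_powr_mult F_def G_def)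
    also have "\<dots> = ennreal (1 / p + 1 / q)"
      using F' G' c d p q by (simp flip: ennreal_mult ennreal_plus)
    finally have le1: "ennreal (c * d) * (\<integral>\<^sup>+x. f x * g x \<partial>M) \<le> 1" using q by simp
    have "ennreal_powr (ennreal (c * d)) p * ennreal_powr (\<integral>\<^sup>+x. f x * g x \<partial>M) p \<le> 1"
      using ennreal_powr_mono[OF le1, of p] p by (simp add: ennreal_powr_mult)
    then have "ennreal (1 / (c * d) powr p) * (ennreal ((c * d) powr p) * ennreal_powr (\<integral>\<^sup>+x. f x * g x \<partial>M) p)
        \<le> ennreal (1 / (c * d) powr p) * 1"
      using c d by (intro mult_left_mono) auto
    also have "ennreal (1 / (c * d) powr p) * (ennreal ((c * d) powr p) * ennreal_powr (\<integral>\<^sup>+x. f x * g x \<partial>M) p)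
       = ennreal_powr (\<integral>\<^sup>+x. f x * g x \<partial>M) p"
    proof -
      have "ennreal (1 / (c * d) powr p) * ennreal ((c * d) powr p) = 1"
        using c d by (simp flip: ennreal_mult)
      then show ?thesis by (simp add: mult.assoc[symmetric])
    qed
    also have "1 / (c * d) powr p = F' * G' powr (p - 1)"
    proof -
      have "d powr p = G' powr (- (p - 1))"
        unfolding d_def q_def powr_powr using p by (intro arg_cong[of _ _ "\<lambda>x. G' powr x"]) (simp add: field_simps)
      then have "d powr p = 1 / G' powr (p - 1)" by (simp only: powr_minus_divide)
      then show ?thesis using F' G' c d cp by (simp add: powr_mult)
    qed
    finally show ?thesis using F' G' by (simp add: ennreal_mult)
  qed
  then show ?thesis by (simp add: F_def G_def q_def)
qed

lemma nn_integral_Jensen_powr: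
  fixes g :: "'a \<Rightarrow> ennreal"
  assumes [measurable]: "g \<in> borel_measurable M" "S \<in> sets M" and p: "1 < p" and fin: "emeasure M S < \<infinity>"
  shows "ennreal_powr (\<integral>\<^sup>+x. indicator S x * g x \<partial>M) p
    \<le> ennreal (measure M S powr (p - 1)) * (\<integral>\<^sup>+x. indicator S x * ennreal_powr (g x) p \<partial>M)"
proof -
  have "ennreal_powr (\<integral>\<^sup>+x. indicator S x * g x \<partial>M) p = ennreal_powr (\<integral>\<^sup>+x. (indicator S x * g x) * indicator S x \<partial>M) p"
    by (intro arg_cong[of _ _ "\<lambda>x. ennreal_powr x p"] nn_integral_cong) (auto simp: indicator_def)
  also have "\<dots> \<le> (\<integral>\<^sup>+x. ennreal_powr (indicator S x * g x) p \<partial>M) *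
      ennreal_powr (\<integral>\<^sup>+x. ennreal_powr (indicator S x) (p / (p - 1)) \<partial>M) (p - 1)"
    by (rule nn_integral_Holder) (use p in auto)
  also have "(\<integral>\<^sup>+x. ennreal_powr (indicator S x * g x) p \<partial>M) = (\<integral>\<^sup>+x. indicator S x * ennreal_powr (g x) p \<partial>M)"
    by (intro nn_integral_cong) (auto simp: indicator_def)
  also have "(\<integral>\<^sup>+x. ennreal_powr (indicator S x) (p / (p - 1)) \<partial>M) = (\<integral>\<^sup>+x. indicator S x \<partial>M)"
    using ennreal_powr_ennreal[of 1] by (intro nn_integral_cong) (auto simp: indicator_def)
  also have "\<dots> = ennreal (measure M S)" using fin by (simp add: emeasure_eq_ennreal_measure)
  finally show ?thesis by (simp add: mult.commute)
qed

text \<open>Hoelder's inequality against the dual weight puts the Muckenhoupt condition into this form,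
  which also covers weights vanishing almost everywhere.\<close>

definition Ap_weight :: "real \<Rightarrow> real \<Rightarrow> (real^'n \<Rightarrow> real) \<Rightarrow> bool" where
  "Ap_weight p K a \<longleftrightarrow> a \<in> borel_measurable borel \<and> (\<forall>x. 0 \<le> a x) \<and>
     (\<forall>x s. emeasure (wm a) (ball x s) < \<infinity>) \<and>
     (\<forall>x s g. 0 < s \<longrightarrow> g \<in> borel_measurable borel \<longrightarrow>
        ennreal_powr (\<integral>\<^sup>+y. indicator (ball x s) y * g y \<partial>lborel) p * emeasure (wm a) (ball x s)
        \<le> ennreal (K * measure lborel (ball x s) powr p) *
          (\<integral>\<^sup>+y. indicator (ball x s) y * (ennreal_powr (g y) p * ennreal (a y)) \<partial>lborel))"

lemma measure_ball_pos: "0 < s \<Longrightarrow> 0 < measure lborel (ball (x::'a::euclidean_space) s)"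
  using content_ball_pos[of s x] by simp

lemma Ap_weight_1:
  assumes "1 < p" shows "Ap_weight p 1 (\<lambda>_. 1)"
proof -
  have "ennreal_powr (\<integral>\<^sup>+y. indicator (ball x s) y * g y \<partial>lborel) p * emeasure lborel (ball x s)
        \<le> ennreal (measure lborel (ball x s) powr p) * (\<integral>\<^sup>+y. indicator (ball x s) y * ennreal_powr (g y) p \<partial>lborel)"
    if "0 < s" and [measurable]: "g \<in> borel_measurable borel" for x :: "real^'n" and s g
  proof -
    have e: "emeasure lborel (ball x s) = ennreal (measure lborel (ball x s))"
      using emeasure_lborel_ball_finite[of x s] by (simp add: emeasure_eq_ennreal_measure)
    have "ennreal_powr (\<integral>\<^sup>+y. indicator (ball x s) y * g y \<partial>lborel) p * emeasure lborel (ball x s)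
      \<le> ennreal (measure lborel (ball x s) powr (p - 1)) * (\<integral>\<^sup>+y. indicator (ball x s) y * ennreal_powr (g y) p \<partial>lborel) * emeasure lborel (ball x s)"
      using assms emeasure_lborel_ball_finite[of x s] by (intro mult_right_mono nn_integral_Jensen_powr) auto
    also have "\<dots> = (ennreal (measure lborel (ball x s) powr (p - 1)) * ennreal (measure lborel (ball x s))) * (\<integral>\<^sup>+y. indicator (ball x s) y * ennreal_powr (g y) p \<partial>lborel)"
      unfolding e by (simp add: mult_ac)
    also have "ennreal (measure lborel (ball x s) powr (p - 1)) * ennreal (measure lborel (ball x s)) = ennreal (measure lborel (ball x s) powr p)"
      using measure_ball_pos[OF that(1), of x] by (simp add: powr_diff flip: ennreal_mult)
    finally show ?thesis .
  qed
  then show ?thesis unfolding Ap_weight_def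
    using emeasure_lborel_ball_finite by (auto simp: density_1 top.not_eq_extremum)
qed

text \<open>Hoelder's inequality for g = (g a^(1/p)) a^(-1/p): the power of the second factor is the
  dual weight. On balls of zero weight the left side is 0 and nothing has to be divided.\<close>

lemma Muckenhoupt_Ap_weight:
  fixes a a' :: "real^'n \<Rightarrow> real"
  assumes p: "1 < p" and M: "a \<in> Muckenhoupt p" and [measurable]: "a' \<in> borel_measurable borel"
    and a'0: "\<And>x. 0 \<le> a' x" and eq: "AE x in lborel. a x = a' x"
  shows "Ap_weight p (enn2real (Ap_const p a)) a'"
proof -
  define K where "K = enn2real (Ap_const p a)"
  have fin: "Ap_const p a < \<infinity>" and L: "a \<in> L1_loc UNIV" using M by (auto simp: Muckenhoupt_def)
  have eqL: "AE x in lebesgue. a x = a' x" using eq by (simp add: AE_completion_iff)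
  have em: "emeasure (wm a') (ball x s) = (\<integral>\<^sup>+y. indicator (ball x s) y * ennreal (a' y) \<partial>lborel)" for x s
    by (simp add: emeasure_density mult.commute)
  have fin_ball: "emeasure (wm a') (ball x s) < \<infinity>" for x s
  proof -
    have i: "integrable lebesgue (\<lambda>y. indicator (cball x s) y *\<^sub>R a y)"
      using L by (auto simp: L1_loc_def set_integrable_def)
    have "(\<integral>\<^sup>+y. indicator (ball x s) y * ennreal (a' y) \<partial>lborel) = (\<integral>\<^sup>+y. indicator (ball x s) y * ennreal (a' y) \<partial>lebesgue)"
      by (simp add: nn_integral_completion)
    also have "\<dots> \<le> (\<integral>\<^sup>+y. norm (indicator (cball x s) y *\<^sub>R a y) \<partial>lebesgue)"
    proof (rule nn_integral_mono_AE)
      show "AE y in lebesgue. indicator (ball x s) y * ennreal (a' y) \<le> ennreal (norm (indicator (cball x s) y *\<^sub>R a y))"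
        using eqL by eventually_elim (use a'0 in \<open>auto simp: indicator_def\<close>)
    qed
    also have "\<dots> < \<infinity>" using i by (simp add: integrable_iff_bounded)
    finally show ?thesis by (simp add: em)
  qed
  have "ennreal_powr (\<integral>\<^sup>+y. indicator (ball x s) y * g y \<partial>lborel) p * emeasure (wm a') (ball x s)
        \<le> ennreal (K * measure lborel (ball x s) powr p) *
          (\<integral>\<^sup>+y. indicator (ball x s) y * (ennreal_powr (g y) p * ennreal (a' y)) \<partial>lborel)"
    if s: "0 < s" and [measurable]: "g \<in> borel_measurable borel" for x s g
  proof (cases "emeasure (wm a') (ball x s) = 0")
    case False
    define V where "V = measure lborel (ball x s)"
    have V: "0 < V" "emeasure lborel (ball x s) = ennreal V"
      using measure_ball_pos[OF s, of x] emeasure_lborel_ball_finite[of x s]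
      by (auto simp: V_def emeasure_eq_ennreal_measure)
    \<comment> \<open>The integral of the dual weight a^(-1/(p-1)), infinite on the zero set of
      \<open>a'\<close>.\<close>
    define J where "J = (\<integral>\<^sup>+y. indicator (ball x s) y * inverse (ennreal (a' y powr (1 / (p - 1)))) \<partial>lborel)"
    obtain A where A: "emeasure (wm a') (ball x s) = ennreal A" "0 < A"
      using False fin_ball[of x s] by (cases "emeasure (wm a') (ball x s)") (auto simp: less_le)
    have "nn_avg (ball x s) (\<lambda>y. ennreal (a y)) * ennreal_powr (nn_avg (ball x s) (\<lambda>y. inverse (ennreal (a y powr (1 / (p - 1)))))) (p - 1) \<le> Ap_const p a"
      unfolding Ap_const_def using s by (intro SUP_upper2[of "(x, s)"]) auto
    also have "nn_avg (ball x s) (\<lambda>y. ennreal (a y)) = ennreal A / ennreal V"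
    proof -
      have "(\<integral>\<^sup>+y. ennreal (a y) * indicator (ball x s) y \<partial>lebesgue) = (\<integral>\<^sup>+y. indicator (ball x s) y * ennreal (a' y) \<partial>lebesgue)"
        by (intro nn_integral_cong_AE) (use eqL in eventually_elim, simp add: mult.commute)
      then show ?thesis using A V by (simp add: nn_avg_def nn_integral_completion em)
    qed
    also have "nn_avg (ball x s) (\<lambda>y. inverse (ennreal (a y powr (1 / (p - 1))))) = J / ennreal V"
    proof -
      have "(\<integral>\<^sup>+y. inverse (ennreal (a y powr (1 / (p - 1)))) * indicator (ball x s) y \<partial>lebesgue)
        = (\<integral>\<^sup>+y. indicator (ball x s) y * inverse (ennreal (a' y powr (1 / (p - 1)))) \<partial>lebesgue)"
        by (intro nn_integral_cong_AE) (use eqL in eventually_elim, simp add: mult.commute)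
      then show ?thesis using V by (simp add: nn_avg_def nn_integral_completion J_def)
    qed
    finally have le: "ennreal A / ennreal V * ennreal_powr (J / ennreal V) (p - 1) \<le> Ap_const p a" .
    have AV: "ennreal A / ennreal V = ennreal (A / V)" using A V by (simp add: divide_ennreal)
    \<comment> \<open>The ball has positive weight here, so an infinite \<open>J\<close> would make
      the whole Muckenhoupt product infinite; the convention 0 times \<infinity> = 0 cannot
      interfere.\<close>
    have Jfin: "J \<noteq> top"
    proof
      assume "J = top"
      then have "ennreal A / ennreal V * ennreal_powr (J / ennreal V) (p - 1) = top"
        using A V by (simp add: AV ennreal_top_divide ennreal_mult_top)
      with le fin show False by (simp add: top_unique)
    qed
    then obtain J' where J': "J = ennreal J'" "0 \<le> J'" by (cases J) auto
    have "ennreal (A / V * (J' / V) powr (p - 1)) \<le> ennreal K"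
    proof -
      have "J / ennreal V = ennreal (J' / V)" using J' V by (simp add: divide_ennreal)
      then have "ennreal (A / V) * ennreal ((J' / V) powr (p - 1)) \<le> Ap_const p a"
        using le J' V by (simp add: AV)
      moreover have "Ap_const p a = ennreal K" using fin by (simp add: K_def)
      ultimately show ?thesis using A V by (subst ennreal_mult') auto
    qed
    then have "A / V * (J' / V) powr (p - 1) \<le> K" by (rule ennreal_le_iff[THEN iffD1, rotated]) (simp add: K_def)
    then have AJ: "A * J' powr (p - 1) \<le> K * V powr p"
    proof -
      assume "A / V * (J' / V) powr (p - 1) \<le> K"
      then have "A / V * (J' / V) powr (p - 1) * V powr p \<le> K * V powr p" by (intro mult_right_mono) auto
      also have "A / V * (J' / V) powr (p - 1) * V powr p = A * J' powr (p - 1)"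
        using V J' by (simp add: powr_divide powr_diff field_simps)
      finally show ?thesis .
    qed
    \<comment> \<open>Finiteness of the dual integral excludes zeros of the weight on a set of
      positive measure, which legitimates inserting a^(1/p) a^(-1/p) below.\<close>
    have pos: "AE y in lborel. y \<in> ball x s \<longrightarrow> 0 < a' y"
    proof -
      have "AE y in lborel. indicator (ball x s) y * inverse (ennreal (a' y powr (1 / (p - 1)))) \<noteq> \<infinity>"
        using Jfin unfolding J_def by (intro nn_integral_PInf_AE) auto
      then show ?thesis
      proof eventually_elim
        case (elim y)
        then show ?case using a'0[of y] by (cases "y \<in> ball x s"; cases "a' y = 0") (simp_all add: less_le del: mem_ball)
      qed
    qed
    define f where "f = (\<lambda>y. indicator (ball x s) y * (g y * ennreal (a' y powr (1 / p))))"
    define h where "h = (\<lambda>y. indicator (ball x s) y * inverse (ennreal (a' y powr (1 / p))))"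
    have [measurable]: "f \<in> borel_measurable borel" "h \<in> borel_measurable borel" unfolding f_def h_def by measurable
    have "(\<integral>\<^sup>+y. indicator (ball x s) y * g y \<partial>lborel) = (\<integral>\<^sup>+y. f y * h y \<partial>lborel)"
    proof (rule nn_integral_cong_AE)
      show "AE y in lborel. indicator (ball x s) y * g y = f y * h y"
        using pos
      proof eventually_elim
        case (elim y)
        show ?case
        proof (cases "y \<in> ball x s")
          case True
          then have "ennreal (a' y powr (1 / p)) * inverse (ennreal (a' y powr (1 / p))) = 1"
            using elim by (simp add: inverse_ennreal flip: ennreal_mult)
          then show ?thesis using True by (simp add: f_def h_def mult.assoc)
        qed (simp add: f_def)
      qed
    qed
    also have "ennreal_powr (\<integral>\<^sup>+y. f y * h y \<partial>lborel) p \<le> (\<integral>\<^sup>+y. ennreal_powr (f y) p \<partial>lborel) *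
       ennreal_powr (\<integral>\<^sup>+y. ennreal_powr (h y) (p / (p - 1)) \<partial>lborel) (p - 1)"
      by (rule nn_integral_Holder) (use p in auto)
    also have "(\<integral>\<^sup>+y. ennreal_powr (f y) p \<partial>lborel) = (\<integral>\<^sup>+y. indicator (ball x s) y * (ennreal_powr (g y) p * ennreal (a' y)) \<partial>lborel)"
      using p a'0 by (intro nn_integral_cong) (auto simp: f_def indicator_def ennreal_powr_mult powr_powr)
    also have "(\<integral>\<^sup>+y. ennreal_powr (h y) (p / (p - 1)) \<partial>lborel) = J"
      unfolding J_def
    proof (rule nn_integral_cong_AE)
      show "AE y in lborel. ennreal_powr (h y) (p / (p - 1)) = indicator (ball x s) y * inverse (ennreal (a' y powr (1 / (p - 1))))"
        using pos
      proof eventually_elim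
        case (elim y)
        show ?case
        proof (cases "y \<in> ball x s")
          case True
          then have "ennreal_powr (inverse (ennreal (a' y powr (1 / p)))) (p / (p - 1)) = inverse (ennreal (a' y powr (1 / (p - 1))))"
            using elim p by (simp add: inverse_ennreal powr_powr flip: powr_minus)
          then show ?thesis using True by (simp add: h_def)
        qed (simp add: h_def)
      qed
    qed
    finally have "ennreal_powr (\<integral>\<^sup>+y. indicator (ball x s) y * g y \<partial>lborel) p * ennreal A
      \<le> (\<integral>\<^sup>+y. indicator (ball x s) y * (ennreal_powr (g y) p * ennreal (a' y)) \<partial>lborel) * ennreal_powr J (p - 1) * ennreal A"
      by (rule mult_right_mono) simp
    also have "\<dots> = ennreal (A * J' powr (p - 1)) * (\<integral>\<^sup>+y. indicator (ball x s) y * (ennreal_powr (g y) p * ennreal (a' y)) \<partial>lborel)"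
      using A J' by (simp add: ennreal_mult mult_ac)
    also have "\<dots> \<le> ennreal (K * V powr p) * (\<integral>\<^sup>+y. indicator (ball x s) y * (ennreal_powr (g y) p * ennreal (a' y)) \<partial>lborel)"
      using AJ by (intro mult_right_mono ennreal_leI) auto
    finally show ?thesis by (simp add: A V_def)
  qed simp
  then show ?thesis using a'0 fin_ball unfolding Ap_weight_def K_def by auto
qed

lemma Ap_weight_mono:
  assumes "Ap_weight p K a" "K \<le> K'" shows "Ap_weight p K' a"
proof -
  have "ennreal (K * measure lborel (ball x s) powr p) * z \<le> ennreal (K' * measure lborel (ball x s) powr p) * z"
    for x :: "real^'a" and s z
    using assms(2) by (intro mult_right_mono ennreal_leI) auto
  then show ?thesis using assms(1) unfolding Ap_weight_def by (meson order_trans)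
qed

context
  fixes p K :: real and a :: "real^'n \<Rightarrow> real"
  assumes p: "1 < p" and w: "Ap_weight p K a" and K: "1 \<le> K"
begin

lemma Ap_weight_measurable [measurable]: "a \<in> borel_measurable borel"
  using w by (simp add: Ap_weight_def)

lemma Ap_weight_finite_ball: "emeasure (wm a) (ball x s) < \<infinity>"
  using w by (simp add: Ap_weight_def)

lemma Ap_weight_finite:
  assumes "bounded E" shows "emeasure (wm a) E < \<infinity>"
proof -
  obtain e where "E \<subseteq> ball 0 e" using bounded_subset_ballD[OF assms] by blast
  then show ?thesis using Ap_weight_finite_ball[of 0 e] emeasure_mono[of E "ball 0 e" "wm a"] by (auto intro: le_less_trans)
qed

lemma Ap_weight_avg:
  assumes "0 < s" "g \<in> borel_measurable borel"
  shows "ennreal_powr (\<integral>\<^sup>+y. indicator (ball x s) y * g y \<partial>lborel) p * emeasure (wm a) (ball x s)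
        \<le> ennreal (K * measure lborel (ball x s) powr p) *
          (\<integral>\<^sup>+y. indicator (ball x s) y * (ennreal_powr (g y) p * ennreal (a y)) \<partial>lborel)"
  using w assms by (simp add: Ap_weight_def)

text \<open>The averaged inequality applied to the indicator of \<open>E\<close>. It carries lower
  bounds on volume over to lower bounds on weight, and is the source of doubling, of the A_infinity
  property and of the Chebyshev estimate.\<close>

lemma Ap_weight_subset:
  assumes s: "0 < s" and E: "E \<in> sets borel" "E \<subseteq> ball x s"
  shows "(measure lborel E / measure lborel (ball x s)) powr p * measure (wm a) (ball x s) \<le> K * measure (wm a) E"
proof -
  note [measurable] = E(1)
  define V where "V = measure lborel (ball x s)"
  have V: "0 < V" using measure_ball_pos[OF s] by (simp add: V_def)
  have fE: "emeasure lborel E < \<infinity>"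
    using emeasure_mono[OF E(2), of lborel] emeasure_lborel_ball_finite[of x s] by (auto intro: le_less_trans)
  have bE: "bounded E" using E(2) bounded_subset bounded_ball by blast
  have 1: "(\<integral>\<^sup>+y. indicator (ball x s) y * indicator E y \<partial>lborel) = ennreal (measure lborel E)"
  proof -
    have "(\<integral>\<^sup>+y. indicator (ball x s) y * indicator E y \<partial>lborel) = (\<integral>\<^sup>+y. indicator E y \<partial>lborel)"
      using E(2) by (intro nn_integral_cong) (auto simp: indicator_def)
    then show ?thesis using fE by (simp add: emeasure_eq_ennreal_measure)
  qed
  have 2: "(\<integral>\<^sup>+y. indicator (ball x s) y * (ennreal_powr (indicator E y) p * ennreal (a y)) \<partial>lborel) = ennreal (measure (wm a) E)"
  proof -
    have "(\<integral>\<^sup>+y. indicator (ball x s) y * (ennreal_powr (indicator E y) p * ennreal (a y)) \<partial>lborel) = (\<integral>\<^sup>+y. ennreal (a y) * indicator E y \<partial>lborel)"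
      using E(2) ennreal_powr_ennreal[of 1 p] by (intro nn_integral_cong) (auto simp: indicator_def)
    then show ?thesis using Ap_weight_finite[OF bE] by (simp add: emeasure_density emeasure_eq_ennreal_measure flip: emeasure_density)
  qed
  have 3: "emeasure (wm a) (ball x s) = ennreal (measure (wm a) (ball x s))"
    using Ap_weight_finite_ball[of x s] by (simp add: emeasure_eq_ennreal_measure)
  have "ennreal (measure lborel E powr p * measure (wm a) (ball x s)) \<le> ennreal (K * V powr p * measure (wm a) E)"
    using Ap_weight_avg[OF s, of "indicator E" x] K unfolding 1 2 3 V_def by (simp add: ennreal_mult)
  then have "measure lborel E powr p * measure (wm a) (ball x s) \<le> K * V powr p * measure (wm a) E"
    using K by (subst (asm) ennreal_le_iff) auto
  then show ?thesis using V by (simp add: powr_divide V_def[symmetric] field_simps)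
qed

text \<open>Doubling with an explicit exponent: the volume ratio of the balls is (s/t)^n, and the
  A_p condition raises it to the power p.\<close>

lemma Ap_weight_ball_subset:
  assumes s: "0 < s" "0 < t" and sub: "ball x s \<subseteq> ball y t"
  shows "measure (wm a) (ball y t) \<le> K * (t / s) powr (CARD('n) * p) * measure (wm a) (ball x s)"
proof -
  have "measure lborel (ball x s) / measure lborel (ball y t) = (s / t) powr CARD('n)"
  proof -
    have "unit_ball_vol (real CARD('n)) \<noteq> 0" 
      using unit_ball_vol_pos[of "real CARD('n)", OF of_nat_0_le_iff] by linarith
    moreover have "(s / t) powr CARD('n) = s ^ CARD('n) / t ^ CARD('n)"
      using s powr_realpow[of "s / t" "CARD('n)"] by (simp add: power_divide)
    ultimately show ?thesis using s content_ball[of s x] content_ball[of t y] by simp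
  qed
  then have "(s / t) powr (CARD('n) * p) * measure (wm a) (ball y t) \<le> K * measure (wm a) (ball x s)"
    using Ap_weight_subset[OF s(2) _ sub] by (simp add: powr_powr)
  then have "(t / s) powr (CARD('n) * p) * ((s / t) powr (CARD('n) * p) * measure (wm a) (ball y t)) \<le> (t / s) powr (CARD('n) * p) * (K * measure (wm a) (ball x s))"
    by (rule mult_left_mono) simp
  moreover have "(t / s) powr (CARD('n) * p) * (s / t) powr (CARD('n) * p) = 1"
    using s by (simp flip: powr_mult)
  ultimately show ?thesis by (simp only: mult.assoc[symmetric] mult_1_left) (simp add: mult_ac)
qed

end

section \<open>The \<open>A\<^sub>\<infinity>\<close> property\<close>

text \<open>The countable Vitali family, indexed by natural numbers so that it can be fed into
  series and countable additivity.\<close>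

lemma Vitali_covering_balls_seq:
  fixes s :: "'a::euclidean_space \<Rightarrow> real"
  assumes s: "\<And>x. x \<in> E \<Longrightarrow> 0 < s x \<and> s x \<le> B"
  obtains I :: "nat set" and z where "\<forall>k\<in>I. z k \<in> E"
    "disjoint_family_on (\<lambda>k. ball (z k) (s (z k))) I" "E \<subseteq> (\<Union>k\<in>I. ball (z k) (5 * s (z k)))"
proof -
  have cov: "E \<subseteq> (\<Union>x\<in>E. ball x (s x))" using s by force
  obtain C where C: "countable C" "C \<subseteq> E"
     "pairwise (\<lambda>i j. disjnt (ball i (s i)) (ball j (s j))) C" "E \<subseteq> (\<Union>i\<in>C. ball i (5 * s i))"
    using Vitali_covering_lemma_balls[where a="\<lambda>x. x" and r=s, OF cov s] .
  define I where "I = to_nat_on C ` C"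
  have inv: "from_nat_into C k \<in> C \<and> to_nat_on C (from_nat_into C k) = k" if "k \<in> I" for k
    using that C(1) by (auto simp: I_def)
  show ?thesis
  proof (rule that[of I "from_nat_into C"])
    show "\<forall>k\<in>I. from_nat_into C k \<in> E" using inv C(2) by auto
    show "disjoint_family_on (\<lambda>k. ball (from_nat_into C k) (s (from_nat_into C k))) I"
      unfolding disjoint_family_on_def
    proof (intro ballI impI)
      fix k l assume kl: "k \<in> I" "l \<in> I" "k \<noteq> l"
      then have "from_nat_into C k \<noteq> from_nat_into C l" using inv by metis
      then show "ball (from_nat_into C k) (s (from_nat_into C k)) \<inter> ball (from_nat_into C l) (s (from_nat_into C l)) = {}"
        using C(3) inv[OF kl(1)] inv[OF kl(2)] unfolding pairwise_def disjnt_def by blast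
    qed
    show "E \<subseteq> (\<Union>k\<in>I. ball (from_nat_into C k) (5 * s (from_nat_into C k)))"
    proof
      fix x assume "x \<in> E"
      then obtain i where i: "i \<in> C" "x \<in> ball i (5 * s i)" using C(4) by blast
      then have "to_nat_on C i \<in> I" "from_nat_into C (to_nat_on C i) = i" using C(1) by (auto simp: I_def)
      then show "x \<in> (\<Union>k\<in>I. ball (from_nat_into C k) (5 * s (from_nat_into C k)))"
        using i(2) by (intro UN_I[of "to_nat_on C i"]) auto
    qed
  qed
qed

text \<open>The radius is doubled, starting with a ball inside \<open>E\<close>, until
  \<open>E\<close> fills at most half of the ball. One doubling earlier it filled more than half;
  the last doubling costs 2^n, hence the factor 2^(n+1).\<close>

lemma half_density_radius:
  fixes E :: "'a::euclidean_space set"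
  assumes E: "open E" "bounded E" "x \<in> E"
  obtains s where "0 < s" "measure lborel (E \<inter> ball x s) \<le> measure lborel (ball x s) / 2"
    "measure lborel (ball x s) \<le> 2 ^ (DIM('a) + 1) * measure lborel (E \<inter> ball x s)"
proof -
  obtain s0 where s0: "0 < s0" "ball x s0 \<subseteq> E" using E(1,3) openE by blast
  define V where "V = (\<lambda>k. measure lborel (ball x (2 ^ k * s0)))"
  have V: "V k = V 0 * (2 ^ DIM('a)) ^ k" for k
    using s0(1) by (simp add: V_def content_ball power_mult_distrib power_mult[symmetric] mult_ac)
  have V0: "0 < V 0" using s0 measure_ball_pos[of s0 x] by (simp add: V_def)
  define P where "P = (\<lambda>k. measure lborel (E \<inter> ball x (2 ^ k * s0)) \<le> V k / 2)"
  have fE: "E \<in> fmeasurable lborel" using E emeasure_bounded_finite[OF E(2)]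
    by (intro fmeasurableI) auto
  have "\<exists>k. P k"
  proof -
    obtain k where k: "2 * measure lborel E / V 0 < (2 ^ DIM('a)) ^ k"
      using real_arch_pow[of "2 ^ DIM('a)"] by (metis DIM_positive one_less_numeral_iff one_less_power semiring_norm(76))
    have "measure lborel (E \<inter> ball x (2 ^ k * s0)) \<le> measure lborel E"
      by (rule measure_mono_fmeasurable) (use fE E in auto)
    also have "\<dots> \<le> V k / 2" using k V0 V[of k] by (simp add: field_simps)
    finally show ?thesis unfolding P_def by blast
  qed
  define k where "k = (LEAST k. P k)"
  have k: "P k" unfolding k_def by (rule LeastI_ex) fact
  have "\<not> P 0" using s0 V0 by (simp add: P_def V_def Int_absorb1)
  then obtain j where j: "k = Suc j" using k by (cases k) auto
  have "\<not> P j" using not_less_Least[of j P] j by (simp add: k_def)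
  then have "V j / 2 \<le> measure lborel (E \<inter> ball x (2 ^ j * s0))" by (simp add: P_def)
  also have "\<dots> \<le> measure lborel (E \<inter> ball x (2 ^ k * s0))"
  proof (rule measure_mono_fmeasurable)
    show "E \<inter> ball x (2 ^ j * s0) \<subseteq> E \<inter> ball x (2 ^ k * s0)" 
      using s0 j subset_ball[of "2 ^ j * s0" "2 ^ k * s0" x] by auto
    show "E \<inter> ball x (2 ^ k * s0) \<in> fmeasurable lborel" using fE by (intro fmeasurable_Int_fmeasurable) auto
  qed (use E in auto)
  finally have "V k \<le> 2 ^ (DIM('a) + 1) * measure lborel (E \<inter> ball x (2 ^ k * s0))"
    using V[of j] V[of k] by (simp add: j mult_ac)
  then show ?thesis using that[of "2 ^ k * s0"] k s0 by (simp add: P_def V_def)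
qed

text \<open>The relative gain of weight in one enlargement step: 2^p from sets filling half a ball,
  5^(n p) from fivefold Vitali balls, and one factor \<open>K\<close> for each.\<close>

definition Ainf_inc :: "nat \<Rightarrow> real \<Rightarrow> real \<Rightarrow> real" where
  "Ainf_inc n p K = 1 / (K\<^sup>2 * 2 powr p * 5 powr (n * p))"

definition Ainf_vol :: "nat \<Rightarrow> real" where
  "Ainf_vol n = 1 + 2 ^ (n + 1)"

text \<open>Chosen so that \<open>Ainf_vol\<close> to this power is 1 + \<open>Ainf_inc\<close>: it
  compares growth of weight with growth of volume per step.\<close>

definition Ainf_exp :: "nat \<Rightarrow> real \<Rightarrow> real \<Rightarrow> real" where
  "Ainf_exp n p K = log (Ainf_vol n) (1 + Ainf_inc n p K)"

text \<open>The first factor pays for rounding the number of steps, the inner factor 2 for replacing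
  a set by an open one of at most twice the volume, and the last for returning from the doubled
  ball.\<close>

definition Ainf_const :: "nat \<Rightarrow> real \<Rightarrow> real \<Rightarrow> real" where
  "Ainf_const n p K = (1 + Ainf_inc n p K) * (2 * 2 ^ (n + 1) / (Ainf_vol n powr (1 / n) - 1) ^ n) powr Ainf_exp n p K
     * (K * 2 powr (n * p))"

lemma Ainf_inc_pos: "1 \<le> K \<Longrightarrow> 0 < Ainf_inc n p K"
  by (simp add: Ainf_inc_def)

lemma Ainf_vol_gt_1: "1 < Ainf_vol n"
  by (simp add: Ainf_vol_def)

lemma Ainf_exp_pos: "1 \<le> K \<Longrightarrow> 0 < Ainf_exp n p K"
  using Ainf_inc_pos[of K n p] Ainf_vol_gt_1[of n] by (simp add: Ainf_exp_def)

context
  fixes p K :: real and a :: "real^'n \<Rightarrow> real"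
  assumes p: "1 < p" and w: "Ap_weight p K a" and K: "1 \<le> K"
begin

lemma measure_wm_eq: "bounded E \<Longrightarrow> emeasure (wm a) E = ennreal (measure (wm a) E)"
  using Ap_weight_finite[OF p w K, of E] by (simp add: emeasure_eq_ennreal_measure)

lemma measure_wm_mono:
  assumes "E \<subseteq> F" "bounded F" "F \<in> sets borel"
  shows "measure (wm a) E \<le> measure (wm a) F"
proof -
  have "emeasure (wm a) E \<le> emeasure (wm a) F" using assms by (intro emeasure_mono) auto
  then show ?thesis using measure_wm_eq[of E] measure_wm_eq[of F] bounded_subset[OF assms(2,1)] assms(2) by simp
qed

text \<open>Disjoint Vitali balls of half density are added to \<open>E\<close>. Since
  \<open>E\<close> fills a fixed fraction of each, volume grows by a bounded factor; since the
  complement fills at least half of each, its weight there controls the fivefold ball, and these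
  cover \<open>E\<close>, so weight grows by a fixed factor above 1.\<close>

lemma Ainf_step:
  assumes E: "open E" "bounded E" "E \<noteq> {}"
  defines "\<sigma> \<equiv> (2 ^ (CARD('n) + 1) * measure lborel E / unit_ball_vol CARD('n)) powr (1 / CARD('n))"
  obtains E' where "open E'" "bounded E'" "E \<subseteq> E'" "measure lborel E' \<le> Ainf_vol CARD('n) * measure lborel E"
    "(1 + Ainf_inc CARD('n) p K) * measure (wm a) E \<le> measure (wm a) E'"
    "\<And>y. y \<in> E' \<Longrightarrow> \<exists>x\<in>E. dist x y < \<sigma>"
proof -
  let ?n = "CARD('n)"
  have [measurable]: "E \<in> sets borel" using E by auto
  have [measurable]: "a \<in> borel_measurable borel" using w by (simp add: Ap_weight_def)
  have fE: "emeasure lborel E = ennreal (measure lborel E)"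
    using emeasure_bounded_finite[OF E(2)] by (simp add: emeasure_eq_ennreal_measure)
  have "\<exists>s>0. measure lborel (E \<inter> ball x s) \<le> measure lborel (ball x s) / 2 \<and>
    measure lborel (ball x s) \<le> 2 ^ (?n + 1) * measure lborel (E \<inter> ball x s)" if xE: "x \<in> E" for x
  proof -
    obtain s where "0 < s" "measure lborel (E \<inter> ball x s) \<le> measure lborel (ball x s) / 2"
      "measure lborel (ball x s) \<le> 2 ^ (DIM(real^'n) + 1) * measure lborel (E \<inter> ball x s)"
      using half_density_radius[OF E(1,2) xE] .
    then show ?thesis by auto
  qed
  then have "\<exists>s. \<forall>x\<in>E. s x > 0 \<and> measure lborel (E \<inter> ball x (s x)) \<le> measure lborel (ball x (s x)) / 2 \<and>
    measure lborel (ball x (s x)) \<le> 2 ^ (?n + 1) * measure lborel (E \<inter> ball x (s x))"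
    by (intro bchoice) blast
  then obtain s where s: "\<And>x. x \<in> E \<Longrightarrow> 0 < s x"
    "\<And>x. x \<in> E \<Longrightarrow> measure lborel (E \<inter> ball x (s x)) \<le> measure lborel (ball x (s x)) / 2"
    "\<And>x. x \<in> E \<Longrightarrow> measure lborel (ball x (s x)) \<le> 2 ^ (?n + 1) * measure lborel (E \<inter> ball x (s x))"
    by auto
  have \<omega>: "0 < unit_ball_vol ?n" by simp
  \<comment> \<open>A ball of radius s x has volume at most 2^(n+1) times that of \<open>E\<close>;
    solving for the radius gives \<open>\<sigma>\<close>, the distance by which \<open>E\<close> can
    spread.\<close>
  have s_le: "s x \<le> \<sigma>" if "x \<in> E" for x
  proof -
    have "measure lborel (E \<inter> ball x (s x)) \<le> measure lborel E"
    proof -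
      have "emeasure lborel (E \<inter> ball x (s x)) \<le> emeasure lborel E" by (intro emeasure_mono) auto
      then show ?thesis unfolding measure_def using fE by (intro enn2real_mono) auto
    qed
    then have "2 ^ (?n + 1) * measure lborel (E \<inter> ball x (s x)) \<le> 2 ^ (?n + 1) * measure lborel E"
      by (intro mult_left_mono) auto
    moreover have "unit_ball_vol ?n * s x ^ ?n = measure lborel (ball x (s x))"
      using content_ball[of "s x" x] s(1)[OF that] by simp
    ultimately have "unit_ball_vol ?n * s x ^ ?n \<le> 2 ^ (?n + 1) * measure lborel E"
      using s(3)[OF that] by linarith
    then have "s x ^ ?n \<le> 2 ^ (?n + 1) * measure lborel E / unit_ball_vol ?n"
      using \<omega> by (simp add: field_simps)
    then have "(s x ^ ?n) powr (1 / ?n) \<le> \<sigma>"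
      unfolding \<sigma>_def using s(1)[OF that] by (intro powr_mono2) auto
    also have "(s x ^ ?n) powr (1 / ?n) = s x"
      using s(1)[OF that] by (simp add: powr_realpow[symmetric] powr_powr)
    finally show ?thesis .
  qed
  have ssl: "0 < s x \<and> s x \<le> \<sigma>" if "x \<in> E" for x using s(1)[OF that] s_le[OF that] by simp
  obtain I :: "nat set" and z where z': "\<forall>k\<in>I. z k \<in> E"
    and dj: "disjoint_family_on (\<lambda>k. ball (z k) (s (z k))) I" and cov: "E \<subseteq> (\<Union>k\<in>I. ball (z k) (5 * s (z k)))"
    using Vitali_covering_balls_seq[OF ssl] .
  have z: "z k \<in> E" if "k \<in> I" for k using z' that by blast
  define B where "B = (\<lambda>k. if k \<in> I then ball (z k) (s (z k)) else {})"
  define B5 where "B5 = (\<lambda>k. if k \<in> I then ball (z k) (5 * s (z k)) else {})"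
  have [measurable]: "B k \<in> sets borel" "B5 k \<in> sets borel" for k by (auto simp: B_def B5_def)
  have djB: "disjoint_family B" using dj by (auto simp: disjoint_family_on_def B_def)
  have bB: "bounded (B k)" "bounded (B5 k)" for k by (auto simp: B_def B5_def)
  define E' where "E' = E \<union> (\<Union>k. B k)"
  have near: "\<exists>x\<in>E. dist x y < \<sigma>" if yE': "y \<in> E'" for y
  proof (cases "y \<in> E")
    case True
    have "0 < \<sigma>" using s(1)[OF True] s_le[OF True] by linarith
    then show ?thesis using True by (intro bexI[of _ y]) auto
  next
    case False
    then obtain k where "k \<in> I" "y \<in> ball (z k) (s (z k))" using yE' by (auto simp: E'_def B_def split: if_splits)
    then show ?thesis using z s_le[of "z k"] by (intro bexI[of _ "z k"]) auto
  qed
  have [measurable]: "E' \<in> sets borel" unfolding E'_def by measurable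
  have bE': "bounded E'"
  proof -
    obtain e where e: "\<And>x. x \<in> E \<Longrightarrow> norm x \<le> e" using E(2) unfolding bounded_iff by blast
    have "norm y \<le> e + \<sigma>" if "y \<in> E'" for y
    proof -
      from near[OF that] obtain x where x: "x \<in> E" "dist x y < \<sigma>" by blast
      then show ?thesis using e[OF x(1)] norm_triangle_sub[of y x] by (simp add: dist_norm norm_minus_commute)
    qed
    then show ?thesis unfolding bounded_iff by blast
  qed
  have vol: "measure lborel E' \<le> Ainf_vol ?n * measure lborel E"
  proof -
    have "emeasure lborel (\<Union>k. B k) = (\<Sum>k. emeasure lborel (B k))"
      using djB by (intro suminf_emeasure[symmetric]) auto
    also have "\<dots> \<le> (\<Sum>k. ennreal (2 ^ (?n + 1)) * emeasure lborel (E \<inter> B k))"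
    proof (intro suminf_le summableI)
      fix k
      show "emeasure lborel (B k) \<le> ennreal (2 ^ (?n + 1)) * emeasure lborel (E \<inter> B k)"
      proof (cases "k \<in> I")
        case True
        have "emeasure lborel (E \<inter> B k) = ennreal (measure lborel (E \<inter> B k))"
          using emeasure_bounded_finite[of "E \<inter> B k"] E(2) by (simp add: emeasure_eq_ennreal_measure bounded_Int)
        moreover have "emeasure lborel (B k) = ennreal (measure lborel (B k))"
          using emeasure_bounded_finite[OF bB(1)[of k]] by (simp add: emeasure_eq_ennreal_measure)
        ultimately show ?thesis using s(3)[OF z[OF True]] True
          by (simp add: B_def ennreal_leI flip: ennreal_mult del: power_Suc add_2_eq_Suc' ennreal_numeral)
      qed (simp add: B_def)
    qed
    also have "\<dots> = ennreal (2 ^ (?n + 1)) * (\<Sum>k. emeasure lborel (E \<inter> B k))" by (rule ennreal_suminf_cmult)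
    also have "(\<Sum>k. emeasure lborel (E \<inter> B k)) = emeasure lborel (\<Union>k. E \<inter> B k)"
      using djB by (intro suminf_emeasure) (auto simp: disjoint_family_on_def)
    also have "\<dots> \<le> emeasure lborel E" by (intro emeasure_mono) auto
    finally have le: "emeasure lborel (\<Union>k. B k) \<le> ennreal (2 ^ (?n + 1)) * emeasure lborel E"
      by (auto simp: mult_left_mono)
    have "emeasure lborel E' \<le> emeasure lborel E + emeasure lborel (\<Union>k. B k)"
      unfolding E'_def by (rule emeasure_subadditive) auto
    also have "\<dots> \<le> emeasure lborel E + ennreal (2 ^ (?n + 1)) * emeasure lborel E" by (intro add_left_mono le)
    also have "\<dots> = ennreal (Ainf_vol ?n * measure lborel E)"
      unfolding fE by (simp add: Ainf_vol_def distrib_right flip: ennreal_mult ennreal_plus del: power_Suc ennreal_numeral)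
    finally have "enn2real (emeasure lborel E') \<le> Ainf_vol ?n * measure lborel E"
      using Ainf_vol_gt_1[of ?n] by (intro enn2real_leI) auto
    then show ?thesis by (simp add: measure_def)
  qed
  define K' where "K' = K\<^sup>2 * 2 powr p * 5 powr (?n * p)"
  have K': "0 < K'" "Ainf_inc ?n p K = 1 / K'" using K by (auto simp: K'_def Ainf_inc_def)
  \<comment> \<open>From the fivefold ball to the ball by doubling, and from the ball to its part
    outside \<open>E\<close> by \<open>Ap_weight_subset\<close> with volume ratio at least
    1/2.\<close>
  have comp: "measure (wm a) (B5 k) \<le> K' * measure (wm a) (B k - E)" for k
  proof (cases "k \<in> I")
    case True
    note zk = z[OF True] and sz = s(1)[OF z[OF True]]
    have L: "measure lborel (B k - E) \<ge> measure lborel (B k) / 2"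
    proof -
      have "measure lborel (B k) = measure lborel (B k \<inter> E) + measure lborel (B k - E)"
        using emeasure_bounded_finite[OF bB(1)[of k]] measure_Diff[of lborel "B k" "B k \<inter> E"]
        by (simp add: Diff_Int)
      then show ?thesis using s(2)[OF zk] True by (simp add: B_def Int_commute)
    qed
    have Lpos: "0 < measure lborel (B k)" using True measure_ball_pos[OF sz] by (simp add: B_def)
    have "(1 / 2) powr p * measure (wm a) (B k) \<le> (measure lborel (B k - E) / measure lborel (B k)) powr p * measure (wm a) (B k)"
      using L Lpos p by (intro mult_right_mono powr_mono2) (auto simp: field_simps)
    also have "\<dots> \<le> K * measure (wm a) (B k - E)"
      using Ap_weight_subset[OF p w K sz, of "B k - E" "z k"] True by (auto simp: B_def)
    finally have 1: "measure (wm a) (B k) \<le> K * 2 powr p * measure (wm a) (B k - E)"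
      by (simp add: powr_divide field_simps)
    have "measure (wm a) (B5 k) \<le> K * (5 * s (z k) / s (z k)) powr (?n * p) * measure (wm a) (B k)"
      using Ap_weight_ball_subset[OF p w K sz, of "5 * s (z k)" "z k" "z k"]
        subset_ball[of "s (z k)" "5 * s (z k)" "z k"] True sz by (auto simp: B_def B5_def)
    also have "5 * s (z k) / s (z k) = 5" using sz by simp
    also have "K * 5 powr (?n * p) * measure (wm a) (B k) \<le> K * 5 powr (?n * p) * (K * 2 powr p * measure (wm a) (B k - E))"
      using 1 K by (intro mult_left_mono) auto
    finally show ?thesis by (simp add: K'_def power2_eq_square mult_ac)
  qed (simp add: B5_def B_def)
  have "emeasure (wm a) E \<le> emeasure (wm a) (\<Union>k. B5 k)"
    using cov by (intro emeasure_mono) (auto simp: B5_def)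
  also have "\<dots> \<le> (\<Sum>k. emeasure (wm a) (B5 k))"
    by (rule emeasure_subadditive_countably) auto
  also have "\<dots> \<le> (\<Sum>k. ennreal K' * emeasure (wm a) (B k - E))"
  proof (intro suminf_le summableI)
    fix k
    show "emeasure (wm a) (B5 k) \<le> ennreal K' * emeasure (wm a) (B k - E)"
      using comp[of k] K'(1) measure_wm_eq[OF bB(2)[of k]] measure_wm_eq[of "B k - E"] bounded_diff[OF bB(1)[of k]]
      by (simp add: ennreal_leI flip: ennreal_mult)
  qed
  also have "\<dots> = ennreal K' * (\<Sum>k. emeasure (wm a) (B k - E))" by (rule ennreal_suminf_cmult)
  also have "(\<Sum>k. emeasure (wm a) (B k - E)) = emeasure (wm a) (\<Union>k. B k - E)"
    using djB by (intro suminf_emeasure) (auto simp: disjoint_family_on_def)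
  also have "\<dots> \<le> emeasure (wm a) (E' - E)" by (intro emeasure_mono) (auto simp: E'_def)
  finally have "emeasure (wm a) E \<le> ennreal K' * emeasure (wm a) (E' - E)" by (auto simp: mult_left_mono)
  then have "measure (wm a) E \<le> K' * measure (wm a) (E' - E)"
    using measure_wm_eq[OF E(2)] measure_wm_eq[of "E' - E"] bounded_diff[OF bE'] K'(1)
    by (simp flip: ennreal_mult)
  moreover have "measure (wm a) E' = measure (wm a) E + measure (wm a) (E' - E)"
  proof -
    have "emeasure (wm a) E' = emeasure (wm a) E + emeasure (wm a) (E' - E)"
      by (subst plus_emeasure) (auto simp: E'_def intro!: arg_cong[of _ _ "emeasure (wm a)"])
    then show ?thesis using measure_wm_eq[OF E(2)] measure_wm_eq[of "E' - E"] measure_wm_eq[OF bE'] bounded_diff[OF bE']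
      by (simp flip: ennreal_plus)
  qed
  ultimately have "(1 + Ainf_inc ?n p K) * measure (wm a) E \<le> measure (wm a) E'"
    unfolding K'(2) using K'(1) by (simp add: field_simps)
  moreover have "open E'" unfolding E'_def using E(1) by (intro open_Un open_UN) (auto simp: B_def)
  ultimately show ?thesis using that[of E'] bE' vol near by (auto simp: E'_def)
qed

end

context
  fixes p K :: real and a :: "real^'n \<Rightarrow> real"
  assumes p: "1 < p" and w: "Ap_weight p K a" and K: "1 \<le> K"
begin

text \<open>Each enlargement moves the set by at most \<open>\<sigma>\<close> of its current volume,
  and volumes grow at most geometrically. A set of small volume can thus be enlarged many times
  before leaving a given ball.\<close>

lemma Ainf_iterate:
  assumes "open E" "E \<subseteq> ball x0 \<rho>"
  defines "\<sigma> \<equiv> (\<lambda>m. (2 ^ (CARD('n) + 1) * m / unit_ball_vol CARD('n)) powr (1 / CARD('n)))"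
  shows "(1 + Ainf_inc CARD('n) p K) ^ k * measure (wm a) E
    \<le> measure (wm a) (ball x0 (\<rho> + (\<Sum>i<k. \<sigma> (Ainf_vol CARD('n) ^ i * measure lborel E))))"
  using assms(1,2)
proof (induction k arbitrary: E \<rho>)
  case 0
  then show ?case by (simp add: measure_wm_mono[OF p w K])
next
  case (Suc k)
  let ?D = "Ainf_vol CARD('n)" and ?c = "Ainf_inc CARD('n) p K"
  have D: "1 < ?D" by (rule Ainf_vol_gt_1)
  have c: "0 < ?c" by (rule Ainf_inc_pos[OF K])
  show ?case
  proof (cases "E = {}")
    case False
    have bE: "bounded E" using Suc.prems(2) bounded_subset bounded_ball by blast
    obtain E' where E': "open E'" "bounded E'" "E \<subseteq> E'" "measure lborel E' \<le> ?D * measure lborel E"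
      "(1 + ?c) * measure (wm a) E \<le> measure (wm a) E'"
      and near: "\<And>y. y \<in> E' \<Longrightarrow> \<exists>x\<in>E. dist x y < \<sigma> (measure lborel E)"
      using Ainf_step[OF p w K Suc.prems(1) bE False] unfolding \<sigma>_def by blast
    have sub: "E' \<subseteq> ball x0 (\<rho> + \<sigma> (measure lborel E))"
    proof
      fix y assume "y \<in> E'"
      then obtain x where x: "x \<in> E" "dist x y < \<sigma> (measure lborel E)" using near by blast
      then have "dist x0 x < \<rho>" using Suc.prems(2) by auto
      then show "y \<in> ball x0 (\<rho> + \<sigma> (measure lborel E))" using x(2) dist_triangle[of x0 y x] by simp
    qed
    have mono: "\<sigma> m \<le> \<sigma> m'" if "0 \<le> m" "m \<le> m'" for m m'
      unfolding \<sigma>_def using that by (intro powr_mono2 divide_right_mono mult_left_mono) auto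
    have "(1 + ?c) ^ Suc k * measure (wm a) E = (1 + ?c) ^ k * ((1 + ?c) * measure (wm a) E)" by (simp add: mult_ac)
    also have "\<dots> \<le> (1 + ?c) ^ k * measure (wm a) E'" using E'(5) c by (intro mult_left_mono) auto
    also have "\<dots> \<le> measure (wm a) (ball x0 (\<rho> + \<sigma> (measure lborel E) + (\<Sum>i<k. \<sigma> (?D ^ i * measure lborel E'))))"
      by (rule Suc.IH[OF E'(1) sub])
    also have "\<dots> \<le> measure (wm a) (ball x0 (\<rho> + (\<Sum>i<Suc k. \<sigma> (?D ^ i * measure lborel E))))"
    proof (rule measure_wm_mono[OF p w K])
      \<comment> \<open>The volume bound for \<open>E'\<close> turns its i-th displacement into the
        (i+1)-st displacement counted from \<open>E\<close>.\<close>
      have "(\<Sum>i<k. \<sigma> (?D ^ i * measure lborel E')) \<le> (\<Sum>i<k. \<sigma> (?D ^ Suc i * measure lborel E))"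
        using E'(4) D by (intro sum_mono mono) (auto simp: mult.assoc mult.left_commute intro!: mult_left_mono)
      then have "\<rho> + \<sigma> (measure lborel E) + (\<Sum>i<k. \<sigma> (?D ^ i * measure lborel E'))
         \<le> \<rho> + (\<Sum>i<Suc k. \<sigma> (?D ^ i * measure lborel E))"
        by (subst sum.lessThan_Suc_shift) simp
      then show "ball x0 (\<rho> + \<sigma> (measure lborel E) + (\<Sum>i<k. \<sigma> (?D ^ i * measure lborel E')))
         \<subseteq> ball x0 (\<rho> + (\<Sum>i<Suc k. \<sigma> (?D ^ i * measure lborel E)))"
        by (rule subset_ball)
    qed auto
    finally show ?thesis .
  qed simp
qed

text \<open>The enlargement is repeated as long as the total displacement is at most
  \<open>\<rho>\<close>. The number of steps is logarithmic in the volume ratio, so the factor (1 +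
  c)^k gained in weight is a power of it.\<close>

lemma Ainf_open:
  assumes \<rho>: "0 < \<rho>" and E: "open E" "E \<subseteq> ball x0 \<rho>"
  shows "measure (wm a) E \<le> (1 + Ainf_inc CARD('n) p K) *
    (2 ^ (CARD('n) + 1) / (Ainf_vol CARD('n) powr (1 / CARD('n)) - 1) ^ CARD('n) * (measure lborel E / measure lborel (ball x0 \<rho>))) powr Ainf_exp CARD('n) p K
    * measure (wm a) (ball x0 (2 * \<rho>))"
proof (cases "E = {}")
  case False
  let ?n = "CARD('n)"
  define D where "D = Ainf_vol ?n"
  define c where "c = Ainf_inc ?n p K"
  define \<epsilon> where "\<epsilon> = Ainf_exp ?n p K"
  define q where "q = D powr (1 / ?n)"
  define m where "m = measure lborel E"
  define V where "V = measure lborel (ball x0 \<rho>)"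
  define M where "M = measure (wm a) (ball x0 (2 * \<rho>))"
  \<comment> \<open>The volume ratio scaled so that D^k t \<le> 1 is a sufficient condition for
    \<open>k\<close> displacements to add up to at most \<open>\<rho>\<close>.\<close>
  define t where "t = 2 ^ (?n + 1) / (q - 1) ^ ?n * (m / V)"
  define \<sigma> where "\<sigma> = (\<lambda>m. (2 ^ (?n + 1) * m / unit_ball_vol ?n) powr (1 / ?n))"
  have D: "1 < D" unfolding D_def by (rule Ainf_vol_gt_1)
  have c: "0 < c" unfolding c_def by (rule Ainf_inc_pos[OF K])
  have \<epsilon>: "0 < \<epsilon>" unfolding \<epsilon>_def by (rule Ainf_exp_pos[OF K])
  have D\<epsilon>: "D powr \<epsilon> = 1 + c" using D c by (simp add: \<epsilon>_def Ainf_exp_def D_def c_def powr_log_cancel)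
  have q: "1 < q" using D by (simp add: q_def gr_one_powr)
  have V: "0 < V" "V = unit_ball_vol ?n * \<rho> ^ ?n"
    using measure_ball_pos[OF \<rho>, of x0] content_ball[of \<rho> x0] \<rho> by (auto simp: V_def)
  have \<omega>: "0 < unit_ball_vol ?n" by simp
  have M0: "0 \<le> M" by (simp add: M_def)
  have m: "0 < m"
  proof -
    obtain x e where e: "0 < e" "ball x e \<subseteq> E" using False E(1) openE by blast
    have "E \<in> fmeasurable lborel"
      using E emeasure_bounded_finite[of E] bounded_subset[OF bounded_ball E(2)] by (intro fmeasurableI) auto
    then have "measure lborel (ball x e) \<le> m"
      unfolding m_def using e by (intro measure_mono_fmeasurable) auto
    then show ?thesis using measure_ball_pos[OF e(1), of x] by linarith
  qed
  have t: "0 < t" using m V q by (simp add: t_def)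
  have ME: "measure (wm a) E \<le> M"
    unfolding M_def using E(2) \<rho> subset_ball[of \<rho> "2 * \<rho>" x0] by (intro measure_wm_mono[OF p w K]) auto
  have "measure (wm a) E \<le> (1 + c) * t powr \<epsilon> * M"
  proof (cases "t \<le> 1")
    case False
    then have "1 \<le> t powr \<epsilon>" using \<epsilon> by (intro ge_one_powr_ge_zero) auto
    then have "1 * 1 \<le> (1 + c) * t powr \<epsilon>" using c by (intro mult_mono) auto
    then have "1 * M \<le> (1 + c) * t powr \<epsilon> * M" using M0 by (intro mult_right_mono) auto
    then show ?thesis using ME by simp
  next
    case True
    have ex: "\<exists>k. 1 < D ^ Suc k * t"
    proof -
      obtain k where "1 / t < D ^ k" using real_arch_pow[OF D] by blast
      also have "D ^ k \<le> D ^ Suc k" using D by simp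
      finally show ?thesis using t by (intro exI[of _ k]) (simp add: field_simps)
    qed
    \<comment> \<open>The largest number of steps that the displacement bound permits: D^k t \<le>
      1, while one further step would exceed 1.\<close>
    define k where "k = (LEAST k. 1 < D ^ Suc k * t)"
    have k1: "1 < D ^ Suc k * t" unfolding k_def by (rule LeastI_ex[OF ex])
    have k2: "D ^ k * t \<le> 1"
    proof (cases k)
      case (Suc j)
      then show ?thesis using not_less_Least[of j "\<lambda>k. 1 < D ^ Suc k * t"] by (simp add: k_def not_less)
    qed (use True in simp)
    have \<sigma>_geo: "\<sigma> (D ^ i * m) = \<sigma> m * q ^ i" for i
    proof -
      have "\<sigma> (D ^ i * m) = (2 ^ (?n + 1) * m / unit_ball_vol ?n) powr (1 / ?n) * (D ^ i) powr (1 / ?n)"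
        unfolding \<sigma>_def using D m \<omega> by (subst powr_mult[symmetric]) (auto simp: field_simps)
      also have "(D ^ i) powr (1 / ?n) = q ^ i"
        using D unfolding q_def by (simp add: powr_realpow[symmetric] powr_powr mult.commute)
      finally show ?thesis by (simp add: \<sigma>_def)
    qed
    \<comment> \<open>The displacements form a geometric series of ratio \<open>q\<close>, the n-th
      root of \<open>D\<close>, dominated by its last term divided by q - 1; this is the origin of
      (q - 1)^n in \<open>t\<close>.\<close>
    have sum_le: "(\<Sum>i<k. \<sigma> (D ^ i * m)) \<le> \<rho>"
    proof -
      have "(\<Sum>i<k. \<sigma> (D ^ i * m)) = \<sigma> m * ((q ^ k - 1) / (q - 1))"
        using q unfolding \<sigma>_geo by (simp add: geometric_sum flip: sum_distrib_left)
      also have "\<dots> \<le> \<sigma> m * (q ^ k / (q - 1))"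
        using q by (intro mult_left_mono divide_right_mono) (auto simp: \<sigma>_def)
      also have "\<dots> = \<sigma> (D ^ k * m) / (q - 1)" by (simp add: \<sigma>_geo)
      also have "\<sigma> (D ^ k * m) = (D ^ k * t * ((q - 1) * \<rho>) ^ ?n) powr (1 / ?n)"
      proof -
        have "2 ^ (?n + 1) * (D ^ k * m) / u = D ^ k * (2 ^ (?n + 1) / A * (m / (u * R))) * (A * R)"
          if "0 < A" "0 < R" "0 < u" for A R u :: real
          using that by (simp add: field_simps)
        note * = this[of "(q - 1) ^ ?n" "\<rho> ^ ?n" "unit_ball_vol ?n"]
        show ?thesis
          unfolding \<sigma>_def t_def power_mult_distrib V(2)
          by (rule arg_cong[of _ _ "\<lambda>x. x powr (1 / ?n)"]) (rule *, use \<omega> q \<rho> in auto)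
      qed
      also have "\<dots> \<le> (1 * ((q - 1) * \<rho>) ^ ?n) powr (1 / ?n)"
        using k2 D t q \<rho> by (intro powr_mono2 mult_right_mono) auto
      also have "\<dots> = (q - 1) * \<rho>"
        using q \<rho> by (simp add: powr_realpow[symmetric] powr_powr)
      finally show ?thesis using q by (simp add: divide_right_mono)
    qed
    have "(1 + c) ^ k * measure (wm a) E \<le> measure (wm a) (ball x0 (\<rho> + (\<Sum>i<k. \<sigma> (D ^ i * m))))"
      using Ainf_iterate[OF E, of k] by (simp add: c_def D_def \<sigma>_def m_def)
    also have "\<dots> \<le> M"
      unfolding M_def using sum_le by (intro measure_wm_mono[OF p w K] subset_ball) auto
    finally have le: "(1 + c) ^ k * measure (wm a) E \<le> M" .
    have "1 \<le> (D ^ Suc k * t) powr \<epsilon>" using k1 \<epsilon> by (intro ge_one_powr_ge_zero) auto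
    also have "\<dots> = (D powr \<epsilon>) ^ Suc k * t powr \<epsilon>"
      using D t by (simp add: powr_mult powr_realpow[symmetric] powr_powr mult.commute del: power_Suc)
    also have "\<dots> = (1 + c) ^ k * ((1 + c) * t powr \<epsilon>)" by (simp add: D\<epsilon> mult_ac)
    finally have "1 * measure (wm a) E \<le> (1 + c) ^ k * ((1 + c) * t powr \<epsilon>) * measure (wm a) E"
      by (rule mult_right_mono) simp
    also have "\<dots> = (1 + c) * t powr \<epsilon> * ((1 + c) ^ k * measure (wm a) E)" by (simp add: mult_ac)
    also have "\<dots> \<le> (1 + c) * t powr \<epsilon> * M" using le c by (intro mult_left_mono) auto
    finally show ?thesis by simp
  qed
  then show ?thesis by (simp add: c_def t_def q_def D_def m_def V_def M_def \<epsilon>_def)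
qed (use Ainf_inc_pos[OF K, of "CARD('n)" p] in simp)

text \<open>Outer regularity replaces \<open>E\<close> by an open set inside the ball of at most
  twice the volume, and doubling returns from the ball of radius 2 \<open>\<rho>\<close> to the
  original one.\<close>

lemma Ap_weight_Ainf:
  assumes \<rho>: "0 < \<rho>" and E: "E \<in> sets borel" "E \<subseteq> ball x0 \<rho>"
  shows "measure (wm a) E \<le> Ainf_const CARD('n) p K *
    (measure lborel E / measure lborel (ball x0 \<rho>)) powr Ainf_exp CARD('n) p K * measure (wm a) (ball x0 \<rho>)"
proof -
  let ?n = "CARD('n)"
  have [measurable]: "E \<in> sets borel" "a \<in> borel_measurable borel" using E w by (auto simp: Ap_weight_def)
  have fE: "emeasure lborel E = ennreal (measure lborel E)"
    using emeasure_bounded_finite[of E] bounded_subset[OF bounded_ball E(2)] by (simp add: emeasure_eq_ennreal_measure)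
  show ?thesis
  proof (cases "measure lborel E = 0")
    case True
    then have "E \<in> null_sets lborel" using fE by (auto simp: null_sets_def)
    then have "emeasure (wm a) E = 0"
      by (subst emeasure_density) (auto intro!: nn_integral_0_iff_AE[THEN iffD2] simp: AE_iff_null_sets indicator_def dest!: AE_not_in)
    then show ?thesis using True by (simp add: measure_def)
  next
    case False
    then have m: "0 < measure lborel E" by (simp add: less_le)
    \<comment> \<open>The excess is allowed to be as large as the volume of \<open>E\<close> itself,
      which is positive in this case.\<close>
    obtain U where U: "open U" "E \<subseteq> U" "emeasure lborel (U - E) < ennreal (measure lborel E)"
      using outer_regular_lborel[OF E(1) m] .
    define W where "W = U \<inter> ball x0 \<rho>"
    have W: "open W" "W \<subseteq> ball x0 \<rho>" "E \<subseteq> W" using U E by (auto simp: W_def)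
    have [measurable]: "U \<in> sets borel" "W \<in> sets borel" using U(1) W(1) by auto
    have "emeasure lborel W \<le> emeasure lborel E + emeasure lborel (U - E)"
    proof -
      have "emeasure lborel W \<le> emeasure lborel (E \<union> (U - E))" by (rule emeasure_mono) (auto simp: W_def)
      also have "\<dots> \<le> emeasure lborel E + emeasure lborel (U - E)" by (rule emeasure_subadditive) auto
      finally show ?thesis .
    qed
    also have "\<dots> \<le> ennreal (measure lborel E) + ennreal (measure lborel E)" using U(3) fE by (intro add_mono) auto
    finally have mW: "measure lborel W \<le> 2 * measure lborel E"
      by (simp add: measure_def[of lborel W] enn2real_leI flip: ennreal_plus)
    define c where "c = Ainf_inc ?n p K"
    define \<epsilon> where "\<epsilon> = Ainf_exp ?n p K"
    define d where "d = 2 ^ (?n + 1) / (Ainf_vol ?n powr (1 / ?n) - 1) ^ ?n"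
    define V where "V = measure lborel (ball x0 \<rho>)"
    have c: "0 < c" unfolding c_def by (rule Ainf_inc_pos[OF K])
    have \<epsilon>: "0 < \<epsilon>" unfolding \<epsilon>_def by (rule Ainf_exp_pos[OF K])
    have "1 < Ainf_vol ?n powr (1 / ?n)" using Ainf_vol_gt_1[of ?n] by (simp add: gr_one_powr)
    then have d: "0 < d" by (simp add: d_def)
    have V: "0 < V" using measure_ball_pos[OF \<rho>] by (simp add: V_def)
    have "measure (wm a) E \<le> measure (wm a) W"
      using W by (intro measure_wm_mono[OF p w K]) (auto intro: bounded_subset[OF bounded_ball])
    also have "\<dots> \<le> (1 + c) * (d * (measure lborel W / V)) powr \<epsilon> * measure (wm a) (ball x0 (2 * \<rho>))"
      using Ainf_open[OF \<rho> W(1,2)] by (simp add: c_def \<epsilon>_def d_def V_def)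
    also have "\<dots> \<le> (1 + c) * (d * (2 * measure lborel E / V)) powr \<epsilon> * measure (wm a) (ball x0 (2 * \<rho>))"
      using c d V mW \<epsilon> by (intro mult_right_mono mult_left_mono powr_mono2 divide_right_mono) auto
    also have "\<dots> \<le> (1 + c) * (d * (2 * measure lborel E / V)) powr \<epsilon> * (K * 2 powr (?n * p) * measure (wm a) (ball x0 \<rho>))"
    proof -
      have "measure (wm a) (ball x0 (2 * \<rho>)) \<le> K * (2 * \<rho> / \<rho>) powr (?n * p) * measure (wm a) (ball x0 \<rho>)"
        using \<rho> by (intro Ap_weight_ball_subset[OF p w K] subset_ball) auto
      then show ?thesis using \<rho> c by (intro mult_left_mono) auto
    qed
    also have "(d * (2 * measure lborel E / V)) powr \<epsilon> = (2 * d) powr \<epsilon> * (measure lborel E / V) powr \<epsilon>"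
      using d V m by (subst powr_mult[symmetric]) (auto simp: mult_ac)
    finally show ?thesis
      by (simp add: Ainf_const_def c_def[symmetric] \<epsilon>_def[symmetric] V_def[symmetric] d_def mult_ac)
  qed
qed

end

lemma Ainf_const_pos: "1 \<le> K \<Longrightarrow> 0 < n \<Longrightarrow> 0 < Ainf_const n p K"
proof -
  assume "1 \<le> K" "0 < n"
  have "1 < Ainf_vol n powr (1 / n)" using Ainf_vol_gt_1[of n] \<open>0 < n\<close> by (simp add: gr_one_powr)
  then show ?thesis using \<open>1 \<le> K\<close> Ainf_inc_pos[of K n p] by (simp add: Ainf_const_def)
qed

section \<open>A weighted Sobolev inequality\<close>

abbreviation nn_mean :: "(real^'n \<Rightarrow> ennreal) \<Rightarrow> real^'n \<Rightarrow> real \<Rightarrow> ennreal" where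
  "nn_mean g x s \<equiv> ennreal (1 / measure lborel (ball x s)) * (\<integral>\<^sup>+y. indicator (ball x s) y * g y \<partial>lborel)"

text \<open>The balance between the lengths of two ranges of radii: with N = n p, the equation
  \<open>\<alpha>\<close> t^(-N) = t has the solution t = \<open>\<alpha>\<close> to this
  exponent.\<close>

definition Sobolev_exp :: "nat \<Rightarrow> real \<Rightarrow> real" where
  "Sobolev_exp n p = 1 / (n * p + 1)"

definition Sobolev_const :: "nat \<Rightarrow> real \<Rightarrow> real \<Rightarrow> real" where
  "Sobolev_const n p K = 2 powr p * (2 * (K\<^sup>2 * 4 powr (n * p)))"

lemma pred_mem_ball [measurable (raw)]:
  fixes f g :: "'b \<Rightarrow> 'a::euclidean_space"
  assumes [measurable]: "f \<in> borel_measurable M" "g \<in> borel_measurable M" "s \<in> borel_measurable M"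
  shows "Measurable.pred M (\<lambda>z. g z \<in> ball (f z) (s z))"
  unfolding mem_ball by measurable

lemma ennreal_le_cmult_inverse:
  assumes "x \<le> ennreal k * y" "x \<noteq> 0" "y \<noteq> top" "0 \<le> k"
  shows "inverse y \<le> ennreal k * inverse x"
proof -
  obtain y' where y: "y = ennreal y'" "0 \<le> y'" using assms(3) by (cases y) auto
  have xt: "x \<noteq> top" using assms(1) y by (metis ennreal_mult ennreal_neq_top top_unique assms(4))
  then obtain x' where x: "x = ennreal x'" "0 < x'" using assms(2) by (cases x) (auto simp: less_le)
  have le: "x' \<le> k * y'" using assms x y by (simp flip: ennreal_mult)
  then have ypos: "0 < y'" using x(2) y(2) assms(4) by (cases "y' = 0") auto
  have "1 / y' \<le> k * (1 / x')" using le ypos x(2) by (simp add: field_simps)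
  then show ?thesis using x y ypos assms(4) by (simp add: inverse_ennreal inverse_eq_divide flip: ennreal_mult)
qed

lemma ennreal_times_inverse: "x \<noteq> 0 \<Longrightarrow> x \<noteq> top \<Longrightarrow> x * inverse x = (1 :: ennreal)"
  by (cases x) (auto simp: inverse_ennreal less_le simp flip: ennreal_mult)

context
  fixes p K :: real and a :: "real^'n \<Rightarrow> real"
  assumes p: "1 < p" and w: "Ap_weight p K a" and K: "1 \<le> K"
begin

lemma Ap_weight_mean:
  assumes [measurable]: "g \<in> borel_measurable borel" and s: "0 < s" and pos: "emeasure (wm a) (ball x s) \<noteq> 0"
  shows "ennreal_powr (nn_mean g x s) p \<le> ennreal K * (inverse (emeasure (wm a) (ball x s)) *
    (\<integral>\<^sup>+y. indicator (ball x s) y * (ennreal_powr (g y) p * ennreal (a y)) \<partial>lborel))"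
proof -
  define V where "V = measure lborel (ball x s)"
  define I where "I = (\<integral>\<^sup>+y. indicator (ball x s) y * g y \<partial>lborel)"
  define J where "J = (\<integral>\<^sup>+y. indicator (ball x s) y * (ennreal_powr (g y) p * ennreal (a y)) \<partial>lborel)"
  define m where "m = emeasure (wm a) (ball x s)"
  have V: "0 < V" unfolding V_def by (rule measure_ball_pos[OF s])
  have fin: "m \<noteq> top" using Ap_weight_finite_ball[OF p w K, of x s] by (simp add: m_def)
  have minv: "m * inverse m = 1" using pos fin by (intro ennreal_times_inverse) (auto simp: m_def)
  have le: "ennreal_powr I p * m \<le> ennreal (K * V powr p) * J"
    using Ap_weight_avg[OF p w K s, of g x] by (simp add: I_def J_def m_def V_def)
  have "ennreal_powr (ennreal (1 / V) * I) p = ennreal ((1 / V) powr p) * (ennreal_powr I p * m) * inverse m"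
    using p V minv by (simp add: ennreal_powr_mult mult.assoc)
  also have "\<dots> \<le> ennreal ((1 / V) powr p) * (ennreal (K * V powr p) * J) * inverse m"
    by (intro mult_right_mono mult_left_mono le) auto
  also have "\<dots> = ennreal ((1 / V) powr p * (K * V powr p)) * (inverse m * J)"
    using V K by (simp add: ennreal_mult mult_ac)
  also have "(1 / V) powr p * (K * V powr p) = K" using V by (simp add: powr_divide)
  finally show ?thesis by (simp add: V_def I_def J_def m_def)
qed

text \<open>Doubling spreads zeros: a ball of zero weight forces zero weight on every larger ball
  around it, hence on every ball.\<close>

lemma Ap_weight_ball_pos:
  assumes "emeasure (wm a) (ball y t) \<noteq> 0" "0 < t" "0 < s"
  shows "emeasure (wm a) (ball x s) \<noteq> 0"
proof
  assume 0: "emeasure (wm a) (ball x s) = 0"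
  define T where "T = max s (t + dist x y)"
  have T: "0 < T" "ball x s \<subseteq> ball x T" "ball y t \<subseteq> ball x T"
    using assms by (auto simp: T_def dist_commute less_max_iff_disj intro: dist_triangle_less_add)
      (smt (verit) dist_commute dist_triangle)
  have "measure (wm a) (ball x T) \<le> K * (T / s) powr (CARD('n) * p) * measure (wm a) (ball x s)"
    by (rule Ap_weight_ball_subset[OF p w K assms(3) T(1,2)])
  also have "\<dots> = 0" using 0 by (simp add: measure_def)
  finally have "measure (wm a) (ball x T) \<le> 0" .
  then have "emeasure (wm a) (ball x T) = 0"
    using measure_wm_eq[OF p w K, of "ball x T"] by (simp add: ennreal_eq_0_iff)
  then have "emeasure (wm a) (ball y t) = 0"
    using emeasure_mono[OF T(3), of "wm a"] by simp
  with assms(1) show False by simp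
qed

lemma emeasure_ball_subset:
  assumes "0 < s" "0 < t" "ball x s \<subseteq> ball y t"
  shows "emeasure (wm a) (ball y t) \<le> ennreal (K * (t / s) powr (CARD('n) * p)) * emeasure (wm a) (ball x s)"
  using Ap_weight_ball_subset[OF p w K assms] measure_wm_eq[OF p w K, of "ball x s"] measure_wm_eq[OF p w K, of "ball y t"] K
  by (simp add: ennreal_leI flip: ennreal_mult)

text \<open>The averaging operator at a fixed radius is bounded on L^p(a), uniformly in the radius:
  A_p on each ball, then Fubini, where doubling exchanges the weights of the balls around x and
  around y.\<close>

lemma mean_powr_integral_le:
  assumes [measurable]: "g \<in> borel_measurable borel" "A \<in> sets borel" and s: "0 < s" and pos: "\<And>x. emeasure (wm a) (ball x s) \<noteq> 0"
  shows "(\<integral>\<^sup>+x. indicator A x * (ennreal (a x) * ennreal_powr (nn_mean g x s) p) \<partial>lborel)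
    \<le> ennreal (K\<^sup>2 * 4 powr (CARD('n) * p)) * (\<integral>\<^sup>+y. ennreal_powr (g y) p * ennreal (a y) \<partial>lborel)"
proof -
  have [measurable]: "a \<in> borel_measurable borel" using w by (simp add: Ap_weight_def)
  define m where "m = (\<lambda>y. \<integral>\<^sup>+z. indicator (ball y s) z * ennreal (a z) \<partial>lborel)"
  have m_eq: "m y = emeasure (wm a) (ball y s)" for y by (simp add: m_def emeasure_density mult.commute)
  have [measurable]: "m \<in> borel_measurable borel" unfolding m_def by measurable
  have mt: "m y \<noteq> top" for y using Ap_weight_finite_ball[OF p w K, of y s] by (simp add: m_eq)
  \<comment> \<open>For dist x y < s the ball around y lies in the doubled ball around x.\<close>
  define k where "k = K * 2 powr (CARD('n) * p)"
  have k: "0 \<le> k" using K by (simp add: k_def)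
  have inv_le: "inverse (m x) \<le> ennreal k * inverse (m y)" if "dist x y < s" for x y
  proof (rule ennreal_le_cmult_inverse)
    have "m y \<le> emeasure (wm a) (ball x (2 * s))"
      unfolding m_eq using that by (intro emeasure_mono) (auto, smt (verit) dist_triangle)
    also have "\<dots> \<le> ennreal (K * (2 * s / s) powr (CARD('n) * p)) * emeasure (wm a) (ball x s)"
      using s by (intro emeasure_ball_subset subset_ball) auto
    finally show "m y \<le> ennreal k * m x" using s by (simp add: k_def m_eq)
  qed (use pos mt k in \<open>auto simp: m_eq\<close>)
  let ?h = "\<lambda>y. ennreal_powr (g y) p * ennreal (a y)"
  have "(\<integral>\<^sup>+x. indicator A x * (ennreal (a x) * ennreal_powr (nn_mean g x s) p) \<partial>lborel)
     \<le> (\<integral>\<^sup>+x. \<integral>\<^sup>+y. ennreal K * (indicator A x * (ennreal (a x) * (indicator (ball y s) x * (ennreal k * inverse (m y) * ?h y)))) \<partial>lborel \<partial>lborel)"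
  proof (rule nn_integral_mono)
    fix x
    have "ennreal_powr (nn_mean g x s) p \<le> ennreal K * (inverse (m x) * (\<integral>\<^sup>+y. indicator (ball x s) y * ?h y \<partial>lborel))"
      using Ap_weight_mean[OF _ s pos[of x], of g] by (simp add: m_eq)
    also have "\<dots> = ennreal K * (\<integral>\<^sup>+y. inverse (m x) * (indicator (ball x s) y * ?h y) \<partial>lborel)"
      by (simp add: nn_integral_cmult)
    also have "\<dots> \<le> ennreal K * (\<integral>\<^sup>+y. indicator (ball y s) x * (ennreal k * inverse (m y) * ?h y) \<partial>lborel)"
    proof (intro mult_left_mono nn_integral_mono)
      fix y
      show "inverse (m x) * (indicator (ball x s) y * ?h y) \<le> indicator (ball y s) x * (ennreal k * inverse (m y) * ?h y)"
        using mult_right_mono[OF inv_le[of x y], of "?h y"]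
        by (auto simp: indicator_def dist_commute mult.assoc)
    qed auto
    finally have "indicator A x * (ennreal (a x) * ennreal_powr (nn_mean g x s) p)
      \<le> indicator A x * (ennreal (a x) * (ennreal K * (\<integral>\<^sup>+y. indicator (ball y s) x * (ennreal k * inverse (m y) * ?h y) \<partial>lborel)))"
      by (intro mult_left_mono) auto
    also have "\<dots> = (\<integral>\<^sup>+y. ennreal K * (indicator A x * (ennreal (a x) * (indicator (ball y s) x * (ennreal k * inverse (m y) * ?h y)))) \<partial>lborel)"
      by (simp add: nn_integral_cmult[symmetric] mult_ac)
    finally show "indicator A x * (ennreal (a x) * ennreal_powr (nn_mean g x s) p)
      \<le> (\<integral>\<^sup>+y. ennreal K * (indicator A x * (ennreal (a x) * (indicator (ball y s) x * (ennreal k * inverse (m y) * ?h y)))) \<partial>lborel)" .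
  qed
  also have "\<dots> = (\<integral>\<^sup>+y. \<integral>\<^sup>+x. ennreal K * (indicator A x * (ennreal (a x) * (indicator (ball y s) x * (ennreal k * inverse (m y) * ?h y)))) \<partial>lborel \<partial>lborel)"
    by (rule lborel_pair.Fubini'[symmetric]) measurable
  also have "\<dots> \<le> (\<integral>\<^sup>+y. ennreal (K * k) * ?h y \<partial>lborel)"
  proof (rule nn_integral_mono)
    fix y
    have "(\<integral>\<^sup>+x. ennreal K * (indicator A x * (ennreal (a x) * (indicator (ball y s) x * (ennreal k * inverse (m y) * ?h y)))) \<partial>lborel)
       \<le> (\<integral>\<^sup>+x. (ennreal (K * k) * inverse (m y) * ?h y) * (indicator (ball y s) x * ennreal (a x)) \<partial>lborel)"
      using K k by (intro nn_integral_mono) (auto simp: indicator_def ennreal_mult mult_ac)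
    also have "\<dots> = (ennreal (K * k) * inverse (m y) * ?h y) * m y"
      by (subst nn_integral_cmult) (auto simp: m_def)
    also have "\<dots> = ennreal (K * k) * ?h y * (m y * inverse (m y))" by (simp add: mult_ac)
    also have "m y * inverse (m y) = 1" using pos[of y] mt[of y]
      by (intro ennreal_times_inverse) (auto simp: m_eq)
    finally show "(\<integral>\<^sup>+x. ennreal K * (indicator A x * (ennreal (a x) * (indicator (ball y s) x * (ennreal k * inverse (m y) * ?h y)))) \<partial>lborel)
       \<le> ennreal (K * k) * ?h y" by simp
  qed
  also have "\<dots> = ennreal (K * k) * (\<integral>\<^sup>+y. ?h y \<partial>lborel)" by (rule nn_integral_cmult) measurable
  \<comment> \<open>The factor 2^(n p) is rounded up to 4^(n p) to share one constant with
    \<open>mean_powr_integral_gain\<close>.\<close>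
  also have "\<dots> \<le> ennreal (K\<^sup>2 * 4 powr (CARD('n) * p)) * (\<integral>\<^sup>+y. ?h y \<partial>lborel)"
    using K p by (intro mult_right_mono ennreal_leI)
      (auto simp: k_def power2_eq_square mult.assoc intro!: mult_left_mono powr_mono2)
  finally show ?thesis .
qed

text \<open>For x in \<open>A\<close> the weight of the small ball is bounded below by that of the
  fixed large ball, at the price (r/s)^(n p). The bound on the mean no longer depends on x, and
  integrating it over \<open>A\<close> produces the relative weight of \<open>A\<close>.\<close>

lemma mean_powr_integral_gain:
  assumes [measurable]: "g \<in> borel_measurable borel" and A: "A \<in> sets borel" "A \<subseteq> ball x0 (2 * r)"
    and s: "0 < s" "s \<le> r" and pos: "\<And>x s. 0 < s \<Longrightarrow> emeasure (wm a) (ball x s) \<noteq> 0"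
  shows "(\<integral>\<^sup>+x. indicator A x * (ennreal (a x) * ennreal_powr (nn_mean g x s) p) \<partial>lborel)
    \<le> ennreal (K\<^sup>2 * 4 powr (CARD('n) * p) * (r / s) powr (CARD('n) * p) * (measure (wm a) A / measure (wm a) (ball x0 (2 * r))))
      * (\<integral>\<^sup>+y. ennreal_powr (g y) p * ennreal (a y) \<partial>lborel)"
proof -
  have [measurable]: "a \<in> borel_measurable borel" "A \<in> sets borel" using w A by (auto simp: Ap_weight_def)
  let ?h = "\<lambda>y. ennreal_powr (g y) p * ennreal (a y)"
  have r: "0 < r" using s by simp
  define M0 where "M0 = measure (wm a) (ball x0 (2 * r))"
  have M0: "0 < M0" "emeasure (wm a) (ball x0 (2 * r)) = ennreal M0"
    using pos[of "2 * r" x0] r measure_wm_eq[OF p w K, of "ball x0 (2 * r)"] by (auto simp: M0_def less_le)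
  define k where "k = K * (4 * r / s) powr (CARD('n) * p)"
  have k: "0 \<le> k" using K by (simp add: k_def)
  have "(\<integral>\<^sup>+x. indicator A x * (ennreal (a x) * ennreal_powr (nn_mean g x s) p) \<partial>lborel)
     \<le> (\<integral>\<^sup>+x. indicator A x * ennreal (a x) * (ennreal (K * (k * (1 / M0))) * (\<integral>\<^sup>+y. ?h y \<partial>lborel)) \<partial>lborel)"
  proof (rule nn_integral_mono)
    fix x
    show "indicator A x * (ennreal (a x) * ennreal_powr (nn_mean g x s) p) \<le> indicator A x * ennreal (a x) * (ennreal (K * (k * (1 / M0))) * (\<integral>\<^sup>+y. ?h y \<partial>lborel))"
    proof (cases "x \<in> A")
      case True
      \<comment> \<open>The fixed ball of radius 2 r lies in the ball of radius 4 r around x, which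
        doubling compares with the ball of radius s.\<close>
      have "inverse (emeasure (wm a) (ball x s)) \<le> ennreal k * inverse (ennreal M0)"
      proof (rule ennreal_le_cmult_inverse)
        have "ennreal M0 \<le> emeasure (wm a) (ball x (4 * r))"
          unfolding M0(2)[symmetric] using True A(2) by (intro emeasure_mono) (auto simp: subset_iff, smt (verit) dist_commute dist_triangle)
        also have "\<dots> \<le> ennreal (K * (4 * r / s) powr (CARD('n) * p)) * emeasure (wm a) (ball x s)"
          using s r by (intro emeasure_ball_subset subset_ball) auto
        finally show "ennreal M0 \<le> ennreal k * emeasure (wm a) (ball x s)" by (simp add: k_def)
        show "emeasure (wm a) (ball x s) \<noteq> top" using Ap_weight_finite_ball[OF p w K, of x s] by simp
      qed (use k M0 in auto)
      also have "\<dots> = ennreal (k * (1 / M0))" using M0(1) k by (simp add: inverse_ennreal inverse_eq_divide flip: ennreal_mult)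
      finally have inv: "inverse (emeasure (wm a) (ball x s)) \<le> ennreal (k * (1 / M0))" .
      have "ennreal_powr (nn_mean g x s) p \<le> ennreal K * (inverse (emeasure (wm a) (ball x s)) * (\<integral>\<^sup>+y. indicator (ball x s) y * ?h y \<partial>lborel))"
        by (rule Ap_weight_mean[OF _ s(1) pos[OF s(1)]]) measurable
      also have "\<dots> \<le> ennreal K * (ennreal (k * (1 / M0)) * (\<integral>\<^sup>+y. ?h y \<partial>lborel))"
      proof (intro mult_left_mono mult_mono[OF inv])
        show "(\<integral>\<^sup>+y. indicator (ball x s) y * ?h y \<partial>lborel) \<le> (\<integral>\<^sup>+y. ?h y \<partial>lborel)"
          by (intro nn_integral_mono) (auto simp: indicator_def)
      qed auto
      also have "\<dots> = ennreal (K * (k * (1 / M0))) * (\<integral>\<^sup>+y. ?h y \<partial>lborel)"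
        using K k M0 by (subst ennreal_mult) (auto simp: mult.assoc)
      finally have "ennreal (a x) * ennreal_powr (nn_mean g x s) p \<le> ennreal (a x) * (ennreal (K * (k * (1 / M0))) * (\<integral>\<^sup>+y. ?h y \<partial>lborel))"
        by (rule mult_left_mono) simp
      then show ?thesis using True by simp
    qed simp
  qed
  also have "\<dots> = (\<integral>\<^sup>+x. indicator A x * ennreal (a x) \<partial>lborel) * (ennreal (K * (k * (1 / M0))) * (\<integral>\<^sup>+y. ?h y \<partial>lborel))"
    by (rule nn_integral_multc) measurable
  also have "(\<integral>\<^sup>+x. indicator A x * ennreal (a x) \<partial>lborel) = ennreal (measure (wm a) A)"
    using measure_wm_eq[OF p w K, of A] bounded_subset[OF bounded_ball A(2)]
    by (simp add: emeasure_density mult.commute)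
  also have "ennreal (measure (wm a) A) * (ennreal (K * (k * (1 / M0))) * (\<integral>\<^sup>+y. ?h y \<partial>lborel))
    = ennreal (measure (wm a) A * (K * (k * (1 / M0)))) * (\<integral>\<^sup>+y. ?h y \<partial>lborel)"
    using K k M0 by (subst ennreal_mult) (auto simp: mult.assoc)
  also have "measure (wm a) A * (K * (k * (1 / M0))) = K\<^sup>2 * 4 powr (CARD('n) * p) * (r / s) powr (CARD('n) * p) * (measure (wm a) A / M0)"
    using s r powr_mult[of 4 "r / s" "CARD('n) * p"] by (simp add: k_def power2_eq_square mult_ac)
  finally show ?thesis by (simp add: M0_def)
qed

text \<open>The pointwise hypothesis bounds \<open>W\<close> by a mean of \<open>W\<close> and by
  means of \<open>F\<close> over all radii t s. Large radii gain by
  \<open>mean_powr_integral_gain\<close>, small ones only obey \<open>mean_powr_integral_le\<close>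
  but occupy a short interval in t.\<close>

lemma Ap_weight_Sobolev:
  fixes W F :: "real^'n \<Rightarrow> ennreal"
  assumes [measurable]: "W \<in> borel_measurable borel" "F \<in> borel_measurable borel"
    and A: "A \<in> sets borel" "A \<subseteq> ball x0 (2 * r)" and s: "0 < s" "s \<le> r"
    and pt: "AE x in lborel. x \<in> A \<longrightarrow> W x * emeasure lborel (ball (0::real^'n) s) \<le>
     (\<integral>\<^sup>+y. indicator (ball x s) y * W y \<partial>lborel) +
     (\<integral>\<^sup>+t. indicator {0<..1} t * (ennreal (s / t ^ CARD('n)) * (\<integral>\<^sup>+y. indicator (ball x (t * s)) y * F y \<partial>lborel)) \<partial>lborel)"
  shows "(\<integral>\<^sup>+x. indicator A x * (ennreal_powr (W x) p * ennreal (a x)) \<partial>lborel)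
    \<le> ennreal (Sobolev_const CARD('n) p K * (r / s) powr (CARD('n) * p) *
        (measure (wm a) A / measure (wm a) (ball x0 (2 * r))) powr Sobolev_exp CARD('n) p)
      * ((\<integral>\<^sup>+y. ennreal_powr (W y) p * ennreal (a y) \<partial>lborel) + ennreal (s powr p) * (\<integral>\<^sup>+y. ennreal_powr (F y) p * ennreal (a y) \<partial>lborel))"
proof (cases "measure (wm a) A = 0")
  case True
  have [measurable]: "a \<in> borel_measurable borel" "A \<in> sets borel" using w A by (auto simp: Ap_weight_def)
  have "emeasure (wm a) A = 0"
    using True measure_wm_eq[OF p w K, of A] bounded_subset[OF bounded_ball A(2)] by simp
  then have "(\<integral>\<^sup>+x. ennreal (a x) * indicator A x \<partial>lborel) = 0" by (simp add: emeasure_density)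
  then have "AE x in lborel. ennreal (a x) * indicator A x = 0" by (subst (asm) nn_integral_0_iff_AE) auto
  then have "AE x in lborel. indicator A x * (ennreal_powr (W x) p * ennreal (a x)) = 0"
    by eventually_elim (auto simp: indicator_def split: if_splits)
  then have "(\<integral>\<^sup>+x. indicator A x * (ennreal_powr (W x) p * ennreal (a x)) \<partial>lborel) = 0"
    by (subst nn_integral_0_iff_AE) auto
  then show ?thesis by simp
next
  case False
  let ?n = "CARD('n)"
  have [measurable]: "a \<in> borel_measurable borel" "A \<in> sets borel" using w A by (auto simp: Ap_weight_def)
  have r: "0 < r" using s by simp
  define M0 where "M0 = measure (wm a) (ball x0 (2 * r))"
  have MA: "0 < measure (wm a) A" using False by (simp add: less_le)
  have MA_le: "measure (wm a) A \<le> M0" unfolding M0_def using A(2) by (intro measure_wm_mono[OF p w K]) auto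
  have "emeasure (wm a) (ball x0 (2 * r)) \<noteq> 0"
    using MA MA_le by (auto simp: M0_def measure_def)
  then have pos: "emeasure (wm a) (ball x s) \<noteq> 0" if "0 < s" for x s
    using Ap_weight_ball_pos[of x0 "2 * r" s x] r that by simp
  define \<alpha> where "\<alpha> = measure (wm a) A / M0"
  have \<alpha>: "0 < \<alpha>" "\<alpha> \<le> 1" using MA MA_le by (auto simp: \<alpha>_def)
  define N where "N = real ?n * p"
  have N: "0 < N" using p by (simp add: N_def)
  define \<theta> where "\<theta> = Sobolev_exp ?n p"
  have \<theta>: "0 < \<theta>" "\<theta> \<le> 1" "\<theta> = 1 / (N + 1)" using N by (auto simp: \<theta>_def Sobolev_exp_def N_def)
  define C where "C = K\<^sup>2 * 4 powr N"
  have C: "0 \<le> C" by (simp add: C_def)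
  define R where "R = (r / s) powr N"
  have R: "1 \<le> R" unfolding R_def using s N by (intro ge_one_powr_ge_zero) auto
  define IW where "IW = (\<integral>\<^sup>+y. ennreal_powr (W y) p * ennreal (a y) \<partial>lborel)"
  define IF where "IF = (\<integral>\<^sup>+y. ennreal_powr (F y) p * ennreal (a y) \<partial>lborel)"
  define E where "E = (\<lambda>(g :: real^'n \<Rightarrow> ennreal) x t. nn_mean g x t)"
  have vol: "measure lborel (ball x t) = unit_ball_vol ?n * t ^ ?n" if "0 < t" for x :: "real^'n" and t
    using content_ball[of t x] that by simp
  have \<omega>: "0 < unit_ball_vol ?n" by simp
  have [measurable]: "(\<lambda>x. E W x s) \<in> borel_measurable borel"
    unfolding E_def vol[OF s(1)] by measurable
  have Emeas: "(\<lambda>(x, t). indicator {0<..1} t * ennreal_powr (E F x (t * s)) p) \<in> borel_measurable (borel \<Otimes>\<^sub>M borel)"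
  proof -
    have "(\<lambda>(x, t). indicator {0<..1} t * ennreal_powr (ennreal (1 / (unit_ball_vol ?n * (t * s) ^ ?n)) *
       (\<integral>\<^sup>+y. indicator (ball x (t * s)) y * F y \<partial>lborel)) p) \<in> borel_measurable (borel \<Otimes>\<^sub>M borel)"
      by measurable
    moreover have "(\<lambda>(x, t). indicator {0<..1} t * ennreal_powr (ennreal (1 / (unit_ball_vol ?n * (t * s) ^ ?n)) *
       (\<integral>\<^sup>+y. indicator (ball x (t * s)) y * F y \<partial>lborel)) p) = (\<lambda>(x, t). indicator {0<..1} t * ennreal_powr (E F x (t * s)) p)"
      using s by (auto simp: fun_eq_iff E_def indicator_def vol)
    ultimately show ?thesis by simp
  qed
  have Emeas1: "(\<lambda>t. indicator {0<..1} t * E F x (t * s)) \<in> borel_measurable borel" for x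
  proof -
    have "(\<lambda>t. indicator {0<..1} t * (ennreal (1 / (unit_ball_vol ?n * (t * s) ^ ?n)) *
       (\<integral>\<^sup>+y. indicator (ball x (t * s)) y * F y \<partial>lborel))) \<in> borel_measurable borel"
      by measurable
    moreover have "(\<lambda>t. indicator {0<..1} t * (ennreal (1 / (unit_ball_vol ?n * (t * s) ^ ?n)) *
       (\<integral>\<^sup>+y. indicator (ball x (t * s)) y * F y \<partial>lborel))) = (\<lambda>t. indicator {0<..1} t * E F x (t * s))"
      using s by (auto simp: fun_eq_iff E_def indicator_def vol)
    ultimately show ?thesis by simp
  qed
  define J where "J = (\<lambda>x. \<integral>\<^sup>+t. indicator {0<..1} t * ennreal_powr (E F x (t * s)) p \<partial>lborel)"
  have [measurable]: "J \<in> borel_measurable borel"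
    unfolding J_def using Emeas by (intro lborel.borel_measurable_nn_integral) auto
  have pw: "AE x in lborel. indicator A x * (ennreal_powr (W x) p * ennreal (a x)) \<le>
     ennreal (2 powr p) * (indicator A x * (ennreal (a x) * ennreal_powr (E W x s) p) + ennreal (s powr p) * (indicator A x * (ennreal (a x) * J x)))"
    using pt
  proof eventually_elim
    case (elim x)
    show ?case
    proof (cases "x \<in> A")
      case True
      define V where "V = measure lborel (ball x s)"
      have V: "0 < V" "V = unit_ball_vol ?n * s ^ ?n" "emeasure lborel (ball (0::real^'n) s) = ennreal V"
        using measure_ball_pos[OF s(1), of x] vol[OF s(1)] emeasure_bounded_finite[of "ball (0::real^'n) s"]
        by (auto simp: V_def emeasure_eq_ennreal_measure)
      have 1: "ennreal (1 / V) * ennreal V = 1" using V(1) by (simp flip: ennreal_mult)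
      have "W x = W x * (ennreal (1 / V) * ennreal V)" using 1 by simp
      also have "\<dots> = ennreal (1 / V) * (W x * ennreal V)" by (simp only: mult_ac)
      also have "\<dots> \<le> ennreal (1 / V) * ((\<integral>\<^sup>+y. indicator (ball x s) y * W y \<partial>lborel) +
        (\<integral>\<^sup>+t. indicator {0<..1} t * (ennreal (s / t ^ ?n) * (\<integral>\<^sup>+y. indicator (ball x (t * s)) y * F y \<partial>lborel)) \<partial>lborel))"
        using elim True V(3) by (intro mult_left_mono) auto
      also have "\<dots> = E W x s + ennreal (1 / V) * (\<integral>\<^sup>+t. indicator {0<..1} t * (ennreal (s / t ^ ?n) * (\<integral>\<^sup>+y. indicator (ball x (t * s)) y * F y \<partial>lborel)) \<partial>lborel)"
        by (simp add: E_def V_def distrib_left)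
      also have "ennreal (1 / V) * (\<integral>\<^sup>+t. indicator {0<..1} t * (ennreal (s / t ^ ?n) * (\<integral>\<^sup>+y. indicator (ball x (t * s)) y * F y \<partial>lborel)) \<partial>lborel)
        = (\<integral>\<^sup>+t. ennreal s * (indicator {0<..1} t * E F x (t * s)) \<partial>lborel)"
      proof (subst nn_integral_cmult[symmetric], measurable, rule nn_integral_cong)
        fix t :: real
        show "ennreal (1 / V) * (indicator {0<..1} t * (ennreal (s / t ^ ?n) * (\<integral>\<^sup>+y. indicator (ball x (t * s)) y * F y \<partial>lborel)))
          = ennreal s * (indicator {0<..1} t * E F x (t * s))"
        proof (cases "t \<in> {0<..1}")
          case True
          \<comment> \<open>The volume of the ball of radius t s is t^n times \<open>V\<close>, so
            s/t^n divided by \<open>V\<close> is exactly s over that volume: the integrand is a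
            mean.\<close>
          then have "ennreal (1 / V) * ennreal (s / t ^ ?n) = ennreal s * ennreal (1 / measure lborel (ball x (t * s)))"
            using s V vol[of "t * s" x] by (simp add: power_mult_distrib field_simps flip: ennreal_mult)
          then show ?thesis using True by (simp add: E_def mult.assoc[symmetric])
        qed simp
      qed
      also have "\<dots> = ennreal s * (\<integral>\<^sup>+t. indicator {0<..1} t * E F x (t * s) \<partial>lborel)"
        by (rule nn_integral_cmult) (use Emeas1 in simp)
      finally have "ennreal_powr (W x) p \<le> ennreal_powr (E W x s + ennreal s * (\<integral>\<^sup>+t. indicator {0<..1} t * E F x (t * s) \<partial>lborel)) p"
        using p by (intro ennreal_powr_mono) auto
      also have "\<dots> \<le> ennreal (2 powr p) * (ennreal_powr (E W x s) p + ennreal_powr (ennreal s * (\<integral>\<^sup>+t. indicator {0<..1} t * E F x (t * s) \<partial>lborel)) p)"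
        using p by (intro ennreal_powr_add_le) auto
      \<comment> \<open>Jensen's inequality in t over an interval of length 1 moves the power inside
        without a constant.\<close>
      also have "ennreal_powr (ennreal s * (\<integral>\<^sup>+t. indicator {0<..1} t * E F x (t * s) \<partial>lborel)) p \<le> ennreal (s powr p) * J x"
      proof -
        have "ennreal_powr (\<integral>\<^sup>+t. indicator {0<..1::real} t * (indicator {0<..1} t * E F x (t * s)) \<partial>lborel) p
          \<le> ennreal (measure lborel {0<..1::real} powr (p - 1)) * (\<integral>\<^sup>+t. indicator {0<..1} t * ennreal_powr (indicator {0<..1} t * E F x (t * s)) p \<partial>lborel)"
          by (rule nn_integral_Jensen_powr) (use Emeas1[of x] p in auto)
        also have "(\<integral>\<^sup>+t. indicator {0<..1::real} t * (indicator {0<..1} t * E F x (t * s)) \<partial>lborel) = (\<integral>\<^sup>+t. indicator {0<..1} t * E F x (t * s) \<partial>lborel)"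
          by (intro nn_integral_cong) (auto simp: indicator_def)
        also have "(\<integral>\<^sup>+t. indicator {0<..1} t * ennreal_powr (indicator {0<..1} t * E F x (t * s)) p \<partial>lborel) = J x"
          unfolding J_def by (intro nn_integral_cong) (auto simp: indicator_def)
        finally have "ennreal_powr (\<integral>\<^sup>+t. indicator {0<..1} t * E F x (t * s) \<partial>lborel) p \<le> J x" by simp
        then have "ennreal (s powr p) * ennreal_powr (\<integral>\<^sup>+t. indicator {0<..1} t * E F x (t * s) \<partial>lborel) p \<le> ennreal (s powr p) * J x"
          by (rule mult_left_mono) simp
        then show ?thesis using s p by (simp add: ennreal_powr_mult)
      qed
      finally have "ennreal_powr (W x) p \<le> ennreal (2 powr p) * (ennreal_powr (E W x s) p + ennreal (s powr p) * J x)"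
        by (auto simp: mult_left_mono add_left_mono)
      then have "ennreal (a x) * ennreal_powr (W x) p \<le> ennreal (a x) * (ennreal (2 powr p) * (ennreal_powr (E W x s) p + ennreal (s powr p) * J x))"
        by (rule mult_left_mono) simp
      then show ?thesis using True by (simp add: distrib_left mult_ac)
    qed simp
  qed
  have T1: "(\<integral>\<^sup>+x. indicator A x * (ennreal (a x) * ennreal_powr (E W x s) p) \<partial>lborel) \<le> ennreal (C * R * \<alpha> powr \<theta>) * IW"
  proof -
    have "(\<integral>\<^sup>+x. indicator A x * (ennreal (a x) * ennreal_powr (E W x s) p) \<partial>lborel) \<le> ennreal (C * R * \<alpha>) * IW"
      unfolding E_def C_def R_def \<alpha>_def M0_def N_def IW_def
      by (rule mean_powr_integral_gain[OF _ A s pos]) auto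
    also have "\<dots> \<le> ennreal (C * R * \<alpha> powr \<theta>) * IW"
      using C R \<alpha> \<theta> powr_mono'[of \<theta> 1 \<alpha>] by (intro mult_right_mono ennreal_leI mult_left_mono) auto
    finally show ?thesis .
  qed
  have T2: "(\<integral>\<^sup>+x. indicator A x * (ennreal (a x) * J x) \<partial>lborel) \<le> ennreal (2 * C * R * \<alpha> powr \<theta>) * IF"
  proof -
    \<comment> \<open>Below \<open>t0\<close> no gain is used and the interval has length
      \<open>\<alpha> powr \<theta>\<close>. Above it the gain is at most \<open>\<alpha>\<close>
      t0^(-N) = \<open>\<alpha> powr \<theta>\<close>, because 1 - N \<open>\<theta>\<close> =
      \<open>\<theta>\<close>.\<close>
    define t0 where "t0 = \<alpha> powr \<theta>"
    have t0: "0 < t0" "t0 \<le> 1" using \<alpha> \<theta> powr_le1[of \<theta> \<alpha>] by (auto simp: t0_def)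
    define H where "H = (\<lambda>t. \<integral>\<^sup>+x. indicator A x * (ennreal (a x) * ennreal_powr (E F x (t * s)) p) \<partial>lborel)"
    have H1: "H t \<le> ennreal C * IF" if "0 < t" for t
      unfolding H_def E_def C_def N_def IF_def using that s pos
      by (intro mean_powr_integral_le) auto
    have H2: "H t \<le> ennreal (C * R * \<alpha> powr \<theta>) * IF" if t: "t0 \<le> t" "t \<le> 1" for t
    proof -
      have tpos: "0 < t" using t t0 by linarith
      have ts: "t * s \<le> r" using mult_right_mono[of t 1 s] s t by linarith
      have "H t \<le> ennreal (C * (r / (t * s)) powr N * \<alpha>) * IF"
        unfolding H_def E_def C_def N_def IF_def \<alpha>_def M0_def
        by (rule mean_powr_integral_gain[OF _ A _ _ pos]) (use tpos s ts in auto)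
      also have "(r / (t * s)) powr N * \<alpha> \<le> R * \<alpha> powr \<theta>"
      proof -
        have "(r / (t * s)) powr N = R * t powr (- N)"
          using r s tpos by (simp add: R_def powr_divide powr_mult powr_minus field_simps)
        also have "t powr (- N) \<le> t0 powr (- N)" using t t0 N by (intro powr_mono2') auto
        finally have "(r / (t * s)) powr N * \<alpha> \<le> R * (t0 powr (- N) * \<alpha>)"
          using R \<alpha> by (auto simp: mult.assoc[symmetric] intro!: mult_right_mono mult_left_mono)
        also have "t0 powr (- N) * \<alpha> = \<alpha> powr \<theta>"
        proof -
          have "t0 powr (- N) * \<alpha> = \<alpha> powr (\<theta> * - N + 1)"
            unfolding t0_def powr_powr powr_add using \<alpha> by simp
          also have "\<theta> * - N + 1 = \<theta>" using \<theta>(3) N by (simp add: field_simps)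
          finally show ?thesis .
        qed
        finally show ?thesis .
      qed
      then have "ennreal (C * (r / (t * s)) powr N * \<alpha>) * IF \<le> ennreal (C * R * \<alpha> powr \<theta>) * IF"
        using C by (intro mult_right_mono ennreal_leI) (auto simp: mult.assoc intro!: mult_left_mono)
      finally show ?thesis .
    qed
    have "(\<integral>\<^sup>+x. indicator A x * (ennreal (a x) * J x) \<partial>lborel)
       = (\<integral>\<^sup>+x. \<integral>\<^sup>+t. indicator A x * (ennreal (a x) * (indicator {0<..1} t * ennreal_powr (E F x (t * s)) p)) \<partial>lborel \<partial>lborel)"
      unfolding J_def
    proof (rule nn_integral_cong)
      fix x
      have m: "(\<lambda>t. indicator {0<..1} t * ennreal_powr (E F x (t * s)) p) \<in> borel_measurable lborel"
        using measurable_compose[OF measurable_Pair1'[of x borel borel] Emeas] by simp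
      show "indicator A x * (ennreal (a x) * (\<integral>\<^sup>+t. indicator {0<..1} t * ennreal_powr (E F x (t * s)) p \<partial>lborel))
        = (\<integral>\<^sup>+t. indicator A x * (ennreal (a x) * (indicator {0<..1} t * ennreal_powr (E F x (t * s)) p)) \<partial>lborel)"
        using m by (simp add: nn_integral_cmult)
    qed
    also have "\<dots> = (\<integral>\<^sup>+t. \<integral>\<^sup>+x. indicator A x * (ennreal (a x) * (indicator {0<..1} t * ennreal_powr (E F x (t * s)) p)) \<partial>lborel \<partial>lborel)"
    proof (rule lborel_pair.Fubini'[symmetric])
      have "(\<lambda>z. indicator A (fst z) * (ennreal (a (fst z)) * (case z of (x, t) \<Rightarrow> indicator {0<..1} t * ennreal_powr (E F x (t * s)) p)))
        \<in> borel_measurable (borel \<Otimes>\<^sub>M borel)"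
        using Emeas by measurable
      then show "(\<lambda>(x, t). indicator A x * (ennreal (a x) * (indicator {0<..1} t * ennreal_powr (E F x (t * s)) p))) \<in> borel_measurable (lborel \<Otimes>\<^sub>M lborel)"
        by (simp add: split_beta')
    qed
    also have "\<dots> \<le> (\<integral>\<^sup>+t. ennreal C * IF * indicator {0<..t0} t + ennreal (C * R * \<alpha> powr \<theta>) * IF * indicator {0<..1} t \<partial>lborel)"
    proof (rule nn_integral_mono)
      fix t :: real
      show "(\<integral>\<^sup>+x. indicator A x * (ennreal (a x) * (indicator {0<..1} t * ennreal_powr (E F x (t * s)) p)) \<partial>lborel)
        \<le> ennreal C * IF * indicator {0<..t0} t + ennreal (C * R * \<alpha> powr \<theta>) * IF * indicator {0<..1} t"
      proof (cases "t \<in> {0<..1}")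
        case True
        then have "(\<integral>\<^sup>+x. indicator A x * (ennreal (a x) * (indicator {0<..1} t * ennreal_powr (E F x (t * s)) p)) \<partial>lborel) = H t"
          by (simp add: H_def)
        also have "H t \<le> ennreal C * IF * indicator {0<..t0} t + ennreal (C * R * \<alpha> powr \<theta>) * IF * indicator {0<..1} t"
        proof (cases "t \<le> t0")
          case True
          then show ?thesis using H1[of t] \<open>t \<in> {0<..1}\<close> by (simp add: add_increasing2)
        next
          case False
          then show ?thesis using H2[of t] \<open>t \<in> {0<..1}\<close> by simp
        qed
        finally show ?thesis .
      qed simp
    qed
    also have "\<dots> = ennreal C * IF * ennreal t0 + ennreal (C * R * \<alpha> powr \<theta>) * IF"
      using t0 by (simp add: nn_integral_add nn_integral_cmult)
    also have "\<dots> = (ennreal (C * t0) + ennreal (C * R * \<alpha> powr \<theta>)) * IF"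
    proof -
      have "ennreal (C * t0) = ennreal C * ennreal t0" using C t0 by (simp add: ennreal_mult)
      then show ?thesis by (simp only: distrib_right) (simp only: mult_ac)
    qed
    also have "\<dots> \<le> ennreal (2 * C * R * \<alpha> powr \<theta>) * IF"
    proof (intro mult_right_mono)
      have "C * t0 * 1 \<le> C * t0 * R" using C t0 R by (intro mult_left_mono) auto
      then have le: "C * t0 + C * R * \<alpha> powr \<theta> \<le> 2 * C * R * \<alpha> powr \<theta>" by (simp add: t0_def mult_ac)
      have "ennreal (C * t0) + ennreal (C * R * \<alpha> powr \<theta>) = ennreal (C * t0 + C * R * \<alpha> powr \<theta>)"
        using C t0 R by (intro ennreal_plus[symmetric]) auto
      also have "\<dots> \<le> ennreal (2 * C * R * \<alpha> powr \<theta>)" by (rule ennreal_leI[OF le])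
      finally show "ennreal (C * t0) + ennreal (C * R * \<alpha> powr \<theta>) \<le> ennreal (2 * C * R * \<alpha> powr \<theta>)" .
    qed simp
    finally show ?thesis .
  qed
  have "(\<integral>\<^sup>+x. indicator A x * (ennreal_powr (W x) p * ennreal (a x)) \<partial>lborel)
    \<le> (\<integral>\<^sup>+x. ennreal (2 powr p) * (indicator A x * (ennreal (a x) * ennreal_powr (E W x s) p) + ennreal (s powr p) * (indicator A x * (ennreal (a x) * J x))) \<partial>lborel)"
    by (rule nn_integral_mono_AE[OF pw])
  also have "\<dots> = ennreal (2 powr p) * ((\<integral>\<^sup>+x. indicator A x * (ennreal (a x) * ennreal_powr (E W x s) p) \<partial>lborel)
      + ennreal (s powr p) * (\<integral>\<^sup>+x. indicator A x * (ennreal (a x) * J x) \<partial>lborel))"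
    by (simp add: nn_integral_cmult nn_integral_add)
  also have "\<dots> \<le> ennreal (2 powr p) * (ennreal (2 * C * R * \<alpha> powr \<theta>) * IW + ennreal (s powr p) * (ennreal (2 * C * R * \<alpha> powr \<theta>) * IF))"
  proof (intro mult_left_mono add_mono T2)
    have "ennreal (C * R * \<alpha> powr \<theta>) * IW \<le> ennreal (2 * C * R * \<alpha> powr \<theta>) * IW"
      using C R by (intro mult_right_mono ennreal_leI) (auto simp: mult.assoc)
    with T1 show "(\<integral>\<^sup>+x. indicator A x * (ennreal (a x) * ennreal_powr (E W x s) p) \<partial>lborel) \<le> ennreal (2 * C * R * \<alpha> powr \<theta>) * IW"
      by (rule order_trans)
  qed auto
  also have "\<dots> = ennreal (2 powr p * (2 * C) * R * \<alpha> powr \<theta>) * (IW + ennreal (s powr p) * IF)"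
    using C R by (simp add: ennreal_mult distrib_left mult_ac)
  finally show ?thesis
    by (simp add: Sobolev_const_def C_def R_def N_def \<alpha>_def M0_def \<theta>_def IW_def IF_def)
qed

end

section \<open>De Giorgi iteration\<close>

text \<open>The bound Y j \<le> L c^j reproduces itself if L^\<open>\<delta>\<close> = c/C and
  c^\<open>\<delta>\<close> = 1/B. Solving for \<open>c\<close> and \<open>L\<close> gives c =
  B^(-1/\<open>\<delta>\<close>), and the start condition says exactly that Y 0 \<le> L.\<close>

lemma fast_geometric_convergence:
  fixes Y :: "nat \<Rightarrow> real"
  assumes C: "0 < C" and B: "1 < B" and \<delta>: "0 < \<delta>" and Y0: "\<And>j. 0 \<le> Y j"
    and step: "\<And>j. Y (Suc j) \<le> C * B ^ j * Y j powr (1 + \<delta>)"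
    and start: "Y 0 \<le> C powr (- 1 / \<delta>) * B powr (- 1 / \<delta>\<^sup>2)"
  shows "Y \<longlonglongrightarrow> 0"
proof -
  define L where "L = C powr (- 1 / \<delta>) * B powr (- 1 / \<delta>\<^sup>2)"
  define c where "c = B powr (- 1 / \<delta>)"
  have L: "0 < L" using C B by (simp add: L_def)
  have c: "0 < c" "c < 1" using B \<delta> by (auto simp: c_def powr_less_one)
  have L\<delta>: "L powr \<delta> = c / C"
  proof -
    have "L powr \<delta> = C powr (- 1 / \<delta> * \<delta>) * B powr (- 1 / \<delta>\<^sup>2 * \<delta>)"
      unfolding L_def using C B by (simp add: powr_mult powr_powr)
    also have "- 1 / \<delta> * \<delta> = - 1" using \<delta> by simp
    also have "- 1 / \<delta>\<^sup>2 * \<delta> = - 1 / \<delta>" using \<delta> by (simp add: power2_eq_square)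
    also have "C powr (- 1) = 1 / C" using C by (simp add: powr_minus_divide)
    finally show ?thesis by (simp add: c_def)
  qed
  have c\<delta>: "c powr \<delta> = 1 / B"
  proof -
    have "c powr \<delta> = B powr (- 1)" unfolding c_def powr_powr using \<delta> by simp
    then show ?thesis using B by (simp add: powr_minus_divide)
  qed
  have "Y j \<le> L * c ^ j" for j
  proof (induction j)
    case 0
    then show ?case using start by (simp add: L_def)
  next
    case (Suc j)
    have "Y (Suc j) \<le> C * B ^ j * Y j powr (1 + \<delta>)" by (rule step)
    also have "\<dots> \<le> C * B ^ j * (L * c ^ j) powr (1 + \<delta>)"
      using C B Suc Y0[of j] \<delta> by (intro mult_left_mono powr_mono2) auto
    also have "(L * c ^ j) powr (1 + \<delta>) = (L * c ^ j) * (L powr \<delta> * (c powr \<delta>) ^ j)"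
      using L c by (simp add: powr_add powr_mult powr_realpow[symmetric] powr_powr mult.commute)
    also have "C * B ^ j * ((L * c ^ j) * (L powr \<delta> * (c powr \<delta>) ^ j)) = L * c ^ Suc j * (B ^ j * (1 / B) ^ j)"
      using C unfolding L\<delta> c\<delta> by (simp add: field_simps)
    also have "B ^ j * (1 / B) ^ j = 1" using B by (simp flip: power_mult_distrib)
    finally show ?case by simp
  qed
  moreover have "(\<lambda>j. L * c ^ j) \<longlonglongrightarrow> 0"
    using c by (intro tendsto_mult_right_zero LIMSEQ_power_zero) auto
  ultimately show ?thesis
    using Y0 by (intro tendsto_sandwich[where f="\<lambda>_. 0" and h="\<lambda>j. L * c ^ j" and g=Y]) auto
qed

text \<open>The product of both exponents is the power of relative volume gained by one phase; the
  minimum serves all phases, and \<open>Q\<close> enters because the volume of a level set is known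
  only through a root of order at most \<open>Q\<close>.\<close>

definition DG_exp :: "nat \<Rightarrow> nat \<Rightarrow> (nat \<Rightarrow> real) \<Rightarrow> (nat \<Rightarrow> real) \<Rightarrow> nat \<Rightarrow> real" where
  "DG_exp n N q K Q = Min ((\<lambda>i. Ainf_exp n (q i) (K i) * Sobolev_exp n (q i)) ` {..N}) / Q"

text \<open>The growth of one iteration step in j: with r/s = 4 * 2^j, the first factor stems from
  (r/s)^(n Q + Q), the second from the level gap M/2^(j+1) in Chebyshev's inequality.\<close>

definition DG_base :: "nat \<Rightarrow> nat \<Rightarrow> (nat \<Rightarrow> real) \<Rightarrow> (nat \<Rightarrow> real) \<Rightarrow> nat \<Rightarrow> real" where
  "DG_base n N q K Q = 2 ^ (n * Q + Q) * (2 ^ Q) powr DG_exp n N q K Q"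

definition DG_const :: "nat \<Rightarrow> nat \<Rightarrow> (nat \<Rightarrow> real) \<Rightarrow> (nat \<Rightarrow> real) \<Rightarrow> nat \<Rightarrow> real \<Rightarrow> real" where
  "DG_const n N q K Q CC =
     (\<Sum>i\<le>N. Sobolev_const n (q i) (K i) * Ainf_const n (q i) (K i) powr Sobolev_exp n (q i))
     * (1 + CC) * 4 ^ (n * Q + Q) * ((\<Sum>i\<le>N. K i) * (N + 1) * 2 ^ Q) powr DG_exp n N q K Q"

definition DG_threshold :: "nat \<Rightarrow> nat \<Rightarrow> (nat \<Rightarrow> real) \<Rightarrow> (nat \<Rightarrow> real) \<Rightarrow> nat \<Rightarrow> real \<Rightarrow> real" where
  "DG_threshold n N q K Q CC =
     DG_const n N q K Q CC powr (- 1 / DG_exp n N q K Q) * DG_base n N q K Q powr (- 1 / (DG_exp n N q K Q)\<^sup>2)"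

text \<open>All that the iteration knows of a minimizer: \<open>u\<close> stands for the function
  minus a constant, up to sign, \<open>g\<close> for the length of its gradient. Phase 0 has weight
  1, which makes \<open>b\<close> a family containing Lebesgue measure.\<close>

locale De_Giorgi =
  fixes N Q :: nat and q K :: "nat \<Rightarrow> real" and CC :: real and b :: "nat \<Rightarrow> real^'n \<Rightarrow> real"
    and u g :: "real^'n \<Rightarrow> real" and x0 :: "real^'n" and r :: real
  assumes q: "\<And>i. i \<le> N \<Longrightarrow> 1 < q i" "\<And>i. i \<le> N \<Longrightarrow> q i \<le> Q"
    and K: "\<And>i. i \<le> N \<Longrightarrow> 1 \<le> K i" and CC: "0 \<le> CC"
    and b: "\<And>i. i \<le> N \<Longrightarrow> Ap_weight (q i) (K i) (b i)" and b0: "b 0 = (\<lambda>_. 1)"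
    and u_meas [measurable]: "u \<in> borel_measurable borel" and g_meas [measurable]: "g \<in> borel_measurable borel"
    and g0: "\<And>x. 0 \<le> g x" and r: "0 < r"
    and Caccioppoli: "\<And>k \<rho> R. 0 \<le> k \<Longrightarrow> r \<le> \<rho> \<Longrightarrow> \<rho> < R \<Longrightarrow> R \<le> 2 * r \<Longrightarrow>
      (\<Sum>i\<le>N. \<integral>\<^sup>+x. indicator (ball x0 \<rho>) x * (indicator {x. k < u x} x * (ennreal (g x powr q i) * ennreal (b i x))) \<partial>lborel)
      \<le> ennreal CC * (\<Sum>i\<le>N. \<integral>\<^sup>+x. indicator (ball x0 R) x * (ennreal ((max 0 (u x - k) / (R - \<rho>)) powr q i) * ennreal (b i x)) \<partial>lborel)"
    and pointwise: "\<And>k R s. 0 \<le> k \<Longrightarrow> 0 < s \<Longrightarrow> R + s \<le> 2 * r \<Longrightarrow>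
      AE x in lborel. x \<in> ball x0 R \<longrightarrow> ennreal (max 0 (u x - k)) * emeasure lborel (ball (0::real^'n) s) \<le>
       (\<integral>\<^sup>+y. indicator (ball x s) y * ennreal (max 0 (u y - k)) \<partial>lborel) +
       (\<integral>\<^sup>+t. indicator {0<..1} t * (ennreal (s / t ^ CARD('n)) * (\<integral>\<^sup>+y. indicator (ball x (t * s)) y * (indicator {x. k < u x} y * ennreal (g y)) \<partial>lborel)) \<partial>lborel)"
begin

definition En :: "real \<Rightarrow> real \<Rightarrow> ennreal" where
  "En \<rho> k = (\<Sum>i\<le>N. \<integral>\<^sup>+x. indicator (ball x0 \<rho>) x * (ennreal ((max 0 (u x - k) / r) powr q i) * ennreal (b i x)) \<partial>lborel)"

text \<open>The integral over the doubled ball of the sum of the b_i (t/r)^(q_i). The ratio of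
  \<open>En\<close> to \<open>mass M\<close> is the dimensionless quantity that is iterated.\<close>

definition mass :: "real \<Rightarrow> real" where
  "mass t = (\<Sum>i\<le>N. measure (wm (b i)) (ball x0 (2 * r)) * (t / r) powr q i)"

lemma b_meas [measurable]: "i \<le> N \<Longrightarrow> b i \<in> borel_measurable borel"
  using b by (auto simp: Ap_weight_def)

lemma Q_ge_1: "1 < real Q"
  using q[of 0] by simp

lemma powr_over_r:
  assumes "0 \<le> v" "i \<le> N" shows "v powr q i = r powr q i * (v / r) powr q i"
  using assms r by (simp add: powr_divide)

lemma En_mono:
  assumes "\<rho> \<le> \<rho>'" "k' \<le> k" shows "En \<rho> k \<le> En \<rho>' k'"
  unfolding En_def
proof (intro sum_mono nn_integral_mono)
  fix i x assume i: "i \<in> {..N}"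
  show "indicator (ball x0 \<rho>) x * (ennreal ((max 0 (u x - k) / r) powr q i) * ennreal (b i x))
    \<le> indicator (ball x0 \<rho>') x * (ennreal ((max 0 (u x - k') / r) powr q i) * ennreal (b i x))"
    using assms r q[of i] i
    by (intro mult_mono ennreal_leI powr_mono2 divide_right_mono) (auto simp: indicator_def)
qed

lemma DG_exp_pos: "0 < DG_exp CARD('n) N q K Q"
proof -
  have "0 < Ainf_exp CARD('n) (q i) (K i) * Sobolev_exp CARD('n) (q i)" if "i \<le> N" for i
  proof -
    have "0 < real CARD('n) * q i + 1" using q(1)[OF that] by (simp add: add_pos_pos)
    then show ?thesis using Ainf_exp_pos[OF K[OF that], of "CARD('n)" "q i"] by (simp add: Sobolev_exp_def)
  qed
  then have "0 < Min ((\<lambda>i. Ainf_exp CARD('n) (q i) (K i) * Sobolev_exp CARD('n) (q i)) ` {..N})"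
    by (subst Min_gr_iff) auto
  then show ?thesis using Q_ge_1 by (simp add: DG_exp_def)
qed

text \<open>Chebyshev is applied to the dominating phase \<open>i\<close> only; the \<open>A\<^sub>\<infinity>\<close> property transfers the
  smallness of the level set to the other weights.\<close>

lemma level_set_volume:
  assumes M: "0 < M" "0 < mass M" and d: "0 < d" and \<rho>: "\<rho> \<le> 2 * r" and fin: "En \<rho> k = ennreal e" "0 \<le> e"
    and A: "A \<in> sets borel" "A \<subseteq> ball x0 \<rho>" "\<And>x. x \<in> A \<Longrightarrow> M / d \<le> u x - k" and d1: "1 \<le> d"
  shows "measure lborel A / measure lborel (ball x0 (2 * r)) \<le> ((\<Sum>i\<le>N. K i) * (N + 1) * d ^ Q * (e / mass M)) powr (1 / Q)"
proof -
  define X where "X = measure lborel A / measure lborel (ball x0 (2 * r))"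
  define Z where "Z = (\<Sum>i\<le>N. K i) * (N + 1) * d ^ Q * (e / mass M)"
  have A2: "A \<subseteq> ball x0 (2 * r)" using A(2) \<rho> subset_ball[OF \<rho>] by blast
  have V: "0 < measure lborel (ball x0 (2 * r))" using r by (intro measure_ball_pos) auto
  have X0: "0 \<le> X" by (simp add: X_def)
  have X1: "X \<le> 1"
  proof -
    have "measure lborel A \<le> measure lborel (ball x0 (2 * r))"
      using A(1) A2 emeasure_bounded_finite[of "ball x0 (2 * r)"] by (intro measure_mono_fmeasurable fmeasurableI) auto
    then show ?thesis using V by (simp add: X_def)
  qed
  \<comment> \<open>By pigeonhole some phase carries at least the fraction 1/(N+1) of the
    mass.\<close>
  have "\<exists>i\<le>N. mass M / (N + 1) \<le> measure (wm (b i)) (ball x0 (2 * r)) * (M / r) powr q i"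
  proof (rule ccontr)
    assume neg: "\<not> ?thesis"
    have "measure (wm (b i)) (ball x0 (2 * r)) * (M / r) powr q i < mass M / (N + 1)" if "i \<le> N" for i
      using neg that not_le by blast
    then have "(\<Sum>i\<le>N. measure (wm (b i)) (ball x0 (2 * r)) * (M / r) powr q i) < (\<Sum>i\<le>N. mass M / (N + 1))"
      by (intro sum_strict_mono) auto
    then show False by (simp add: mass_def[symmetric])
  qed
  then obtain i where i: "i \<le> N" and dom: "mass M / (N + 1) \<le> measure (wm (b i)) (ball x0 (2 * r)) * (M / r) powr q i" by blast
  note w = q(1)[OF i] b[OF i] K[OF i]
  note [measurable] = b_meas[OF i]
  have [measurable]: "A \<in> sets borel" by fact
  define \<beta> where "\<beta> = measure (wm (b i)) (ball x0 (2 * r))"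
  have sub: "X powr q i * \<beta> \<le> K i * measure (wm (b i)) A"
    using Ap_weight_subset[OF w _ A(1) A2] r by (simp add: X_def \<beta>_def)
  have Ki: "K i \<le> (\<Sum>i\<le>N. K i)" using i K by (intro member_le_sum) (auto intro: order_trans[of 0 1])
  have "ennreal (measure (wm (b i)) A * (M / d / r) powr q i) = (\<integral>\<^sup>+x. ennreal ((M / d / r) powr q i) * (ennreal (b i x) * indicator A x) \<partial>lborel)"
  proof -
    have "(\<integral>\<^sup>+x. ennreal (b i x) * indicator A x \<partial>lborel) = ennreal (measure (wm (b i)) A)"
      using measure_wm_eq[OF w, of A] bounded_subset[OF bounded_ball A2] by (simp add: emeasure_density[symmetric])
    then show ?thesis by (subst nn_integral_cmult) (auto simp: ennreal_mult mult.commute)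
  qed
  also have "\<dots> \<le> (\<integral>\<^sup>+x. indicator (ball x0 \<rho>) x * (ennreal ((max 0 (u x - k) / r) powr q i) * ennreal (b i x)) \<partial>lborel)"
  proof (rule nn_integral_mono)
    fix x
    show "ennreal ((M / d / r) powr q i) * (ennreal (b i x) * indicator A x) \<le> indicator (ball x0 \<rho>) x * (ennreal ((max 0 (u x - k) / r) powr q i) * ennreal (b i x))"
    proof (cases "x \<in> A")
      case True
      have "(M / d / r) powr q i \<le> (max 0 (u x - k) / r) powr q i"
        using A(3)[OF True] M d r w(1) by (intro powr_mono2 divide_right_mono) auto
      then show ?thesis using True A(2) by (auto simp: subset_iff intro!: mult_right_mono ennreal_leI)
    qed simp
  qed
  also have "\<dots> \<le> En \<rho> k" unfolding En_def using i by (intro member_le_sum) auto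
  finally have cheb: "measure (wm (b i)) A * (M / d / r) powr q i \<le> e" using fin by simp
  have "X powr q i * mass M \<le> X powr q i * ((N + 1) * (\<beta> * (M / r) powr q i))"
    using dom by (intro mult_left_mono) (auto simp: \<beta>_def field_simps)
  also have "\<dots> = (X powr q i * \<beta>) * ((N + 1) * (M / r) powr q i)" by simp
  also have "\<dots> \<le> (K i * measure (wm (b i)) A) * ((N + 1) * (M / r) powr q i)"
    using sub by (intro mult_right_mono) auto
  also have "\<dots> = K i * (N + 1) * d powr q i * (measure (wm (b i)) A * (M / d / r) powr q i)"
    using M d r by (simp add: powr_divide powr_mult)
  also have "\<dots> \<le> K i * (N + 1) * d powr q i * e"
    using cheb w d by (intro mult_left_mono) auto
  also have "\<dots> \<le> (\<Sum>i\<le>N. K i) * (N + 1) * d powr Q * e"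
    using Ki w d1 q(2)[OF i] fin(2) by (intro mult_right_mono mult_mono powr_mono) auto
  finally have "X powr q i \<le> Z" using M(2) d by (simp add: Z_def field_simps powr_realpow)
  then have "(X powr q i) powr (1 / q i) \<le> Z powr (1 / q i)" using w(1) by (intro powr_mono2) auto
  then have XZ: "X \<le> Z powr (1 / q i)" using X0 w(1) by (simp add: powr_powr)
  have Z0: "0 \<le> Z" using \<open>X powr q i \<le> Z\<close> powr_ge_zero[of X "q i"] by linarith
  show ?thesis unfolding X_def[symmetric] Z_def[symmetric]
  \<comment> \<open>Only q i \<le> Q is known about the dominating phase. For Z \<le> 1 the smaller
    exponent 1/Q gives the weaker bound; for Z > 1 the trivial bound X \<le> 1 suffices.\<close>
  proof (cases "Z \<le> 1")
    case True
    have "Z powr (1 / q i) \<le> Z powr (1 / Q)"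
      using True Z0 w(1) q(2)[OF i] by (intro powr_mono') (auto simp: frac_le)
    with XZ show "X \<le> Z powr (1 / Q)" by simp
  next
    case False
    then have "1 \<le> Z powr (1 / Q)" by (intro ge_one_powr_ge_zero) auto
    with X1 show "X \<le> Z powr (1 / Q)" by simp
  qed
qed

text \<open>In each phase the Sobolev inequality on the level set gains a power of its relative
  weight, and Caccioppoli bounds the gradient term by the previous energy.
  \<open>level_set_volume\<close> turns the gain into a power of the normalized energy, so the total
  exponent exceeds 1.\<close>

lemma DG_step:
  assumes M: "0 < M" "0 < mass M" and fin: "En (r * (1 + 1 / 2 ^ j)) (M * (1 - 1 / 2 ^ j)) = ennreal e" "0 \<le> e"
  shows "En (r * (1 + 1 / 2 ^ Suc j)) (M * (1 - 1 / 2 ^ Suc j)) \<le>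
    ennreal (mass M * (DG_const CARD('n) N q K Q CC * DG_base CARD('n) N q K Q ^ j * (e / mass M) powr (1 + DG_exp CARD('n) N q K Q)))"
proof -
  let ?n = "CARD('n)"
  define \<rho> where "\<rho> = r * (1 + 1 / 2 ^ j)"
  define \<rho>1 where "\<rho>1 = r * (1 + 1 / 2 ^ Suc j)"
  \<comment> \<open>A quarter of r/2^j, that is half of the gap between consecutive radii: one
    \<open>s\<close> is spent on the averages in \<open>pointwise\<close>, the other on
    Caccioppoli.\<close>
  define s where "s = r / (4 * 2 ^ j)"
  define k where "k = M * (1 - 1 / 2 ^ j)"
  define k1 where "k1 = M * (1 - 1 / 2 ^ Suc j)"
  have two: "(1::real) \<le> 2 ^ j" by simp
  then have "1 \<le> 4 * (2::real) ^ j" by linarith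
  then have s: "0 < s" "s \<le> r" using r by (auto simp: s_def divide_le_eq)
  have geo: "\<rho>1 + s + s = \<rho>" using r by (simp add: \<rho>_def \<rho>1_def s_def field_simps)
  have \<rho>2: "\<rho> \<le> 2 * r" using r two by (simp add: \<rho>_def field_simps)
  have \<rho>1r: "r \<le> \<rho>1" using r by (simp add: \<rho>1_def)
  have kk: "k1 - k = M / 2 ^ Suc j" by (simp add: k_def k1_def field_simps)
  have k0: "0 \<le> k" "0 \<le> k1" "k \<le> k1"
    using M kk two one_le_power[of "2::real" "Suc j"] by (auto simp: k_def k1_def field_simps simp del: power_Suc)
  have rs: "r / s = 4 * 2 ^ j" using r by (simp add: s_def)
  have rs1: "1 \<le> r / s" using s by simp
  define A where "A = ball x0 \<rho>1 \<inter> {x. k1 < u x}"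
  have A[measurable]: "A \<in> sets borel" unfolding A_def by measurable
  have A\<rho>: "A \<subseteq> ball x0 \<rho>" "A \<subseteq> ball x0 (2 * r)" "A \<subseteq> ball x0 \<rho>1"
    using geo s \<rho>2 by (auto simp: A_def)
  \<comment> \<open>Averages of radius at most \<open>s\<close> around points of \<open>A\<close> do
    not leave the ball of radius \<rho>1 + s, so the cutoff preserves the pointwise bound and makes
    the global integrals of the Sobolev inequality local.\<close>
  define W where "W = (\<lambda>x. indicator (ball x0 (\<rho>1 + s)) x * ennreal (max 0 (u x - k1)))"
  define F where "F = (\<lambda>x. indicator (ball x0 (\<rho>1 + s)) x * (indicator {x. k1 < u x} x * ennreal (g x)))"
  have WF[measurable]: "W \<in> borel_measurable borel" "F \<in> borel_measurable borel"
    unfolding W_def F_def by measurable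
  define \<delta> where "\<delta> = DG_exp ?n N q K Q"
  have \<delta>: "0 < \<delta>" unfolding \<delta>_def by (rule DG_exp_pos)
  define X where "X = measure lborel A / measure lborel (ball x0 (2 * r))"
  define Z where "Z = (\<Sum>i\<le>N. K i) * (N + 1) * (2 ^ Suc j) ^ Q * (e / mass M)"
  have V: "0 < measure lborel (ball x0 (2 * r))" using r by (intro measure_ball_pos) auto
  have X0: "0 \<le> X" by (simp add: X_def)
  have X1: "X \<le> 1"
  proof -
    have "measure lborel A \<le> measure lborel (ball x0 (2 * r))"
      using A A\<rho> emeasure_bounded_finite[of "ball x0 (2 * r)"] by (intro measure_mono_fmeasurable fmeasurableI) auto
    then show ?thesis using V by (simp add: X_def)
  qed
  have SK: "0 \<le> (\<Sum>i\<le>N. K i)" using K by (intro sum_nonneg) (auto intro: order_trans[of 0 1])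
  have Z0: "0 \<le> Z" unfolding Z_def using SK fin(2) M(2) by (intro mult_nonneg_nonneg) auto
  have XZ: "X \<le> Z powr (1 / Q)"
    unfolding X_def Z_def
  proof (rule level_set_volume[OF M _ \<rho>2 _ fin(2) A A\<rho>(1)])
    show "En \<rho> k = ennreal e" using fin(1) by (simp add: \<rho>_def k_def)
    show "M / 2 ^ Suc j \<le> u x - k" if "x \<in> A" for x using that kk by (auto simp: A_def)
    show "1 \<le> (2::real) ^ Suc j" by (rule one_le_power) simp
  qed simp
  have pt: "AE x in lborel. x \<in> A \<longrightarrow> W x * emeasure lborel (ball (0::real^'n) s) \<le>
     (\<integral>\<^sup>+y. indicator (ball x s) y * W y \<partial>lborel) +
     (\<integral>\<^sup>+t. indicator {0<..1} t * (ennreal (s / t ^ CARD('n)) * (\<integral>\<^sup>+y. indicator (ball x (t * s)) y * F y \<partial>lborel)) \<partial>lborel)"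
  proof -
    have "\<rho>1 + s \<le> 2 * r" using geo s \<rho>2 by linarith
    from pointwise[OF k0(2) s(1) this] show ?thesis
    proof eventually_elim
      case (elim x)
      show ?case
      proof
        assume x: "x \<in> A"
        have sub: "ball x (t * s) \<subseteq> ball x0 (\<rho>1 + s)" if "t \<le> 1" for t
        proof
          fix y assume "y \<in> ball x (t * s)"
          moreover have "t * s \<le> s" using that s by simp
          moreover have "dist x0 x < \<rho>1" using x A\<rho>(3) by auto
          ultimately show "y \<in> ball x0 (\<rho>1 + s)" using dist_triangle[of x0 y x] by auto
        qed
        have x1: "x \<in> ball x0 \<rho>1" "x \<in> ball x0 (\<rho>1 + s)" using x A\<rho>(3) s by auto
        have 1: "(\<integral>\<^sup>+y. indicator (ball x s) y * ennreal (max 0 (u y - k1)) \<partial>lborel) = (\<integral>\<^sup>+y. indicator (ball x s) y * W y \<partial>lborel)"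
          using sub[of 1] by (intro nn_integral_cong) (auto simp: W_def indicator_def)
        have 2: "(\<integral>\<^sup>+t. indicator {0<..1} t * (ennreal (s / t ^ ?n) * (\<integral>\<^sup>+y. indicator (ball x (t * s)) y * (indicator {x. k1 < u x} y * ennreal (g y)) \<partial>lborel)) \<partial>lborel)
           = (\<integral>\<^sup>+t. indicator {0<..1} t * (ennreal (s / t ^ ?n) * (\<integral>\<^sup>+y. indicator (ball x (t * s)) y * F y \<partial>lborel)) \<partial>lborel)"
        proof (rule nn_integral_cong)
          fix t :: real
          show "indicator {0<..1} t * (ennreal (s / t ^ ?n) * (\<integral>\<^sup>+y. indicator (ball x (t * s)) y * (indicator {x. k1 < u x} y * ennreal (g y)) \<partial>lborel))
            = indicator {0<..1} t * (ennreal (s / t ^ ?n) * (\<integral>\<^sup>+y. indicator (ball x (t * s)) y * F y \<partial>lborel))"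
          proof (cases "t \<in> {0<..1}")
            case True
            then have "(\<integral>\<^sup>+y. indicator (ball x (t * s)) y * (indicator {x. k1 < u x} y * ennreal (g y)) \<partial>lborel) = (\<integral>\<^sup>+y. indicator (ball x (t * s)) y * F y \<partial>lborel)"
              using sub[of t] by (intro nn_integral_cong) (auto simp: F_def indicator_def)
            then show ?thesis by simp
          qed simp
        qed
        have "W x = ennreal (max 0 (u x - k1))" using x1 by (simp add: W_def)
        then show "W x * emeasure lborel (ball (0::real^'n) s) \<le> (\<integral>\<^sup>+y. indicator (ball x s) y * W y \<partial>lborel) +
          (\<integral>\<^sup>+t. indicator {0<..1} t * (ennreal (s / t ^ CARD('n)) * (\<integral>\<^sup>+y. indicator (ball x (t * s)) y * F y \<partial>lborel)) \<partial>lborel)"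
          using elim x1(1) unfolding 1 2 by simp
      qed
    qed
  qed
  define IW where "IW = (\<lambda>i. \<integral>\<^sup>+y. ennreal_powr (W y) (q i) * ennreal (b i y) \<partial>lborel)"
  define IF where "IF = (\<lambda>i. \<integral>\<^sup>+y. ennreal_powr (F y) (q i) * ennreal (b i y) \<partial>lborel)"
  have IW_le: "IW i \<le> ennreal (r powr q i) * En \<rho> k" if i: "i \<le> N" for i
  proof -
    note [measurable] = b_meas[OF i]
    have "IW i \<le> (\<integral>\<^sup>+x. ennreal (r powr q i) * (indicator (ball x0 \<rho>) x * (ennreal ((max 0 (u x - k) / r) powr q i) * ennreal (b i x))) \<partial>lborel)"
      unfolding IW_def
    proof (rule nn_integral_mono)
      fix x
      show "ennreal_powr (W x) (q i) * ennreal (b i x) \<le> ennreal (r powr q i) * (indicator (ball x0 \<rho>) x * (ennreal ((max 0 (u x - k) / r) powr q i) * ennreal (b i x)))"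
      proof (cases "x \<in> ball x0 (\<rho>1 + s)")
        case True
        then have x: "x \<in> ball x0 \<rho>" using geo s by auto
        have "max 0 (u x - k1) powr q i \<le> max 0 (u x - k) powr q i"
          using k0 q(1)[OF i] by (intro powr_mono2) auto
        also have "\<dots> = r powr q i * (max 0 (u x - k) / r) powr q i" by (rule powr_over_r[OF _ i]) simp
        finally have "ennreal (max 0 (u x - k1) powr q i) * ennreal (b i x) \<le> ennreal (r powr q i * (max 0 (u x - k) / r) powr q i) * ennreal (b i x)"
          by (intro mult_right_mono ennreal_leI) auto
        then show ?thesis using True x by (simp add: W_def ennreal_mult mult.assoc del: mem_ball)
      qed (simp add: W_def)
    qed
    also have "\<dots> = ennreal (r powr q i) * (\<integral>\<^sup>+x. indicator (ball x0 \<rho>) x * (ennreal ((max 0 (u x - k) / r) powr q i) * ennreal (b i x)) \<partial>lborel)"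
      by (rule nn_integral_cmult) measurable
    also have "\<dots> \<le> ennreal (r powr q i) * En \<rho> k"
      unfolding En_def using i by (intro mult_left_mono member_le_sum) auto
    finally show ?thesis .
  qed
  \<comment> \<open>Caccioppoli across the outer gap, at the new level: (u - k1)_+ is at most (u -
    k)_+, and division by s instead of r costs at most (r/s)^Q in each phase.\<close>
  have IF_le: "IF i \<le> ennreal (CC * (r / s) ^ Q) * En \<rho> k" if i: "i \<le> N" for i
  proof -
    have "IF i \<le> (\<Sum>i\<le>N. IF i)" using i by (intro member_le_sum) auto
    also have "\<dots> = (\<Sum>i\<le>N. \<integral>\<^sup>+x. indicator (ball x0 (\<rho>1 + s)) x * (indicator {x. k1 < u x} x * (ennreal (g x powr q i) * ennreal (b i x))) \<partial>lborel)"
      unfolding IF_def F_def using g0 by (intro sum.cong nn_integral_cong) (auto simp: indicator_def)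
    also have "\<dots> \<le> ennreal CC * (\<Sum>i\<le>N. \<integral>\<^sup>+x. indicator (ball x0 \<rho>) x * (ennreal ((max 0 (u x - k1) / (\<rho> - (\<rho>1 + s))) powr q i) * ennreal (b i x)) \<partial>lborel)"
      using geo s \<rho>1r \<rho>2 k0 by (intro Caccioppoli) auto
    also have "\<rho> - (\<rho>1 + s) = s" using geo by simp
    also have "(\<Sum>i\<le>N. \<integral>\<^sup>+x. indicator (ball x0 \<rho>) x * (ennreal ((max 0 (u x - k1) / s) powr q i) * ennreal (b i x)) \<partial>lborel)
      \<le> (\<Sum>i\<le>N. ennreal ((r / s) ^ Q) * (\<integral>\<^sup>+x. indicator (ball x0 \<rho>) x * (ennreal ((max 0 (u x - k) / r) powr q i) * ennreal (b i x)) \<partial>lborel))"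
    proof (intro sum_mono)
      fix i assume "i \<in> {..N}"
      then have i: "i \<le> N" by simp
      note [measurable] = b_meas[OF i]
      have "(\<integral>\<^sup>+x. indicator (ball x0 \<rho>) x * (ennreal ((max 0 (u x - k1) / s) powr q i) * ennreal (b i x)) \<partial>lborel)
        \<le> (\<integral>\<^sup>+x. ennreal ((r / s) ^ Q) * (indicator (ball x0 \<rho>) x * (ennreal ((max 0 (u x - k) / r) powr q i) * ennreal (b i x))) \<partial>lborel)"
      proof (rule nn_integral_mono)
        fix x
        have "(max 0 (u x - k1) / s) powr q i = ((r / s) * (max 0 (u x - k1) / r)) powr q i" using r s by simp
        also have "\<dots> = (r / s) powr q i * (max 0 (u x - k1) / r) powr q i" using r s by (subst powr_mult) auto
        also have "\<dots> \<le> (r / s) powr Q * (max 0 (u x - k) / r) powr q i"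
          using k0 q[OF i] rs1 r s by (intro mult_mono powr_mono powr_mono2 divide_right_mono) auto
        also have "(r / s) powr Q = (r / s) ^ Q" using r s by (simp add: powr_realpow)
        finally have "ennreal ((max 0 (u x - k1) / s) powr q i) \<le> ennreal ((r / s) ^ Q * (max 0 (u x - k) / r) powr q i)"
          by (rule ennreal_leI)
        then show "indicator (ball x0 \<rho>) x * (ennreal ((max 0 (u x - k1) / s) powr q i) * ennreal (b i x))
          \<le> ennreal ((r / s) ^ Q) * (indicator (ball x0 \<rho>) x * (ennreal ((max 0 (u x - k) / r) powr q i) * ennreal (b i x)))"
          using r s by (auto simp: indicator_def ennreal_mult mult.assoc[symmetric] intro!: mult_right_mono)
      qed
      also have "\<dots> = ennreal ((r / s) ^ Q) * (\<integral>\<^sup>+x. indicator (ball x0 \<rho>) x * (ennreal ((max 0 (u x - k) / r) powr q i) * ennreal (b i x)) \<partial>lborel)"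
        by (rule nn_integral_cmult) measurable
      finally show "(\<integral>\<^sup>+x. indicator (ball x0 \<rho>) x * (ennreal ((max 0 (u x - k1) / s) powr q i) * ennreal (b i x)) \<partial>lborel)
        \<le> ennreal ((r / s) ^ Q) * (\<integral>\<^sup>+x. indicator (ball x0 \<rho>) x * (ennreal ((max 0 (u x - k) / r) powr q i) * ennreal (b i x)) \<partial>lborel)" .
    qed
    also have "\<dots> = ennreal ((r / s) ^ Q) * En \<rho> k" by (simp add: En_def sum_distrib_left)
    finally show ?thesis using CC r s by (simp add: ennreal_mult mult.assoc mult_left_mono)
  qed
  define \<Gamma> where "\<Gamma> = (\<lambda>i. Sobolev_const ?n (q i) (K i) * Ainf_const ?n (q i) (K i) powr Sobolev_exp ?n (q i))"
  have \<Gamma>0: "0 \<le> \<Gamma> i" if "i \<le> N" for i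
    using K[OF that] by (auto simp: \<Gamma>_def Sobolev_const_def)
  have summand: "(\<integral>\<^sup>+x. indicator (ball x0 \<rho>1) x * (ennreal ((max 0 (u x - k1) / r) powr q i) * ennreal (b i x)) \<partial>lborel)
      \<le> ennreal (\<Gamma> i * ((1 + CC) * (r / s) ^ (?n * Q + Q) * Z powr \<delta>) * e)" if i: "i \<le> N" for i
  proof -
    note [measurable] = b_meas[OF i]
    note w = q(1)[OF i] b[OF i] K[OF i]
    define \<theta> where "\<theta> = Sobolev_exp ?n (q i)"
    define \<epsilon> where "\<epsilon> = Ainf_exp ?n (q i) (K i)"
    define CA where "CA = Ainf_const ?n (q i) (K i)"
    define S where "S = Sobolev_const ?n (q i) (K i)"
    have S: "0 \<le> S" by (simp add: S_def Sobolev_const_def)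
    have \<theta>: "0 < \<theta>" using w by (simp add: \<theta>_def Sobolev_exp_def add_pos_pos)
    have \<epsilon>: "0 < \<epsilon>" unfolding \<epsilon>_def by (rule Ainf_exp_pos[OF w(3)])
    have CA: "0 < CA" unfolding CA_def by (rule Ainf_const_pos[OF w(3)]) simp
    define \<alpha> where "\<alpha> = measure (wm (b i)) A / measure (wm (b i)) (ball x0 (2 * r))"
    have \<alpha>0: "0 \<le> \<alpha>" by (simp add: \<alpha>_def)
    \<comment> \<open>If the ball has zero weight, the quotient \<open>\<alpha>\<close> is 0 by the
      convention for division by 0.\<close>
    have \<alpha>_le: "\<alpha> \<le> CA * X powr \<epsilon>"
    proof -
      have "measure (wm (b i)) A \<le> CA * X powr \<epsilon> * measure (wm (b i)) (ball x0 (2 * r))"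
        unfolding CA_def X_def \<epsilon>_def using r by (intro Ap_weight_Ainf[OF w _ A A\<rho>(2)]) auto
      then show ?thesis
        using CA by (cases "measure (wm (b i)) (ball x0 (2 * r)) = 0")
          (auto simp: \<alpha>_def divide_le_eq less_le)
    qed
    have \<alpha>\<theta>: "\<alpha> powr \<theta> \<le> CA powr \<theta> * Z powr \<delta>"
    proof -
      have "\<alpha> powr \<theta> \<le> (CA * X powr \<epsilon>) powr \<theta>" using \<alpha>_le \<alpha>0 \<theta> by (intro powr_mono2) auto
      also have "\<dots> = CA powr \<theta> * X powr (\<epsilon> * \<theta>)" using CA by (simp add: powr_mult powr_powr)
      \<comment> \<open>Since X \<le> 1, replacing the exponent of this phase by the common minimum
        only enlarges the power.\<close>
      also have "X powr (\<epsilon> * \<theta>) \<le> X powr (\<delta> * Q)"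
      proof (rule powr_mono')
        have "\<delta> * Q = Min ((\<lambda>i. Ainf_exp ?n (q i) (K i) * Sobolev_exp ?n (q i)) ` {..N})"
          using Q_ge_1 by (simp add: \<delta>_def DG_exp_def)
        also have "\<dots> \<le> \<epsilon> * \<theta>" using i by (intro Min_le) (auto simp: \<epsilon>_def \<theta>_def)
        finally show "\<delta> * Q \<le> \<epsilon> * \<theta>" .
      qed (use X0 X1 in auto)
      also have "\<dots> \<le> (Z powr (1 / Q)) powr (\<delta> * Q)" using XZ X0 \<delta> by (intro powr_mono2) auto
      also have "\<dots> = Z powr \<delta>" using Q_ge_1 by (simp add: powr_powr)
      finally show ?thesis using CA by (simp add: mult_left_mono)
    qed
    have "(\<integral>\<^sup>+x. indicator (ball x0 \<rho>1) x * (ennreal ((max 0 (u x - k1) / r) powr q i) * ennreal (b i x)) \<partial>lborel)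
      = (\<integral>\<^sup>+x. ennreal ((1 / r) powr q i) * (indicator A x * (ennreal_powr (W x) (q i) * ennreal (b i x))) \<partial>lborel)"
    proof (rule nn_integral_cong)
      fix x
      show "indicator (ball x0 \<rho>1) x * (ennreal ((max 0 (u x - k1) / r) powr q i) * ennreal (b i x))
        = ennreal ((1 / r) powr q i) * (indicator A x * (ennreal_powr (W x) (q i) * ennreal (b i x)))"
      proof (cases "x \<in> A")
        case True
        then have x: "x \<in> ball x0 \<rho>1" "x \<in> ball x0 (\<rho>1 + s)" using A\<rho>(3) s by auto
        have "(max 0 (u x - k1) / r) powr q i = (1 / r) powr q i * max 0 (u x - k1) powr q i"
          using r by (simp add: powr_divide)
        then show ?thesis using True x by (simp add: W_def ennreal_mult mult.assoc del: mem_ball)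
      next
        case False
        then have "x \<notin> ball x0 \<rho>1 \<or> max 0 (u x - k1) = 0" by (auto simp: A_def)
        then show ?thesis using False by auto
      qed
    qed
    also have "\<dots> = ennreal ((1 / r) powr q i) * (\<integral>\<^sup>+x. indicator A x * (ennreal_powr (W x) (q i) * ennreal (b i x)) \<partial>lborel)"
      by (rule nn_integral_cmult) measurable
    also have "\<dots> \<le> ennreal ((1 / r) powr q i) * (ennreal (S * (r / s) powr (?n * q i) * \<alpha> powr \<theta>) * (IW i + ennreal (s powr q i) * IF i))"
      unfolding S_def \<alpha>_def \<theta>_def IW_def IF_def
      by (intro mult_left_mono Ap_weight_Sobolev[OF w WF A A\<rho>(2) s pt]) auto
    also have "\<dots> \<le> ennreal ((1 / r) powr q i) * (ennreal (S * (r / s) powr (?n * q i) * \<alpha> powr \<theta>) * (ennreal (r powr q i * ((1 + CC) * (r / s) ^ Q)) * En \<rho> k))"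
    proof (intro mult_left_mono)
      have "IW i + ennreal (s powr q i) * IF i \<le> ennreal (r powr q i) * En \<rho> k + ennreal (r powr q i) * (ennreal (CC * (r / s) ^ Q) * En \<rho> k)"
        using s w(1) by (intro add_mono mult_mono IW_le[OF i] IF_le[OF i] ennreal_leI powr_mono2) auto
      also have "\<dots> = ennreal (r powr q i * (1 + CC * (r / s) ^ Q)) * En \<rho> k"
      proof -
        have "ennreal (r powr q i * (1 + CC * (r / s) ^ Q)) = ennreal (r powr q i) + ennreal (r powr q i) * ennreal (CC * (r / s) ^ Q)"
          using CC r s by (simp add: distrib_left ennreal_mult ennreal_plus)
        then show ?thesis by (simp only: distrib_right mult.assoc)
      qed
      also have "\<dots> \<le> ennreal (r powr q i * ((1 + CC) * (r / s) ^ Q)) * En \<rho> k"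
        using one_le_power[OF rs1, of Q] by (intro mult_right_mono ennreal_leI mult_left_mono) (auto simp: distrib_right)
      finally show "IW i + ennreal (s powr q i) * IF i \<le> ennreal (r powr q i * ((1 + CC) * (r / s) ^ Q)) * En \<rho> k" .
    qed auto
    also have "\<dots> = ennreal ((1 / r) powr q i * (S * (r / s) powr (?n * q i) * \<alpha> powr \<theta>) * (r powr q i * ((1 + CC) * (r / s) ^ Q)) * e)"
    proof -
      have "En \<rho> k = ennreal e" using fin(1) by (simp add: \<rho>_def k_def)
      then show ?thesis using S CC rs1 fin(2) by (simp add: ennreal_mult mult.assoc)
    qed
    also have "(1 / r) powr q i * (S * (r / s) powr (?n * q i) * \<alpha> powr \<theta>) * (r powr q i * ((1 + CC) * (r / s) ^ Q))
      = S * (r / s) powr (?n * q i) * \<alpha> powr \<theta> * ((1 + CC) * (r / s) ^ Q)"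
      using r by (simp add: powr_divide)
    also have "ennreal (S * (r / s) powr (?n * q i) * \<alpha> powr \<theta> * ((1 + CC) * (r / s) ^ Q) * e)
      \<le> ennreal (S * (r / s) ^ (?n * Q) * (CA powr \<theta> * Z powr \<delta>) * ((1 + CC) * (r / s) ^ Q) * e)"
    proof -
      have "(r / s) powr (?n * q i) \<le> (r / s) powr (real (?n * Q))"
        using rs1 q(2)[OF i] by (intro powr_mono) auto
      also have "\<dots> = (r / s) ^ (?n * Q)" using r s by (subst powr_realpow) auto
      finally have 1: "(r / s) powr (?n * q i) \<le> (r / s) ^ (?n * Q)" .
      show ?thesis
        using S CC rs1 fin(2) r s by (intro ennreal_leI mult_right_mono mult_mono 1 \<alpha>\<theta>) auto
    qed
    finally show ?thesis
      by (simp add: \<Gamma>_def S_def CA_def \<theta>_def power_add mult_ac)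
  qed
  have "En \<rho>1 k1 \<le> (\<Sum>i\<le>N. ennreal (\<Gamma> i * ((1 + CC) * (r / s) ^ (?n * Q + Q) * Z powr \<delta>) * e))"
    unfolding En_def by (intro sum_mono summand) auto
  also have "\<dots> = ennreal (\<Sum>i\<le>N. \<Gamma> i * ((1 + CC) * (r / s) ^ (?n * Q + Q) * Z powr \<delta>) * e)"
    using \<Gamma>0 CC r s fin(2) by (intro sum_ennreal) auto
  also have "(\<Sum>i\<le>N. \<Gamma> i * ((1 + CC) * (r / s) ^ (?n * Q + Q) * Z powr \<delta>) * e) = (\<Sum>i\<le>N. \<Gamma> i) * ((1 + CC) * (r / s) ^ (?n * Q + Q) * Z powr \<delta>) * e"
    by (simp only: sum_distrib_right)
  also have "\<dots> = mass M * (DG_const ?n N q K Q CC * DG_base ?n N q K Q ^ j * (e / mass M) powr (1 + \<delta>))"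
  proof -
    have 1: "(r / s) ^ (?n * Q + Q) = 4 ^ (?n * Q + Q) * (2 ^ (?n * Q + Q)) ^ j"
      unfolding rs power_mult_distrib by (simp add: power_mult[symmetric] mult.commute)
    have "Z = ((\<Sum>i\<le>N. K i) * (N + 1) * 2 ^ Q) * (2 ^ Q) ^ j * (e / mass M)"
      by (simp add: Z_def power_mult_distrib power_mult[symmetric] mult_ac)
    then have 2: "Z powr \<delta> = ((\<Sum>i\<le>N. K i) * (N + 1) * 2 ^ Q) powr \<delta> * ((2 ^ Q) powr \<delta>) ^ j * (e / mass M) powr \<delta>"
    proof -
      have "(P * D ^ j * y) powr \<delta> = P powr \<delta> * (D powr \<delta>) ^ j * y powr \<delta>" if "0 \<le> P" "0 < D" "0 \<le> y" for P D y :: real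
      proof -
        have "(D ^ j) powr \<delta> = (D powr \<delta>) ^ j"
          using that by (simp add: powr_realpow[symmetric] powr_powr mult.commute)
        then show ?thesis using that by (simp add: powr_mult)
      qed
      note * = this
      assume "Z = ((\<Sum>i\<le>N. K i) * (N + 1) * 2 ^ Q) * (2 ^ Q) ^ j * (e / mass M)"
      then show ?thesis using SK fin(2) M(2) by (simp only: *) (rule *, auto)
    qed
    \<comment> \<open>The case e = 0 is separated because \<open>powr_add\<close> concerns the base
      e / mass M, and both sides vanish there.\<close>
    have 3: "e * (e / mass M) powr \<delta> = mass M * (e / mass M) powr (1 + \<delta>)"
      using fin(2) M(2) by (cases "e = 0") (auto simp: powr_add)
    have "(\<Sum>i\<le>N. \<Gamma> i) * ((1 + CC) * (r / s) ^ (?n * Q + Q) * Z powr \<delta>) * e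
      = ((\<Sum>i\<le>N. \<Gamma> i) * (1 + CC) * 4 ^ (?n * Q + Q) * ((\<Sum>i\<le>N. K i) * (N + 1) * 2 ^ Q) powr \<delta>)
       * ((2 ^ (?n * Q + Q)) ^ j * ((2 ^ Q) powr \<delta>) ^ j) * (e * (e / mass M) powr \<delta>)"
      unfolding 1 2 by (simp only: mult_ac)
    also have "(2 ^ (?n * Q + Q)) ^ j * ((2 ^ Q) powr \<delta>) ^ j = DG_base ?n N q K Q ^ j"
      by (simp only: DG_base_def \<delta>_def power_mult_distrib)
    also have "(\<Sum>i\<le>N. \<Gamma> i) * (1 + CC) * 4 ^ (?n * Q + Q) * ((\<Sum>i\<le>N. K i) * (N + 1) * 2 ^ Q) powr \<delta> = DG_const ?n N q K Q CC"
      by (simp only: DG_const_def \<delta>_def \<Gamma>_def)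
    finally show ?thesis unfolding 3 by (simp only: mult_ac)
  qed
  finally show ?thesis by (simp add: \<rho>1_def k1_def \<delta>_def)
qed

lemma DG_const_pos: "0 < DG_const CARD('n) N q K Q CC"
proof -
  have \<Gamma>: "0 < Sobolev_const CARD('n) (q i) (K i) * Ainf_const CARD('n) (q i) (K i) powr Sobolev_exp CARD('n) (q i)" if "i \<le> N" for i
    using Ainf_const_pos[OF K[OF that], of "CARD('n)" "q i"] K[OF that] by (auto simp: Sobolev_const_def)
  have "0 < (\<Sum>i\<le>N. Sobolev_const CARD('n) (q i) (K i) * Ainf_const CARD('n) (q i) (K i) powr Sobolev_exp CARD('n) (q i))"
    using \<Gamma> by (intro sum_pos) auto
  moreover have "0 < (\<Sum>i\<le>N. K i)" using K by (intro sum_pos) (auto intro: less_le_trans[of 0 1])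
  ultimately show ?thesis using CC by (simp add: DG_const_def)
qed

text \<open>The normalized energies satisfy the hypotheses of
  \<open>fast_geometric_convergence\<close>. Radii decrease to \<open>r\<close> and levels increase
  to \<open>M\<close>, so \<open>En r M\<close> lies below all of them and is 0.\<close>

theorem sup_bound:
  assumes M: "0 < M" "0 < mass M" and start: "En (2 * r) 0 \<le> ennreal (DG_threshold CARD('n) N q K Q CC * mass M)"
  shows "AE x in lborel. x \<in> ball x0 r \<longrightarrow> u x \<le> M"
proof -
  let ?n = "CARD('n)"
  define \<delta> where "\<delta> = DG_exp ?n N q K Q"
  define B where "B = DG_base ?n N q K Q"
  define C where "C = DG_const ?n N q K Q CC"
  have \<delta>: "0 < \<delta>" unfolding \<delta>_def by (rule DG_exp_pos)
  have C: "0 < C" unfolding C_def by (rule DG_const_pos)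
  have Q0: "0 < Q" using Q_ge_1 by simp
  have B: "1 < B"
  proof -
    have "1 < (2::real) ^ (?n * Q + Q)" using Q0 by (intro one_less_power) auto
    moreover have "1 \<le> ((2::real) ^ Q) powr \<delta>" using \<delta> by (intro ge_one_powr_ge_zero) auto
    ultimately have "1 * 1 < (2::real) ^ (?n * Q + Q) * (2 ^ Q) powr \<delta>" by (intro mult_less_le_imp_less) auto
    then show ?thesis by (simp add: B_def DG_base_def \<delta>_def)
  qed
  define E where "E = (\<lambda>j. En (r * (1 + 1 / 2 ^ j)) (M * (1 - 1 / 2 ^ j)))"
  define e where "e = (\<lambda>j. enn2real (E j))"
  have E_le: "E j \<le> En (2 * r) 0" for j
    unfolding E_def using r M one_le_power[of "2::real" j] by (intro En_mono) (auto simp: field_simps)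
  have "En (2 * r) 0 < top" using start by (auto intro: le_less_trans)
  then have "E j < top" for j using E_le[of j] by (rule le_less_trans[rotated])
  then have E_fin: "E j = ennreal (e j)" for j by (simp add: e_def)
  have e0: "0 \<le> e j" for j by (simp add: e_def)
  define Y where "Y = (\<lambda>j. e j / mass M)"
  have lim: "Y \<longlonglongrightarrow> 0"
  proof (rule fast_geometric_convergence[OF C B \<delta>])
    show "0 \<le> Y j" for j using e0 M by (simp add: Y_def)
    show "Y (Suc j) \<le> C * B ^ j * Y j powr (1 + \<delta>)" for j
    proof -
      have "E (Suc j) \<le> ennreal (mass M * (C * B ^ j * Y j powr (1 + \<delta>)))"
        unfolding E_def C_def B_def Y_def \<delta>_def by (rule DG_step[OF M _ e0]) (use E_fin[of j] in \<open>simp add: E_def\<close>)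
      then have "e (Suc j) \<le> mass M * (C * B ^ j * Y j powr (1 + \<delta>))"
        unfolding E_fin using C B M by (subst (asm) ennreal_le_iff) auto
      then show ?thesis using M by (simp add: Y_def field_simps)
    qed
    have "E 0 \<le> ennreal (DG_threshold ?n N q K Q CC * mass M)" using E_le[of 0] start by (rule order_trans)
    then have "e 0 \<le> DG_threshold ?n N q K Q CC * mass M"
      unfolding E_fin using M by (subst (asm) ennreal_le_iff) (auto simp: DG_threshold_def)
    then show "Y 0 \<le> C powr (- 1 / \<delta>) * B powr (- 1 / \<delta>\<^sup>2)"
      using M by (simp add: Y_def DG_threshold_def C_def B_def \<delta>_def divide_le_eq)
  qed
  have "En r M = 0"
  proof -
    have le: "En r M \<le> E j" for j
      unfolding E_def using r M by (intro En_mono) (auto simp: field_simps)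
    have "En r M \<le> ennreal (mass M * Y j)" for j using le[of j] E_fin[of j] M by (simp add: Y_def)
    moreover have "(\<lambda>j. ennreal (mass M * Y j)) \<longlonglongrightarrow> ennreal (mass M * 0)"
      by (intro tendsto_ennrealI tendsto_mult tendsto_const lim)
    ultimately have "En r M \<le> ennreal (mass M * 0)" by (intro LIMSEQ_le_const) auto
    then show ?thesis by simp
  qed
  \<comment> \<open>Phase 0 is singled out: its weight is 1, so its vanishing integral gives a
    statement almost everywhere with respect to Lebesgue measure.\<close>
  then have "(\<integral>\<^sup>+x. indicator (ball x0 r) x * (ennreal ((max 0 (u x - M) / r) powr q 0) * ennreal (b 0 x)) \<partial>lborel) = 0"
    unfolding En_def by (subst (asm) sum_eq_0_iff) auto
  then have "AE x in lborel. indicator (ball x0 r) x * (ennreal ((max 0 (u x - M) / r) powr q 0) * ennreal (b 0 x)) = 0"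
    unfolding b0 by (subst (asm) nn_integral_0_iff_AE) auto
  then show ?thesis
  proof eventually_elim
    case (elim x)
    show ?case
    proof
      assume "x \<in> ball x0 r"
      then have "(max 0 (u x - M) / r) powr q 0 = 0" using elim b0 by (simp add: ennreal_eq_0_iff)
      then show "u x \<le> M" using r by (auto simp: max_def split: if_splits)
    qed
  qed
qed

end

lemma (in De_Giorgi) DG_threshold_pos: "0 < DG_threshold CARD('n) N q K Q CC"
proof -
  have "0 < DG_base CARD('n) N q K Q" by (simp add: DG_base_def)
  then show ?thesis using DG_const_pos by (simp add: DG_threshold_def)
qed

text \<open>Phase 0 alone gives both bounds. The linear growth for t \<ge> r guarantees that the
  start condition of \<open>sup_bound\<close> is met for some large \<open>M\<close>.\<close>

lemma (in De_Giorgi) mass_pos: "0 < t \<Longrightarrow> 0 < mass t"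
  and mass_ge: "r \<le> t \<Longrightarrow> measure lborel (ball x0 (2 * r)) * (t / r) \<le> mass t"
proof -
  have b0m: "measure (wm (b 0)) (ball x0 (2 * r)) = measure lborel (ball x0 (2 * r))"
    by (simp add: b0 measure_def emeasure_density)
  have le: "measure lborel (ball x0 (2 * r)) * (t / r) powr q 0 \<le> mass t" for t
    unfolding mass_def b0m[symmetric] by (rule member_le_sum) auto
  have V: "0 < measure lborel (ball x0 (2 * r))" using r by (intro measure_ball_pos) auto
  show "0 < mass t" if "0 < t"
  proof -
    have "0 < measure lborel (ball x0 (2 * r)) * (t / r) powr q 0"
      using V that r by simp
    then show ?thesis using le[of t] by linarith
  qed
  show "measure lborel (ball x0 (2 * r)) * (t / r) \<le> mass t" if "r \<le> t"
  proof -
    have "(t / r) powr 1 \<le> (t / r) powr q 0" using that r q(1)[of 0] by (intro powr_mono) auto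
    then have "t / r \<le> (t / r) powr q 0" using that r by simp
    then have "measure lborel (ball x0 (2 * r)) * (t / r) \<le> measure lborel (ball x0 (2 * r)) * (t / r) powr q 0"
      using V by (intro mult_left_mono) auto
    then show ?thesis using le[of t] by linarith
  qed
qed

lemma (in De_Giorgi) isCont_mass: "0 < t \<Longrightarrow> isCont mass t"
  unfolding mass_def using r by (intro continuous_intros) auto

lemma (in De_Giorgi) mass_0: "mass 0 = 0"
  by (simp add: mass_def)

section \<open>The multi-phase integrand\<close>

text \<open>The cutoff is exp(-1/\<tau>) with \<tau> = (R^2 - |x - x0|^2)/(R^2 - \<rho>^2), hence in
  \<open>smooth_fn\<close>. On the inner ball \<tau> \<ge> 1, so the value is at least exp(-1)
  there; a positive lower bound is enough for Caccioppoli.\<close>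

lemma cutoff_exists:
  fixes x0 :: "real^'n"
  assumes "0 < \<rho>" "\<rho> < R"
  obtains \<eta> where "smooth_fn \<eta>" "\<And>x. 0 \<le> \<eta> x" "\<And>x. \<eta> x \<le> 1"
    "\<And>x. x \<notin> ball x0 R \<Longrightarrow> \<eta> x = 0" "\<And>x. x \<in> ball x0 \<rho> \<Longrightarrow> exp (- 1) \<le> \<eta> x"
    "\<And>x. norm (\<chi> i. partial i \<eta> x) \<le> 4 / (R - \<rho>)" "\<And>x. \<eta> x = 0 \<Longrightarrow> (\<chi> i. partial i \<eta> x) = 0"
proof -
  define d where "d = R\<^sup>2 - \<rho>\<^sup>2"
  have d: "0 < d" using assms by (simp add: d_def power_strict_mono)
  define \<tau> where "\<tau> = (\<lambda>x. (R\<^sup>2 - (\<Sum>i\<in>UNIV. (x $ i - x0 $ i) * (x $ i - x0 $ i))) * (1 / d))"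
  have \<tau>_smooth: "smooth_fn \<tau>"
    unfolding \<tau>_def by (rule smooth_mult smooth_diff smooth_const smooth_sum smooth_coord)+
  define \<eta> where "\<eta> = (\<lambda>x. flat 0 (\<tau> x))"
  have \<eta>_smooth: "smooth_fn \<eta>" unfolding \<eta>_def by (rule smooth_flat[OF \<tau>_smooth])
  have nsq: "(\<Sum>i\<in>UNIV. (x $ i - x0 $ i) * (x $ i - x0 $ i)) = (norm (x - x0))\<^sup>2" for x
    by (simp add: power2_norm_eq_inner inner_vec_def)
  have \<tau>_eq: "\<tau> x = (R\<^sup>2 - (norm (x - x0))\<^sup>2) / d" for x by (simp add: \<tau>_def nsq)
  have p\<tau>: "(\<tau> has_derivative (\<lambda>h. - 2 / d * ((x - x0) \<bullet> h))) (at x)" for x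
  proof -
    have "((\<lambda>x. (R\<^sup>2 - (x - x0) \<bullet> (x - x0)) * (1 / d)) has_derivative (\<lambda>h. - 2 / d * ((x - x0) \<bullet> h))) (at x)"
      using d by (auto intro!: derivative_eq_intros simp: inner_commute algebra_simps)
    moreover have "\<tau> = (\<lambda>x. (R\<^sup>2 - (x - x0) \<bullet> (x - x0)) * (1 / d))"
      by (rule ext) (simp add: \<tau>_eq power2_norm_eq_inner)
    ultimately show ?thesis by simp
  qed
  have p\<eta>: "(\<chi> i. partial i \<eta> x) = (flat 2 (\<tau> x) * (- 2 / d)) *\<^sub>R (x - x0)" for x
  proof -
    have "(\<eta> has_derivative (\<lambda>h. (flat 2 (\<tau> x) - real 0 * flat 1 (\<tau> x)) * (- 2 / d * ((x - x0) \<bullet> h)))) (at x)"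
      unfolding \<eta>_def
      using has_derivative_compose[OF p\<tau>, of "flat 0", OF has_field_derivative_flat[of 0, unfolded has_field_derivative_def]]
      by (simp add: numeral_2_eq_2)
    from partial_eq[OF this] show ?thesis by (simp add: vec_eq_iff inner_axis)
  qed
  \<comment> \<open>\<open>flat 2\<close> is the derivative of \<open>flat 0\<close>. Its bound 2 =
    2!, the gradient 2 |x - x0|/d of \<tau> and d = (R - \<rho>)(R + \<rho>) combine to 4/(R -
    \<rho>).\<close>
  have flat2: "flat 2 t \<le> 2" for t
  proof (cases "0 < t")
    case True
    have "(1 / t)\<^sup>2 \<le> 2 * exp (1 / t)" using power_le_fact_exp[of "1 / t" 2] True by (simp add: fact_numeral)
    then have "(1 / t)\<^sup>2 * exp (- 1 / t) \<le> 2 * exp (1 / t) * exp (- 1 / t)" by (intro mult_right_mono) auto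
    also have "\<dots> = 2" by (simp add: mult.assoc flip: exp_add)
    finally show ?thesis using True by (simp add: flat_def)
  qed (simp add: flat_def)
  show ?thesis
  proof (rule that[OF \<eta>_smooth])
    fix x
    show "0 \<le> \<eta> x" "\<eta> x \<le> 1" by (auto simp: \<eta>_def flat_nonneg flat_0_le_1)
    show z: "\<eta> x = 0" if "x \<notin> ball x0 R"
    proof -
      have "R \<le> norm (x - x0)" using that by (simp add: dist_norm norm_minus_commute)
      then have "R\<^sup>2 \<le> (norm (x - x0))\<^sup>2" using assms by (intro power_mono) auto
      then show ?thesis using d by (simp add: \<eta>_def flat_def \<tau>_eq divide_le_0_iff not_less)
    qed
    show "exp (- 1) \<le> \<eta> x" if "x \<in> ball x0 \<rho>"
    proof -
      have "norm (x - x0) \<le> \<rho>" using that by (simp add: dist_norm norm_minus_commute)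
      then have "(norm (x - x0))\<^sup>2 \<le> \<rho>\<^sup>2" by (intro power_mono) auto
      then have "1 \<le> \<tau> x" using d by (simp add: \<tau>_eq d_def)
      then show ?thesis by (simp add: \<eta>_def flat_def divide_le_eq)
    qed
    show "(\<chi> i. partial i \<eta> x) = 0" if "\<eta> x = 0"
    proof -
      have "\<not> 0 < \<tau> x" using that by (auto simp: \<eta>_def flat_def)
      then have "flat 2 (\<tau> x) = 0" by (simp add: flat_def)
      then show ?thesis by (simp add: p\<eta>)
    qed
    show "norm (\<chi> i. partial i \<eta> x) \<le> 4 / (R - \<rho>)"
    proof (cases "0 < \<tau> x")
      case True
      then have "(norm (x - x0))\<^sup>2 \<le> R\<^sup>2" using d by (simp add: \<tau>_eq zero_less_divide_iff)
      then have nR: "norm (x - x0) \<le> R" by (rule power2_le_imp_le) (use assms in simp)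
      have "norm (\<chi> i. partial i \<eta> x) = flat 2 (\<tau> x) * (2 / d) * norm (x - x0)"
        unfolding p\<eta> using d flat_nonneg[of 2 "\<tau> x"] by (simp add: abs_mult)
      also have "\<dots> \<le> 2 * (2 / d) * R"
        using flat2 nR d flat_nonneg[of 2 "\<tau> x"] by (intro mult_mono) auto
      also have "\<dots> = 4 * (R / d)" by simp
      also have "d = (R - \<rho>) * (R + \<rho>)" by (simp add: d_def power2_eq_square algebra_simps)
      also have "4 * (R / ((R - \<rho>) * (R + \<rho>))) \<le> 4 * (1 / (R - \<rho>))"
      proof (intro mult_left_mono)
        have "R / ((R - \<rho>) * (R + \<rho>)) \<le> (R + \<rho>) / ((R - \<rho>) * (R + \<rho>))"
          using assms by (intro divide_right_mono) auto
        also have "\<dots> = 1 / (R - \<rho>)" using assms by simp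
        finally show "R / ((R - \<rho>) * (R + \<rho>)) \<le> 1 / (R - \<rho>)" .
      qed simp
      finally show ?thesis by simp
    next
      case False
      then have "flat 2 (\<tau> x) = 0" by (simp add: flat_def)
      then show ?thesis using assms unfolding p\<eta> by simp
    qed
  qed
qed

lemma partial_power:
  assumes "smooth_fn \<eta>"
  shows "(\<chi> i. partial i (\<lambda>x. \<eta> x ^ Q) x) = (real Q * \<eta> x ^ (Q - 1)) *\<^sub>R (\<chi> i. partial i \<eta> x)"
proof -
  have d: "(\<eta> has_derivative frechet_derivative \<eta> (at x)) (at x)"
    using smooth_partial[OF assms] by (simp add: frechet_derivative_works)
  from partial_eq[OF has_derivative_power[OF d, of Q]] show ?thesis
    by (simp add: vec_eq_iff partial_def mult_ac)
qed

text \<open>Convexity on the open half line covers positive \<open>s\<close> and \<open>t\<close>;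
  if one of them is 0, the claim reduces to l^q \<le> l.\<close>

lemma convex_powr:
  fixes q :: real
  assumes q: "1 \<le> q" and "0 \<le> s" "0 \<le> t" "0 \<le> l" "l \<le> 1"
  shows "((1 - l) * s + l * t) powr q \<le> (1 - l) * s powr q + l * t powr q"
proof -
  have le: "l powr q \<le> l" if "0 \<le> l" "l \<le> 1" for l :: real
    using powr_mono'[of 1 q l] that q by simp
  consider "s = 0" | "t = 0" | "0 < s" "0 < t" using assms by linarith
  then show ?thesis
  proof cases
    case 1
    then show ?thesis using assms le[of l] by (simp add: powr_mult mult_right_mono)
  next
    case 2
    then show ?thesis using assms le[of "1 - l"] by (simp add: powr_mult mult_right_mono)
  next
    case 3
    then show ?thesis
      using convex_onD[OF powr_convex[OF q], of l s t] assms by simp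
  qed
qed

section \<open>The phases as one indexed family\<close>

definition phase_exp :: "real \<Rightarrow> (nat \<Rightarrow> real) \<Rightarrow> nat \<Rightarrow> real" where
  "phase_exp p ps i = (if i = 0 then p else ps i)"

definition phase_wt :: "(nat \<Rightarrow> real^'n \<Rightarrow> real) \<Rightarrow> nat \<Rightarrow> real^'n \<Rightarrow> real" where
  "phase_wt a i = (if i = 0 then (\<lambda>_. 1) else a i)"

text \<open>A natural number, so that a cutoff to this power remains in \<open>smooth_fn\<close>.
  The sum of all exponents is an upper bound for each of them.\<close>

definition phase_top :: "nat \<Rightarrow> real \<Rightarrow> (nat \<Rightarrow> real) \<Rightarrow> nat" where
  "phase_top N p ps = nat \<lceil>\<Sum>i\<le>N. phase_exp p ps i\<rceil>"

lemma multi_phase_eq: "multi_phase N p ps a x t = (\<Sum>i\<le>N. phase_wt a i x * t powr phase_exp p ps i)"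
proof -
  have "{..N} = insert 0 {1..N}" by auto
  then show ?thesis
    by (simp add: multi_phase_def phase_wt_def phase_exp_def)
qed

context
  fixes N :: nat and p :: real and ps :: "nat \<Rightarrow> real"
  assumes p: "1 < p" and ps: "\<And>i. i \<in> {1..N} \<Longrightarrow> p \<le> ps i"
begin

lemma phase_exp_gt_1: "i \<le> N \<Longrightarrow> 1 < phase_exp p ps i"
  using p ps[of i] by (auto simp: phase_exp_def)

lemma phase_exp_nonneg: "i \<le> N \<Longrightarrow> 0 \<le> phase_exp p ps i"
  using phase_exp_gt_1[of i] by simp

lemma phase_exp_le_top: "i \<le> N \<Longrightarrow> phase_exp p ps i \<le> phase_top N p ps"
proof -
  assume i: "i \<le> N"
  have "phase_exp p ps i \<le> (\<Sum>i\<le>N. phase_exp p ps i)"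
    using i phase_exp_nonneg by (intro member_le_sum) auto
  also have "\<dots> \<le> phase_top N p ps" unfolding phase_top_def by linarith
  finally show ?thesis .
qed

lemma phase_top_ge_2: "2 \<le> phase_top N p ps"
  using phase_exp_gt_1[of 0] phase_exp_le_top[of 0] by linarith

context
  fixes a :: "nat \<Rightarrow> real^'n \<Rightarrow> real"
  assumes a0: "\<And>i x. i \<in> {1..N} \<Longrightarrow> 0 \<le> a i x"
begin

lemma phase_wt_nonneg: "i \<le> N \<Longrightarrow> 0 \<le> phase_wt a i x"
  using a0[of i x] by (auto simp: phase_wt_def)

lemma multi_phase_nonneg: "0 \<le> multi_phase N p ps a x t"
  unfolding multi_phase_eq by (intro sum_nonneg mult_nonneg_nonneg phase_wt_nonneg) auto

lemma multi_phase_mono: "0 \<le> s \<Longrightarrow> s \<le> t \<Longrightarrow> multi_phase N p ps a x s \<le> multi_phase N p ps a x t"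
  unfolding multi_phase_eq using phase_wt_nonneg phase_exp_nonneg
  by (intro sum_mono mult_left_mono powr_mono2) auto

lemma multi_phase_scale:
  assumes "1 \<le> c" "0 \<le> t"
  shows "multi_phase N p ps a x (c * t) \<le> c ^ phase_top N p ps * multi_phase N p ps a x t"
  unfolding multi_phase_eq sum_distrib_left
proof (intro sum_mono)
  fix i assume "i \<in> {..N}"
  then have i: "i \<le> N" by simp
  have "(c * t) powr phase_exp p ps i = c powr phase_exp p ps i * t powr phase_exp p ps i"
    using assms by (simp add: powr_mult)
  also have "\<dots> \<le> c powr phase_top N p ps * t powr phase_exp p ps i"
    using assms phase_exp_le_top[OF i] by (intro mult_right_mono powr_mono) auto
  also have "c powr phase_top N p ps = c ^ phase_top N p ps" using assms by (simp add: powr_realpow)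
  finally show "phase_wt a i x * (c * t) powr phase_exp p ps i \<le> c ^ phase_top N p ps * (phase_wt a i x * t powr phase_exp p ps i)"
    using mult_left_mono[OF _ phase_wt_nonneg[OF i]] by (simp add: mult.left_commute)
qed

lemma multi_phase_add:
  assumes "0 \<le> s" "0 \<le> t"
  shows "multi_phase N p ps a x (s + t) \<le> 2 ^ phase_top N p ps * (multi_phase N p ps a x s + multi_phase N p ps a x t)"
proof -
  have "multi_phase N p ps a x (s + t) \<le> multi_phase N p ps a x (2 * max s t)"
    using assms by (intro multi_phase_mono) auto
  also have "\<dots> \<le> 2 ^ phase_top N p ps * multi_phase N p ps a x (max s t)"
    using assms by (intro multi_phase_scale) auto
  also have "multi_phase N p ps a x (max s t) \<le> multi_phase N p ps a x s + multi_phase N p ps a x t"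
    using multi_phase_nonneg[of x s] multi_phase_nonneg[of x t] by (auto simp: max_def)
  finally show ?thesis by simp
qed

text \<open>The convexity estimate that replaces the hole-filling argument: \<open>l = \<eta>\<^sup>Q\<close> with \<open>Q\<close> above all
  exponents, so that \<open>\<eta>\<^sup>Q (z / \<eta>)\<^sup>q \<le> z\<^sup>q\<close>.\<close>

lemma multi_phase_convex_cutoff:
  assumes \<eta>: "0 < \<eta>" "\<eta> \<le> 1" and s: "0 \<le> s" and z: "0 \<le> z"
    and t: "0 \<le> t" "t \<le> (1 - \<eta> ^ phase_top N p ps) * s + \<eta> ^ (phase_top N p ps - 1) * z"
  shows "multi_phase N p ps a x t + \<eta> ^ phase_top N p ps * multi_phase N p ps a x s \<le> multi_phase N p ps a x s + multi_phase N p ps a x z"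
proof -
  let ?Q = "phase_top N p ps"
  define l where "l = \<eta> ^ ?Q"
  have l: "0 < l" "l \<le> 1" using \<eta> by (auto simp: l_def power_le_one)
  \<comment> \<open>Written this way the bound on \<open>t\<close> is a convex combination of
    \<open>s\<close> and \<open>z / \<eta>\<close> with the small weight
    \<open>\<eta> ^ ?Q\<close>.\<close>
  have "\<eta> ^ (?Q - 1) * z = l * (z / \<eta>)"
    using \<eta> phase_top_ge_2 by (simp add: l_def power_eq_if)
  then have t2: "t \<le> (1 - l) * s + l * (z / \<eta>)" using t by (simp add: l_def)
  have "phase_wt a i x * t powr phase_exp p ps i
     \<le> (1 - l) * (phase_wt a i x * s powr phase_exp p ps i) + phase_wt a i x * z powr phase_exp p ps i" if i: "i \<le> N" for i
  proof -
    define q where "q = phase_exp p ps i"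
    have q: "1 < q" "q \<le> ?Q" using phase_exp_gt_1[OF i] phase_exp_le_top[OF i] by (auto simp: q_def)
    have "t powr q \<le> ((1 - l) * s + l * (z / \<eta>)) powr q" using t2 t q by (intro powr_mono2) auto
    also have "\<dots> \<le> (1 - l) * s powr q + l * (z / \<eta>) powr q"
      using q s z l \<eta> by (intro convex_powr) auto
    also have "l * (z / \<eta>) powr q \<le> z powr q"
    proof -
      have "l * (z / \<eta>) powr q = (l / \<eta> powr q) * z powr q" using \<eta> z by (simp add: powr_divide)
      also have "l / \<eta> powr q \<le> 1"
      proof -
        have "l = \<eta> powr ?Q" using \<eta> by (simp add: l_def powr_realpow)
        also have "\<dots> \<le> \<eta> powr q" using \<eta> q by (intro powr_mono') auto
        finally show ?thesis using \<eta> by (simp add: divide_le_eq)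
      qed
      then have "(l / \<eta> powr q) * z powr q \<le> 1 * z powr q" by (intro mult_right_mono) auto
      finally show ?thesis by simp
    qed
    finally have "phase_wt a i x * t powr q \<le> phase_wt a i x * ((1 - l) * s powr q + z powr q)"
      using phase_wt_nonneg[OF i] by (intro mult_left_mono) auto
    then show ?thesis by (simp add: q_def algebra_simps)
  qed
  then have "multi_phase N p ps a x t \<le> (\<Sum>i\<le>N. (1 - l) * (phase_wt a i x * s powr phase_exp p ps i) + phase_wt a i x * z powr phase_exp p ps i)"
    unfolding multi_phase_eq by (intro sum_mono) auto
  also have "\<dots> = (1 - l) * multi_phase N p ps a x s + multi_phase N p ps a x z"
    by (simp add: multi_phase_eq sum.distrib sum_distrib_left)
  finally show ?thesis by (simp add: l_def algebra_simps)
qed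

end
end

section \<open>Local minimizers\<close>

lemma wgrad_sign:
  assumes "wgrad \<Omega> f G" "open \<Omega>" "\<sigma> = 1 \<or> \<sigma> = -1"
  shows "wgrad \<Omega> (\<lambda>x. \<sigma> * f x) (\<lambda>x. \<sigma> *\<^sub>R G x)"
  using assms wgrad_uminus[OF assms(1,2)] by auto

lemma borel_measurable_lebesgue_on_AE:
  fixes f f' :: "'a::euclidean_space \<Rightarrow> real"
  assumes [measurable]: "f' \<in> borel_measurable borel" "U \<in> sets borel" and eq: "AE x in lborel. x \<in> U \<longrightarrow> f x = f' x"
  shows "f \<in> borel_measurable (lebesgue_on U)"
proof -
  have m: "(\<lambda>x. f' x * indicator U x) \<in> borel_measurable lebesgue" by (rule measurable_completion) measurable
  have "AE x in lebesgue. f' x * indicator U x = f x * indicator U x"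
    using eq unfolding AE_completion_iff by eventually_elim (auto simp: indicator_def)
  from borel_measurable_AE[OF m this] show ?thesis
    by (subst borel_measurable_restrict_space_iff) (auto simp: mult.commute)
qed

text \<open>The cutoff is at least exp(-1), hence exp(Q) after taking the Q-th power; 4 Q is the
  gradient bound of that power, and scaling it out of the integrand raises it to the power
  Q.\<close>

definition Caccioppoli_const :: "nat \<Rightarrow> real" where
  "Caccioppoli_const Q = exp Q * (4 * Q) ^ Q"

text \<open>The weights \<open>a\<close> are Lebesgue measurable only, so Borel versions
  \<open>a'\<close> accompany them: \<open>H\<close> occurs in the definitions of the problem,
  \<open>H'\<close> in the computations. Finite weight of balls gives constants locally finite
  energy.\<close>

locale multi_phase_setting =
  fixes N :: nat and p :: real and ps :: "nat \<Rightarrow> real" and a a' :: "nat \<Rightarrow> real^'n \<Rightarrow> real"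
  assumes p: "1 < p" and ps: "\<And>i. i \<in> {1..N} \<Longrightarrow> p \<le> ps i"
    and a'_meas [measurable]: "\<And>i. a' i \<in> borel_measurable borel" and a'_nonneg: "\<And>i x. 0 \<le> a' i x"
    and a'_eq: "\<And>i. i \<in> {1..N} \<Longrightarrow> AE x in lborel. a i x = a' i x"
    and a'_fin: "\<And>i x s. i \<in> {1..N} \<Longrightarrow> emeasure (wm (a' i)) (ball x s) < \<infinity>"
begin

abbreviation H where "H \<equiv> multi_phase N p ps a"
abbreviation H' where "H' \<equiv> multi_phase N p ps a'"
abbreviation Q where "Q \<equiv> phase_top N p ps"

lemma H'_nonneg: "0 \<le> H' x t"
  by (rule multi_phase_nonneg[OF p ps]) (auto intro: a'_nonneg)

lemma H'_mono: "0 \<le> s \<Longrightarrow> s \<le> t \<Longrightarrow> H' x s \<le> H' x t"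
  by (rule multi_phase_mono[OF p ps]) (auto intro: a'_nonneg)

lemma H'_add: "0 \<le> s \<Longrightarrow> 0 \<le> t \<Longrightarrow> H' x (s + t) \<le> 2 ^ Q * (H' x s + H' x t)"
  by (rule multi_phase_add[OF p ps]) (auto intro: a'_nonneg)

lemma H'_scale: "1 \<le> c \<Longrightarrow> 0 \<le> t \<Longrightarrow> H' x (c * t) \<le> c ^ Q * H' x t"
  by (rule multi_phase_scale[OF p ps]) (auto intro: a'_nonneg)

lemma H'_convex_cutoff:
  assumes "0 < \<eta>" "\<eta> \<le> 1" "0 \<le> s" "0 \<le> z" "0 \<le> t" "t \<le> (1 - \<eta> ^ Q) * s + \<eta> ^ (Q - 1) * z"
  shows "H' x t + \<eta> ^ Q * H' x s \<le> H' x s + H' x z"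
  by (rule multi_phase_convex_cutoff[OF p ps _ assms]) (auto intro: a'_nonneg)

lemma H'_measurable [measurable (raw)]:
  assumes [measurable]: "f \<in> borel_measurable borel"
  shows "(\<lambda>x. H' x (f x)) \<in> borel_measurable borel"
  unfolding multi_phase_def by measurable

lemma H_eq_H': "AE x in lborel. \<forall>t. H x t = H' x t"
proof -
  have "AE x in lborel. \<forall>i\<in>{1..N}. a i x = a' i x" using a'_eq by (intro AE_finite_allI) auto
  then show ?thesis by eventually_elim (auto simp: multi_phase_def)
qed

lemma nn_integral_H_eq:
  assumes "AE x in lborel. x \<in> D \<longrightarrow> f x = f' x" "T \<subseteq> D"
  shows "(\<integral>\<^sup>+x\<in>T. ennreal (H x (f x)) \<partial>lebesgue) = (\<integral>\<^sup>+x. indicator T x * ennreal (H' x (f' x)) \<partial>lborel)"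
proof -
  have "(\<integral>\<^sup>+x\<in>T. ennreal (H x (f x)) \<partial>lebesgue) = (\<integral>\<^sup>+x. ennreal (H x (f x)) * indicator T x \<partial>lborel)"
    by (rule nn_integral_completion)
  also have "\<dots> = (\<integral>\<^sup>+x. indicator T x * ennreal (H' x (f' x)) \<partial>lborel)"
    by (rule nn_integral_cong_AE) (use H_eq_H' assms(1) in eventually_elim, use assms(2) in \<open>auto simp: indicator_def\<close>)
  finally show ?thesis .
qed

section \<open>Functions of finite energy\<close>

definition fin_energy :: "(real^'n) set \<Rightarrow> (real^'n \<Rightarrow> real) \<Rightarrow> bool" where
  "fin_energy U f \<longleftrightarrow> (\<integral>\<^sup>+x. indicator U x * ennreal (H' x \<bar>f x\<bar>) \<partial>lborel) < \<infinity>"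

lemma orlicz_classI:
  assumes "open U" and [measurable]: "f' \<in> borel_measurable borel" and eq: "AE x in lborel. x \<in> U \<longrightarrow> f x = f' x"
    and "fin_energy U f'"
  shows "f \<in> orlicz_class H U"
proof -
  have [measurable]: "U \<in> sets borel" using assms(1) by auto
  have "f \<in> borel_measurable (lebesgue_on U)"
    by (rule borel_measurable_lebesgue_on_AE[OF _ _ eq]) measurable
  moreover have "(\<integral>\<^sup>+x\<in>U. ennreal (H x \<bar>f x\<bar>) \<partial>lebesgue) = (\<integral>\<^sup>+x. indicator U x * ennreal (H' x \<bar>f' x\<bar>) \<partial>lborel)"
    by (rule nn_integral_H_eq[of U]) (use eq in eventually_elim, auto)
  ultimately show ?thesis using assms(4) by (simp add: orlicz_class_def fin_energy_def)
qed

lemma orlicz_classE: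
  assumes "f \<in> orlicz_class H U" "open U"
  obtains f' where "f' \<in> borel_measurable borel" "AE x in lborel. x \<in> U \<longrightarrow> f x = f' x" "fin_energy U f'"
proof -
  have "f \<in> borel_measurable (lebesgue_on U)" using assms by (simp add: orlicz_class_def)
  then have "(\<lambda>x. indicator U x *\<^sub>R f x) \<in> borel_measurable lebesgue"
    using assms(2) by (subst (asm) borel_measurable_restrict_space_iff) auto
  then obtain f' where f': "f' \<in> borel_measurable borel" "AE x in lborel. indicator U x *\<^sub>R f x = f' x"
    by (rule lebesgue_ex_borel)
  have eq: "AE x in lborel. x \<in> U \<longrightarrow> f x = f' x" using f'(2) by eventually_elim auto
  have "(\<integral>\<^sup>+x\<in>U. ennreal (H x \<bar>f x\<bar>) \<partial>lebesgue) = (\<integral>\<^sup>+x. indicator U x * ennreal (H' x \<bar>f' x\<bar>) \<partial>lborel)"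
    by (rule nn_integral_H_eq[of U]) (use eq in eventually_elim, auto)
  then have "fin_energy U f'" using assms(1) by (simp add: orlicz_class_def fin_energy_def)
  with f' eq show ?thesis using that by blast
qed

lemma fin_energy_mono:
  assumes "fin_energy U g" "\<And>x. x \<in> V \<Longrightarrow> \<bar>f x\<bar> \<le> \<bar>g x\<bar>" "V \<subseteq> U"
  shows "fin_energy V f"
proof -
  have "(\<integral>\<^sup>+x. indicator V x * ennreal (H' x \<bar>f x\<bar>) \<partial>lborel) \<le> (\<integral>\<^sup>+x. indicator U x * ennreal (H' x \<bar>g x\<bar>) \<partial>lborel)"
    using assms(2,3) by (intro nn_integral_mono) (auto simp: indicator_def intro!: ennreal_leI H'_mono)
  then show ?thesis using assms(1) by (auto simp: fin_energy_def)
qed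

lemma fin_energy_AE:
  assumes "fin_energy U f" "AE x in lborel. x \<in> U \<longrightarrow> f x = g x"
  shows "fin_energy U g"
proof -
  have "(\<integral>\<^sup>+x. indicator U x * ennreal (H' x \<bar>f x\<bar>) \<partial>lborel) = (\<integral>\<^sup>+x. indicator U x * ennreal (H' x \<bar>g x\<bar>) \<partial>lborel)"
    by (rule nn_integral_cong_AE) (use assms(2) in eventually_elim, auto simp: indicator_def)
  then show ?thesis using assms(1) by (simp add: fin_energy_def)
qed

lemma fin_energy_add:
  assumes [measurable]: "f \<in> borel_measurable borel" "g \<in> borel_measurable borel" "U \<in> sets borel"
    and "fin_energy U f" "fin_energy U g"
  shows "fin_energy U (\<lambda>x. f x + g x)"
proof -
  have "(\<integral>\<^sup>+x. indicator U x * ennreal (H' x \<bar>f x + g x\<bar>) \<partial>lborel)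
    \<le> (\<integral>\<^sup>+x. ennreal (2 ^ Q) * (indicator U x * ennreal (H' x \<bar>f x\<bar>)) + ennreal (2 ^ Q) * (indicator U x * ennreal (H' x \<bar>g x\<bar>)) \<partial>lborel)"
  proof (rule nn_integral_mono)
    fix x
    have "H' x \<bar>f x + g x\<bar> \<le> H' x (\<bar>f x\<bar> + \<bar>g x\<bar>)" by (intro H'_mono) auto
    also have "\<dots> \<le> 2 ^ Q * (H' x \<bar>f x\<bar> + H' x \<bar>g x\<bar>)" by (intro H'_add) auto
    finally have "ennreal (H' x \<bar>f x + g x\<bar>) \<le> ennreal (2 ^ Q * (H' x \<bar>f x\<bar> + H' x \<bar>g x\<bar>))" by (rule ennreal_leI)
    also have "\<dots> = ennreal (2 ^ Q) * ennreal (H' x \<bar>f x\<bar>) + ennreal (2 ^ Q) * ennreal (H' x \<bar>g x\<bar>)"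
      using H'_nonneg by (simp add: ennreal_mult ennreal_plus distrib_left)
    finally show "indicator U x * ennreal (H' x \<bar>f x + g x\<bar>) \<le> ennreal (2 ^ Q) * (indicator U x * ennreal (H' x \<bar>f x\<bar>)) + ennreal (2 ^ Q) * (indicator U x * ennreal (H' x \<bar>g x\<bar>))"
      by (auto simp: indicator_def)
  qed
  also have "\<dots> < \<infinity>"
    using assms(4,5) by (simp add: nn_integral_add nn_integral_cmult fin_energy_def ennreal_mult_less_top)
  finally show ?thesis by (simp add: fin_energy_def)
qed

lemma fin_energy_scale:
  assumes [measurable]: "f \<in> borel_measurable borel" "U \<in> sets borel" and "fin_energy U f"
  shows "fin_energy U (\<lambda>x. c * f x)"
proof -
  have "(\<integral>\<^sup>+x. indicator U x * ennreal (H' x \<bar>c * f x\<bar>) \<partial>lborel)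
    \<le> (\<integral>\<^sup>+x. ennreal (max 1 \<bar>c\<bar> ^ Q) * (indicator U x * ennreal (H' x \<bar>f x\<bar>)) \<partial>lborel)"
  proof (rule nn_integral_mono)
    fix x
    have "H' x \<bar>c * f x\<bar> \<le> H' x (max 1 \<bar>c\<bar> * \<bar>f x\<bar>)"
      by (intro H'_mono) (auto simp: abs_mult intro!: mult_right_mono)
    also have "\<dots> \<le> max 1 \<bar>c\<bar> ^ Q * H' x \<bar>f x\<bar>" by (intro H'_scale) auto
    finally have "ennreal (H' x \<bar>c * f x\<bar>) \<le> ennreal (max 1 \<bar>c\<bar> ^ Q) * ennreal (H' x \<bar>f x\<bar>)"
      using H'_nonneg by (simp add: ennreal_leI flip: ennreal_mult)
    then show "indicator U x * ennreal (H' x \<bar>c * f x\<bar>) \<le> ennreal (max 1 \<bar>c\<bar> ^ Q) * (indicator U x * ennreal (H' x \<bar>f x\<bar>))"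
      by (auto simp: indicator_def)
  qed
  also have "\<dots> < \<infinity>"
    using assms(3) by (simp add: nn_integral_cmult fin_energy_def ennreal_mult_less_top)
  finally show ?thesis by (simp add: fin_energy_def)
qed

text \<open>Weights are integrable on bounded sets. Truncations at a level and subtraction of a
  constant therefore stay within functions of finite energy on bounded sets.\<close>

lemma fin_energy_const:
  assumes "bounded U" "U \<in> sets borel"
  shows "fin_energy U (\<lambda>x. c)"
proof -
  have [measurable]: "U \<in> sets borel" by fact
  have wt[measurable]: "phase_wt a' i \<in> borel_measurable borel" for i by (simp add: phase_wt_def)
  have wt0: "0 \<le> phase_wt a' i x" for i x using a'_nonneg by (simp add: phase_wt_def)
  have fin: "(\<integral>\<^sup>+x. indicator U x * ennreal (phase_wt a' i x) \<partial>lborel) < \<infinity>" if i: "i \<le> N" for i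
  proof (cases "i = 0")
    case True
    then show ?thesis using emeasure_bounded_finite[OF assms(1)] by (simp add: phase_wt_def)
  next
    case False
    obtain e where e: "U \<subseteq> ball 0 e" using bounded_subset_ballD[OF assms(1)] by blast
    have "(\<integral>\<^sup>+x. indicator U x * ennreal (phase_wt a' i x) \<partial>lborel) = emeasure (wm (a' i)) U"
      using False by (simp add: phase_wt_def emeasure_density mult.commute)
    also have "\<dots> \<le> emeasure (wm (a' i)) (ball 0 e)" using e by (intro emeasure_mono) auto
    also have "\<dots> < \<infinity>" using a'_fin[of i 0 e] i False by auto
    finally show ?thesis .
  qed
  have "(\<integral>\<^sup>+x. indicator U x * ennreal (H' x \<bar>c\<bar>) \<partial>lborel)
      = (\<integral>\<^sup>+x. (\<Sum>i\<le>N. ennreal (\<bar>c\<bar> powr phase_exp p ps i) * (indicator U x * ennreal (phase_wt a' i x))) \<partial>lborel)"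
  proof (rule nn_integral_cong)
    fix x
    have "ennreal (H' x \<bar>c\<bar>) = (\<Sum>i\<le>N. ennreal (phase_wt a' i x * \<bar>c\<bar> powr phase_exp p ps i))"
      unfolding multi_phase_eq using wt0 by (intro sum_ennreal[symmetric]) auto
    also have "\<dots> = (\<Sum>i\<le>N. ennreal (\<bar>c\<bar> powr phase_exp p ps i) * ennreal (phase_wt a' i x))"
      using wt0 by (simp add: ennreal_mult mult.commute)
    finally show "indicator U x * ennreal (H' x \<bar>c\<bar>) = (\<Sum>i\<le>N. ennreal (\<bar>c\<bar> powr phase_exp p ps i) * (indicator U x * ennreal (phase_wt a' i x)))"
      by (simp add: sum_distrib_left mult.left_commute)
  qed
  also have "\<dots> = (\<Sum>i\<le>N. ennreal (\<bar>c\<bar> powr phase_exp p ps i) * (\<integral>\<^sup>+x. indicator U x * ennreal (phase_wt a' i x) \<partial>lborel))"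
    by (subst nn_integral_sum) (auto simp: nn_integral_cmult)
  also have "\<dots> < \<infinity>" using fin by (auto simp: ennreal_mult_less_top)
  finally show ?thesis by (simp add: fin_energy_def)
qed

text \<open>The integrand satisfies a doubling condition in t, so finite energy is preserved by
  linear combinations, and the linear hull adds nothing up to null sets.\<close>

lemma L_spaceE:
  assumes "f \<in> L_space H U" "open U"
  obtains f' where "f' \<in> borel_measurable borel" "AE x in lborel. x \<in> U \<longrightarrow> f x = f' x" "fin_energy U f'"
proof -
  have [measurable]: "U \<in> sets borel" using assms(2) by auto
  obtain k :: nat and c g where g: "\<forall>j<k. g j \<in> orlicz_class H U" and f: "\<forall>x\<in>U. f x = (\<Sum>j<k. c j * g j x)"
    using assms(1) unfolding L_space_def by blast
  have "\<forall>j. \<exists>g'. j < k \<longrightarrow> g' \<in> borel_measurable borel \<and> (AE x in lborel. x \<in> U \<longrightarrow> g j x = g' x) \<and> fin_energy U g'"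
  proof
    fix j
    show "\<exists>g'. j < k \<longrightarrow> g' \<in> borel_measurable borel \<and> (AE x in lborel. x \<in> U \<longrightarrow> g j x = g' x) \<and> fin_energy U g'"
    proof (cases "j < k")
      case True
      obtain g' where "g' \<in> borel_measurable borel" "AE x in lborel. x \<in> U \<longrightarrow> g j x = g' x" "fin_energy U g'"
        using orlicz_classE[OF g[rule_format, OF True] assms(2)] .
      then show ?thesis by blast
    qed simp
  qed
  then obtain g' where g': "\<And>j. j < k \<Longrightarrow> g' j \<in> borel_measurable borel"
    "\<And>j. j < k \<Longrightarrow> AE x in lborel. x \<in> U \<longrightarrow> g j x = g' j x" "\<And>j. j < k \<Longrightarrow> fin_energy U (g' j)"
    unfolding choice_iff by blast
  have meas: "(\<lambda>x. \<Sum>j<l. c j * g' j x) \<in> borel_measurable borel" if "l \<le> k" for l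
    using that g'(1) by (intro borel_measurable_sum borel_measurable_times) auto
  have "fin_energy U (\<lambda>x. \<Sum>j<l. c j * g' j x)" if "l \<le> k" for l
    using that
  proof (induction l)
    case 0
    then show ?case by (simp add: fin_energy_def multi_phase_def)
  next
    case (Suc l)
    then have "fin_energy U (\<lambda>x. (\<Sum>j<l. c j * g' j x) + c l * g' l x)"
      using g' meas[of l] by (intro fin_energy_add fin_energy_scale) auto
    then show ?case by simp
  qed
  moreover have "AE x in lborel. \<forall>j\<in>{..<k}. x \<in> U \<longrightarrow> g j x = g' j x"
    using g'(2) by (intro AE_finite_allI) auto
  then have "AE x in lborel. x \<in> U \<longrightarrow> f x = (\<Sum>j<k. c j * g' j x)"
    by eventually_elim (use f in \<open>auto intro!: sum.cong\<close>)
  ultimately show ?thesis using that meas[of k] by blast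
qed

lemma orlicz_class_L_space: "f \<in> orlicz_class H U \<Longrightarrow> f \<in> L_space H U"
  unfolding L_space_def by (auto intro!: exI[of _ "1::nat"] exI[of _ "\<lambda>_. 1"] exI[of _ "\<lambda>_. f"])

text \<open>Pointwise convexity makes the gradient energy of the level set, weighted by \<eta>^Q,
  appear on the left after minimality is used; the common energy is finite and cancels. The sign
  \<open>\<sigma>\<close> treats upper and lower level sets together.\<close>

lemma minimizer_Caccioppoli:
  fixes \<sigma> \<kappa> \<rho> R :: real
  assumes op: "open \<Omega>" and min: "local_minimizer H \<Omega> u"
    and w: "wgrad \<Omega> U G" and uU: "AE x in lborel. x \<in> \<Omega> \<longrightarrow> u x = U x"
    and finU: "fin_energy \<Omega> U" and finG: "fin_energy \<Omega> (\<lambda>x. norm (G x))"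
    and \<sigma>: "\<sigma> = 1 \<or> \<sigma> = -1" and \<rho>: "0 < \<rho>" "\<rho> < R" and sub: "cball x0 R \<subseteq> \<Omega>"
  shows "(\<integral>\<^sup>+x. indicator (ball x0 \<rho>) x * (indicator {x. \<kappa> < \<sigma> * U x} x * ennreal (H' x (norm (G x)))) \<partial>lborel)
    \<le> ennreal (Caccioppoli_const Q) * (\<integral>\<^sup>+x. indicator (ball x0 R) x * ennreal (H' x (max 0 (\<sigma> * U x - \<kappa>) / (R - \<rho>))) \<partial>lborel)"
proof -
  have \<sigma>2: "\<sigma> * \<sigma> = 1" using \<sigma> by auto
  have [measurable]: "U \<in> borel_measurable borel" "G \<in> borel_measurable borel" using w by (auto simp: wgrad_def)
  have Q2: "2 \<le> Q" by (rule phase_top_ge_2[OF p ps])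
  have Q1: "1 \<le> real Q" using Q2 by linarith
  obtain \<eta> where \<eta>: "smooth_fn \<eta>" "\<And>x. 0 \<le> \<eta> x" "\<And>x. \<eta> x \<le> 1"
    "\<And>x. x \<notin> ball x0 R \<Longrightarrow> \<eta> x = 0" "\<And>x. x \<in> ball x0 \<rho> \<Longrightarrow> exp (- 1) \<le> \<eta> x"
    "\<And>x. norm (\<chi> i. partial i \<eta> x) \<le> 4 / (R - \<rho>)" "\<And>x. \<eta> x = 0 \<Longrightarrow> (\<chi> i. partial i \<eta> x) = 0"
    by (rule cutoff_exists[OF \<rho>, of x0]) blast
  define \<zeta> where "\<zeta> = (\<lambda>x. \<eta> x ^ Q)"
  have \<zeta>_smooth: "smooth_fn \<zeta>" unfolding \<zeta>_def by (rule smooth_power[OF \<eta>(1)])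
  have [measurable]: "\<eta> \<in> borel_measurable borel" "\<zeta> \<in> borel_measurable borel"
    by (rule smooth_measurable[OF \<eta>(1)]) (rule smooth_measurable[OF \<zeta>_smooth])
  have \<zeta>01: "0 \<le> \<zeta> x" "\<zeta> x \<le> 1" for x using \<eta>(2,3) by (auto simp: \<zeta>_def power_le_one)
  define S where "S = {x. \<kappa> < \<sigma> * U x}"
  have [measurable]: "S \<in> sets borel" unfolding S_def by measurable
  define v where "v = (\<lambda>x. max 0 (\<sigma> * U x - \<kappa>))"
  have [measurable]: "v \<in> borel_measurable borel" unfolding v_def by measurable
  have v0: "0 \<le> v x" for x by (simp add: v_def)
  define Gv where "Gv = (\<lambda>x. (if \<kappa> < \<sigma> * U x then 1 else 0) *\<^sub>R (\<sigma> *\<^sub>R G x))"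
  define D where "D = (\<lambda>x. \<zeta> x *\<^sub>R Gv x + v x *\<^sub>R (\<chi> i. partial i \<zeta> x))"
  define Hw where "Hw = (\<lambda>x. G x - \<sigma> *\<^sub>R D x)"
  have wv: "wgrad \<Omega> v Gv" unfolding v_def Gv_def by (rule wgrad_pos_part[OF wgrad_sign[OF w op \<sigma>] op])
  have wD: "wgrad \<Omega> (\<lambda>x. \<zeta> x * v x) D" unfolding D_def by (rule wgrad_smooth_mult[OF wv op \<zeta>_smooth])
  have wHw: "wgrad \<Omega> (\<lambda>x. U x - \<sigma> * (\<zeta> x * v x)) Hw"
    unfolding Hw_def by (rule wgrad_diff[OF w wgrad_sign[OF wD op \<sigma>]])
  have [measurable]: "Hw \<in> borel_measurable borel" using wHw by (simp add: wgrad_def)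
  \<comment> \<open>The competitor is built from \<open>u\<close> itself and not from its
    representative \<open>U\<close>, so that u - w' equals the correction term at every point and
    its support can be computed.\<close>
  define w' where "w' = (\<lambda>x. u x - \<sigma> * (\<zeta> x * v x))"
  have w'_eq: "AE x in lborel. x \<in> \<Omega> \<longrightarrow> w' x = U x - \<sigma> * (\<zeta> x * v x)"
    using uU by eventually_elim (simp add: w'_def)
  have pz: "(\<chi> i. partial i \<zeta> x) = (real Q * \<eta> x ^ (Q - 1)) *\<^sub>R (\<chi> i. partial i \<eta> x)" for x
    unfolding \<zeta>_def by (rule partial_power[OF \<eta>(1)])
  have zero: "\<zeta> x = 0 \<and> (\<chi> i. partial i \<zeta> x) = 0" if "\<eta> x = 0" for x
  proof
    show "\<zeta> x = 0" using Q2 that by (simp add: \<zeta>_def)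
    show "(\<chi> i. partial i \<zeta> x) = 0" unfolding pz using \<eta>(7)[OF that] by simp
  qed
  define Z where "Z = (\<lambda>x. (4 * real Q) ^ Q * H' x (v x / (R - \<rho>)))"
  have Z0: "0 \<le> Z x" for x unfolding Z_def using H'_nonneg by (intro mult_nonneg_nonneg) auto
  have [measurable]: "Z \<in> borel_measurable borel" unfolding Z_def by measurable
  \<comment> \<open>On the level set the new gradient is (1 - \<zeta>) G minus \<sigma> v times the
    gradient of \<zeta>, and that gradient is Q \<eta>^(Q-1) times the gradient of \<eta>: the shape
    required by \<open>H'_convex_cutoff\<close>.\<close>
  have key: "ennreal (H' x (norm (Hw x))) + indicator S x * (ennreal (\<zeta> x) * ennreal (H' x (norm (G x))))
    \<le> ennreal (H' x (norm (G x))) + indicator (ball x0 R) x * ennreal (Z x)" for x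
  proof (cases "x \<in> S \<and> \<eta> x \<noteq> 0")
    case True
    then have xS: "\<kappa> < \<sigma> * U x" and e: "0 < \<eta> x" using \<eta>(2)[of x] by (auto simp: S_def less_le)
    have xR: "x \<in> ball x0 R" using \<eta>(4)[of x] True by blast
    define z where "z = real Q * v x * norm (\<chi> i. partial i \<eta> x)"
    have z0: "0 \<le> z" by (simp add: z_def v0)
    have "Hw x = (1 - \<zeta> x) *\<^sub>R G x - (\<sigma> * v x) *\<^sub>R (\<chi> i. partial i \<zeta> x)"
      using xS \<sigma>2 by (simp add: Hw_def D_def Gv_def scaleR_add_right scaleR_diff_left mult.assoc[symmetric])
    then have "norm (Hw x) \<le> (1 - \<zeta> x) * norm (G x) + \<bar>\<sigma>\<bar> * v x * norm (\<chi> i. partial i \<zeta> x)"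
      using norm_triangle_ineq4[of "(1 - \<zeta> x) *\<^sub>R G x" "(\<sigma> * v x) *\<^sub>R (\<chi> i. partial i \<zeta> x)"] \<zeta>01[of x] v0[of x]
      by (simp add: abs_mult)
    also have "\<bar>\<sigma>\<bar> * v x * norm (\<chi> i. partial i \<zeta> x) = \<eta> x ^ (Q - 1) * z"
      using \<sigma> e by (auto simp: pz z_def)
    finally have t: "norm (Hw x) \<le> (1 - \<eta> x ^ Q) * norm (G x) + \<eta> x ^ (Q - 1) * z" by (simp add: \<zeta>_def)
    have "H' x (norm (Hw x)) + \<zeta> x * H' x (norm (G x)) \<le> H' x (norm (G x)) + H' x z"
      unfolding \<zeta>_def by (rule H'_convex_cutoff[OF e \<eta>(3) _ z0 _ t]) auto
    also have "H' x z \<le> Z x"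
    proof -
      have "z \<le> (4 * real Q) * (v x / (R - \<rho>))"
        unfolding z_def using mult_left_mono[OF \<eta>(6)[of x], of "real Q * v x"] v0[of x] by (simp add: mult_ac)
      then have "H' x z \<le> H' x ((4 * real Q) * (v x / (R - \<rho>)))" using z0 by (intro H'_mono)
      also have "\<dots> \<le> Z x" unfolding Z_def using Q1 v0[of x] \<rho> by (intro H'_scale) auto
      finally show ?thesis .
    qed
    finally have "H' x (norm (Hw x)) + \<zeta> x * H' x (norm (G x)) \<le> H' x (norm (G x)) + Z x" by simp
    then show ?thesis using True xR H'_nonneg \<zeta>01[of x] Z0[of x]
      by (simp add: ennreal_leI flip: ennreal_mult ennreal_plus del: mem_ball)
  next
    case False
    \<comment> \<open>Off the level set the truncation and its gradient vanish, and where \<eta> = 0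
      the gradient of \<zeta> vanishes too; the competitor has the old gradient in both
      cases.\<close>
    then have HG: "Hw x = G x"
    proof (cases "x \<in> S")
      case True
      then have "\<eta> x = 0" using False by simp
      then show ?thesis using zero by (simp add: Hw_def D_def)
    next
      case False
      then show ?thesis by (simp add: Hw_def D_def Gv_def v_def S_def)
    qed
    have Z0': "indicator S x * (ennreal (\<zeta> x) * ennreal (H' x (norm (G x)))) = 0"
      using False zero by (auto simp: indicator_def)
    show ?thesis unfolding HG Z0' by simp
  qed
  have Hw_le: "ennreal (H' x (norm (Hw x))) \<le> ennreal (H' x (norm (G x))) + ennreal (Z x)" for x
  proof -
    have "ennreal (H' x (norm (Hw x))) \<le> ennreal (H' x (norm (Hw x))) + indicator S x * (ennreal (\<zeta> x) * ennreal (H' x (norm (G x))))"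
      by simp
    also note key[of x]
    also have "ennreal (H' x (norm (G x))) + indicator (ball x0 R) x * ennreal (Z x) \<le> ennreal (H' x (norm (G x))) + ennreal (Z x)"
      by (intro add_left_mono) (auto simp: indicator_def)
    finally show ?thesis .
  qed
  have W: "w' \<in> W_loc_space H \<Omega>"
    unfolding W_loc_space_def
  proof (safe)
    fix V assume V: "open V" "compactly_contained V \<Omega>"
    have V\<Omega>: "V \<subseteq> \<Omega>" and bV: "bounded V"
      using V(2) closure_subset[of V] compact_imp_bounded bounded_subset by (auto simp: compactly_contained_def)
    have [measurable]: "V \<in> sets borel" using V(1) by auto
    have eqV: "AE x in lborel. x \<in> V \<longrightarrow> w' x = U x - \<sigma> * (\<zeta> x * v x)" using w'_eq by eventually_elim (use V\<Omega> in auto)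
    have wV: "wgrad V (\<lambda>x. U x - \<sigma> * (\<zeta> x * v x)) Hw" by (rule wgrad_subset[OF wHw V\<Omega>])
    have finUV: "fin_energy V (\<lambda>x. \<bar>U x\<bar>)" by (rule fin_energy_mono[OF finU _ V\<Omega>]) simp
    have fin_\<kappa>: "fin_energy V (\<lambda>x. \<bar>\<kappa>\<bar>)" by (rule fin_energy_const[OF bV]) simp
    have finUk: "fin_energy V (\<lambda>x. \<bar>U x\<bar> + \<bar>\<kappa>\<bar>)" by (rule fin_energy_add[OF _ _ _ finUV fin_\<kappa>]) measurable
    have v_le: "v x \<le> \<bar>U x\<bar> + \<bar>\<kappa>\<bar>" for x using \<sigma> by (auto simp: v_def)
    have fin1: "fin_energy V (\<lambda>x. U x - \<sigma> * (\<zeta> x * v x))"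
    proof (rule fin_energy_mono[of V "\<lambda>x. \<bar>U x\<bar> + (\<bar>U x\<bar> + \<bar>\<kappa>\<bar>)"])
      show "fin_energy V (\<lambda>x. \<bar>U x\<bar> + (\<bar>U x\<bar> + \<bar>\<kappa>\<bar>))" by (rule fin_energy_add[OF _ _ _ finUV finUk]) measurable
      fix x
      have "\<zeta> x * v x \<le> 1 * v x" using \<zeta>01[of x] v0[of x] by (intro mult_right_mono) auto
      moreover have "\<bar>\<sigma> * (\<zeta> x * v x)\<bar> = \<zeta> x * v x" using \<sigma> \<zeta>01[of x] v0[of x] by (auto simp: abs_mult)
      ultimately have "\<bar>U x - \<sigma> * (\<zeta> x * v x)\<bar> \<le> \<bar>U x\<bar> + v x" by linarith
      then show "\<bar>U x - \<sigma> * (\<zeta> x * v x)\<bar> \<le> \<bar>\<bar>U x\<bar> + (\<bar>U x\<bar> + \<bar>\<kappa>\<bar>)\<bar>" using v_le[of x] by linarith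
    qed simp
    have "fin_energy V (\<lambda>x. v x / (R - \<rho>))"
    proof (rule fin_energy_mono[of V "\<lambda>x. (1 / (R - \<rho>)) * (\<bar>U x\<bar> + \<bar>\<kappa>\<bar>)"])
      show "fin_energy V (\<lambda>x. 1 / (R - \<rho>) * (\<bar>U x\<bar> + \<bar>\<kappa>\<bar>))" by (intro fin_energy_scale finUk) auto
      show "\<bar>v x / (R - \<rho>)\<bar> \<le> \<bar>1 / (R - \<rho>) * (\<bar>U x\<bar> + \<bar>\<kappa>\<bar>)\<bar>" for x
        using v_le[of x] v0[of x] \<rho> by (simp add: abs_mult divide_right_mono)
    qed simp
    then have finZ: "(\<integral>\<^sup>+x. indicator V x * ennreal (Z x) \<partial>lborel) < \<infinity>"
    proof -
      assume f: "fin_energy V (\<lambda>x. v x / (R - \<rho>))"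
      have "(\<integral>\<^sup>+x. indicator V x * ennreal (Z x) \<partial>lborel) = (\<integral>\<^sup>+x. ennreal ((4 * real Q) ^ Q) * (indicator V x * ennreal (H' x \<bar>v x / (R - \<rho>)\<bar>)) \<partial>lborel)"
        using v0 \<rho> H'_nonneg by (intro nn_integral_cong) (auto simp: Z_def ennreal_mult mult.left_commute)
      then show ?thesis using f by (simp add: nn_integral_cmult fin_energy_def ennreal_mult_less_top)
    qed
    have fin2: "fin_energy V (\<lambda>x. norm (Hw x))"
    proof -
      have "(\<integral>\<^sup>+x. indicator V x * ennreal (H' x \<bar>norm (Hw x)\<bar>) \<partial>lborel)
         \<le> (\<integral>\<^sup>+x. indicator \<Omega> x * ennreal (H' x \<bar>norm (G x)\<bar>) + indicator V x * ennreal (Z x) \<partial>lborel)"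
        using V\<Omega> Hw_le by (intro nn_integral_mono) (auto simp: indicator_def)
      also have "\<dots> = (\<integral>\<^sup>+x. indicator \<Omega> x * ennreal (H' x \<bar>norm (G x)\<bar>) \<partial>lborel) + (\<integral>\<^sup>+x. indicator V x * ennreal (Z x) \<partial>lborel)"
        using op by (intro nn_integral_add) auto
      also have "\<dots> < \<infinity>" using finG finZ by (simp add: fin_energy_def)
      finally show ?thesis by (simp add: fin_energy_def)
    qed
    show "w' \<in> W_space H V"
      unfolding W_space_def
    proof (intro CollectI conjI)
      show "w' \<in> L_space H V"
        by (rule orlicz_class_L_space, rule orlicz_classI[OF V(1) _ eqV fin1]) measurable
      show "\<exists>G. has_weak_gradient V w' G" using wgrad_imp_has_weak_gradient[OF wV V(1) eqV] by blast
      have "AE x in lborel. x \<in> V \<longrightarrow> norm (weak_gradient V w' x) = norm (Hw x)"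
        using weak_gradient_AE_eq[OF wV V(1) eqV] by eventually_elim auto
      then show "(\<lambda>x. norm (weak_gradient V w' x)) \<in> L_space H V"
        by (intro orlicz_class_L_space orlicz_classI[OF V(1) _ _ fin2]) auto
    qed
  qed
  define T where "T = supp \<Omega> (\<lambda>x. u x - w' x)"
  have T_sub: "T \<subseteq> cball x0 R"
    unfolding T_def supp_def support_on_def
  proof (rule closure_minimal)
    show "{x \<in> \<Omega>. u x - w' x \<noteq> 0} \<subseteq> cball x0 R"
    proof
      fix x assume "x \<in> {x \<in> \<Omega>. u x - w' x \<noteq> 0}"
      then have "\<zeta> x \<noteq> 0" by (auto simp: w'_def)
      then have "\<eta> x \<noteq> 0" using zero by blast
      then have "x \<in> ball x0 R" using \<eta>(4) by blast
      then show "x \<in> cball x0 R" by simp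
    qed
  qed simp
  have T_closed: "closed T" by (simp add: T_def supp_def)
  then have [measurable]: "T \<in> sets borel" by simp
  have T\<Omega>: "T \<subseteq> \<Omega>" using T_sub sub by blast
  have "compact T" using T_closed T_sub compact_cball[of x0 R] by (metis compact_Int_closed inf.absorb_iff2)
  then have cc: "compactly_contained T \<Omega>" using T\<Omega> T_closed by (simp add: compactly_contained_def closure_closed)
  have le: "energy H \<Omega> u T \<le> energy H \<Omega> w' T"
    using min W cc unfolding local_minimizer_def Let_def T_def by blast
  define X where "X = (\<integral>\<^sup>+x. indicator T x * ennreal (H' x (norm (Hw x))) \<partial>lborel)"
  define Y where "Y = (\<integral>\<^sup>+x. indicator T x * (indicator S x * (ennreal (\<zeta> x) * ennreal (H' x (norm (G x))))) \<partial>lborel)"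
  define E where "E = (\<integral>\<^sup>+x. indicator T x * ennreal (H' x (norm (G x))) \<partial>lborel)"
  define B where "B = (\<integral>\<^sup>+x. indicator T x * (indicator (ball x0 R) x * ennreal (Z x)) \<partial>lborel)"
  have eu: "energy H \<Omega> u T = E"
    unfolding energy_def E_def
    by (rule nn_integral_H_eq[OF _ T\<Omega>]) (use weak_gradient_AE_eq[OF w op uU] in eventually_elim, auto)
  have ew: "energy H \<Omega> w' T = X"
    unfolding energy_def X_def
    by (rule nn_integral_H_eq[OF _ T\<Omega>]) (use weak_gradient_AE_eq[OF wHw op w'_eq] in eventually_elim, auto)
  have EX: "E \<le> X" using le eu ew by simp
  \<comment> \<open>Finiteness of the energy on the support is what allows it to be cancelled from E
    + Y \<le> E + B.\<close>
  have Efin: "E < \<infinity>"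
  proof -
    have "E \<le> (\<integral>\<^sup>+x. indicator \<Omega> x * ennreal (H' x \<bar>norm (G x)\<bar>) \<partial>lborel)"
      unfolding E_def using T\<Omega> by (intro nn_integral_mono) (auto simp: indicator_def)
    then show ?thesis using finG by (auto simp: fin_energy_def)
  qed
  have [measurable]: "(\<lambda>x. H' x (norm (Hw x))) \<in> borel_measurable borel" "(\<lambda>x. H' x (norm (G x))) \<in> borel_measurable borel"
    by (rule H'_measurable, measurable)+
  have "X + Y = (\<integral>\<^sup>+x. indicator T x * (ennreal (H' x (norm (Hw x))) + indicator S x * (ennreal (\<zeta> x) * ennreal (H' x (norm (G x))))) \<partial>lborel)"
    unfolding X_def Y_def distrib_left by (rule nn_integral_add[symmetric]) measurable
  also have "\<dots> \<le> (\<integral>\<^sup>+x. indicator T x * (ennreal (H' x (norm (G x))) + indicator (ball x0 R) x * ennreal (Z x)) \<partial>lborel)"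
    by (intro nn_integral_mono mult_left_mono key) auto
  also have "\<dots> = E + B"
    unfolding E_def B_def distrib_left by (rule nn_integral_add) measurable
  finally have "E + Y \<le> E + B" using EX by (meson add_right_mono order_trans)
  then have YB: "Y \<le> B" using Efin by (auto simp: ennreal_add_left_cancel_le)
  have "(\<integral>\<^sup>+x. indicator (ball x0 \<rho>) x * (indicator S x * ennreal (H' x (norm (G x)))) \<partial>lborel)
    \<le> (\<integral>\<^sup>+x. ennreal (exp Q) * (indicator T x * (indicator S x * (ennreal (\<zeta> x) * ennreal (H' x (norm (G x)))))) \<partial>lborel)"
  proof (rule nn_integral_mono)
    fix x
    show "indicator (ball x0 \<rho>) x * (indicator S x * ennreal (H' x (norm (G x)))) \<le> ennreal (exp Q) * (indicator T x * (indicator S x * (ennreal (\<zeta> x) * ennreal (H' x (norm (G x))))))"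
    proof (cases "x \<in> ball x0 \<rho> \<and> x \<in> S")
      case True
      \<comment> \<open>On the inner ball \<zeta> \<ge> exp(-Q), and on the level set the correction
        is nonzero, so these points belong to the support \<open>T\<close> on which minimality was
        used.\<close>
      then have e: "exp (- 1) \<le> \<eta> x" using \<eta>(5) by blast
      have "exp (- 1) ^ Q \<le> \<zeta> x" unfolding \<zeta>_def using e by (intro power_mono) auto
      moreover have "exp (- 1) ^ Q = 1 / exp (real Q)" by (subst exp_of_nat_mult[symmetric]) (simp add: exp_minus inverse_eq_divide)
      ultimately have z1: "1 \<le> exp (real Q) * \<zeta> x" by (simp add: divide_le_eq mult.commute)
      have "\<zeta> x \<noteq> 0" using z1 by auto
      moreover have "0 < v x" using True by (simp add: v_def S_def)
      ultimately have "u x - w' x \<noteq> 0" using \<sigma> by (auto simp: w'_def)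
      moreover have "x \<in> \<Omega>" using True sub \<rho> by (auto simp: subset_iff)
      ultimately have xT: "x \<in> T" unfolding T_def supp_def support_on_def using closure_subset by fastforce
      have "H' x (norm (G x)) \<le> exp (real Q) * \<zeta> x * H' x (norm (G x))"
        using mult_right_mono[OF z1 H'_nonneg] by simp
      then have "ennreal (H' x (norm (G x))) \<le> ennreal (exp (real Q) * \<zeta> x * H' x (norm (G x)))" by (rule ennreal_leI)
      also have "\<dots> = ennreal (exp Q) * (ennreal (\<zeta> x) * ennreal (H' x (norm (G x))))"
        using \<zeta>01[of x] H'_nonneg by (simp add: ennreal_mult mult.assoc)
      finally show ?thesis using True xT by simp
    qed (auto simp: indicator_def)
  qed
  also have "\<dots> = ennreal (exp Q) * Y" unfolding Y_def by (rule nn_integral_cmult) measurable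
  also have "\<dots> \<le> ennreal (exp Q) * B" by (intro mult_left_mono YB) auto
  also have "\<dots> \<le> ennreal (exp Q) * (\<integral>\<^sup>+x. ennreal ((4 * real Q) ^ Q) * (indicator (ball x0 R) x * ennreal (H' x (v x / (R - \<rho>)))) \<partial>lborel)"
    unfolding B_def using H'_nonneg
    by (intro mult_left_mono nn_integral_mono) (auto simp: Z_def indicator_def ennreal_mult)
  also have "\<dots> = ennreal (exp Q) * (ennreal ((4 * real Q) ^ Q) * (\<integral>\<^sup>+x. indicator (ball x0 R) x * ennreal (H' x (v x / (R - \<rho>))) \<partial>lborel))"
    by (subst nn_integral_cmult) auto
  also have "\<dots> = ennreal (Caccioppoli_const Q) * (\<integral>\<^sup>+x. indicator (ball x0 R) x * ennreal (H' x (v x / (R - \<rho>))) \<partial>lborel)"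
    by (simp add: Caccioppoli_const_def ennreal_mult mult.assoc)
  finally show ?thesis by (simp add: S_def v_def)
qed

end

text \<open>The smallness condition of the De Giorgi iteration holds for every \<open>M\<close> with
  \<open>mass M \<ge> e / threshold\<close>; comparing with the essential supremum \<open>L\<close> turns it into an upper bound for \<open>mass L\<close>.\<close>

lemma mass_esssup_le:
  fixes mass :: "real \<Rightarrow> real"
  assumes sup: "\<And>M. 0 < M \<Longrightarrow> e \<le> T * mass M \<Longrightarrow> L \<le> M"
    and cont: "\<And>t. 0 < t \<Longrightarrow> isCont mass t" and "mass 0 = 0" and "0 \<le> L" "0 \<le> e"
  shows "T * mass L \<le> e"
proof (cases "L = 0")
  case False
  then have L: "0 < L" using assms by simp
  \<comment> \<open>Below \<open>L\<close> the contrapositive of \<open>sup\<close> bounds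
    \<open>T * mass t\<close> by \<open>e\<close>; continuity from the left carries the bound to
    \<open>L\<close> itself.\<close>
  have "((\<lambda>t. T * mass t) \<longlongrightarrow> T * mass L) (at_left L)"
    using cont[OF L] by (intro tendsto_mult tendsto_const) (auto simp: isCont_def intro: tendsto_within_subset)
  moreover have "eventually (\<lambda>t. t \<in> {0<..<L}) (at_left L)" using L by (rule eventually_at_left_real)
  then have "eventually (\<lambda>t. T * mass t \<le> e) (at_left L)"
  proof eventually_elim
    case (elim t)
    then show ?case using sup[of t] by force
  qed
  ultimately show ?thesis by (rule tendsto_upperbound) simp
qed (use assms in simp)

section \<open>From bounds on level sets to the estimate of the essential supremum\<close>

lemma compact_AE_bounded:
  fixes K :: "'a::euclidean_space set" and f :: "'a \<Rightarrow> real"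
  assumes "compact K" and loc: "\<And>x. x \<in> K \<Longrightarrow> \<exists>r>0. \<exists>M. AE y in lborel. y \<in> ball x r \<longrightarrow> \<bar>f y\<bar> \<le> M"
  shows "\<exists>M. AE y in lborel. y \<in> K \<longrightarrow> \<bar>f y\<bar> \<le> M"
proof -
  obtain r M where rM: "\<And>x. x \<in> K \<Longrightarrow> 0 < r x" "\<And>x. x \<in> K \<Longrightarrow> AE y in lborel. y \<in> ball x (r x) \<longrightarrow> \<bar>f y\<bar> \<le> M x"
    using loc by metis
  obtain D where D: "D \<subseteq> K" "finite D" "K \<subseteq> (\<Union>x\<in>D. ball x (r x))"
    using compactE_image[OF \<open>compact K\<close>, of K "\<lambda>x. ball x (r x)"] rM(1) by force
  have "AE y in lborel. \<forall>x\<in>D. y \<in> ball x (r x) \<longrightarrow> \<bar>f y\<bar> \<le> M x"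
    using D rM(2) by (intro AE_finite_allI) auto
  then have "AE y in lborel. y \<in> K \<longrightarrow> \<bar>f y\<bar> \<le> (\<Sum>x\<in>D. \<bar>M x\<bar>)"
  proof eventually_elim
    case (elim y)
    show ?case
    proof
      assume "y \<in> K"
      then obtain x where x: "x \<in> D" "y \<in> ball x (r x)" using D(3) by blast
      then have "\<bar>f y\<bar> \<le> \<bar>M x\<bar>" using elim by fastforce
      also have "\<dots> \<le> (\<Sum>x\<in>D. \<bar>M x\<bar>)" using x(1) D(2) by (intro member_le_sum) auto
      finally show "\<bar>f y\<bar> \<le> (\<Sum>x\<in>D. \<bar>M x\<bar>)" .
    qed
  qed
  then show ?thesis by blast
qed

lemma Linf_norm_le:
  assumes "f \<in> borel_measurable (lebesgue_on D)" "D \<in> sets lebesgue" "AE x in lborel. x \<in> D \<longrightarrow> \<bar>f x\<bar> \<le> M"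
  shows "Linf_norm D f \<le> ennreal M"
  unfolding Linf_norm_def
proof (rule esssup_I)
  show "(\<lambda>x. ennreal \<bar>f x\<bar>) \<in> borel_measurable (lebesgue_on D)" using assms(1) by measurable
  show "AE x in lebesgue_on D. ennreal \<bar>f x\<bar> \<le> ennreal M"
    using assms(3) by (subst AE_restrict_space_iff) (use assms(2) in \<open>auto simp: AE_completion_iff ennreal_leI\<close>)
qed

context multi_phase_setting
begin

lemma nn_integral_H':
  assumes [measurable]: "\<phi> \<in> borel_measurable borel" "f \<in> borel_measurable borel"
  shows "(\<integral>\<^sup>+x. \<phi> x * ennreal (H' x (f x)) \<partial>lborel)
    = (\<Sum>i\<le>N. \<integral>\<^sup>+x. \<phi> x * (ennreal (f x powr phase_exp p ps i) * ennreal (phase_wt a' i x)) \<partial>lborel)"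
proof -
  have [measurable]: "phase_wt a' i \<in> borel_measurable borel" for i by (simp add: phase_wt_def)
  have wt0: "0 \<le> phase_wt a' i x" for i x using a'_nonneg by (simp add: phase_wt_def)
  have "ennreal (H' x t) = (\<Sum>i\<le>N. ennreal (t powr phase_exp p ps i) * ennreal (phase_wt a' i x))" for x t
  proof -
    have "ennreal (H' x t) = (\<Sum>i\<le>N. ennreal (phase_wt a' i x * t powr phase_exp p ps i))"
      unfolding multi_phase_eq using wt0 by (intro sum_ennreal[symmetric]) auto
    then show ?thesis using wt0 by (simp add: ennreal_mult mult.commute)
  qed
  then show ?thesis by (simp add: sum_distrib_left nn_integral_sum)
qed

text \<open>Subtracting \<open>m\<close> only shifts levels: \<sigma> (U - m) exceeds k iff \<sigma>
  U exceeds k + \<sigma> m. The Caccioppoli inequality holds at all real levels, so \<open>m\<close>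
  may be arbitrary.\<close>

lemma minimizer_De_Giorgi:
  assumes op: "open \<Omega>" and min: "local_minimizer H \<Omega> u"
    and w: "wgrad \<Omega> U G" and uU: "AE x in lborel. x \<in> \<Omega> \<longrightarrow> u x = U x"
    and finU: "fin_energy \<Omega> U" and finG: "fin_energy \<Omega> (\<lambda>x. norm (G x))"
    and \<sigma>: "\<sigma> = 1 \<or> \<sigma> = -1" and r: "0 < r" and sub: "cball x0 (2 * r) \<subseteq> \<Omega>"
    and wt: "\<And>i. i \<le> N \<Longrightarrow> Ap_weight (phase_exp p ps i) (K i) (phase_wt a' i)" and K: "\<And>i. i \<le> N \<Longrightarrow> 1 \<le> K i"
  shows "De_Giorgi N Q (phase_exp p ps) K (Caccioppoli_const Q) (phase_wt a') (\<lambda>x. \<sigma> * (U x - m)) (\<lambda>x. norm (G x)) x0 r"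
proof
  have [measurable]: "U \<in> borel_measurable borel" "G \<in> borel_measurable borel" using w by (auto simp: wgrad_def)
  show "(\<lambda>x. \<sigma> * (U x - m)) \<in> borel_measurable borel" "(\<lambda>x. norm (G x)) \<in> borel_measurable borel" by measurable
  show "1 < phase_exp p ps i" if "i \<le> N" for i by (rule phase_exp_gt_1[OF p ps that])
  show "phase_exp p ps i \<le> Q" if "i \<le> N" for i by (rule phase_exp_le_top[OF p ps that])
  show "0 \<le> Caccioppoli_const Q" by (simp add: Caccioppoli_const_def)
  show "phase_wt a' 0 = (\<lambda>_. 1)" by (simp add: phase_wt_def)
  show "0 \<le> norm (G x)" for x by simp
  have lev: "k < \<sigma> * (U x - m) \<longleftrightarrow> k + \<sigma> * m < \<sigma> * U x" for x k by (auto simp: algebra_simps)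
  have pos: "max 0 (\<sigma> * (U x - m) - k) = max 0 (\<sigma> * U x - (k + \<sigma> * m))" for x k by (simp add: algebra_simps)
  {
    fix k \<rho> R :: real
    assume *: "0 \<le> k" "r \<le> \<rho>" "\<rho> < R" "R \<le> 2 * r"
    then have \<rho>: "0 < \<rho>" using r by simp
    have "cball x0 R \<subseteq> \<Omega>" using sub *(4) by (auto simp: subset_iff)
    note C = minimizer_Caccioppoli[OF op min w uU finU finG \<sigma> \<rho> *(3) this, of "k + \<sigma> * m"]
    have 1: "(\<integral>\<^sup>+x. indicator (ball x0 \<rho>) x * (indicator {x. k + \<sigma> * m < \<sigma> * U x} x * ennreal (H' x (norm (G x)))) \<partial>lborel)
      = (\<Sum>i\<le>N. \<integral>\<^sup>+x. indicator (ball x0 \<rho>) x * (indicator {x. k < \<sigma> * (U x - m)} x * (ennreal (norm (G x) powr phase_exp p ps i) * ennreal (phase_wt a' i x))) \<partial>lborel)"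
      unfolding lev mult.assoc[symmetric, of "indicator (ball x0 \<rho>) _"] by (rule nn_integral_H') measurable
    have 2: "(\<integral>\<^sup>+x. indicator (ball x0 R) x * ennreal (H' x (max 0 (\<sigma> * U x - (k + \<sigma> * m)) / (R - \<rho>))) \<partial>lborel)
      = (\<Sum>i\<le>N. \<integral>\<^sup>+x. indicator (ball x0 R) x * (ennreal ((max 0 (\<sigma> * (U x - m) - k) / (R - \<rho>)) powr phase_exp p ps i) * ennreal (phase_wt a' i x)) \<partial>lborel)"
      unfolding pos by (rule nn_integral_H') measurable
    show "(\<Sum>i\<le>N. \<integral>\<^sup>+x. indicator (ball x0 \<rho>) x * (indicator {x. k < \<sigma> * (U x - m)} x * (ennreal (norm (G x) powr phase_exp p ps i) * ennreal (phase_wt a' i x))) \<partial>lborel)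
      \<le> ennreal (Caccioppoli_const Q) * (\<Sum>i\<le>N. \<integral>\<^sup>+x. indicator (ball x0 R) x * (ennreal ((max 0 (\<sigma> * (U x - m) - k) / (R - \<rho>)) powr phase_exp p ps i) * ennreal (phase_wt a' i x)) \<partial>lborel)"
      using C unfolding 1 2 .
  }
  {
    fix k R s :: real
    assume *: "0 \<le> k" "0 < s" "R + s \<le> 2 * r"
    have s: "cball x0 (R + s) \<subseteq> \<Omega>" using sub *(3) by (auto simp: subset_iff)
    have wv: "wgrad \<Omega> (\<lambda>x. max 0 (\<sigma> * U x - (k + \<sigma> * m))) (\<lambda>x. (if k + \<sigma> * m < \<sigma> * U x then 1 else 0) *\<^sub>R (\<sigma> *\<^sub>R G x))"
      by (rule wgrad_pos_part[OF wgrad_sign[OF w op \<sigma>] op])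
    have n: "ennreal (norm ((if k + \<sigma> * m < \<sigma> * U y then 1 else 0) *\<^sub>R (\<sigma> *\<^sub>R G y)))
      = indicator {x. k + \<sigma> * m < \<sigma> * U x} y * ennreal (norm (G y))" for y
      using \<sigma> by auto
    show "AE x in lborel. x \<in> ball x0 R \<longrightarrow> ennreal (max 0 (\<sigma> * (U x - m) - k)) * emeasure lborel (ball (0::real^'n) s) \<le>
       (\<integral>\<^sup>+y. indicator (ball x s) y * ennreal (max 0 (\<sigma> * (U y - m) - k)) \<partial>lborel) +
       (\<integral>\<^sup>+t. indicator {0<..1} t * (ennreal (s / t ^ CARD('n)) * (\<integral>\<^sup>+y. indicator (ball x (t * s)) y * (indicator {x. k < \<sigma> * (U x - m)} y * ennreal (norm (G y))) \<partial>lborel)) \<partial>lborel)"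
      using wgrad_avg[OF wv *(2) s] unfolding n lev pos .
  }
qed (use wt K r in auto)

lemma minimizer_bound:
  fixes u U :: "real^'n \<Rightarrow> real" and x0 :: "real^'n" and m r :: real and K :: "nat \<Rightarrow> real"
  defines "T \<equiv> DG_threshold CARD('n) N (phase_exp p ps) K Q (Caccioppoli_const Q)"
  defines "L \<equiv> Linf_norm (ball x0 r) (\<lambda>y. u y - m)"
  assumes op: "open \<Omega>" and min: "local_minimizer H \<Omega> u"
    and w: "wgrad \<Omega> U G" and uU: "AE x in lborel. x \<in> \<Omega> \<longrightarrow> u x = U x"
    and finU: "fin_energy \<Omega> U" and finG: "fin_energy \<Omega> (\<lambda>x. norm (G x))"
    and r: "0 < r" and sub: "cball x0 (2 * r) \<subseteq> \<Omega>"
    and wt: "\<And>i. i \<le> N \<Longrightarrow> Ap_weight (phase_exp p ps i) (K i) (phase_wt a' i)" and K: "\<And>i. i \<le> N \<Longrightarrow> 1 \<le> K i"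
  shows "L < \<infinity>" and "nn_avg (ball x0 (2 * r)) (\<lambda>x. ennreal (H x (enn2real L / r)))
      \<le> ennreal (max 1 (1 / T)) * nn_avg (ball x0 (2 * r)) (\<lambda>x. ennreal (H x (\<bar>u x - m\<bar> / r)))"
    and "\<exists>M. AE x in lborel. x \<in> ball x0 r \<longrightarrow> \<bar>u x - m\<bar> \<le> M"
proof -
  let ?B = "ball x0 r" and ?B2 = "ball x0 (2 * r)"
  have [measurable]: "U \<in> borel_measurable borel" using w by (auto simp: wgrad_def)
  have DG: "De_Giorgi N Q (phase_exp p ps) K (Caccioppoli_const Q) (phase_wt a') (\<lambda>x. \<sigma> * (U x - m)) (\<lambda>x. norm (G x)) x0 r"
    if "\<sigma> = 1 \<or> \<sigma> = -1" for \<sigma>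
    by (rule minimizer_De_Giorgi[OF op min w uU finU finG that r sub wt K])
  \<comment> \<open>One instance for U - m and one for m - U. Threshold and \<open>mass\<close>
    involve only the exponents, the weights and the ball, so a single level \<open>M\<close> serves
    both.\<close>
  interpret P: De_Giorgi N Q "phase_exp p ps" K "Caccioppoli_const Q" "phase_wt a'" "\<lambda>x. 1 * (U x - m)" "\<lambda>x. norm (G x)" x0 r
    by (rule DG) simp
  interpret M: De_Giorgi N Q "phase_exp p ps" K "Caccioppoli_const Q" "phase_wt a'" "\<lambda>x. (-1) * (U x - m)" "\<lambda>x. norm (G x)" x0 r
    by (rule DG) simp
  have T: "0 < T" unfolding T_def by (rule P.DG_threshold_pos)
  have B\<Omega>: "?B2 \<subseteq> \<Omega>" "?B \<subseteq> \<Omega>" using sub r by (auto simp: subset_iff)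
  define E where "E = (\<integral>\<^sup>+x. indicator ?B2 x * ennreal (H' x (\<bar>U x - m\<bar> / r)) \<partial>lborel)"
  have fin: "fin_energy ?B2 (\<lambda>x. (1 / r) * (\<bar>U x\<bar> + \<bar>m\<bar>))"
    by (intro fin_energy_scale fin_energy_add fin_energy_const fin_energy_mono[OF finU _ B\<Omega>(1)]) auto
  have "fin_energy ?B2 (\<lambda>x. \<bar>U x - m\<bar> / r)"
    using r by (intro fin_energy_mono[OF fin _ subset_refl]) (auto simp: divide_right_mono abs_mult)
  then have Efin: "E < \<infinity>" using r by (simp add: E_def fin_energy_def)
  define e where "e = enn2real E"
  have Ee: "E = ennreal e" "0 \<le> e" using Efin by (auto simp: e_def)
  have En: "P.En (2 * r) 0 \<le> E" "M.En (2 * r) 0 \<le> E"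
  proof -
    have "(\<Sum>i\<le>N. \<integral>\<^sup>+x. indicator ?B2 x * (ennreal ((max 0 (\<sigma> * (U x - m) - 0) / r) powr phase_exp p ps i) * ennreal (phase_wt a' i x)) \<partial>lborel)
      \<le> E" if \<sigma>: "\<sigma> = 1 \<or> \<sigma> = -1" for \<sigma>
    proof -
      have "(\<Sum>i\<le>N. \<integral>\<^sup>+x. indicator ?B2 x * (ennreal ((max 0 (\<sigma> * (U x - m) - 0) / r) powr phase_exp p ps i) * ennreal (phase_wt a' i x)) \<partial>lborel)
        = (\<integral>\<^sup>+x. indicator ?B2 x * ennreal (H' x (max 0 (\<sigma> * (U x - m) - 0) / r)) \<partial>lborel)"
        by (rule nn_integral_H'[symmetric]) measurable
      also have "\<dots> \<le> E"
        unfolding E_def using \<sigma> r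
        by (intro nn_integral_mono mult_left_mono ennreal_leI H'_mono divide_right_mono) auto
      finally show ?thesis .
    qed
    from this[of 1] this[of "-1"] show "P.En (2 * r) 0 \<le> E" "M.En (2 * r) 0 \<le> E"
      unfolding P.En_def M.En_def by auto
  qed
  have bound: "AE x in lborel. x \<in> ?B \<longrightarrow> \<bar>u x - m\<bar> \<le> M" if M: "0 < M" "e \<le> T * P.mass M" for M
  proof -
    have le: "E \<le> ennreal (T * P.mass M)" using M(2) Ee by (simp add: ennreal_leI)
    have "AE x in lborel. x \<in> ?B \<longrightarrow> 1 * (U x - m) \<le> M"
      by (rule P.sup_bound[OF M(1) P.mass_pos[OF M(1)] order_trans[OF En(1) le[unfolded T_def]]])
    moreover have "AE x in lborel. x \<in> ?B \<longrightarrow> (-1) * (U x - m) \<le> M"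
      by (rule M.sup_bound[OF M(1) M.mass_pos[OF M(1)] order_trans[OF En(2) le[unfolded T_def]]])
    ultimately show ?thesis using uU by eventually_elim (use B\<Omega> in auto)
  qed
  have "AE y in lborel. y \<in> ?B \<longrightarrow> u y - m = U y - m" using uU by eventually_elim (use B\<Omega> in auto)
  then have meas: "(\<lambda>y. u y - m) \<in> borel_measurable (lebesgue_on ?B)"
    by (rule borel_measurable_lebesgue_on_AE[rotated 2]) auto
  have L_le: "L \<le> ennreal M" if "0 < M" "e \<le> T * P.mass M" for M
    unfolding L_def by (rule Linf_norm_le[OF meas _ bound[OF that]]) simp
  define V where "V = measure lborel ?B2"
  have V: "0 < V" unfolding V_def using r by (intro measure_ball_pos) auto
  \<comment> \<open>An explicit admissible level, obtained from the linear lower bound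
    \<open>mass_ge\<close>. It shows that the supremum is finite before the sharper comparison
    below.\<close>
  define M0 where "M0 = r * max 1 (e / (T * V))"
  have M0: "0 < M0" "r \<le> M0" using r by (auto simp: M0_def)
  have "e \<le> T * P.mass M0"
  proof -
    have "e = T * (V * (e / (T * V)))" using T V by simp
    also have "\<dots> \<le> T * (V * (M0 / r))" using T V r by (intro mult_left_mono) (auto simp: M0_def)
    also have "\<dots> \<le> T * P.mass M0" using T P.mass_ge[OF M0(2)] by (intro mult_left_mono) (auto simp: V_def)
    finally show ?thesis .
  qed
  note M0 = M0(1) this
  show L_fin: "L < \<infinity>" using L_le[OF M0] by (auto intro: le_less_trans)
  show "\<exists>M. AE x in lborel. x \<in> ball x0 r \<longrightarrow> \<bar>u x - m\<bar> \<le> M" using bound[OF M0] by blast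
  define l where "l = enn2real L"
  have l: "L = ennreal l" "0 \<le> l" using L_fin by (auto simp: l_def)
  \<comment> \<open>This is the estimate itself: \<open>P.mass l\<close> is the integral of H(x,
    l/r) over the doubled ball, and \<open>e\<close> that of H(x, |u - m|/r).\<close>
  have "T * P.mass l \<le> e"
  proof (rule mass_esssup_le[where mass="P.mass"])
    show "l \<le> M" if "0 < M" "e \<le> T * P.mass M" for M using L_le[OF that] l that by simp
  qed (use l Ee P.isCont_mass P.mass_0 in auto)
  have "(\<integral>\<^sup>+x. indicator ?B2 x * ennreal (H' x (l / r)) \<partial>lborel) = ennreal (P.mass l)"
  proof -
    have "(\<integral>\<^sup>+x. indicator ?B2 x * (ennreal ((l / r) powr phase_exp p ps i) * ennreal (phase_wt a' i x)) \<partial>lborel)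
      = ennreal (measure (wm (phase_wt a' i)) ?B2 * (l / r) powr phase_exp p ps i)" if i: "i \<le> N" for i
    proof -
      have [measurable]: "phase_wt a' i \<in> borel_measurable borel" by (simp add: phase_wt_def)
      have fin: "emeasure (wm (phase_wt a' i)) ?B2 < \<infinity>" using wt[OF i] by (simp add: Ap_weight_def)
      have "(\<integral>\<^sup>+x. indicator ?B2 x * (ennreal ((l / r) powr phase_exp p ps i) * ennreal (phase_wt a' i x)) \<partial>lborel)
        = ennreal ((l / r) powr phase_exp p ps i) * (\<integral>\<^sup>+x. ennreal (phase_wt a' i x) * indicator ?B2 x \<partial>lborel)"
        by (subst nn_integral_cmult[symmetric]) (auto simp: mult_ac)
      also have "(\<integral>\<^sup>+x. ennreal (phase_wt a' i x) * indicator ?B2 x \<partial>lborel) = ennreal (measure (wm (phase_wt a' i)) ?B2)"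
        using fin by (subst emeasure_density[symmetric]) (auto simp: emeasure_eq_ennreal_measure)
      finally show ?thesis by (simp add: ennreal_mult mult.commute)
    qed
    then show ?thesis by (subst nn_integral_H') (auto simp: P.mass_def sum_ennreal)
  qed
  also have "\<dots> \<le> ennreal (1 / T * e)"
    using \<open>T * P.mass l \<le> e\<close> T by (intro ennreal_leI) (simp add: field_simps)
  also have "\<dots> \<le> ennreal (max 1 (1 / T) * e)" using Ee by (intro ennreal_leI mult_right_mono) auto
  also have "\<dots> = ennreal (max 1 (1 / T)) * E" using Ee by (simp add: ennreal_mult)
  finally have main: "(\<integral>\<^sup>+x. indicator ?B2 x * ennreal (H' x (l / r)) \<partial>lborel) \<le> ennreal (max 1 (1 / T)) * E" .
  have "(\<integral>\<^sup>+x\<in>?B2. ennreal (H x (l / r)) \<partial>lebesgue) = (\<integral>\<^sup>+x. indicator ?B2 x * ennreal (H' x (l / r)) \<partial>lborel)"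
    by (rule nn_integral_H_eq[of ?B2]) auto
  moreover have "(\<integral>\<^sup>+x\<in>?B2. ennreal (H x (\<bar>u x - m\<bar> / r)) \<partial>lebesgue) = E"
    unfolding E_def by (rule nn_integral_H_eq[OF _ B\<Omega>(1)]) (use uU in \<open>eventually_elim\<close>, auto)
  ultimately have le: "(\<integral>\<^sup>+x\<in>?B2. ennreal (H x (l / r)) \<partial>lebesgue)
    \<le> ennreal (max 1 (1 / T)) * (\<integral>\<^sup>+x\<in>?B2. ennreal (H x (\<bar>u x - m\<bar> / r)) \<partial>lebesgue)" using main by simp
  show "nn_avg ?B2 (\<lambda>x. ennreal (H x (enn2real L / r)))
      \<le> ennreal (max 1 (1 / T)) * nn_avg ?B2 (\<lambda>x. ennreal (H x (\<bar>u x - m\<bar> / r)))"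
    using divide_right_mono_ennreal[OF le, of "emeasure lebesgue ?B2"]
    unfolding nn_avg_def l_def by (simp add: ennreal_times_divide)
qed

end

lemma Muckenhoupt_borel:
  assumes "a \<in> Muckenhoupt p"
  obtains a' where "a' \<in> borel_measurable borel" "\<And>x. 0 \<le> a' x" "AE x in lborel. a x = a' x"
proof -
  have "a \<in> L1_loc UNIV" and a0: "\<And>x. 0 \<le> a x" using assms by (auto simp: Muckenhoupt_def)
  then have "a \<in> borel_measurable lebesgue" using L1_loc_measurable[of a UNIV] by simp
  then obtain g where g: "g \<in> borel_measurable borel" "AE x in lborel. a x = g x" by (rule lebesgue_ex_borel)
  show ?thesis
  proof (rule that[of "\<lambda>x. max 0 (g x)"])
    show "AE x in lborel. a x = max 0 (g x)"
      using g(2) by eventually_elim (metis a0 max.absorb2)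
  qed (use g(1) in auto)
qed

text \<open>Dependence on the data alone is expressed by the order of quantifiers: the A_p constants
  are prescribed through \<open>K\<close>, and the constants are chosen before the domain, the
  weights and the minimizer.\<close>

theorem theoremB:
  fixes N :: nat and p :: real and ps :: "nat \<Rightarrow> real" and K :: "nat \<Rightarrow> ennreal"
  assumes "CARD('n::finite) \<ge> 2" and "N \<ge> 1" and "1 < p"
    and "\<And>i. i \<in> {1..N} \<Longrightarrow> p \<le> ps i"
    and "\<And>i j. i \<in> {1..N} \<Longrightarrow> j \<in> {1..N} \<Longrightarrow> i \<le> j \<Longrightarrow> ps i \<le> ps j"
  shows "\<exists>C>0. \<exists>C'. (\<forall>\<sigma>\<in>{0<..<1}. C' \<sigma> > 0) \<and>
    (\<forall>(\<Omega> :: (real^'n) set) (a :: nat \<Rightarrow> real^'n \<Rightarrow> real) (u :: real^'n \<Rightarrow> real).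
      open \<Omega> \<and> bounded \<Omega> \<and>
      (\<forall>i\<in>{1..N}. a i \<in> Muckenhoupt (ps i) \<and> Ap_const (ps i) (a i) = K i) \<and>
      local_minimizer (multi_phase N p ps a) \<Omega> u \<longrightarrow>
        u \<in> Linf_loc \<Omega> \<and>
        (\<forall>x0 r. r > 0 \<and> compactly_contained (ball x0 (2 * r)) \<Omega> \<longrightarrow>
          (let B = ball x0 r; B2 = ball x0 (2 * r); m = avg B2 u; H = multi_phase N p ps a in
            Linf_norm B (\<lambda>y. u y - m) < \<infinity> \<and>
            nn_avg B2 (\<lambda>x. ennreal (H x (enn2real (Linf_norm B (\<lambda>y. u y - m)) / r)))
              \<le> ennreal C * nn_avg B2 (\<lambda>x. ennreal (H x (\<bar>u x - m\<bar> / r))) \<and>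
            (\<forall>\<sigma>\<in>{0<..<1}.
              measure lebesgue {x \<in> B2. u x = 0} \<ge> \<sigma> * measure lebesgue B \<longrightarrow>
              Linf_norm B u < \<infinity> \<and>
              nn_avg B2 (\<lambda>x. ennreal (H x (enn2real (Linf_norm B u) / r)))
                \<le> ennreal (C' \<sigma>) * nn_avg B2 (\<lambda>x. ennreal (H x (\<bar>u x\<bar> / r)))))))"
proof -
  let ?Q = "phase_top N p ps"
  \<comment> \<open>Raising the constants to at least 1 provides the assumption 1 \<le> K of the
    lemmas on weights; larger constants are admissible by \<open>Ap_weight_mono\<close>.\<close>
  define Kr where "Kr = (\<lambda>i. max 1 (enn2real (K i)))"
  \<comment> \<open>The maximum with 1 shows at once that \<open>C\<close> is positive, before any
    De Giorgi instance exists that would give the sign of the threshold.\<close>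
  define C where "C = max 1 (1 / DG_threshold CARD('n) N (phase_exp p ps) Kr ?Q (Caccioppoli_const ?Q))"
  have C0: "0 < C" unfolding C_def by (simp add: less_max_iff_disj)
  have main: "u \<in> Linf_loc \<Omega> \<and>
      (\<forall>x0 r m. r > 0 \<and> compactly_contained (ball x0 (2 * r)) \<Omega> \<longrightarrow>
        Linf_norm (ball x0 r) (\<lambda>y. u y - m) < \<infinity> \<and>
        nn_avg (ball x0 (2 * r)) (\<lambda>x. ennreal (multi_phase N p ps a x (enn2real (Linf_norm (ball x0 r) (\<lambda>y. u y - m)) / r)))
          \<le> ennreal C * nn_avg (ball x0 (2 * r)) (\<lambda>x. ennreal (multi_phase N p ps a x (\<bar>u x - m\<bar> / r))))"
    if op: "open \<Omega>" and a: "\<forall>i\<in>{1..N}. a i \<in> Muckenhoupt (ps i) \<and> Ap_const (ps i) (a i) = K i"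
      and min: "local_minimizer (multi_phase N p ps a) \<Omega> u"
    for \<Omega> :: "(real^'n) set" and a :: "nat \<Rightarrow> real^'n \<Rightarrow> real" and u
  proof -
    \<comment> \<open>Indices outside \<open>{1..N}\<close> receive the weight 0, since
      measurability and sign of \<open>a'\<close> are demanded for all indices.\<close>
    have "\<exists>a'. a' \<in> borel_measurable borel \<and> (\<forall>x. 0 \<le> a' x) \<and> (i \<in> {1..N} \<longrightarrow> (AE x in lborel. a i x = a' x))" for i
    proof (cases "i \<in> {1..N}")
      case True
      then have "a i \<in> Muckenhoupt (ps i)" using a by blast
      then show ?thesis by (rule Muckenhoupt_borel) blast
    next
      case False
      then show ?thesis by (intro exI[of _ "\<lambda>_. 0"]) auto
    qed
    then have "\<exists>a'. \<forall>i. a' i \<in> borel_measurable borel \<and> (\<forall>x. 0 \<le> a' i x) \<and> (i \<in> {1..N} \<longrightarrow> (AE x in lborel. a i x = a' i x))"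
      by (intro choice) blast
    then obtain a' where a': "\<And>i. a' i \<in> borel_measurable borel" "\<And>i x. 0 \<le> a' i x"
      "\<And>i. i \<in> {1..N} \<Longrightarrow> AE x in lborel. a i x = a' i x" by blast
    have Kr1: "1 \<le> Kr i" for i by (simp add: Kr_def)
    have wt: "Ap_weight (phase_exp p ps i) (Kr i) (phase_wt a' i)" if "i \<le> N" for i
    proof (cases "i = 0")
      case True
      then show ?thesis
        using Ap_weight_mono[OF Ap_weight_1[OF assms(3)] Kr1] by (simp add: phase_exp_def phase_wt_def)
    next
      case False
      then have i: "i \<in> {1..N}" using that by simp
      have "1 < ps i" using assms(3) assms(4)[OF i] by simp
      then have "Ap_weight (ps i) (enn2real (Ap_const (ps i) (a i))) (a' i)"
        by (rule Muckenhoupt_Ap_weight) (use a i a' in auto)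
      then have "Ap_weight (ps i) (Kr i) (a' i)"
        by (rule Ap_weight_mono) (use a i in \<open>auto simp: Kr_def\<close>)
      then show ?thesis using False by (simp add: phase_exp_def phase_wt_def)
    qed
    interpret multi_phase_setting N p ps a a'
    proof
      show "emeasure (wm (a' i)) (ball x s) < \<infinity>" if "i \<in> {1..N}" for i x s
        using wt[of i] that by (simp add: phase_wt_def Ap_weight_def)
    qed (use assms a' in auto)
    have uW: "u \<in> W_space H \<Omega>" using min by (simp add: local_minimizer_def)
    then have "\<exists>G. has_weak_gradient \<Omega> u G" by (simp add: W_space_def)
    then have "has_weak_gradient \<Omega> u (weak_gradient \<Omega> u)"
      unfolding weak_gradient_def by (rule someI_ex)
    then obtain U G where w: "wgrad \<Omega> U G" and UG: "AE x in lborel. x \<in> \<Omega> \<longrightarrow> u x = U x \<and> weak_gradient \<Omega> u x = G x"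
      by (rule has_weak_gradient_imp_wgrad[OF _ op])
    have uU: "AE x in lborel. x \<in> \<Omega> \<longrightarrow> u x = U x" using UG by eventually_elim auto
    have [measurable]: "U \<in> borel_measurable borel" using w by (simp add: wgrad_def)
    have "u \<in> L_space H \<Omega>" using uW by (simp add: W_space_def)
    then obtain f where f: "AE x in lborel. x \<in> \<Omega> \<longrightarrow> u x = f x" "fin_energy \<Omega> f" by (rule L_spaceE[OF _ op])
    have finU: "fin_energy \<Omega> U"
      by (rule fin_energy_AE[OF f(2)]) (use f(1) uU in \<open>eventually_elim, auto\<close>)
    have "(\<lambda>x. norm (weak_gradient \<Omega> u x)) \<in> L_space H \<Omega>" using uW by (simp add: W_space_def)
    then obtain g where g: "AE x in lborel. x \<in> \<Omega> \<longrightarrow> norm (weak_gradient \<Omega> u x) = g x" "fin_energy \<Omega> g"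
      by (rule L_spaceE[OF _ op])
    have finG: "fin_energy \<Omega> (\<lambda>x. norm (G x))"
      by (rule fin_energy_AE[OF g(2)]) (use g(1) UG in \<open>eventually_elim, auto\<close>)
    note bound = minimizer_bound[OF op min w uU finU finG _ _ wt Kr1]
    have "Linf_norm D u < \<infinity>" if D: "compact D" "D \<subseteq> \<Omega>" for D
    proof -
      have "\<exists>M. AE y in lborel. y \<in> D \<longrightarrow> \<bar>u y\<bar> \<le> M"
      proof (rule compact_AE_bounded[OF D(1)])
        fix x assume "x \<in> D"
        then obtain s where s: "0 < s" "cball x s \<subseteq> \<Omega>" using D(2) op open_contains_cball by blast
        have "\<exists>M. AE y in lborel. y \<in> ball x (s / 2) \<longrightarrow> \<bar>u y - 0\<bar> \<le> M"
          by (rule bound(3)) (use s in auto)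
        then show "\<exists>r>0. \<exists>M. AE y in lborel. y \<in> ball x r \<longrightarrow> \<bar>u y\<bar> \<le> M"
          using s(1) by (intro exI[of _ "s / 2"]) simp
      qed
      then obtain M where M: "AE y in lborel. y \<in> D \<longrightarrow> \<bar>u y\<bar> \<le> M" by blast
      have DU: "AE y in lborel. y \<in> D \<longrightarrow> u y = U y" using uU by eventually_elim (use D in auto)
      have Db: "D \<in> sets borel" using compact_imp_closed[OF D(1)] by simp
      have "Linf_norm D u \<le> ennreal M"
        by (rule Linf_norm_le[OF borel_measurable_lebesgue_on_AE[OF _ Db DU] _ M]) (use Db in auto)
      then show ?thesis by (auto intro: le_less_trans)
    qed
    moreover have "u \<in> borel_measurable (lebesgue_on \<Omega>)"
      by (rule borel_measurable_lebesgue_on_AE[OF _ _ uU]) (use op in auto)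
    ultimately have "u \<in> Linf_loc \<Omega>" by (simp add: Linf_loc_def)
    moreover have "Linf_norm (ball x0 r) (\<lambda>y. u y - m) < \<infinity> \<and>
        nn_avg (ball x0 (2 * r)) (\<lambda>x. ennreal (H x (enn2real (Linf_norm (ball x0 r) (\<lambda>y. u y - m)) / r)))
          \<le> ennreal C * nn_avg (ball x0 (2 * r)) (\<lambda>x. ennreal (H x (\<bar>u x - m\<bar> / r)))"
      if "r > 0 \<and> compactly_contained (ball x0 (2 * r)) \<Omega>" for x0 r m
    proof -
      have r: "0 < r" and sub: "cball x0 (2 * r) \<subseteq> \<Omega>" using that by (auto simp: compactly_contained_def)
      show ?thesis
        unfolding C_def by (rule conjI[OF bound(1)[OF r sub] bound(2)[OF r sub]])
    qed
    ultimately show ?thesis by iprover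
  qed
  show ?thesis
  proof (intro exI[of _ C] conjI exI[of _ "\<lambda>_. C"] allI impI, goal_cases)
    case 1
    show ?case by (rule C0)
  next
    case 2
    show ?case using C0 by simp
  next
    case (3 \<Omega> a u)
    then show ?case using main[of \<Omega> a u] by blast
  next
    case (4 \<Omega> a u x0 r)
    then have "\<forall>m. Linf_norm (ball x0 r) (\<lambda>y. u y - m) < \<infinity> \<and>
        nn_avg (ball x0 (2 * r)) (\<lambda>x. ennreal (multi_phase N p ps a x (enn2real (Linf_norm (ball x0 r) (\<lambda>y. u y - m)) / r)))
          \<le> ennreal C * nn_avg (ball x0 (2 * r)) (\<lambda>x. ennreal (multi_phase N p ps a x (\<bar>u x - m\<bar> / r)))"
      using main[of \<Omega> a u] by blast
    from this[rule_format, of "avg (ball x0 (2 * r)) u"] this[rule_format, of 0] show ?case by (simp add: Let_def)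
  qed
qed

end
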